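(* Let $0<f<1$, $\nu>0$ and $\Lambda=\sqrt{f(1-f)}$. Let $\mathscr{L}$ be the linear operator on $[L^2(\mathbb{R}^3)]^3$ defined in the context, and let $e^{t\mathscr{L}}$ be the $C_0$-semigroup it generates. Then its growth bound satisfies $\omega_0(\mathscr{L})=\Lambda$. Moreover, for every $\varepsilon>0$ there exists a constant $C_\varepsilon>0$ depending on $\varepsilon$ such that $$\|e^{t\mathscr{L}}\|_{L^2\to L^2}\le C_\varepsilon e^{(\Lambda+\varepsilon)t}\quad\text{for all } t\ge 0 .$$ Furthermore, there is a constant $C>0$ depending only on $f$ such that for every $\varepsilon>0$, $$\|(\lambda-\mathscr{L})^{-1}\|_{L^2\to L^2}\le C\varepsilon^{-1}\bigl(1+\varepsilon^{-1}\bigr)e^{C\varepsilon^{-1}}\quad\text{for every } \lambda\in\mathbb{C} \text{ with } \operatorname{Re}\lambda\ge\Lambda+\varepsilon .$$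
   Context: Points of $\mathbb{R}^3$ are written $\mathbf{x}=(x,y,z)$. Let $$\mathscr{L}=\begin{pmatrix}\nu\Delta-y\partial_x+f\Delta^{-1}\partial_{xy} & f-1+(2-f)\Delta^{-1}\partial_x^2 & 0\\ -f+f\Delta^{-1}\partial_y^2 & \nu\Delta-y\partial_x+(2-f)\Delta^{-1}\partial_{xy} & 0\\ f\Delta^{-1}\partial_{yz} & (2-f)\Delta^{-1}\partial_{xz} & \nu\Delta-y\partial_x\end{pmatrix}$$ with domain $\mathcal{D}(\mathscr{L})=\{\mathbf{u}\in[L^2(\mathbb{R}^3)]^3:\ \nu\Delta\mathbf{u},\ y\partial_x\mathbf{u}\in[L^2(\mathbb{R}^3)]^3\}$. Here $\Delta^{-1}\partial_j\partial_k$ is the Fourier multiplier with symbol $\xi_j\xi_k/|\boldsymbol{\xi}|^2$. (This is the operator of the Navier--Stokes equations with Coriolis force linearized about the Couette flow $(y,0,0)$, acting on all complex-valued $L^2$ vector fields.) The operator $\mathscr{L}$ generates a $C_0$-semigroup on $[L^2(\mathbb{R}^3)]^3$. The growth bound is $\omega_0(\mathscr{L})=\lim_{t\to\infty}\frac1t\log\|e^{t\mathscr{L}}\|_{L^2\to L^2}$. *)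

theory Defs
  imports "HOL-Analysis.Analysis"
begin

section \<open>The space \<open>L\<^sup>2(\<real>\<^sup>3)\<close> of complex-valued functions\<close>

type_synonym R3 = "real ^ 3"

definition square_integrable :: "(R3 \<Rightarrow> complex) \<Rightarrow> bool" where
  "square_integrable u \<longleftrightarrow>
     u \<in> borel_measurable lborel \<and> integrable lborel (\<lambda>x. (cmod (u x))\<^sup>2)"

lemma square_integrable_zero: "square_integrable (\<lambda>_. 0)"
  by (simp add: square_integrable_def)

lemma square_integrable_cmult:
  assumes "square_integrable u"
  shows "square_integrable (\<lambda>x. c * u x)"
  using assms by (auto simp: square_integrable_def norm_mult power_mult_distrib)

lemma square_integrable_add:
  assumes "square_integrable u" "square_integrable v"
  shows "square_integrable (\<lambda>x. u x + v x)"
proof -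
  have [measurable]: "u \<in> borel_measurable lborel" "v \<in> borel_measurable lborel"
    using assms by (auto simp: square_integrable_def)
  have "integrable lborel (\<lambda>x. (cmod (u x + v x))\<^sup>2)"
  proof (rule Bochner_Integration.integrable_bound)
    show "integrable lborel (\<lambda>x. 2 * (cmod (u x))\<^sup>2 + 2 * (cmod (v x))\<^sup>2)"
      using assms by (auto simp: square_integrable_def)
    have "(cmod (a + b))\<^sup>2 \<le> 2 * (cmod a)\<^sup>2 + 2 * (cmod b)\<^sup>2" for a b
    proof -
      have "(cmod (a + b))\<^sup>2 \<le> (cmod a + cmod b)\<^sup>2"
        by (intro power_mono norm_triangle_ineq) auto
      also have "\<dots> \<le> 2 * (cmod a)\<^sup>2 + 2 * (cmod b)\<^sup>2"
        using sum_squares_bound[of "cmod a" "cmod b"] by (simp add: power2_sum)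
      finally show ?thesis .
    qed
    then show "AE x in lborel. norm ((cmod (u x + v x))\<^sup>2)
        \<le> norm (2 * (cmod (u x))\<^sup>2 + 2 * (cmod (v x))\<^sup>2)"
      by (auto intro!: AE_I2)
  qed measurable
  then show ?thesis by (simp add: square_integrable_def)
qed

lemma square_integrable_diff:
  assumes "square_integrable u" "square_integrable v"
  shows "square_integrable (\<lambda>x. u x - v x)"
  using square_integrable_add[OF assms(1) square_integrable_cmult[OF assms(2), of "-1"]]
  by simp

lemma square_integrable_inner:
  assumes "square_integrable u" "square_integrable v"
  shows "integrable lborel (\<lambda>x. u x \<bullet> v x)"
proof (rule Bochner_Integration.integrable_bound)
  have [measurable]: "u \<in> borel_measurable lborel" "v \<in> borel_measurable lborel"
    using assms by (auto simp: square_integrable_def)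
  show "(\<lambda>x. u x \<bullet> v x) \<in> borel_measurable lborel" by measurable
  show "integrable lborel (\<lambda>x. (cmod (u x))\<^sup>2 + (cmod (v x))\<^sup>2)"
    using assms by (auto simp: square_integrable_def)
  have "\<bar>a \<bullet> b\<bar> \<le> (cmod a)\<^sup>2 + (cmod b)\<^sup>2" for a b :: complex
  proof -
    have "2 * (cmod a * cmod b) \<le> (cmod a)\<^sup>2 + (cmod b)\<^sup>2"
      using sum_squares_bound[of "cmod a" "cmod b"] by simp
    moreover have "0 \<le> cmod a * cmod b" by simp
    ultimately show ?thesis
      using Cauchy_Schwarz_ineq2[of a b] by linarith
  qed
  then show "AE x in lborel. norm (u x \<bullet> v x) \<le> norm ((cmod (u x))\<^sup>2 + (cmod (v x))\<^sup>2)"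
    by (auto intro!: AE_I2)
qed

quotient_type L2 = "R3 \<Rightarrow> complex" / partial:
  "\<lambda>u v. square_integrable u \<and> square_integrable v \<and> (AE x in lborel. u x = v x)"
proof (rule part_equivpI)
  show "\<exists>u. square_integrable u \<and> square_integrable u \<and> (AE x in lborel. u x = u x)"
    using square_integrable_zero by auto
qed (auto intro!: sympI transpI)

instantiation L2 :: real_vector
begin

lift_definition zero_L2 :: L2 is "\<lambda>_. 0" by (simp add: square_integrable_zero)

lift_definition plus_L2 :: "L2 \<Rightarrow> L2 \<Rightarrow> L2" is "\<lambda>u v x. u x + v x"
  by (auto intro: square_integrable_add)

lift_definition minus_L2 :: "L2 \<Rightarrow> L2 \<Rightarrow> L2" is "\<lambda>u v x. u x - v x"
  by (auto intro: square_integrable_diff)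

lift_definition uminus_L2 :: "L2 \<Rightarrow> L2" is "\<lambda>u x. - u x"
  using square_integrable_cmult[of _ "-1"] by auto

lift_definition scaleR_L2 :: "real \<Rightarrow> L2 \<Rightarrow> L2" is "\<lambda>r u x. r *\<^sub>R u x"
  by (auto simp: scaleR_conv_of_real intro: square_integrable_cmult)

instance
proof
  fix u v w :: L2 and r s :: real
  show "u + v + w = u + (v + w)"
    by transfer (simp add: add.assoc square_integrable_add)
  show "u + v = v + u"
    by transfer (simp add: add.commute square_integrable_add)
  show "0 + u = u" by transfer simp
  show "- u + u = 0" by transfer (simp add: square_integrable_zero)
  show "u - v = u + - v"
    by transfer (simp add: square_integrable_diff)
  show "r *\<^sub>R (u + v) = r *\<^sub>R u + r *\<^sub>R v"
    by transfer (simp add: scaleR_conv_of_real distrib_left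
        square_integrable_add square_integrable_cmult)
  show "(r + s) *\<^sub>R u = r *\<^sub>R u + s *\<^sub>R u"
    by transfer (simp add: scaleR_conv_of_real distrib_right
        square_integrable_add square_integrable_cmult)
  show "r *\<^sub>R s *\<^sub>R u = (r * s) *\<^sub>R u"
    by transfer (simp add: scaleR_conv_of_real mult.assoc square_integrable_cmult)
  show "1 *\<^sub>R u = u" by transfer simp
qed

end

instantiation L2 :: real_inner
begin

text \<open>The real part of the usual Hermitian product; it induces the usual \<open>L\<^sup>2\<close> norm.\<close>

lift_definition inner_L2 :: "L2 \<Rightarrow> L2 \<Rightarrow> real" is "\<lambda>u v. \<integral>x. u x \<bullet> v x \<partial>lborel"
  by (intro integral_cong_AE) (auto simp: square_integrable_def)

definition norm_L2 :: "L2 \<Rightarrow> real" where "norm_L2 u = sqrt (u \<bullet> u)"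
definition dist_L2 :: "L2 \<Rightarrow> L2 \<Rightarrow> real" where "dist_L2 u v = norm (u - v)"
definition sgn_L2 :: "L2 \<Rightarrow> L2" where "sgn_L2 u = inverse (norm u) *\<^sub>R u"
definition uniformity_L2 :: "(L2 \<times> L2) filter" where
  "uniformity_L2 = (INF e\<in>{0<..}. principal {(u, v). dist u v < e})"
definition open_L2 :: "L2 set \<Rightarrow> bool" where
  "open_L2 U \<longleftrightarrow> (\<forall>u\<in>U. eventually (\<lambda>(u', v). u' = u \<longrightarrow> v \<in> U) uniformity)"

instance
proof
  fix u v w :: L2 and r :: real
  show "dist u v = norm (u - v)" by (rule dist_L2_def)
  show "sgn u = inverse (norm u) *\<^sub>R u" by (rule sgn_L2_def)
  show "uniformity = (INF e\<in>{0<..}. principal {(u :: L2, v). dist u v < e})"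
    by (rule uniformity_L2_def)
  show "open U \<longleftrightarrow> (\<forall>u\<in>U. eventually (\<lambda>(u', v). u' = u \<longrightarrow> v \<in> U) uniformity)"
    for U :: "L2 set" by (rule open_L2_def)
  show "norm u = sqrt (u \<bullet> u)" by (rule norm_L2_def)
  show "u \<bullet> v = v \<bullet> u" by transfer (simp add: inner_commute)
  show "(u + v) \<bullet> w = u \<bullet> w + v \<bullet> w"
    by transfer (simp add: inner_add_left square_integrable_inner)
  show "(r *\<^sub>R u) \<bullet> v = r * (u \<bullet> v)" by transfer simp
  show "0 \<le> u \<bullet> u" by transfer (auto intro: integral_nonneg_AE)
  show "u \<bullet> u = 0 \<longleftrightarrow> u = 0"
  proof transfer
    fix u assume "square_integrable u \<and> square_integrable u \<and> (AE x in lborel. u x = u x)"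
    then have u: "square_integrable u" by simp
    have "(\<integral>x. u x \<bullet> u x \<partial>lborel) = 0 \<longleftrightarrow> (AE x in lborel. u x \<bullet> u x = 0)"
      by (intro integral_nonneg_eq_0_iff_AE square_integrable_inner u) auto
    then show "(\<integral>x. u x \<bullet> u x \<partial>lborel) = 0 \<longleftrightarrow>
        square_integrable u \<and> square_integrable (\<lambda>_. 0) \<and> (AE x in lborel. u x = 0)"
      using u by (simp add: square_integrable_zero)
  qed
qed

end

lift_definition scaleC_L2 :: "complex \<Rightarrow> L2 \<Rightarrow> L2" is "\<lambda>c u x. c * u x"
  by (auto intro: square_integrable_cmult)

text \<open>The vector fields \<open>[L\<^sup>2(\<real>\<^sup>3)]\<^sup>3\<close>, with \<open>\<parallel>u\<parallel>\<^sup>2 = \<parallel>u\<^sub>1\<parallel>\<^sup>2 + \<parallel>u\<^sub>2\<parallel>\<^sup>2 + \<parallel>u\<^sub>3\<parallel>\<^sup>2\<close>.\<close>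

type_synonym L2_field = "L2 ^ 3"

definition scaleC_field :: "complex \<Rightarrow> L2_field \<Rightarrow> L2_field" where
  "scaleC_field c u = (\<chi> j. scaleC_L2 c (u $ j))"


section \<open>Distributions\<close>

definition pd :: "3 \<Rightarrow> (R3 \<Rightarrow> complex) \<Rightarrow> R3 \<Rightarrow> complex" where
  "pd i \<phi> x = frechet_derivative \<phi> (at x) (axis i 1)"

primrec Ck :: "nat \<Rightarrow> (R3 \<Rightarrow> complex) \<Rightarrow> bool" where
  "Ck 0 \<phi> \<longleftrightarrow> continuous_on UNIV \<phi>"
| "Ck (Suc k) \<phi> \<longleftrightarrow> (\<forall>x. \<phi> differentiable (at x)) \<and> (\<forall>i. Ck k (pd i \<phi>))"

definition test_functions :: "(R3 \<Rightarrow> complex) set" where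
  "test_functions = {\<phi>. (\<forall>k. Ck k \<phi>) \<and> compact (closure {x. \<phi> x \<noteq> 0})}"

text \<open>A distribution is represented by its values on \<^const>\<open>test_functions\<close>; its values
  on other functions are irrelevant.\<close>

type_synonym distribution = "(R3 \<Rightarrow> complex) \<Rightarrow> complex"

definition distr_of :: "L2 \<Rightarrow> distribution" where
  "distr_of u \<phi> = (\<integral>x. rep_L2 u x * \<phi> x \<partial>lborel)"

definition distr_pd :: "3 \<Rightarrow> distribution \<Rightarrow> distribution" where
  "distr_pd i S \<phi> = - S (pd i \<phi>)"

definition distr_mult :: "(R3 \<Rightarrow> complex) \<Rightarrow> distribution \<Rightarrow> distribution" where
  "distr_mult g S \<phi> = S (\<lambda>x. g x * \<phi> x)"

definition represents :: "L2 \<Rightarrow> distribution \<Rightarrow> bool" where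
  "represents w S \<longleftrightarrow> (\<forall>\<phi>\<in>test_functions. S \<phi> = distr_of w \<phi>)"

definition in_L2 :: "distribution \<Rightarrow> bool" where
  "in_L2 S \<longleftrightarrow> (\<exists>w. represents w S)"

definition to_L2 :: "distribution \<Rightarrow> L2" where
  "to_L2 S = (THE w. represents w S)"

definition nu_laplacian :: "real \<Rightarrow> L2 \<Rightarrow> distribution" where
  "nu_laplacian \<nu> u \<phi> = complex_of_real \<nu> * (\<Sum>i\<in>UNIV. distr_pd i (distr_pd i (distr_of u)) \<phi>)"

definition y_dx :: "L2 \<Rightarrow> distribution" where
  "y_dx u = distr_mult (\<lambda>x. complex_of_real (x $ 2)) (distr_pd 1 (distr_of u))"


section \<open>Fourier multipliers\<close>

text \<open>\<open>v\<close> is the Plancherel--Fourier transform of \<open>u\<close>: the \<open>L\<^sup>2\<close> limit, as \<open>r \<rightarrow> \<infinity>\<close>, of the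
  Fourier integrals of \<open>u\<close> over balls of radius \<open>r\<close>. No normalizing factor is used, as it
  cancels in \<open>multiplier\<close>.\<close>

definition L2_fourier :: "(R3 \<Rightarrow> complex) \<Rightarrow> (R3 \<Rightarrow> complex) \<Rightarrow> bool" where
  "L2_fourier u v \<longleftrightarrow> square_integrable u \<and> square_integrable v \<and>
     ((\<lambda>r. \<integral>\<^sup>+\<xi>. ennreal ((cmod ((LINT x:cball 0 r|lborel. cis (- (\<xi> \<bullet> x)) * u x) - v \<xi>))\<^sup>2)
        \<partial>lborel) \<longlongrightarrow> 0) at_top"

definition multiplier :: "(R3 \<Rightarrow> complex) \<Rightarrow> L2 \<Rightarrow> L2" where
  "multiplier m u = (THE w. \<exists>v. L2_fourier (rep_L2 u) v \<and>
     L2_fourier (rep_L2 w) (\<lambda>\<xi>. m \<xi> * v \<xi>))"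

text \<open>\<open>riesz j k\<close> is \<open>\<Delta>\<^sup>-\<^sup>1 \<partial>\<^sub>j \<partial>\<^sub>k\<close>; the coordinates \<open>x, y, z\<close> are numbered \<open>1, 2, 3\<close>.\<close>

definition riesz :: "3 \<Rightarrow> 3 \<Rightarrow> L2 \<Rightarrow> L2" where
  "riesz j k = multiplier (\<lambda>\<xi>. complex_of_real (\<xi> $ j * \<xi> $ k / (norm \<xi>)\<^sup>2))"


section \<open>The linearized operator\<close>

definition couette_dom :: "real \<Rightarrow> L2_field set" where
  "couette_dom \<nu> = {u. \<forall>j. in_L2 (nu_laplacian \<nu> (u $ j)) \<and> in_L2 (y_dx (u $ j))}"

definition couette_op :: "real \<Rightarrow> real \<Rightarrow> L2_field \<Rightarrow> L2_field" where
  "couette_op f \<nu> u =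
    (let P = (\<lambda>g. to_L2 (nu_laplacian \<nu> g) - to_L2 (y_dx g)) in vector
      [P (u $ 1) + f *\<^sub>R riesz 1 2 (u $ 1)
         + (f - 1) *\<^sub>R u $ 2 + (2 - f) *\<^sub>R riesz 1 1 (u $ 2),
       (- f) *\<^sub>R u $ 1 + f *\<^sub>R riesz 2 2 (u $ 1)
         + P (u $ 2) + (2 - f) *\<^sub>R riesz 1 2 (u $ 2),
       f *\<^sub>R riesz 2 3 (u $ 1) + (2 - f) *\<^sub>R riesz 1 3 (u $ 2) + P (u $ 3)])"


section \<open>Semigroups and resolvents\<close>

text \<open>Only \<open>t \<ge> 0\<close> matters for \<open>T t\<close>. The bounded operators below are real-linear; a
  semigroup generated by, or an inverse of, a complex-linear operator is automatically
  complex-linear, and its operator norm does not depend on the scalar field.\<close>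

definition C0_semigroup :: "(real \<Rightarrow> 'a::real_normed_vector \<Rightarrow>\<^sub>L 'a) \<Rightarrow> bool" where
  "C0_semigroup T \<longleftrightarrow> T 0 = id_blinfun \<and> (\<forall>s\<ge>0. \<forall>t\<ge>0. T (s + t) = T s o\<^sub>L T t) \<and>
     (\<forall>u. ((\<lambda>t. T t u) \<longlongrightarrow> u) (at_right 0))"

definition generator_graph :: "(real \<Rightarrow> 'a::real_normed_vector \<Rightarrow>\<^sub>L 'a) \<Rightarrow> ('a \<times> 'a) set" where
  "generator_graph T = {(u, v). ((\<lambda>h. (T h u - u) /\<^sub>R h) \<longlongrightarrow> v) (at_right 0)}"

definition generates ::
  "'a::real_normed_vector set \<Rightarrow> ('a \<Rightarrow> 'a) \<Rightarrow> (real \<Rightarrow> 'a \<Rightarrow>\<^sub>L 'a) \<Rightarrow> bool" where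
  "generates D A T \<longleftrightarrow> C0_semigroup T \<and> generator_graph T = {(u, A u) |u. u \<in> D}"

definition has_growth_bound :: "(real \<Rightarrow> 'a::real_normed_vector \<Rightarrow>\<^sub>L 'a) \<Rightarrow> real \<Rightarrow> bool" where
  "has_growth_bound T \<omega> \<longleftrightarrow> ((\<lambda>t. 1 / t * ln (norm (T t))) \<longlongrightarrow> \<omega>) at_top"

definition is_resolvent ::
  "L2_field set \<Rightarrow> (L2_field \<Rightarrow> L2_field) \<Rightarrow> complex \<Rightarrow> (L2_field \<Rightarrow>\<^sub>L L2_field) \<Rightarrow> bool" where
  "is_resolvent D A z R \<longleftrightarrow>
     (\<forall>v. R v \<in> D \<and> scaleC_field z (R v) - A (R v) = v) \<and>
     (\<forall>u\<in>D. R (scaleC_field z u - A u) = u)"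

end

theory Submission
  imports Defs "HOL-Probability.Characteristic_Functions" "HOL-Real_Asymp.Real_Asymp"
begin

text \<open>
  In frequency the operator is \<open>- \<nu> \<bar>\<xi>\<bar>\<^sup>2 + \<xi>\<^sub>1 \<partial>\<^sub>2 + M \<xi>\<close> with a bounded matrix \<open>M\<close>, homogeneous of degree
  \<open>0\<close>. On the plane \<open>\<xi>\<^sub>1 = 0\<close> there is no transport, and the first two components are coupled by the
  off-diagonal entries \<open>f - 1\<close> and \<open>- f (1 - \<xi>\<^sub>2\<^sup>2 / \<bar>\<xi>\<bar>\<^sup>2)\<close>; the eigenvalues are at most
  \<open>\<Lambda> = sqrt (f (1 - f))\<close>, with equality for vertical \<open>\<xi>\<close>. The third component is driven by the other two
  and does not act back. So \<open>\<Lambda>\<close> is the growth rate that a frozen frequency suggests.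

  \<^bold>\<open>Upper bounds.\<close> The energy with weights \<open>f\<close>, \<open>1 - f\<close> and a small third weight sees the coupling above
  with rate \<open>\<Lambda>\<close> (\<open>symbol_energy_le\<close>). The other entries that act on the first two components are at most
  of size \<open>(1 + \<bar>\<tau>\<bar>) / (1 + \<tau>\<^sup>2)\<close> in \<open>\<tau> = \<xi>\<^sub>2 / \<xi>\<^sub>1\<close>, which is not small. But the transport moves \<open>\<tau>\<close> with
  unit speed, so they exceed \<open>\<epsilon>\<close> only for a time of order \<open>1 + 1/\<epsilon>\<close>. This is exploited by the additional weight
  \<open>exp (2 N arctan \<tau>)\<close>, whose relative rate of change along the transport is \<open>2 N / (1 + \<tau>\<^sup>2)\<close>: with
  \<open>N\<close> of order \<open>1 + 1/\<epsilon>\<close> it absorbs the other entries up to \<open>\<epsilon>\<close> (\<open>error_symbol_le\<close>).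
  Viscosity only helps. The outcome is \<open>energy_dissipation\<close>, in which \<open>\<L> - \<Lambda> - \<epsilon>/2\<close> is dissipative
  for an energy equivalent to the squared norm with ratio \<open>e\<^sup>C\<^sup>/\<^sup>\<epsilon>\<close>, up to powers of \<open>\<epsilon>\<close>, independently
  of \<open>\<nu>\<close>. It bounds the semigroup through \<open>energy_growth\<close> and the resolvent
  through \<open>resolvent_a_priori\<close>; that \<open>z - \<L>\<close> is onto follows by integrating the decaying orbits of
  \<open>e\<^sup>-\<^sup>z\<^sup>t T t\<close> over time (\<open>resolvent_onto\<close>).

  \<^bold>\<open>Lower bound.\<close> A wave packet near the vertical frequency axis, of low frequency and much narrower in
  \<open>\<xi>\<^sub>1\<close> than in \<open>\<xi>\<^sub>2\<close>, almost annihilates viscosity, transport and all Riesz transforms that occur.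
  Polarized along \<open>(sqrt (1 - f), - sqrt f, 0)\<close> it is an approximate eigenvector for \<open>\<Lambda>\<close>
  (\<open>approximate_eigenvector\<close>), and this forces \<open>\<parallel>T t\<parallel> \<ge> e\<^sup>\<Lambda>\<^sup>t\<close> (\<open>semigroup_norm_ge_exp\<close>).

  \<^bold>\<open>Passing to frequency.\<close> The Fourier transform is an isometry of \<open>L\<^sup>2\<close>, up to a factor, by Gaussian
  regularization (\<open>plancherel_test\<close>) and density of the test functions, and it is onto because its
  conjugate is its adjoint. It turns distributional Laplacians into multiplication
  (\<open>fourier_laplacian\<close>). The transport term is not a function of frequency, but \<open>y \<partial>\<^sub>x\<close> generates a unitary
  group of shears, which the Fourier transform maps to shears in frequency (\<open>fourier_shear\<close>).
  Energy identities are obtained by differentiating along these shears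
  (\<open>weighted_transport_identity\<close>), so that elements of the domain need no approximation by
  smoother ones.
\<close>

section \<open>Classes of square-integrable functions\<close>

lemma square_integrable_rep_L2 [simp]: "square_integrable (rep_L2 u)"
  using Quotient3_rep_reflp[OF Quotient3_L2, of u] by simp

lemma abs_rep_L2 [simp]: "abs_L2 (rep_L2 u) = u"
  by (rule Quotient3_abs_rep[OF Quotient3_L2])

lemma rep_abs_L2: "square_integrable f \<Longrightarrow> AE x in lborel. rep_L2 (abs_L2 f) x = f x"
  using Quotient3_rep_abs[OF Quotient3_L2, of f] by simp

lemma abs_L2_eq_iff:
  "square_integrable f \<Longrightarrow> square_integrable g \<Longrightarrow> abs_L2 f = abs_L2 g \<longleftrightarrow> (AE x in lborel. f x = g x)"
  using Quotient3_rel[OF Quotient3_L2, of f g] by simp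

lemma L2_eqI: "(AE x in lborel. rep_L2 u x = rep_L2 v x) \<Longrightarrow> u = v"
  using abs_L2_eq_iff[of "rep_L2 u" "rep_L2 v"] by simp

lemma square_integrable_measurable [measurable_dest]:
  "square_integrable f \<Longrightarrow> f \<in> borel_measurable lborel"
  by (simp add: square_integrable_def)

lemma rep_L2_measurable [measurable]: "rep_L2 u \<in> borel_measurable borel"
  using square_integrable_measurable[OF square_integrable_rep_L2[of u]] by simp

lemma abs_L2_add:
  assumes "square_integrable f" "square_integrable g"
  shows "abs_L2 f + abs_L2 g = abs_L2 (\<lambda>x. f x + g x)"
  using rep_abs_L2[OF assms(1)] rep_abs_L2[OF assms(2)] assms
  by (auto simp: plus_L2_def abs_L2_eq_iff square_integrable_add elim: eventually_elim2)

lemma abs_L2_diff: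
  assumes "square_integrable f" "square_integrable g"
  shows "abs_L2 f - abs_L2 g = abs_L2 (\<lambda>x. f x - g x)"
  using rep_abs_L2[OF assms(1)] rep_abs_L2[OF assms(2)] assms
  by (auto simp: minus_L2_def abs_L2_eq_iff square_integrable_diff elim: eventually_elim2)

lemma abs_L2_scaleC:
  assumes "square_integrable f"
  shows "scaleC_L2 c (abs_L2 f) = abs_L2 (\<lambda>x. c * f x)"
  using rep_abs_L2[OF assms(1)] assms
  by (simp add: scaleC_L2_def abs_L2_eq_iff square_integrable_cmult)

lemma scaleR_scaleC_L2: "r *\<^sub>R u = scaleC_L2 (complex_of_real r) u"
  by (simp add: scaleC_L2_def scaleR_L2_def scaleR_conv_of_real)

lemma abs_L2_scaleR:
  assumes "square_integrable f"
  shows "r *\<^sub>R (abs_L2 f) = abs_L2 (\<lambda>x. r *\<^sub>R f x)"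
  by (simp add: scaleR_scaleC_L2 abs_L2_scaleC assms scaleR_conv_of_real)

lemma square_integrable_scaleR: "square_integrable f \<Longrightarrow> square_integrable (\<lambda>x. r *\<^sub>R f x)"
  using square_integrable_cmult[of f "complex_of_real r"] by (simp add: scaleR_conv_of_real)

lemma square_integrable_uminus: "square_integrable f \<Longrightarrow> square_integrable (\<lambda>x. - f x)"
  using square_integrable_cmult[of f "-1"] by simp

lemma zero_L2_abs: "0 = abs_L2 (\<lambda>_. 0)"
  by (simp add: zero_L2_def)

lemma rep_L2_add: "AE x in lborel. rep_L2 (u + v) x = rep_L2 u x + rep_L2 v x"
  unfolding plus_L2_def by (auto intro!: rep_abs_L2 square_integrable_add)

lemma rep_L2_scaleC: "AE x in lborel. rep_L2 (scaleC_L2 c u) x = c * rep_L2 u x"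
  unfolding scaleC_L2_def by (auto intro!: rep_abs_L2 square_integrable_cmult)

lemma rep_L2_scaleR: "AE x in lborel. rep_L2 (r *\<^sub>R u) x = r *\<^sub>R rep_L2 u x"
  using rep_L2_scaleC[of "of_real r" u] by (simp add: scaleR_scaleC_L2 scaleR_conv_of_real)

lemma inner_L2_rep: "inner u v = (\<integral>x. rep_L2 u x \<bullet> rep_L2 v x \<partial>lborel)"
  by (simp add: inner_L2_def)

lemma inner_abs_L2:
  assumes "square_integrable f" "square_integrable g"
  shows "inner (abs_L2 f) (abs_L2 g) = (\<integral>x. f x \<bullet> g x \<partial>lborel)"
  unfolding inner_L2_rep using rep_abs_L2[OF assms(1)] rep_abs_L2[OF assms(2)] assms
  by (intro integral_cong_AE) (auto simp: square_integrable_def)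

lemma norm_L2_sq: "(norm (u :: L2))\<^sup>2 = (\<integral>x. (cmod (rep_L2 u x))\<^sup>2 \<partial>lborel)"
  by (simp add: power2_norm_eq_inner inner_L2_rep)

lemma norm_abs_L2_sq:
  assumes "square_integrable f"
  shows "(norm (abs_L2 f))\<^sup>2 = (\<integral>x. (cmod (f x))\<^sup>2 \<partial>lborel)"
  using inner_abs_L2[OF assms assms] by (simp add: power2_norm_eq_inner)

lemma square_integrable_iff_nn:
  "square_integrable f \<longleftrightarrow>
    f \<in> borel_measurable borel \<and> (\<integral>\<^sup>+x. ennreal ((cmod (f x))\<^sup>2) \<partial>lborel) < \<infinity>"
  by (auto simp: square_integrable_def integrable_iff_bounded)

lemma nn_norm_abs_L2:
  assumes "square_integrable f"
  shows "(\<integral>\<^sup>+x. ennreal ((cmod (f x))\<^sup>2) \<partial>lborel) = ennreal ((norm (abs_L2 f))\<^sup>2)"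
  unfolding norm_abs_L2_sq[OF assms] using assms
  by (intro nn_integral_eq_integral) (auto simp: square_integrable_def)

lemma nn_norm_diff_L2:
  assumes "square_integrable f" "square_integrable g"
  shows "(\<integral>\<^sup>+x. ennreal ((cmod (f x - g x))\<^sup>2) \<partial>lborel) = ennreal ((norm (abs_L2 f - abs_L2 g))\<^sup>2)"
  using nn_norm_abs_L2[OF square_integrable_diff[OF assms]] by (simp add: abs_L2_diff assms)

lemma square_integrable_bound:
  assumes "square_integrable g" "f \<in> borel_measurable borel" "\<And>x. cmod (f x) \<le> C * cmod (g x)"
  shows "square_integrable f"
proof -
  have "integrable lborel (\<lambda>x. (cmod (f x))\<^sup>2)"
  proof (rule Bochner_Integration.integrable_bound)
    show "integrable lborel (\<lambda>x. C\<^sup>2 * (cmod (g x))\<^sup>2)"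
      using assms(1) by (auto simp: square_integrable_def)
    have "(cmod (f x))\<^sup>2 \<le> (C * cmod (g x))\<^sup>2" for x
      using assms(3)[of x] by (intro power_mono) auto
    then show "AE x in lborel. norm ((cmod (f x))\<^sup>2) \<le> norm (C\<^sup>2 * (cmod (g x))\<^sup>2)"
      by (auto simp: power_mult_distrib)
  qed (use assms(2) in measurable)
  then show ?thesis using assms(2) by (simp add: square_integrable_def)
qed

lemma square_integrable_AE:
  assumes "square_integrable g" "f \<in> borel_measurable borel" "AE x in lborel. f x = g x"
  shows "square_integrable f"
proof -
  have "(\<integral>\<^sup>+x. ennreal ((cmod (f x))\<^sup>2) \<partial>lborel) = (\<integral>\<^sup>+x. ennreal ((cmod (g x))\<^sup>2) \<partial>lborel)"
    using assms(3) by (intro nn_integral_cong_AE) auto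
  then show ?thesis using assms by (simp add: square_integrable_iff_nn)
qed

text \<open>An \<open>L\<^sup>2\<close> limit and an almost everywhere limit of the same sequence agree, by Fatou's lemma.\<close>

lemma L2_limit_pointwise:
  assumes f: "\<And>n. square_integrable (f n)"
    and lim: "AE x in lborel. (\<lambda>n. f n x) \<longlonglongrightarrow> h x" and h: "h \<in> borel_measurable borel"
    and g: "(\<lambda>n. abs_L2 (f n)) \<longlonglongrightarrow> g"
  shows "square_integrable h" "abs_L2 h = g"
proof -
  have [measurable]: "h \<in> borel_measurable borel" "\<And>n. f n \<in> borel_measurable borel"
    using h f by (auto simp: square_integrable_def)
  have "(\<integral>\<^sup>+x. ennreal ((cmod (h x - rep_L2 g x))\<^sup>2) \<partial>lborel)
      = (\<integral>\<^sup>+x. liminf (\<lambda>n. ennreal ((cmod (f n x - rep_L2 g x))\<^sup>2)) \<partial>lborel)"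
    using lim
  proof (intro nn_integral_cong_AE, eventually_elim)
    case (elim x)
    have "(\<lambda>n. ennreal ((cmod (f n x - rep_L2 g x))\<^sup>2)) \<longlonglongrightarrow> ennreal ((cmod (h x - rep_L2 g x))\<^sup>2)"
      by (intro tendsto_intros elim) 
    then show ?case by (rule lim_imp_Liminf[OF trivial_limit_sequentially, symmetric])
  qed
  also have "\<dots> \<le> liminf (\<lambda>n. \<integral>\<^sup>+x. ennreal ((cmod (f n x - rep_L2 g x))\<^sup>2) \<partial>lborel)"
    by (intro nn_integral_liminf) auto
  also have "\<dots> = liminf (\<lambda>n. ennreal ((norm (abs_L2 (f n) - g))\<^sup>2))"
    using nn_norm_diff_L2[OF f square_integrable_rep_L2[of g]] by simp
  also have "\<dots> = 0"
  proof (rule lim_imp_Liminf)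
    have "(\<lambda>n. ennreal ((norm (abs_L2 (f n) - g))\<^sup>2)) \<longlonglongrightarrow> ennreal ((norm (g - g))\<^sup>2)"
      by (intro tendsto_intros g)
    then show "(\<lambda>n. ennreal ((norm (abs_L2 (f n) - g))\<^sup>2)) \<longlonglongrightarrow> 0" by simp
  qed simp
  finally have "(\<integral>\<^sup>+x. ennreal ((cmod (h x - rep_L2 g x))\<^sup>2) \<partial>lborel) = 0" by simp
  then have eq: "AE x in lborel. h x = rep_L2 g x"
    by (subst (asm) nn_integral_0_iff_AE) auto
  show "square_integrable h" by (rule square_integrable_AE[OF _ h eq]) simp
  then show "abs_L2 h = g" using abs_L2_eq_iff[of h "rep_L2 g"] eq by simp
qed

text \<open>Along a subsequence with \<open>\<parallel>u\<^sub>k\<^sub>+\<^sub>1 - u\<^sub>k\<parallel>\<^sup>2 \<le> 4\<^sup>-\<^sup>k\<close> the sum of \<open>2\<^sup>k \<bar>u\<^sub>k\<^sub>+\<^sub>1 - u\<^sub>k\<bar>\<^sup>2\<close> is finite almost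
  everywhere, so the increments decay geometrically and the subsequence converges pointwise.\<close>

lemma L2_Cauchy_convergent:
  fixes X :: "nat \<Rightarrow> L2"
  assumes "Cauchy X"
  shows "convergent X"
proof -
  have "\<exists>M. \<forall>m\<ge>M. \<forall>n\<ge>M. norm (X m - X n) < (1/2)^k" for k :: nat
    using CauchyD[OF assms, of "(1/2)^k"] by auto
  then obtain M where M: "\<And>k m n. m \<ge> M k \<Longrightarrow> n \<ge> M k \<Longrightarrow> norm (X m - X n) < (1/2)^k"
    by metis
  define r where "r k = (\<Sum>i\<le>k. M i) + k" for k
  have r: "strict_mono r" by (auto simp: strict_mono_Suc_iff r_def)
  have rM: "r k \<ge> M j" if "j \<le> k" for j k
  proof -
    have "M j \<le> (\<Sum>i\<le>k. M i)" using that by (intro member_le_sum) auto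
    then show ?thesis by (simp add: r_def)
  qed
  define F where "F k = rep_L2 (X (r k))" for k
  have F: "square_integrable (F k)" "abs_L2 (F k) = X (r k)" for k by (auto simp: F_def)
  have [measurable]: "F k \<in> borel_measurable borel" for k by (simp add: F_def)
  have diff: "(\<integral>\<^sup>+x. ennreal ((cmod (F m x - F k x))\<^sup>2) \<partial>lborel) \<le> ennreal ((1/4)^k)" if "k \<le> m" for k m
  proof -
    have "norm (X (r m) - X (r k)) < (1/2)^k" using that rM by (intro M) auto
    then have "(norm (X (r m) - X (r k)))\<^sup>2 \<le> ((1/2)^k)\<^sup>2" by (intro power_mono) auto
    also have "((1/2::real)^k)\<^sup>2 = (1/4)^k" by (simp add: power2_eq_square flip: power_mult_distrib)
    finally show ?thesis using nn_norm_diff_L2[OF F(1) F(1), of m k] F(2) by (simp add: ennreal_leI)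
  qed
  define d where "d k x = ennreal (2^k * (cmod (F (Suc k) x - F k x))\<^sup>2)" for k x
  have "(\<integral>\<^sup>+x. (\<Sum>k. d k x) \<partial>lborel) = (\<Sum>k. \<integral>\<^sup>+x. d k x \<partial>lborel)"
    by (rule nn_integral_suminf) (auto simp: d_def)
  also have "\<dots> \<le> (\<Sum>k. ennreal ((1/2)^k))"
  proof (rule suminf_le)
    fix k
    have "(\<integral>\<^sup>+x. d k x \<partial>lborel) = ennreal (2^k) * (\<integral>\<^sup>+x. ennreal ((cmod (F (Suc k) x - F k x))\<^sup>2) \<partial>lborel)"
      by (simp add: d_def[abs_def] ennreal_mult nn_integral_cmult)
    also have "\<dots> \<le> ennreal (2^k) * ennreal ((1/4)^k)" by (intro mult_left_mono diff) auto
    also have "\<dots> = ennreal ((1/2)^k)"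
      by (simp add: ennreal_mult[symmetric] flip: power_mult_distrib)
    finally show "(\<integral>\<^sup>+x. d k x \<partial>lborel) \<le> ennreal ((1/2)^k)" .
  qed auto
  also have "\<dots> = ennreal (\<Sum>k. (1/2)^k)" by (rule suminf_ennreal2) (auto intro!: summable_geometric)
  also have "\<dots> < \<infinity>" by simp
  finally have "AE x in lborel. (\<Sum>k. d k x) \<noteq> \<infinity>" by (intro nn_integral_PInf_AE) (auto simp: d_def)
  then have conv: "AE x in lborel. convergent (\<lambda>k. F k x)"
  proof eventually_elim
    case (elim x)
    have le: "d k x \<le> (\<Sum>k. d k x)" for k
      using sum_le_suminf[of "\<lambda>k. d k x" "{k}"] by simp
    obtain C where C: "0 \<le> C" "(\<Sum>k. d k x) = ennreal C"
      using elim by (cases "\<Sum>k. d k x" rule: ennreal_cases) auto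
    have "2^k * (cmod (F (Suc k) x - F k x))\<^sup>2 \<le> C" for k
      using le[of k] C unfolding d_def by simp
    then have "(cmod (F (Suc k) x - F k x))\<^sup>2 \<le> C / 2^k" for k by (simp add: field_simps)
    then have "cmod (F (Suc k) x - F k x) \<le> sqrt (C / 2^k)" for k by (simp add: real_le_rsqrt)
    then have "norm (F (Suc k) x - F k x) \<le> sqrt C * (sqrt (1/2))^k" for k
      by (simp add: real_sqrt_divide real_sqrt_power power_divide)
    moreover have "summable (\<lambda>k. sqrt C * (sqrt (1/2))^k)"
      by (intro summable_mult summable_geometric) (simp add: real_sqrt_divide)
    ultimately have "summable (\<lambda>k. F (Suc k) x - F k x)" by (rule summable_comparison_test'[rotated])
    then have "convergent (\<lambda>n. \<Sum>k<n. F (Suc k) x - F k x)" by (simp add: summable_iff_convergent)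
    then have "convergent (\<lambda>n. F n x - F 0 x)" by (simp only: sum_lessThan_telescope[where f = "\<lambda>k. F k x"])
    then show ?case by (auto simp: convergent_diff_const_right_iff)
  qed
  define h where "h x = lim (\<lambda>k. F k x)" for x
  have hm[measurable]: "h \<in> borel_measurable borel" unfolding h_def by measurable
  have lim: "AE x in lborel. (\<lambda>k. F k x) \<longlonglongrightarrow> h x"
    using conv by eventually_elim (simp add: h_def convergent_LIMSEQ_iff)
  have lim2: "(\<integral>\<^sup>+x. ennreal ((cmod (h x - F k x))\<^sup>2) \<partial>lborel) \<le> ennreal ((1/4)^k)" for k
  proof -
    have "(\<integral>\<^sup>+x. ennreal ((cmod (h x - F k x))\<^sup>2) \<partial>lborel)
        = (\<integral>\<^sup>+x. liminf (\<lambda>m. ennreal ((cmod (F m x - F k x))\<^sup>2)) \<partial>lborel)"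
      using lim
    proof (intro nn_integral_cong_AE, eventually_elim)
      case (elim x)
      have "(\<lambda>m. ennreal ((cmod (F m x - F k x))\<^sup>2)) \<longlonglongrightarrow> ennreal ((cmod (h x - F k x))\<^sup>2)"
        by (intro tendsto_intros elim)
      then show ?case by (rule lim_imp_Liminf[OF trivial_limit_sequentially, symmetric])
    qed
    also have "\<dots> \<le> liminf (\<lambda>m. \<integral>\<^sup>+x. ennreal ((cmod (F m x - F k x))\<^sup>2) \<partial>lborel)"
      by (intro nn_integral_liminf) auto
    also have "\<dots> \<le> ennreal ((1/4)^k)"
      by (intro Liminf_le) (auto simp: eventually_sequentially intro!: diff exI[of _ k])
    finally show ?thesis .
  qed
  have "(\<integral>\<^sup>+x. ennreal ((cmod (h x - F 0 x))\<^sup>2) \<partial>lborel) < \<infinity>"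
    using lim2[of 0] by (auto simp: le_less_trans)
  then have "square_integrable (\<lambda>x. h x - F 0 x)" by (auto simp: square_integrable_iff_nn)
  from square_integrable_add[OF this F(1)[of 0]] have h: "square_integrable h" by simp
  have "norm (X (r k) - abs_L2 h) \<le> (1/2)^k" for k
  proof -
    have "ennreal ((norm (abs_L2 h - X (r k)))\<^sup>2) \<le> ennreal ((1/4)^k)"
      using lim2[of k] nn_norm_diff_L2[OF h F(1)] F(2) by simp
    then have "(norm (abs_L2 h - X (r k)))\<^sup>2 \<le> (1/4)^k" by simp
    also have "(1/4::real)^k = ((1/2)^k)\<^sup>2" by (simp add: power2_eq_square flip: power_mult_distrib)
    finally show ?thesis by (subst norm_minus_commute) (rule power2_le_imp_le, auto)
  qed
  then have "(\<lambda>k. X (r k) - abs_L2 h) \<longlonglongrightarrow> 0"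
    by (intro Lim_null_comparison[OF _ LIMSEQ_realpow_zero[of "1/2"]]) auto
  then have "(X \<circ> r) \<longlonglongrightarrow> abs_L2 h" by (simp add: LIM_zero_iff o_def)
  with Cauchy_converges_subseq[OF assms r] show ?thesis by (auto simp: convergent_def)
qed

instance L2 :: complete_space
  by standard (rule L2_Cauchy_convergent)

instance L2 :: banach ..

lemma L2_dominated_convergence:
  assumes f: "\<And>n. f n \<in> borel_measurable borel" and h: "h \<in> borel_measurable borel"
    and lim: "AE x in lborel. (\<lambda>n. f n x) \<longlonglongrightarrow> h x"
    and g: "square_integrable g" and le: "\<And>n. AE x in lborel. cmod (f n x) \<le> cmod (g x)"
  shows "\<And>n. square_integrable (f n)" "square_integrable h" "(\<lambda>n. abs_L2 (f n)) \<longlonglongrightarrow> abs_L2 h"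
proof -
  have [measurable]: "h \<in> borel_measurable borel" "\<And>n. f n \<in> borel_measurable borel"
      "g \<in> borel_measurable borel"
    using h f g by (auto simp: square_integrable_def)
  have gi: "integrable lborel (\<lambda>x. (cmod (g x))\<^sup>2)" using g by (simp add: square_integrable_def)
  show fs: "square_integrable (f n)" for n
    unfolding square_integrable_def using f le[of n]
    by (auto intro!: Bochner_Integration.integrable_bound[OF gi] elim: eventually_mono)
  have hle: "AE x in lborel. cmod (h x) \<le> cmod (g x)"
  proof -
    have "AE x in lborel. \<forall>n. cmod (f n x) \<le> cmod (g x)" using le by (simp add: AE_all_countable)
    with lim show ?thesis
    proof eventually_elim
      case (elim x)
      show ?case using elim by (intro LIMSEQ_le_const2[OF tendsto_norm[OF elim(1)]]) auto
    qed
  qed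
  show hs: "square_integrable h"
    unfolding square_integrable_def using h hle
    by (auto intro!: Bochner_Integration.integrable_bound[OF gi] elim: eventually_mono)
  have "(\<lambda>n. \<integral>x. (cmod (f n x - h x))\<^sup>2 \<partial>lborel) \<longlonglongrightarrow> (\<integral>x. 0 \<partial>(lborel :: R3 measure))"
  proof (rule integral_dominated_convergence[where w = "\<lambda>x. 4 * (cmod (g x))\<^sup>2"])
    show "AE x in lborel. (\<lambda>n. (cmod (f n x - h x))\<^sup>2) \<longlonglongrightarrow> 0"
      using lim
    proof eventually_elim
      case (elim x)
      have "(\<lambda>n. (cmod (f n x - h x))\<^sup>2) \<longlonglongrightarrow> (cmod (h x - h x))\<^sup>2" by (intro tendsto_intros elim)
      then show ?case by simp
    qed
    show "AE x in lborel. norm ((cmod (f n x - h x))\<^sup>2) \<le> 4 * (cmod (g x))\<^sup>2" for n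
      using le[of n] hle
    proof eventually_elim
      case (elim x)
      have "cmod (f n x - h x) \<le> 2 * cmod (g x)" using elim norm_triangle_ineq4[of "f n x" "h x"] by simp
      then have "(cmod (f n x - h x))\<^sup>2 \<le> (2 * cmod (g x))\<^sup>2" by (intro power_mono) auto
      then show ?case by (simp add: power_mult_distrib)
    qed
  qed (use gi in auto)
  then have "(\<lambda>n. (norm (abs_L2 (f n) - abs_L2 h))\<^sup>2) \<longlonglongrightarrow> 0"
    by (simp add: abs_L2_diff norm_abs_L2_sq square_integrable_diff fs hs)
  then have "(\<lambda>n. sqrt ((norm (abs_L2 (f n) - abs_L2 h))\<^sup>2)) \<longlonglongrightarrow> sqrt 0" by (intro tendsto_intros)
  then have "(\<lambda>n. norm (abs_L2 (f n) - abs_L2 h)) \<longlonglongrightarrow> 0" by simp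
  then show "(\<lambda>n. abs_L2 (f n)) \<longlonglongrightarrow> abs_L2 h" by (simp add: tendsto_norm_zero_iff LIM_zero_iff)
qed

section \<open>Smooth test functions\<close>

lemma pd_eqI: "(\<phi> has_derivative D) (at x) \<Longrightarrow> pd i \<phi> x = D (axis i 1)"
  unfolding pd_def by (metis frechet_derivative_at)

lemma Ck_mono: "Ck (Suc k) \<phi> \<Longrightarrow> Ck k \<phi>"
  by (induction k arbitrary: \<phi>)
     (auto intro!: differentiable_imp_continuous_on simp: differentiable_on_def
        intro: differentiable_at_withinI)

lemma Ck_const [simp]: "Ck k (\<lambda>x. c)"
proof (induction k arbitrary: c)
  case (Suc k)
  have "pd i (\<lambda>x. c) = (\<lambda>x. 0)" for i
    by (simp add: pd_def fun_eq_iff)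
  then show ?case using Suc by simp
qed simp

lemma Ck_bounded_linear:
  assumes B: "bounded_linear B"
  shows "Ck k \<phi> \<Longrightarrow> Ck k (\<lambda>x. B (\<phi> x))"
proof (induction k arbitrary: \<phi>)
  case 0
  then show ?case by (auto intro!: linear_continuous_on_compose[of UNIV \<phi> B] 
      simp: linear_conv_bounded_linear B)
next
  case (Suc k)
  have d: "((\<lambda>x. B (\<phi> x)) has_derivative (\<lambda>h. B (frechet_derivative \<phi> (at x) h))) (at x)" for x
    using Suc.prems by (intro bounded_linear.has_derivative[OF B]) (auto simp: frechet_derivative_works)
  have "pd i (\<lambda>x. B (\<phi> x)) = (\<lambda>x. B (pd i \<phi> x))" for i
    using pd_eqI[OF d] by (auto simp: pd_def)
  then show ?case using Suc d by (auto simp: differentiable_def)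
qed

lemma pd_add:
  assumes "\<And>x. \<phi> differentiable (at x)" "\<And>x. \<psi> differentiable (at x)"
  shows "pd i (\<lambda>x. \<phi> x + \<psi> x) = (\<lambda>x. pd i \<phi> x + pd i \<psi> x)"
proof
  fix x
  have "((\<lambda>x. \<phi> x + \<psi> x) has_derivative
      (\<lambda>h. frechet_derivative \<phi> (at x) h + frechet_derivative \<psi> (at x) h)) (at x)"
    using assms by (intro has_derivative_add) (auto simp: frechet_derivative_works)
  from pd_eqI[OF this] show "pd i (\<lambda>x. \<phi> x + \<psi> x) x = pd i \<phi> x + pd i \<psi> x" by (simp add: pd_def)
qed

lemma pd_mult:
  assumes "\<phi> differentiable (at x)" "\<psi> differentiable (at x)"
  shows "pd i (\<lambda>x. \<phi> x * \<psi> x) x = \<phi> x * pd i \<psi> x + pd i \<phi> x * \<psi> x"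
proof -
  have "((\<lambda>x. \<phi> x * \<psi> x) has_derivative
      (\<lambda>h. \<phi> x * frechet_derivative \<psi> (at x) h + frechet_derivative \<phi> (at x) h * \<psi> x)) (at x)"
    using assms by (intro has_derivative_mult) (auto simp: frechet_derivative_works)
  from pd_eqI[OF this] show ?thesis by (simp add: pd_def)
qed

lemma Ck_add: "Ck k \<phi> \<Longrightarrow> Ck k \<psi> \<Longrightarrow> Ck k (\<lambda>x. \<phi> x + \<psi> x)"
  by (induction k arbitrary: \<phi> \<psi>) (auto intro!: continuous_intros derivative_intros simp: pd_add)

lemma Ck_mult: "Ck k \<phi> \<Longrightarrow> Ck k \<psi> \<Longrightarrow> Ck k (\<lambda>x. \<phi> x * \<psi> x)"
proof (induction k arbitrary: \<phi> \<psi>)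
  case (Suc k)
  have "pd i (\<lambda>x. \<phi> x * \<psi> x) = (\<lambda>x. \<phi> x * pd i \<psi> x + pd i \<phi> x * \<psi> x)" for i
    using Suc.prems by (intro ext pd_mult) auto
  moreover have "Ck k (\<lambda>x. \<phi> x * pd i \<psi> x + pd i \<phi> x * \<psi> x)" for i
    using Suc.prems by (intro Ck_add Suc.IH) (auto dest: Ck_mono simp del: Ck.simps, auto)
  ultimately show ?case using Suc.prems by (auto intro!: derivative_intros)
qed (auto intro!: continuous_intros)

lemma Ck_sum: "finite A \<Longrightarrow> (\<And>i. i \<in> A \<Longrightarrow> Ck k (\<phi> i)) \<Longrightarrow> Ck k (\<lambda>x. \<Sum>i\<in>A. \<phi> i x)"
  by (induction A rule: finite_induct) (auto intro!: Ck_add)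

lemma Ck_prod: "finite A \<Longrightarrow> (\<And>i. i \<in> A \<Longrightarrow> Ck k (\<phi> i)) \<Longrightarrow> Ck k (\<lambda>x. \<Prod>i\<in>A. \<phi> i x)"
  by (induction A rule: finite_induct) (auto intro!: Ck_mult)

lemma frechet_sum_pd:
  assumes "\<phi> differentiable (at x)"
  shows "frechet_derivative \<phi> (at x) h = (\<Sum>j\<in>UNIV. of_real (h $ j) * pd j \<phi> x)"
proof -
  interpret linear "frechet_derivative \<phi> (at x)" using assms by (rule linear_frechet_derivative)
  have "h = (\<Sum>j\<in>UNIV. (h $ j) *\<^sub>R axis j 1)"
    by (simp add: vec_eq_iff sum.delta axis_def if_distrib cong: if_cong)
  then have "frechet_derivative \<phi> (at x) h = frechet_derivative \<phi> (at x) (\<Sum>j\<in>UNIV. (h $ j) *\<^sub>R axis j 1)"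
    by simp
  also have "\<dots> = (\<Sum>j\<in>UNIV. (h $ j) *\<^sub>R pd j \<phi> x)"
    by (simp only: sum scale pd_def)
  finally show ?thesis by (simp add: scaleR_conv_of_real)
qed

lemma pd_affine:
  assumes \<phi>: "\<And>x. \<phi> differentiable (at x)" and A: "bounded_linear A"
  shows "((\<lambda>x. \<phi> (A x + c)) has_derivative (\<lambda>h. frechet_derivative \<phi> (at (A x + c)) (A h))) (at x)"
    "pd i (\<lambda>x. \<phi> (A x + c)) x = (\<Sum>j\<in>UNIV. of_real (A (axis i 1) $ j) * pd j \<phi> (A x + c))"
proof -
  have "((\<lambda>x. A x + c) has_derivative A) (at x)"
    using bounded_linear_imp_has_derivative[OF A] by (auto intro!: derivative_eq_intros)
  moreover have "(\<phi> has_derivative frechet_derivative \<phi> (at (A x + c))) (at (A x + c))"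
    using \<phi> by (simp add: frechet_derivative_works)
  ultimately show d: "((\<lambda>x. \<phi> (A x + c)) has_derivative (\<lambda>h. frechet_derivative \<phi> (at (A x + c)) (A h))) (at x)"
    using diff_chain_at[of "\<lambda>x. A x + c" A x \<phi>] by (simp add: o_def)
  show "pd i (\<lambda>x. \<phi> (A x + c)) x = (\<Sum>j\<in>UNIV. of_real (A (axis i 1) $ j) * pd j \<phi> (A x + c))"
    using pd_eqI[OF d, of i] by (simp add: frechet_sum_pd \<phi>)
qed

lemma Ck_affine: "bounded_linear A \<Longrightarrow> Ck k \<phi> \<Longrightarrow> Ck k (\<lambda>x. \<phi> (A x + c))"
proof (induction k arbitrary: \<phi>)
  case 0
  then have \<phi>: "continuous_on UNIV \<phi>" by simp
  have "continuous_on UNIV (\<lambda>x. \<phi> (A x + c))"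
    by (rule continuous_on_compose2[OF \<phi>]) (auto intro!: continuous_on_add[OF linear_continuous_on[OF 0(1)] continuous_on_const])
  then show ?case by simp
next
  case (Suc k)
  then have d: "\<And>x. \<phi> differentiable (at x)" by auto
  have "pd i (\<lambda>x. \<phi> (A x + c)) = (\<lambda>x. \<Sum>j\<in>UNIV. of_real (A (axis i 1) $ j) * pd j \<phi> (A x + c))" for i
    using pd_affine(2)[OF d Suc.prems(1)] by auto
  moreover have "Ck k (\<lambda>x. \<Sum>j\<in>UNIV. of_real (A (axis i 1) $ j) * pd j \<phi> (A x + c))" for i
    using Suc by (intro Ck_sum Ck_mult) auto
  moreover have "(\<lambda>x. \<phi> (A x + c)) differentiable (at x)" for x
    unfolding differentiable_def using pd_affine(1)[OF d Suc.prems(1)] by blast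
  ultimately show ?case by simp
qed

text \<open>A class of functions that is closed under differentiation consists of smooth functions.\<close>

lemma Ck_coordinate:
  assumes G: "\<And>g. g \<in> G \<Longrightarrow> \<exists>g'\<in>G. \<forall>t. (g has_real_derivative g' t) (at t)"
  shows "g \<in> G \<Longrightarrow> Ck k (\<lambda>x. complex_of_real (g (a * x $ i + b)))"
proof (induction k arbitrary: g)
  case 0
  then obtain g' where "\<And>t. (g has_real_derivative g' t) (at t)" using G by blast
  then have g: "continuous_on UNIV g"
    by (intro continuous_at_imp_continuous_on ballI) (rule DERIV_isCont)
  have "continuous_on UNIV (\<lambda>x::R3. g (a * x $ i + b))"
    by (rule continuous_on_compose2[OF g]) (auto intro!: continuous_intros)
  then show ?case by (auto intro!: continuous_on_of_real)
next
  case (Suc k)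
  then obtain g' where g': "g' \<in> G" "\<And>t. (g has_real_derivative g' t) (at t)" using G by blast
  have d: "((\<lambda>x. complex_of_real (g (a * x $ i + b))) has_derivative
      (\<lambda>h. of_real (a * h $ i * g' (a * x $ i + b)))) (at x)" for x
  proof -
    have "((\<lambda>x::R3. a * x $ i + b) has_derivative (\<lambda>h. a * h $ i)) (at x)"
      by (auto intro!: derivative_eq_intros bounded_linear_imp_has_derivative bounded_linear_vec_nth)
    from DERIV_compose_FDERIV[OF g'(2) this]
    have "((\<lambda>x. g (a * x $ i + b)) has_derivative (\<lambda>h. a * h $ i * g' (a * x $ i + b))) (at x)" .
    then show ?thesis by (rule has_derivative_of_real)
  qed
  have "pd j (\<lambda>x. complex_of_real (g (a * x $ i + b)))
      = (\<lambda>x. of_real (a * axis j 1 $ i) * complex_of_real (g' (a * x $ i + b)))" for j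
    using pd_eqI[OF d] by auto
  then show ?case using d Suc.IH[OF g'(1)] 
    by (auto simp: differentiable_def simp del: of_real_mult intro!: Ck_mult)
qed

lemma Ck_coord: "Ck k (\<lambda>x. complex_of_real (x $ i))"
  using Ck_coordinate[of "{\<lambda>t. t, \<lambda>t. 1, \<lambda>t. 0}" "\<lambda>t. t" k 1 i 0]
  by (auto intro!: derivative_eq_intros)

lemma test_functions_iff: "\<phi> \<in> test_functions \<longleftrightarrow> (\<forall>k. Ck k \<phi>) \<and> bounded {x. \<phi> x \<noteq> 0}"
  by (simp add: test_functions_def compact_closure)

lemma test_functions_bounded_support:
  assumes "\<phi> \<in> test_functions"
  obtains R where "R > 0" "\<And>x. norm x > R \<Longrightarrow> \<phi> x = 0"
proof -
  obtain R where "R > 0" "\<forall>x\<in>{x. \<phi> x \<noteq> 0}. norm x \<le> R"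
    using assms by (auto simp: test_functions_iff bounded_pos)
  then show ?thesis by (intro that[of R]) force+
qed

lemma test_functionsI:
  "(\<And>k. Ck k \<phi>) \<Longrightarrow> (\<And>x. norm x > R \<Longrightarrow> \<phi> x = 0) \<Longrightarrow> \<phi> \<in> test_functions"
  unfolding test_functions_iff by (auto simp: bounded_iff not_less[symmetric] intro!: exI[of _ R])

lemma test_functions_Ck: "\<phi> \<in> test_functions \<Longrightarrow> Ck k \<phi>"
  by (simp add: test_functions_iff)

lemma test_functions_differentiable: "\<phi> \<in> test_functions \<Longrightarrow> \<phi> differentiable (at x)"
  using test_functions_Ck[of \<phi> "Suc 0"] by simp

lemma test_functions_continuous: "\<phi> \<in> test_functions \<Longrightarrow> continuous_on UNIV \<phi>"
  using test_functions_Ck[of \<phi> 0] by simp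

lemma test_functions_measurable [measurable_dest]: "\<phi> \<in> test_functions \<Longrightarrow> \<phi> \<in> borel_measurable borel"
  by (intro borel_measurable_continuous_onI test_functions_continuous)

lemma bounded_support_bounded:
  fixes \<phi> :: "R3 \<Rightarrow> complex"
  assumes c: "continuous_on UNIV \<phi>" and R: "\<And>x. norm x > R \<Longrightarrow> \<phi> x = 0"
  shows "\<exists>B>0. \<forall>x. cmod (\<phi> x) \<le> B"
proof -
  have "bounded (\<phi> ` cball 0 R)"
    by (intro compact_imp_bounded compact_continuous_image continuous_on_subset[OF c]) auto
  then obtain B where B: "B > 0" "\<And>x. norm x \<le> R \<Longrightarrow> cmod (\<phi> x) \<le> B"
    by (auto simp: bounded_pos)
  have "cmod (\<phi> x) \<le> B" for x using B R[of x] by (cases "norm x \<le> R") auto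
  with B(1) show ?thesis by blast
qed

lemma bounded_support_integrable:
  fixes \<phi> :: "R3 \<Rightarrow> complex"
  assumes m: "\<phi> \<in> borel_measurable borel" and R: "\<And>x. norm x > R \<Longrightarrow> \<phi> x = 0" and B: "\<And>x. cmod (\<phi> x) \<le> B"
  shows "integrable lborel \<phi>" "square_integrable \<phi>"
proof -
  have *: "integrable lborel \<psi>" if "\<psi> \<in> borel_measurable borel" "\<And>x. norm x > R \<Longrightarrow> \<psi> x = 0"
      "\<And>x. norm (\<psi> x) \<le> C" for \<psi> :: "R3 \<Rightarrow> 'a::{banach, second_countable_topology}" and C
  proof (rule Bochner_Integration.integrable_bound)
    have "emeasure lborel (cball 0 R :: R3 set) < \<infinity>" by (intro emeasure_bounded_finite) auto
    then show "integrable lborel (\<lambda>x::R3. C * indicator (cball 0 R) x)"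
      by (intro integrable_mult_right integrable_real_indicator) auto
    show "AE x in lborel. norm (\<psi> x) \<le> norm (C * indicator (cball 0 R) x)"
    proof (rule AE_I2)
      fix x :: R3
      show "norm (\<psi> x) \<le> norm (C * indicator (cball 0 R) x)"
        using that(2)[of x] that(3)[of x] by (cases "norm x \<le> R") (auto simp: indicator_def)
    qed
  qed (use that in auto)
  show "integrable lborel \<phi>" by (rule *) (use assms in auto)
  have "integrable lborel (\<lambda>x. (cmod (\<phi> x))\<^sup>2)"
    by (rule *[of _ "B\<^sup>2"]) (use assms in \<open>auto intro!: power_mono\<close>)
  then show "square_integrable \<phi>" using m by (simp add: square_integrable_def)
qed

lemma test_functions_integrable:
  assumes "\<phi> \<in> test_functions"
  shows "integrable lborel \<phi>" "square_integrable \<phi>" "\<exists>B>0. \<forall>x. cmod (\<phi> x) \<le> B"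
proof -
  obtain R where R: "\<And>x. norm x > R \<Longrightarrow> \<phi> x = 0" using test_functions_bounded_support[OF assms] by blast
  show B: "\<exists>B>0. \<forall>x. cmod (\<phi> x) \<le> B"
    by (rule bounded_support_bounded[OF test_functions_continuous[OF assms] R])
  then show "integrable lborel \<phi>" "square_integrable \<phi>"
    using bounded_support_integrable[OF test_functions_measurable[OF assms] R] by auto
qed

lemma test_functions_add:
  assumes "\<phi> \<in> test_functions" "\<psi> \<in> test_functions"
  shows "(\<lambda>x. \<phi> x + \<psi> x) \<in> test_functions"
proof -
  obtain R where R: "\<And>x. norm x > R \<Longrightarrow> \<phi> x = 0" using test_functions_bounded_support[OF assms(1)] by blast
  obtain S where S: "\<And>x. norm x > S \<Longrightarrow> \<psi> x = 0" using test_functions_bounded_support[OF assms(2)] by blast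
  show ?thesis using assms R S
    by (intro test_functionsI[of _ "max R S"]) (auto intro!: Ck_add[OF test_functions_Ck test_functions_Ck])
qed

lemma test_functions_mult:
  assumes "\<phi> \<in> test_functions" "\<And>k. Ck k g"
  shows "(\<lambda>x. g x * \<phi> x) \<in> test_functions"
proof -
  obtain R where R: "\<And>x. norm x > R \<Longrightarrow> \<phi> x = 0" using test_functions_bounded_support[OF assms(1)] by blast
  show ?thesis using assms R
    by (intro test_functionsI[of _ R]) (auto intro!: Ck_mult[OF _ test_functions_Ck])
qed

lemma test_functions_cnj:
  assumes "\<phi> \<in> test_functions"
  shows "(\<lambda>x. cnj (\<phi> x)) \<in> test_functions"
proof -
  obtain R where R: "\<And>x. norm x > R \<Longrightarrow> \<phi> x = 0" using test_functions_bounded_support[OF assms(1)] by blast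
  show ?thesis using assms R
    by (intro test_functionsI[of _ R]) (auto intro!: Ck_bounded_linear[OF bounded_linear_cnj test_functions_Ck])
qed

lemma test_functions_pd:
  assumes "\<phi> \<in> test_functions"
  shows "pd i \<phi> \<in> test_functions"
proof -
  obtain R where R: "\<And>x. norm x > R \<Longrightarrow> \<phi> x = 0" using test_functions_bounded_support[OF assms(1)] by blast
  show ?thesis
  proof (rule test_functionsI[of _ R])
    show "Ck k (pd i \<phi>)" for k using test_functions_Ck[OF assms, of "Suc k"] by simp
    show "pd i \<phi> x = 0" if "norm x > R" for x
    proof -
      have "(\<phi> has_derivative (\<lambda>h. 0)) (at x)"
      proof (rule has_derivative_transform_within_open)
        show "open {x. norm x > R}" by (intro open_Collect_less continuous_intros)
        show "((\<lambda>x. 0) has_derivative (\<lambda>h. 0)) (at x)" by simp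
      qed (use that R in auto)
      from pd_eqI[OF this] show ?thesis by simp
    qed
  qed
qed

lemma test_functions_affine:
  assumes \<phi>: "\<phi> \<in> test_functions" and A: "bounded_linear A" and inv: "\<And>x. B (A x) = x" and B: "bounded_linear B"
  shows "(\<lambda>x. \<phi> (A x + c)) \<in> test_functions"
proof -
  obtain R where R: "R > 0" "\<And>x. norm x > R \<Longrightarrow> \<phi> x = 0" using test_functions_bounded_support[OF \<phi>] by blast
  obtain K where K: "K > 0" "\<And>x. norm (B x) \<le> norm x * K" using bounded_linear.pos_bounded[OF B] by blast
  show ?thesis
  proof (rule test_functionsI[of _ "(R + norm c) * K"])
    show "Ck k (\<lambda>x. \<phi> (A x + c))" for k by (intro Ck_affine A test_functions_Ck \<phi>)
    show "\<phi> (A x + c) = 0" if "norm x > (R + norm c) * K" for x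
    proof (rule R(2))
      have "(R + norm c) * K < norm (A x) * K" using that K(2)[of "A x"] by (simp add: inv)
      then have "R + norm c < norm (A x)" using K(1) by simp
      then show "R < norm (A x + c)" using norm_diff_ineq[of "A x" c] by linarith
    qed
  qed
qed

subsection \<open>Bump functions\<close>

text \<open>The derivative of \<open>p (1/t) e\<^sup>-\<^sup>1\<^sup>/\<^sup>t\<close> is \<open>t\<^sup>-\<^sup>2 (p - p') (1/t) e\<^sup>-\<^sup>1\<^sup>/\<^sup>t\<close>. Carrying the polynomial
  along as a parameter makes the class closed under differentiation, so that \<open>e\<^sup>-\<^sup>1\<^sup>/\<^sup>t\<close>, extended by
  zero, is smooth without a formula for its higher derivatives.\<close>

definition flat :: "real poly \<Rightarrow> real \<Rightarrow> real" where
  "flat p t = (if t \<le> 0 then 0 else poly p (1 / t) * exp (- (1 / t)))"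

lemma poly_times_exp_tendsto_0: "((\<lambda>s. poly p s * exp (- s)) \<longlongrightarrow> (0::real)) at_top"
proof -
  have "((\<lambda>s. \<Sum>i\<le>degree p. coeff p i * (s ^ i / exp s)) \<longlongrightarrow> (\<Sum>i\<le>degree p. coeff p i * 0)) at_top"
    by (intro tendsto_sum tendsto_mult tendsto_const tendsto_power_div_exp_0)
  then show ?thesis
    by (simp add: poly_altdef sum_distrib_right exp_minus divide_inverse mult.assoc)
qed

lemma flat_deriv: "(flat p has_real_derivative flat (monom 1 2 * (p - pderiv p)) t) (at t)"
proof -
  consider "t < 0" | "t > 0" | "t = 0" by linarith
  then show ?thesis
  proof cases
    case 1
    have "((\<lambda>t. 0) has_real_derivative 0) (at t)" by simp
    then have "(flat p has_real_derivative 0) (at t)"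
      by (rule has_field_derivative_transform_within_open[where S = "{..<0}"]) (use 1 in \<open>auto simp: flat_def\<close>)
    then show ?thesis using 1 by (simp add: flat_def)
  next
    case 2
    have "((\<lambda>t. poly p (1 / t) * exp (- (1 / t))) has_real_derivative
        flat (monom 1 2 * (p - pderiv p)) t) (at t)"
      using 2 by (auto intro!: derivative_eq_intros DERIV_chain'[of "\<lambda>t. 1/t" _ _ _ "poly p", OF _ poly_DERIV]
          simp: flat_def poly_monom field_simps power2_eq_square)
    then show ?thesis
      by (rule has_field_derivative_transform_within_open[where S = "{0<..}"]) (use 2 in \<open>auto simp: flat_def\<close>)
  next
    case 3
    have "((\<lambda>h. poly (p * [:0, 1:]) (1 / h) * exp (- (1 / h))) \<longlongrightarrow> 0) (at_right 0)"
      using filterlim_compose[OF poly_times_exp_tendsto_0 filterlim_inverse_at_top_right, of "p * [:0, 1:]"]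
      by (simp add: inverse_eq_divide)
    then have "((\<lambda>h. (flat p (0 + h) - flat p 0) / h) \<longlongrightarrow> 0) (at_right 0)"
      by (rule Lim_transform_eventually)
         (auto simp: eventually_at_filter flat_def field_simps)
    moreover have "((\<lambda>h. (flat p (0 + h) - flat p 0) / h) \<longlongrightarrow> 0) (at_left 0)"
      by (rule Lim_transform_eventually[of "\<lambda>_. 0"])
         (auto simp: eventually_at_filter flat_def)
    ultimately have "((\<lambda>h. (flat p (0 + h) - flat p 0) / h) \<longlongrightarrow> 0) (at 0)"
      by (simp add: filterlim_split_at)
    then have "(flat p has_real_derivative 0) (at 0)" by (simp add: DERIV_def)
    then show ?thesis using 3 by (simp add: flat_def)
  qed
qed

lemma Ck_flat: "Ck k (\<lambda>x. complex_of_real (flat p (a * x $ i + b)))"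
  by (rule Ck_coordinate[of "range flat"]) (auto intro: flat_deriv)

text \<open>The bumps \<open>box_bump n l r\<close> increase to the indicator of the open box between \<open>l\<close> and \<open>r\<close>.\<close>

definition box_bump :: "nat \<Rightarrow> R3 \<Rightarrow> R3 \<Rightarrow> R3 \<Rightarrow> real" where
  "box_bump n l r x = (\<Prod>i\<in>UNIV. flat 1 (real n * (x $ i - l $ i)) * flat 1 (real n * (r $ i - x $ i)))"

lemma flat_bounds: "0 \<le> flat 1 t" "flat 1 t \<le> 1" "flat 1 t > 0 \<longleftrightarrow> t > 0"
  by (auto simp: flat_def)

lemma box_bump_bounds: "0 \<le> box_bump n l r x" "box_bump n l r x \<le> 1"
  unfolding box_bump_def
  by (auto intro!: prod_nonneg prod_le_1 mult_le_one simp: flat_bounds)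

lemma box_bump_zero: "x \<notin> box l r \<Longrightarrow> box_bump n l r x = 0"
proof -
  assume "x \<notin> box l r"
  then obtain i where "\<not> (l $ i < x $ i \<and> x $ i < r $ i)" by (auto simp: mem_box_cart)
  then have "flat 1 (real n * (x $ i - l $ i)) * flat 1 (real n * (r $ i - x $ i)) = 0"
    by (auto simp: flat_def mult_le_0_iff not_less)
  then show ?thesis unfolding box_bump_def by (intro prod_zero) auto
qed

lemma box_bump_pos: "x \<in> box l r \<Longrightarrow> n > 0 \<Longrightarrow> box_bump n l r x > 0"
  unfolding box_bump_def by (auto intro!: prod_pos mult_pos_pos simp: flat_bounds mem_box_cart)

lemma box_bump_tendsto: "(\<lambda>n. box_bump n l r x) \<longlonglongrightarrow> indicator (box l r) x"
proof (cases "x \<in> box l r")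
  case True
  have *: "(\<lambda>n. flat 1 (real n * d)) \<longlonglongrightarrow> 1" if "d > 0" for d
  proof -
    have "(\<lambda>n. exp (- (1 / (real n * d)))) \<longlonglongrightarrow> 1"
      using that by real_asymp
    then show ?thesis
      by (rule Lim_transform_eventually)
         (use that in \<open>auto simp: flat_def eventually_sequentially mult_le_0_iff intro!: exI[of _ 1]\<close>)
  qed
  have "(\<lambda>n. box_bump n l r x) \<longlonglongrightarrow> (\<Prod>i\<in>(UNIV :: 3 set). 1 * 1)"
    unfolding box_bump_def using True by (intro tendsto_prod tendsto_mult *) (auto simp: mem_box_cart)
  then show ?thesis using True by simp
qed (simp add: box_bump_zero)

lemma box_bump_test: "(\<lambda>x. complex_of_real (box_bump n l r x)) \<in> test_functions"
  unfolding test_functions_iff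
proof (intro conjI allI)
  fix k
  have "Ck k (\<lambda>x. \<Prod>i\<in>UNIV. complex_of_real (flat 1 (real n * x $ i + (- real n * l $ i))) *
      complex_of_real (flat 1 ((- real n) * x $ i + real n * r $ i)))"
    by (intro Ck_prod Ck_mult Ck_flat finite)
  then show "Ck k (\<lambda>x. complex_of_real (box_bump n l r x))"
    by (simp add: box_bump_def right_diff_distrib algebra_simps)
next
  have "{x. complex_of_real (box_bump n l r x) \<noteq> 0} \<subseteq> box l r" using box_bump_zero by force
  then show "bounded {x. complex_of_real (box_bump n l r x) \<noteq> 0}" using bounded_box bounded_subset by blast
qed


subsection \<open>Density of the test functions\<close>

lemma norm_scaleC_L2: "norm (scaleC_L2 c u) = cmod c * norm u"
proof -
  have "(norm (scaleC_L2 c u))\<^sup>2 = (\<integral>x. (cmod c)\<^sup>2 * (cmod (rep_L2 u x))\<^sup>2 \<partial>lborel)"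
    unfolding norm_L2_sq using rep_L2_scaleC[of c u]
    by (intro integral_cong_AE) (auto simp: norm_mult power_mult_distrib)
  also have "\<dots> = (cmod c * norm u)\<^sup>2" by (simp add: norm_L2_sq power_mult_distrib)
  finally show ?thesis by (simp add: power2_eq_iff_nonneg)
qed

lemma scaleC_L2_add: "scaleC_L2 c (u + v) = scaleC_L2 c u + scaleC_L2 c v"
proof -
  have "AE x in lborel. rep_L2 (scaleC_L2 c (u + v)) x = rep_L2 (scaleC_L2 c u + scaleC_L2 c v) x"
    using rep_L2_scaleC[of c "u + v"] rep_L2_scaleC[of c u] rep_L2_scaleC[of c v] rep_L2_add[of u v]
      rep_L2_add[of "scaleC_L2 c u" "scaleC_L2 c v"]
    by eventually_elim (simp add: distrib_left)
  then show ?thesis by (rule L2_eqI)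
qed

lemma scaleC_L2_scaleC: "scaleC_L2 c (scaleC_L2 d u) = scaleC_L2 (c * d) u"
proof -
  have "AE x in lborel. rep_L2 (scaleC_L2 c (scaleC_L2 d u)) x = rep_L2 (scaleC_L2 (c * d) u) x"
    using rep_L2_scaleC[of c "scaleC_L2 d u"] rep_L2_scaleC[of d u] rep_L2_scaleC[of "c * d" u]
    by eventually_elim simp
  then show ?thesis by (rule L2_eqI)
qed

lemma scaleC_L2_one [simp]: "scaleC_L2 1 u = u"
  using scaleR_scaleC_L2[of 1 u] by simp

lemma bounded_linear_scaleC_L2: "bounded_linear (scaleC_L2 c)"
  by (rule bounded_linear_intro[of _ "cmod c"])
     (auto simp: scaleC_L2_add scaleR_scaleC_L2 scaleC_L2_scaleC norm_scaleC_L2 mult_ac)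

lemma abs_L2_sum:
  assumes "finite I" "\<And>i. i \<in> I \<Longrightarrow> square_integrable (f i)"
  shows "square_integrable (\<lambda>x. \<Sum>i\<in>I. f i x) \<and> abs_L2 (\<lambda>x. \<Sum>i\<in>I. f i x) = (\<Sum>i\<in>I. abs_L2 (f i))"
  using assms
proof (induction I rule: finite_induct)
  case empty
  then show ?case by (simp add: zero_L2_abs square_integrable_zero)
next
  case (insert i I)
  then show ?case by (auto simp: square_integrable_add abs_L2_add[symmetric])
qed

definition cube :: "nat \<Rightarrow> R3 set" where
  "cube n = box (vec (- real n)) (vec (real n))"

lemma cube_sets [measurable]: "cube n \<in> sets borel"
  by (simp add: cube_def)

lemma cube_bounded: "\<exists>R>0. \<forall>x\<in>cube n. norm x \<le> R"
  unfolding cube_def using bounded_box[of "vec (- real n) :: R3" "vec (real n)"] by (auto simp: bounded_pos)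

lemma square_integrable_indicator_cube: "square_integrable (indicator (A \<inter> cube n))" if "A \<in> sets borel"
proof -
  obtain R where R: "\<And>x. x \<in> cube n \<Longrightarrow> norm x \<le> R" using cube_bounded by blast
  have [measurable]: "A \<in> sets borel" by fact
  show ?thesis
    by (rule bounded_support_integrable(2)[of _ R 1]) (use R in \<open>auto simp: indicator_def not_less[symmetric]\<close>)
qed

text \<open>Density is proved inside a fixed cube. Approximants with a common bounded support converge
  in \<open>L\<^sup>1\<close> as soon as they converge in \<open>L\<^sup>2\<close>, and so do their Fourier integrals.\<close>

definition cube_tests :: "nat \<Rightarrow> L2 set" where
  "cube_tests n = abs_L2 ` {\<phi> \<in> test_functions. \<forall>x. x \<notin> cube n \<longrightarrow> \<phi> x = 0}"

lemma cube_tests_add: "u \<in> closure (cube_tests n) \<Longrightarrow> v \<in> closure (cube_tests n) \<Longrightarrow> u + v \<in> closure (cube_tests n)"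
proof -
  assume "u \<in> closure (cube_tests n)" "v \<in> closure (cube_tests n)"
  then obtain a b where ab: "\<And>i. a i \<in> cube_tests n" "a \<longlonglongrightarrow> u" "\<And>i. b i \<in> cube_tests n" "b \<longlonglongrightarrow> v"
    unfolding closure_sequential by blast
  have "a i + b i \<in> cube_tests n" for i
  proof -
    obtain \<phi> \<psi> where "a i = abs_L2 \<phi>" "b i = abs_L2 \<psi>" "\<phi> \<in> test_functions" "\<psi> \<in> test_functions"
      "\<forall>x. x \<notin> cube n \<longrightarrow> \<phi> x = 0" "\<forall>x. x \<notin> cube n \<longrightarrow> \<psi> x = 0"
      using ab(1,3)[of i] by (auto simp: cube_tests_def)
    then show ?thesis unfolding cube_tests_def
      by (intro image_eqI[of _ _ "\<lambda>x. \<phi> x + \<psi> x"]) (auto simp: abs_L2_add test_functions_integrable test_functions_add)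
  qed
  moreover have "(\<lambda>i. a i + b i) \<longlonglongrightarrow> u + v" by (intro tendsto_intros ab)
  ultimately show ?thesis unfolding closure_sequential by (intro exI[of _ "\<lambda>i. a i + b i"]) auto
qed

lemma cube_tests_scaleC: "u \<in> closure (cube_tests n) \<Longrightarrow> scaleC_L2 c u \<in> closure (cube_tests n)"
proof -
  assume "u \<in> closure (cube_tests n)"
  then obtain a where ab: "\<And>i. a i \<in> cube_tests n" "a \<longlonglongrightarrow> u"
    unfolding closure_sequential by blast
  have "scaleC_L2 c (a i) \<in> cube_tests n" for i
  proof -
    obtain \<phi> where "a i = abs_L2 \<phi>" "\<phi> \<in> test_functions" "\<forall>x. x \<notin> cube n \<longrightarrow> \<phi> x = 0"
      using ab(1)[of i] by (auto simp: cube_tests_def)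
    then show ?thesis unfolding cube_tests_def
      by (intro image_eqI[of _ _ "\<lambda>x. c * \<phi> x"])
         (auto simp: abs_L2_scaleC test_functions_integrable intro!: test_functions_mult)
  qed
  moreover have "(\<lambda>i. scaleC_L2 c (a i)) \<longlonglongrightarrow> scaleC_L2 c u"
    by (intro bounded_linear.tendsto[OF bounded_linear_scaleC_L2] ab)
  ultimately show ?thesis
    unfolding closure_sequential by (intro exI[of _ "\<lambda>i. scaleC_L2 c (a i)"]) auto
qed

lemma cube_tests_sum:
  assumes "\<And>i. i \<in> I \<Longrightarrow> f i \<in> closure (cube_tests n)"
  shows "sum f I \<in> closure (cube_tests n)"
proof -
  have z: "0 \<in> closure (cube_tests n)"
  proof -
    have "(\<lambda>x. 0) \<in> test_functions" by (rule test_functionsI[of _ 0]) auto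
    then have "0 \<in> cube_tests n" unfolding cube_tests_def zero_L2_abs by (intro image_eqI[of _ _ "\<lambda>x. 0"]) auto
    then show ?thesis using closure_subset by blast
  qed
  show ?thesis using assms by (induction I rule: infinite_finite_induct) (auto simp: z cube_tests_add)
qed

lemma cube_tests_limit:
  assumes "\<And>k. abs_L2 (f k) \<in> closure (cube_tests n)"
    and "\<And>k. f k \<in> borel_measurable borel" "h \<in> borel_measurable borel"
    and "\<And>x. (\<lambda>k. f k x) \<longlonglongrightarrow> h x" "square_integrable g" "\<And>k x. cmod (f k x) \<le> cmod (g x)"
  shows "abs_L2 h \<in> closure (cube_tests n)"
proof -
  have "(\<lambda>k. abs_L2 (f k)) \<longlonglongrightarrow> abs_L2 h"
    by (rule L2_dominated_convergence(3)[OF assms(2,3) AE_I2[OF assms(4)] assms(5) AE_I2[OF assms(6)]])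
  with closed_closure assms(1) show ?thesis by (rule closed_sequentially)
qed

text \<open>The sets with this property form a Dynkin system, and the boxes, which are reached by bumps,
  are closed under intersection and generate the Borel sets.\<close>

lemma indicator_in_cube_tests:
  assumes "A \<in> sets borel"
  shows "abs_L2 (indicator (A \<inter> cube n)) \<in> closure (cube_tests n)"
proof -
  let ?G = "range (\<lambda>(a, b). box a b) :: R3 set set"
  have box: "abs_L2 (indicator (box a b \<inter> cube n)) \<in> closure (cube_tests n)" for a b
  proof -
    define l r where "l = (\<chi> i. max (a $ i) (- real n))" and "r = (\<chi> i. min (b $ i) (real n))"
    have B: "box a b \<inter> cube n = box l r"
      unfolding cube_def l_def r_def by (auto simp: mem_box_cart set_eq_iff)
    let ?f = "\<lambda>k x. complex_of_real (box_bump k l r x)"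
    have "abs_L2 (indicator (box l r)) \<in> closure (cube_tests n)"
    proof (rule cube_tests_limit[where f = ?f and g = "indicator (box a b \<inter> cube n)"])
      fix k
      have "?f k \<in> test_functions" by (rule box_bump_test)
      moreover have "?f k x = 0" if "x \<notin> cube n" for x
        using that B box_bump_zero[of x l r k] by auto
      ultimately have "abs_L2 (?f k) \<in> cube_tests n" by (auto simp: cube_tests_def)
      then show "abs_L2 (?f k) \<in> closure (cube_tests n)" using closure_subset by blast
      show "?f k \<in> borel_measurable borel" using box_bump_test by (rule test_functions_measurable)
      show "cmod (?f k x) \<le> cmod (indicator (box a b \<inter> cube n) x)" for x
        using box_bump_bounds[of k l r x] box_bump_zero[of x l r k] B by (auto simp: indicator_def)
    next
      fix x
      have "(\<lambda>k. ?f k x) \<longlonglongrightarrow> complex_of_real (indicator (box l r) x)"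
        by (intro tendsto_of_real box_bump_tendsto)
      also have "complex_of_real (indicator (box l r) x) = indicator (box l r) x" by (simp add: indicator_def)
      finally show "(\<lambda>k. ?f k x) \<longlonglongrightarrow> indicator (box l r) x" .
    qed (auto simp: square_integrable_indicator_cube)
    then show ?thesis by (simp add: B)
  qed
  have sb: "sets (borel :: R3 measure) = sigma_sets UNIV ?G"
    by (subst borel_eq_box) simp
  have "Int_stable ?G"
  proof (rule Int_stableI)
    fix A B assume "A \<in> ?G" "B \<in> ?G"
    then obtain a b c d where "A = box a b" "B = box c d" by auto
    then have "A \<inter> B = box (\<chi> i. max (a $ i) (c $ i)) (\<chi> i. min (b $ i) (d $ i))"
      by (auto simp: mem_box_cart set_eq_iff)
    then show "A \<inter> B \<in> ?G" by auto
  qed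
  moreover have "?G \<subseteq> Pow UNIV" by simp
  moreover have "A \<in> sigma_sets UNIV ?G" using assms by (simp only: sb)
  ultimately show ?thesis
  proof (induction rule: sigma_sets_induct_disjoint)
    case (basic A)
    then show ?case using box by auto
  next
    case empty
    show ?case using cube_tests_sum[of "{}"] by (simp add: zero_L2_abs)
  next
    case (compl A)
    have A: "A \<in> sets borel" using compl(1) by (simp only: sb)
    have "indicator ((UNIV - A) \<inter> cube n)
        = (\<lambda>x. indicator (UNIV \<inter> cube n) x - indicator (A \<inter> cube n) x :: complex)"
      by (auto simp: indicator_def fun_eq_iff)
    then have "abs_L2 (indicator ((UNIV - A) \<inter> cube n))
        = abs_L2 (indicator (UNIV \<inter> cube n)) - abs_L2 (indicator (A \<inter> cube n))"
      using square_integrable_indicator_cube[OF A, of n] square_integrable_indicator_cube[of UNIV n]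
      by (simp only: abs_L2_diff space_borel[symmetric] sets.top)
    also have "\<dots> = abs_L2 (indicator (UNIV \<inter> cube n)) + scaleC_L2 (- 1) (abs_L2 (indicator (A \<inter> cube n)))"
      using scaleR_scaleC_L2[of "-1" "abs_L2 (indicator (A \<inter> cube n))"] by simp
    also have "\<dots> \<in> closure (cube_tests n)"
      using compl(2) box[of "vec (- real n)" "vec (real n)"]
      by (intro cube_tests_add cube_tests_scaleC) (auto simp flip: cube_def)
    finally show ?case .
  next
    case (union A)
    have A: "A i \<in> sets borel" for i using union(2) by (auto simp only: sb)
    show ?case
    proof (rule cube_tests_limit[where g = "indicator (UNIV \<inter> cube n)"])
      let ?f = "\<lambda>k x. \<Sum>i<k. indicator (A i \<inter> cube n) x :: complex"
      have eq: "?f k x = indicator ((\<Union>i<k. A i) \<inter> cube n) x" for k x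
      proof -
        have "disjoint_family_on (\<lambda>i. A i \<inter> cube n) {..<k}"
          using union(1) by (auto simp: disjoint_family_on_def)
        then have "?f k x = indicator (\<Union>i<k. A i \<inter> cube n) x"
          by (intro indicator_UN_disjoint[symmetric]) auto
        then show ?thesis by simp
      qed
      show "abs_L2 (?f k) \<in> closure (cube_tests n)" for k
        using union(3) abs_L2_sum[of "{..<k}" "\<lambda>i. indicator (A i \<inter> cube n)"] A
        by (auto simp: square_integrable_indicator_cube intro!: cube_tests_sum)
      show "?f k \<in> borel_measurable borel" for k using A by measurable
      show "indicator (\<Union> (range A) \<inter> cube n) \<in> borel_measurable borel" using A by measurable
      show "(\<lambda>k. ?f k x) \<longlonglongrightarrow> indicator (\<Union> (range A) \<inter> cube n) x" for x
      proof (cases "x \<in> \<Union> (range A) \<inter> cube n")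
        case True
        then obtain j where "x \<in> A j" "x \<in> cube n" by blast
        then have *: "?f k x = indicator (\<Union> (range A) \<inter> cube n) x" if "k > j" for k
          unfolding eq using that by (simp add: indicator_def) blast
        have "\<forall>\<^sub>F k in sequentially. ?f k x = indicator (\<Union> (range A) \<inter> cube n) x"
          using eventually_gt_at_top[of j] by eventually_elim (rule *)
        then show ?thesis by (rule tendsto_eventually)
      next
        case False
        then have "(\<lambda>k. ?f k x) = (\<lambda>k. 0)" by (auto simp: eq indicator_def fun_eq_iff)
        then show ?thesis using False by simp
      qed
      show "cmod (?f k x) \<le> cmod (indicator (UNIV \<inter> cube n) x)" for k x
        unfolding eq by (auto simp: indicator_def)
    qed (use square_integrable_indicator_cube[of UNIV n] in simp)
  qed
qed

lemma cube_tests_dense: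
  assumes f: "square_integrable f" and z: "\<And>x. x \<notin> cube n \<Longrightarrow> f x = 0"
  shows "abs_L2 f \<in> closure (cube_tests n)"
proof -
  have fm: "f \<in> borel_measurable borel" using square_integrable_measurable[OF f] by simp
  from borel_measurable_implies_sequence_metric[OF fm, of 0] obtain s where
    s: "\<And>i. simple_function borel (s i)" "\<And>x. (\<lambda>i. s i x) \<longlonglongrightarrow> f x"
      "\<And>i x. dist (s i x) 0 \<le> 2 * dist (f x) 0" by auto
  show ?thesis
  proof (rule cube_tests_limit[where f = s and g = "\<lambda>x. 2 * f x"])
    fix k
    have sz: "s k x = 0" if "x \<notin> cube n" for x using s(3)[of k x] z[OF that] by simp
    have fin: "finite (range (s k))" using s(1)[of k] by (simp add: simple_function_def)
    have meas: "s k -` {y} \<in> sets borel" for y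
      using simple_functionD(2)[OF s(1)[of k], of "{y}"] by simp
    have "(\<lambda>x. \<Sum>y\<in>range (s k). y * indicator (s k -` {y} \<inter> cube n) x) = s k"
    proof
      fix x
      have "(\<Sum>y\<in>range (s k). y * indicator (s k -` {y} \<inter> cube n) x)
          = (\<Sum>y\<in>range (s k). if y = s k x then y * indicator (cube n) x else 0)"
        by (intro sum.cong) (auto simp: indicator_def)
      also have "\<dots> = s k x" using fin sz[of x] by (auto simp: indicator_def)
      finally show "(\<Sum>y\<in>range (s k). y * indicator (s k -` {y} \<inter> cube n) x) = s k x" .
    qed
    then have "abs_L2 (s k) = abs_L2 (\<lambda>x. \<Sum>y\<in>range (s k). y * indicator (s k -` {y} \<inter> cube n) x)"
      by simp
    also have "\<dots> = (\<Sum>y\<in>range (s k). abs_L2 (\<lambda>x. y * indicator (s k -` {y} \<inter> cube n) x))"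
      using fin meas by (intro abs_L2_sum[THEN conjunct2] square_integrable_cmult square_integrable_indicator_cube)
    also have "\<dots> = (\<Sum>y\<in>range (s k). scaleC_L2 y (abs_L2 (indicator (s k -` {y} \<inter> cube n))))"
      using meas by (intro sum.cong) (auto simp: abs_L2_scaleC square_integrable_indicator_cube)
    also have "\<dots> \<in> closure (cube_tests n)"
      using meas by (intro cube_tests_sum cube_tests_scaleC indicator_in_cube_tests)
    finally show "abs_L2 (s k) \<in> closure (cube_tests n)" .
    show "s k \<in> borel_measurable borel" using s(1) by (rule borel_measurable_simple_function)
    show "cmod (s k x) \<le> cmod (2 * f x)" for x using s(3)[of k x] by (simp add: norm_mult)
  qed (use fm s f in \<open>auto intro: square_integrable_cmult\<close>)
qed

lemma cube_eventually: "\<forall>\<^sub>F n in sequentially. x \<in> cube n"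
proof -
  obtain N :: nat where N: "norm x < real N" using reals_Archimedean2[of "norm x"] by blast
  have "x \<in> cube n" if "n \<ge> N" for n
  proof -
    have "\<bar>x $ i\<bar> < real n" for i using component_le_norm_cart[of x i] N that by linarith
    then have "- real n < x $ i \<and> x $ i < real n" for i by (simp add: abs_less_iff minus_less_iff)
    then show ?thesis by (simp add: cube_def mem_box_cart)
  qed
  then show ?thesis unfolding eventually_sequentially by blast
qed

lemma cube_truncation_tendsto: 
  assumes "square_integrable f"
  shows "(\<lambda>n. abs_L2 (\<lambda>x. indicator (cube n) x * f x)) \<longlonglongrightarrow> abs_L2 f"
    "square_integrable (\<lambda>x. indicator (cube n) x * f x)"
proof -
  have f: "f \<in> borel_measurable borel" using square_integrable_measurable[OF assms] by simp
  have m: "(\<lambda>x. indicator (cube n) x * f x) \<in> borel_measurable borel" for n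
    by (intro borel_measurable_times borel_measurable_indicator f cube_sets)
  have lim: "(\<lambda>n. indicator (cube n) x * f x) \<longlonglongrightarrow> f x" for x
    by (intro tendsto_eventually eventually_mono[OF cube_eventually[of x]]) simp
  have le: "cmod (indicator (cube n) x * f x) \<le> cmod (f x)" for n x
    by (simp add: indicator_def)
  show "(\<lambda>n. abs_L2 (\<lambda>x. indicator (cube n) x * f x)) \<longlonglongrightarrow> abs_L2 f"
    by (rule L2_dominated_convergence(3)[OF m f AE_I2[OF lim] assms AE_I2[OF le]])
  show "square_integrable (\<lambda>x. indicator (cube n) x * f x)"
    by (rule L2_dominated_convergence(1)[OF m f AE_I2[OF lim] assms AE_I2[OF le]])
qed

lemma test_functions_dense: "closure (abs_L2 ` test_functions) = UNIV"
proof -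
  have "u \<in> closure (abs_L2 ` test_functions)" for u
  proof -
    have "abs_L2 (\<lambda>x. indicator (cube n) x * rep_L2 u x) \<in> closure (abs_L2 ` test_functions)" for n
    proof -
      have "abs_L2 (\<lambda>x. indicator (cube n) x * rep_L2 u x) \<in> closure (cube_tests n)"
        by (intro cube_tests_dense cube_truncation_tendsto) auto
      moreover have "closure (cube_tests n) \<subseteq> closure (abs_L2 ` test_functions)"
        by (intro closure_mono) (auto simp: cube_tests_def)
      ultimately show ?thesis by blast
    qed
    then show ?thesis
      using closed_sequentially[OF closed_closure _ cube_truncation_tendsto(1)[of "rep_L2 u"]] by simp
  qed
  then show ?thesis by blast
qed

section \<open>The Fourier transform on \<open>L\<^sup>2\<close>\<close>

text \<open>There is no normalizing factor, as in \<^const>\<open>L2_fourier\<close>; Plancherel's identity therefore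
  carries the factor \<open>(2\<pi>)\<^sup>3\<close>.\<close>

definition ft :: "(R3 \<Rightarrow> complex) \<Rightarrow> R3 \<Rightarrow> complex" where
  "ft u \<xi> = (\<integral>x. cis (- (\<xi> \<bullet> x)) * u x \<partial>lborel)"

lemma borel_measurable_cis [measurable (raw)]:
  "f \<in> borel_measurable M \<Longrightarrow> (\<lambda>x. cis (f x)) \<in> borel_measurable M"
  by (rule borel_measurable_continuous_on[of cis]) (auto simp: cis_conv_exp intro!: continuous_intros)

lemma borel_measurable_cnj [measurable (raw)]:
  "f \<in> borel_measurable M \<Longrightarrow> (\<lambda>x. cnj (f x)) \<in> borel_measurable M"
  by (rule borel_measurable_continuous_on[of cnj]) (auto intro!: continuous_intros)

lemma integrable_cis_mult:
  fixes u :: "R3 \<Rightarrow> complex"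
  assumes "integrable lborel u" "g \<in> borel_measurable borel"
  shows "integrable lborel (\<lambda>x. cis (g x) * u x)"
  using assms(1) by (rule Bochner_Integration.integrable_bound) (use assms in \<open>auto simp: norm_mult\<close>)

lemma ft_measurable [measurable]:
  assumes [measurable]: "u \<in> borel_measurable borel"
  shows "ft u \<in> borel_measurable borel"
proof -
  have "(\<lambda>\<xi>. \<integral>x. cis (- (\<xi> \<bullet> x)) * u x \<partial>lborel) \<in> borel_measurable lborel"
    by (rule lborel.borel_measurable_lebesgue_integral) measurable
  then show ?thesis by (simp add: ft_def[abs_def])
qed

lemma ft_bound: "integrable lborel u \<Longrightarrow> cmod (ft u \<xi>) \<le> (\<integral>x. cmod (u x) \<partial>lborel)"
  unfolding ft_def by (rule order_trans[OF integral_norm_bound]) (simp add: norm_mult)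

lemma ft_cong_AE:
  assumes "AE x in lborel. u x = v x" "u \<in> borel_measurable borel" "v \<in> borel_measurable borel"
  shows "ft u \<xi> = ft v \<xi>"
  unfolding ft_def using assms by (intro integral_cong_AE) (auto elim: eventually_mono)

lemma ft_add:
  assumes "integrable lborel u" "integrable lborel v"
  shows "ft (\<lambda>x. u x + v x) \<xi> = ft u \<xi> + ft v \<xi>"
  unfolding ft_def using assms by (simp add: distrib_left integrable_cis_mult)

lemma ft_diff:
  assumes "integrable lborel u" "integrable lborel v"
  shows "ft (\<lambda>x. u x - v x) \<xi> = ft u \<xi> - ft v \<xi>"
  unfolding ft_def using assms by (simp add: right_diff_distrib integrable_cis_mult)

lemma ft_cmult: "ft (\<lambda>x. c * u x) \<xi> = c * ft u \<xi>"
  unfolding ft_def by (simp add: mult.left_commute)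

text \<open>Fubini moves the Fourier transform from one factor of a product to the other.\<close>

lemma ft_multiplication_formula:
  assumes u: "integrable lborel u" and v: "integrable lborel v"
  shows "(\<integral>\<xi>. ft u \<xi> * v \<xi> \<partial>lborel) = (\<integral>x. u x * ft v x \<partial>lborel)"
proof -
  have [measurable]: "u \<in> borel_measurable borel" "v \<in> borel_measurable borel" using u v by auto
  let ?F = "\<lambda>(\<xi>, x). cis (- (\<xi> \<bullet> x)) * (v \<xi> * u x)"
  have uv: "integrable (lborel \<Otimes>\<^sub>M lborel) (\<lambda>(\<xi>, x). v \<xi> * u x)"
  proof (rule lborel_pair.Fubini_integrable)
    show "(\<lambda>(\<xi>, x). v \<xi> * u x) \<in> borel_measurable (lborel \<Otimes>\<^sub>M lborel)" by measurable
    show "integrable lborel (\<lambda>\<xi>. \<integral>x. norm (case (\<xi>, x) of (\<xi>, x) \<Rightarrow> v \<xi> * u x) \<partial>lborel)"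
      using u v by (simp add: norm_mult)
    show "AE \<xi> in lborel. integrable lborel (\<lambda>x. case (\<xi>, x) of (\<xi>, x) \<Rightarrow> v \<xi> * u x)"
      using u by simp
  qed
  have F: "integrable (lborel \<Otimes>\<^sub>M lborel) ?F"
    by (rule Bochner_Integration.integrable_bound[OF uv]) (auto simp: norm_mult)
  have "(\<integral>\<xi>. ft u \<xi> * v \<xi> \<partial>lborel) = (\<integral>\<xi>. (\<integral>x. ?F (\<xi>, x) \<partial>lborel) \<partial>lborel)"
    unfolding ft_def by (simp add: mult_ac flip: integral_mult_right_zero)
  also have "\<dots> = (\<integral>x. (\<integral>\<xi>. ?F (\<xi>, x) \<partial>lborel) \<partial>lborel)"
    using lborel_pair.Fubini_integral[OF F] by simp
  also have "\<dots> = (\<integral>x. u x * ft v x \<partial>lborel)"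
    unfolding ft_def by (simp add: mult_ac inner_commute flip: integral_mult_right_zero)
  finally show ?thesis .
qed

subsection \<open>Gaussians\<close>

lemma integral_lborel_product:
  fixes g :: "3 \<Rightarrow> real \<Rightarrow> complex"
  assumes g: "\<And>i. integrable lborel (g i)"
  shows "(\<integral>x. (\<Prod>i\<in>UNIV. g i (x $ i)) \<partial>(lborel :: R3 measure)) = (\<Prod>i\<in>UNIV. \<integral>t. g i t \<partial>lborel)"
    "integrable (lborel :: R3 measure) (\<lambda>x. \<Prod>i\<in>UNIV. g i (x $ i))"
proof -
  interpret product_sigma_finite "\<lambda>_. lborel :: real measure" by standard
  define h where "h b = g (THE i. b = axis i 1)" for b :: R3
  have h: "h (axis i 1) = g i" for i unfolding h_def by (subst the1_equality) (auto simp: axis_eq_axis)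
  have B: "(Basis :: R3 set) = range (\<lambda>i. axis i 1)" by (auto simp: Basis_vec_def)
  have inj: "inj (\<lambda>i::3. axis i (1::real))" by (auto simp: inj_on_def axis_eq_axis)
  have p: "(\<Prod>b\<in>Basis. h b (f b)) = (\<Prod>i\<in>UNIV. g i (f (axis i 1)))" for f :: "R3 \<Rightarrow> real"
    unfolding B by (subst prod.reindex[OF inj]) (simp add: h)
  have hi: "integrable lborel (h b)" for b unfolding h_def by (rule g)
  have [measurable]: "\<And>i. g i \<in> borel_measurable borel" using g borel_measurable_integrable by fastforce
  have nth: "(\<Sum>b\<in>Basis. f b *\<^sub>R b) $ i = f (axis i 1)" for f :: "R3 \<Rightarrow> real" and i
  proof -
    have "(\<Sum>b\<in>Basis. f b *\<^sub>R b) \<bullet> axis i 1 = f (axis i 1)"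
      by (rule inner_sum_left_Basis) (auto simp: B)
    then show ?thesis by (simp add: inner_axis)
  qed
  have m: "(\<lambda>f. \<Sum>b\<in>Basis. f b *\<^sub>R b) \<in> measurable (\<Pi>\<^sub>M b\<in>Basis. lborel) (borel :: R3 measure)" by measurable
  have mg: "(\<lambda>x::R3. \<Prod>i\<in>UNIV. g i (x $ i)) \<in> borel_measurable borel" by measurable
  show "(\<integral>x. (\<Prod>i\<in>UNIV. g i (x $ i)) \<partial>(lborel :: R3 measure)) = (\<Prod>i\<in>UNIV. \<integral>t. g i t \<partial>lborel)"
  proof -
    have "(\<integral>x. (\<Prod>i\<in>UNIV. g i (x $ i)) \<partial>(lborel :: R3 measure))
        = (\<integral>f. (\<Prod>i\<in>UNIV. g i ((\<Sum>b\<in>Basis. f b *\<^sub>R b :: R3) $ i)) \<partial>(\<Pi>\<^sub>M b\<in>(Basis :: R3 set). lborel))"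
      by (subst lborel_eq, rule integral_distr[OF m mg])
    also have "\<dots> = (\<integral>f. (\<Prod>b\<in>Basis. h b (f b)) \<partial>(\<Pi>\<^sub>M b\<in>(Basis :: R3 set). lborel))"
      by (simp only: nth p)
    also have "\<dots> = (\<Prod>b\<in>Basis. \<integral>t. h b t \<partial>lborel)"
      by (rule product_integral_prod) (auto simp: hi)
    also have "\<dots> = (\<Prod>i\<in>UNIV. \<integral>t. g i t \<partial>lborel)"
      unfolding B by (subst prod.reindex[OF inj]) (simp add: h)
    finally show ?thesis .
  qed
  show "integrable (lborel :: R3 measure) (\<lambda>x. \<Prod>i\<in>UNIV. g i (x $ i))"
  proof -
    have "integrable (\<Pi>\<^sub>M b\<in>(Basis :: R3 set). lborel) (\<lambda>f. \<Prod>b\<in>Basis. h b (f b))"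
      by (rule product_integrable_prod) (auto simp: hi)
    then have "integrable (\<Pi>\<^sub>M b\<in>(Basis :: R3 set). lborel)
        (\<lambda>f. \<Prod>i\<in>UNIV. g i ((\<Sum>b\<in>Basis. f b *\<^sub>R b :: R3) $ i))"
      by (simp only: nth p)
    then show ?thesis by (subst lborel_eq, subst integrable_distr_eq[OF m mg])
  qed
qed

definition gauss :: "real \<Rightarrow> R3 \<Rightarrow> real" where
  "gauss \<epsilon> \<xi> = exp (- (\<epsilon>\<^sup>2 * (norm \<xi>)\<^sup>2 / 2))"

text \<open>The transform of a Gaussian is the characteristic function of a normal distribution.\<close>

lemma gauss_1d:
  assumes "\<epsilon> > 0"
  shows "integrable lborel (\<lambda>t::real. complex_of_real (exp (- (\<epsilon>\<^sup>2 * t\<^sup>2 / 2))))"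
    "integrable lborel (\<lambda>t. cis (- (t * s)) * complex_of_real (exp (- (\<epsilon>\<^sup>2 * t\<^sup>2 / 2))))"
    "(\<integral>t. cis (- (t * s)) * complex_of_real (exp (- (\<epsilon>\<^sup>2 * t\<^sup>2 / 2))) \<partial>lborel)
      = of_real (sqrt (2 * pi) / \<epsilon> * exp (- (s\<^sup>2 / (2 * \<epsilon>\<^sup>2))))"
proof -
  have d: "std_normal_density t = exp (- (t\<^sup>2 / 2)) / sqrt (2 * pi)" for t
    by (simp add: std_normal_density_def)
  have "integrable lborel (\<lambda>t. sqrt (2 * pi) * std_normal_density t)"
    by (intro integrable_mult_right integrable_normal_density) simp
  then have "integrable lborel (\<lambda>t::real. exp (- (t\<^sup>2 / 2)))" by (simp add: d)
  then have "integrable lborel (\<lambda>t::real. exp (- ((0 + \<epsilon> * t)\<^sup>2 / 2)))"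
    using assms by (subst lborel_integrable_real_affine_iff) auto
  then show 1: "integrable lborel (\<lambda>t::real. complex_of_real (exp (- (\<epsilon>\<^sup>2 * t\<^sup>2 / 2))))"
    by (simp only: complex_of_real_integrable_eq add_0 power_mult_distrib)
  show "integrable lborel (\<lambda>t. cis (- (t * s)) * complex_of_real (exp (- (\<epsilon>\<^sup>2 * t\<^sup>2 / 2))))"
    using 1 by (rule Bochner_Integration.integrable_bound) (auto simp: norm_mult)
  have "(\<integral>t. cis (- (t * s)) * complex_of_real (exp (- (\<epsilon>\<^sup>2 * t\<^sup>2 / 2))) \<partial>lborel)
    = (1 / \<epsilon>) *\<^sub>R (\<integral>t. cis (- ((0 + 1 / \<epsilon> * t) * s)) * complex_of_real (exp (- (\<epsilon>\<^sup>2 * (0 + 1 / \<epsilon> * t)\<^sup>2 / 2))) \<partial>lborel)"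
    using assms by (subst lborel_integral_real_affine[where c = "1/\<epsilon>" and t = 0]) auto
  also have "(\<lambda>t. cis (- ((0 + 1 / \<epsilon> * t) * s)) * complex_of_real (exp (- (\<epsilon>\<^sup>2 * (0 + 1 / \<epsilon> * t)\<^sup>2 / 2))))
    = (\<lambda>t. complex_of_real (sqrt (2 * pi)) * (std_normal_density t *\<^sub>R iexp (- (s / \<epsilon>) * t)))"
    using assms by (auto simp: fun_eq_iff d cis_conv_exp scaleR_conv_of_real power_mult_distrib field_simps)
  also have "(\<integral>t. complex_of_real (sqrt (2 * pi)) * (std_normal_density t *\<^sub>R iexp (- (s / \<epsilon>) * t)) \<partial>lborel)
    = complex_of_real (sqrt (2 * pi)) * char std_normal_distribution (- (s / \<epsilon>))"
    by (simp add: char_def integral_density normal_density_nonneg del: of_real_mult mult_scaleR_right)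
  also have "char std_normal_distribution (- (s / \<epsilon>)) = of_real (exp (- (s\<^sup>2 / (2 * \<epsilon>\<^sup>2))))"
    by (simp add: char_std_normal_distribution power_divide)
  finally show "(\<integral>t. cis (- (t * s)) * complex_of_real (exp (- (\<epsilon>\<^sup>2 * t\<^sup>2 / 2))) \<partial>lborel)
      = of_real (sqrt (2 * pi) / \<epsilon> * exp (- (s\<^sup>2 / (2 * \<epsilon>\<^sup>2))))"
    by (simp add: scaleR_conv_of_real)
qed

lemma norm_sq_R3: "(norm (x :: R3))\<^sup>2 = (\<Sum>i\<in>UNIV. (x $ i)\<^sup>2)"
  by (simp add: norm_vec_def L2_set_def sum_nonneg)

lemma gauss_prod: "gauss \<epsilon> \<xi> = (\<Prod>i\<in>UNIV. exp (- (\<epsilon>\<^sup>2 * (\<xi> $ i)\<^sup>2 / 2)))"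
  unfolding gauss_def norm_sq_R3 by (simp add: exp_sum[symmetric] sum_negf sum_distrib_left sum_divide_distrib)

lemma gauss_integrable: "\<epsilon> > 0 \<Longrightarrow> integrable lborel (\<lambda>\<xi>. complex_of_real (gauss \<epsilon> \<xi>))"
  unfolding gauss_prod of_real_prod
  by (rule integral_lborel_product(2)[of "\<lambda>i t. complex_of_real (exp (- (\<epsilon>\<^sup>2 * t\<^sup>2 / 2)))"]) (rule gauss_1d)

lemma cis_sum: "finite A \<Longrightarrow> cis (\<Sum>i\<in>A. f i) = (\<Prod>i\<in>A. cis (f i))"
  by (induction A rule: finite_induct) (auto simp: cis_mult[symmetric])

lemma ft_gauss:
  assumes "\<epsilon> > 0"
  shows "ft (\<lambda>\<xi>. of_real (gauss \<epsilon> \<xi>)) x = of_real ((sqrt (2 * pi) / \<epsilon>)^3 * gauss (1 / \<epsilon>) x)"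
proof -
  have "ft (\<lambda>\<xi>. of_real (gauss \<epsilon> \<xi>)) x
    = (\<integral>\<xi>. (\<Prod>i\<in>UNIV. cis (- (\<xi> $ i * x $ i)) * complex_of_real (exp (- (\<epsilon>\<^sup>2 * (\<xi> $ i)\<^sup>2 / 2)))) \<partial>lborel)"
    unfolding ft_def gauss_prod
    by (simp add: inner_vec_def prod.distrib cis_sum[symmetric] sum_negf[symmetric] mult.commute[of "x $ _"])
  also have "\<dots> = (\<Prod>i\<in>UNIV. of_real (sqrt (2 * pi) / \<epsilon> * exp (- ((x $ i)\<^sup>2 / (2 * \<epsilon>\<^sup>2)))))"
    by (subst integral_lborel_product(1)[of "\<lambda>i t. cis (- (t * x $ i)) * complex_of_real (exp (- (\<epsilon>\<^sup>2 * t\<^sup>2 / 2)))"])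
       (use assms in \<open>auto simp: gauss_1d\<close>)
  also have "\<dots> = of_real (\<Prod>i\<in>UNIV. sqrt (2 * pi) / \<epsilon> * exp (- ((1/\<epsilon>)\<^sup>2 * (x $ i)\<^sup>2 / 2)))"
    unfolding of_real_prod by (intro prod.cong refl) (simp add: power_divide mult.commute)
  also have "(\<Prod>i\<in>UNIV. sqrt (2 * pi) / \<epsilon> * exp (- ((1/\<epsilon>)\<^sup>2 * (x $ i)\<^sup>2 / 2))) = (sqrt (2 * pi) / \<epsilon>)^3 * gauss (1 / \<epsilon>) x"
    unfolding gauss_prod by (simp only: prod.distrib prod_constant card_num1 card_bit1 card_num0) simp
  finally show ?thesis .
qed

lemma integral_gauss: "(\<integral>x. complex_of_real (gauss 1 x) \<partial>lborel) = of_real (sqrt (2 * pi) ^ 3)"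
  using ft_gauss[of 1 0] by (simp add: ft_def gauss_def)

lemma integral_lborel_affine:
  fixes f :: "R3 \<Rightarrow> complex"
  assumes [measurable]: "f \<in> borel_measurable borel" and c: "c > 0"
  shows "(\<integral>x. f x \<partial>lborel) = of_real (c ^ 3) * (\<integral>x. f (t + c *\<^sub>R x) \<partial>lborel)"
proof -
  have "(\<integral>x. f x \<partial>lborel) = (\<integral>x. f x \<partial>(density (distr lborel borel (\<lambda>x. t + c *\<^sub>R x)) (\<lambda>_. ennreal (c ^ 3))))"
    using lborel_affine[of c t] c by simp
  also have "\<dots> = (\<integral>x. (c ^ 3) *\<^sub>R f x \<partial>(distr lborel borel (\<lambda>x. t + c *\<^sub>R x)))"
    using c by (intro integral_density) auto
  also have "\<dots> = of_real (c ^ 3) * (\<integral>x. f (t + c *\<^sub>R x) \<partial>lborel)"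
  proof -
    have "(\<lambda>x::R3. t + c *\<^sub>R x) \<in> measurable lborel borel" by measurable
    then show ?thesis by (subst integral_distr) (auto simp: scaleR_conv_of_real)
  qed
  finally show ?thesis .
qed


subsection \<open>Plancherel's theorem\<close>

text \<open>With the weight \<open>gauss \<epsilon>\<close> the double integral that defines \<open>\<bar>ft \<phi>\<bar>\<^sup>2\<close> can be evaluated by Fubini;
  it becomes the correlation of \<open>\<phi>\<close> with a Gaussian average of itself over the distance \<open>\<epsilon>\<close>.\<close>

lemma gauss_weighted_plancherel:
  assumes \<phi>: "integrable lborel \<phi>" and e: "\<epsilon> > 0"
  shows "(\<integral>\<xi>. ft \<phi> \<xi> * (of_real (gauss \<epsilon> \<xi>) * cnj (ft \<phi> \<xi>)) \<partial>lborel)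
    = of_real (sqrt (2 * pi) ^ 3) * (\<integral>x. \<phi> x * cnj (\<integral>z. \<phi> (x + \<epsilon> *\<^sub>R z) * of_real (gauss 1 z) \<partial>lborel) \<partial>lborel)"
proof -
  have [measurable]: "\<phi> \<in> borel_measurable borel" using \<phi> by auto
  have [measurable]: "gauss \<epsilon> \<in> borel_measurable borel" for \<epsilon> unfolding gauss_def[abs_def] by measurable
  have g: "integrable lborel (\<lambda>\<xi>. complex_of_real (gauss \<epsilon> \<xi>))" using e by (rule gauss_integrable)
  let ?h = "\<lambda>\<xi>. complex_of_real (gauss \<epsilon> \<xi>) * cnj (ft \<phi> \<xi>)"
  have h: "integrable lborel ?h"
  proof (rule Bochner_Integration.integrable_bound)
    show "integrable lborel (\<lambda>\<xi>. complex_of_real (\<integral>x. cmod (\<phi> x) \<partial>lborel) * complex_of_real (gauss \<epsilon> \<xi>))"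
      using g by (rule integrable_mult_right)
    show "AE \<xi> in lborel. norm (?h \<xi>) \<le> norm (complex_of_real (\<integral>x. cmod (\<phi> x) \<partial>lborel) * complex_of_real (gauss \<epsilon> \<xi>))"
      using ft_bound[OF \<phi>] by (auto simp: norm_mult mult.commute gauss_def intro!: mult_right_mono)
  qed measurable
  have inner: "ft ?h x = of_real (sqrt (2 * pi) ^ 3) * cnj (\<integral>z. \<phi> (x + \<epsilon> *\<^sub>R z) * of_real (gauss 1 z) \<partial>lborel)" for x
  proof -
    let ?g = "\<lambda>\<xi>. cis (x \<bullet> \<xi>) * complex_of_real (gauss \<epsilon> \<xi>)"
    have gi: "integrable lborel ?g" by (rule integrable_cis_mult[OF g]) simp
    have gf: "ft ?g y = of_real ((sqrt (2 * pi) / \<epsilon>)^3 * gauss (1 / \<epsilon>) (y - x))" for y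
    proof -
      have "ft ?g y = ft (\<lambda>\<xi>. of_real (gauss \<epsilon> \<xi>)) (y - x)"
        unfolding ft_def by (simp add: mult.assoc[symmetric] cis_mult inner_diff_left)
      then show ?thesis by (simp add: ft_gauss e)
    qed
    have "ft ?h x = cnj (\<integral>\<xi>. ft \<phi> \<xi> * ?g \<xi> \<partial>lborel)"
      unfolding ft_def[of ?h] Bochner_Integration.integral_cnj[symmetric]
      by (intro Bochner_Integration.integral_cong refl) (simp add: cis_cnj mult_ac)
    also have "(\<integral>\<xi>. ft \<phi> \<xi> * ?g \<xi> \<partial>lborel) = (\<integral>y. \<phi> y * ft ?g y \<partial>lborel)"
      by (rule ft_multiplication_formula[OF \<phi> gi])
    also have "\<dots> = of_real (\<epsilon>^3) * (\<integral>z. \<phi> (x + \<epsilon> *\<^sub>R z) * of_real ((sqrt (2 * pi) / \<epsilon>)^3 * gauss (1 / \<epsilon>) (\<epsilon> *\<^sub>R z)) \<partial>lborel)"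
      unfolding gf by (subst integral_lborel_affine[OF _ e, of _ x]) (auto simp del: of_real_mult of_real_power)
    also have "(\<lambda>z. \<phi> (x + \<epsilon> *\<^sub>R z) * complex_of_real ((sqrt (2 * pi) / \<epsilon>)^3 * gauss (1 / \<epsilon>) (\<epsilon> *\<^sub>R z)))
      = (\<lambda>z. complex_of_real ((sqrt (2 * pi) / \<epsilon>)^3) * (\<phi> (x + \<epsilon> *\<^sub>R z) * of_real (gauss 1 z)))"
      using e by (auto simp: gauss_def fun_eq_iff power_mult_distrib power_divide)
    also have "of_real (\<epsilon>^3) * (\<integral>z. complex_of_real ((sqrt (2 * pi) / \<epsilon>)^3) * (\<phi> (x + \<epsilon> *\<^sub>R z) * of_real (gauss 1 z)) \<partial>lborel)
      = of_real (sqrt (2 * pi) ^ 3) * (\<integral>z. \<phi> (x + \<epsilon> *\<^sub>R z) * of_real (gauss 1 z) \<partial>lborel)"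
      using e by (simp add: power_divide)
    finally show ?thesis by simp
  qed
  have "(\<integral>\<xi>. ft \<phi> \<xi> * ?h \<xi> \<partial>lborel) = (\<integral>x. \<phi> x * ft ?h x \<partial>lborel)"
    by (rule ft_multiplication_formula[OF \<phi> h])
  also have "\<dots> = (\<integral>x. of_real (sqrt (2 * pi) ^ 3) * (\<phi> x * cnj (\<integral>z. \<phi> (x + \<epsilon> *\<^sub>R z) * of_real (gauss 1 z) \<partial>lborel)) \<partial>lborel)"
    unfolding inner by (simp add: mult_ac)
  finally show ?thesis by (simp only: integral_mult_right_zero)
qed

text \<open>Both sides of the weighted identity have limits as \<open>\<epsilon> \<rightarrow> 0\<close>: on the frequency side by monotone
  convergence, which also yields square integrability, and on the other side because the Gaussian
  averages converge to \<open>\<phi>\<close>.\<close>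

lemma plancherel_test:
  assumes \<phi>: "\<phi> \<in> test_functions"
  shows "square_integrable (ft \<phi>)" "(norm (abs_L2 (ft \<phi>)))\<^sup>2 = (2 * pi)^3 * (norm (abs_L2 \<phi>))\<^sup>2"
proof -
  have \<phi>i: "integrable lborel \<phi>" "square_integrable \<phi>" using test_functions_integrable[OF \<phi>] by auto
  have [measurable]: "\<phi> \<in> borel_measurable borel" using \<phi> by (rule test_functions_measurable)
  have gm[measurable]: "gauss \<epsilon> \<in> borel_measurable borel" for \<epsilon> unfolding gauss_def[abs_def] by measurable
  obtain B where B: "B > 0" "\<And>x. cmod (\<phi> x) \<le> B" using test_functions_integrable(3)[OF \<phi>] by blast
  let ?c = "sqrt (2 * pi) ^ 3"
  let ?e = "\<lambda>n. 1 / real (Suc n)"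
  let ?G = "\<lambda>n x. \<integral>z. \<phi> (x + ?e n *\<^sub>R z) * of_real (gauss 1 z) \<partial>lborel"
  have gi: "integrable lborel (gauss 1)"
    using gauss_integrable[of 1] by (simp add: complex_of_real_integrable_eq)
  have ig: "(\<integral>z. gauss 1 z \<partial>lborel) = ?c"
    using integral_gauss unfolding integral_complex_of_real of_real_eq_iff .
  have e0: "?e \<longlonglongrightarrow> 0" using LIMSEQ_inverse_real_of_nat by (simp add: inverse_eq_divide)
  have G: "(\<lambda>n. ?G n x) \<longlonglongrightarrow> \<phi> x * of_real ?c" for x
  proof -
    have "(\<lambda>n. ?G n x) \<longlonglongrightarrow> (\<integral>z. \<phi> x * of_real (gauss 1 z) \<partial>lborel)"
    proof (rule integral_dominated_convergence[where w = "\<lambda>z. B * gauss 1 z"])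
      show "AE z in lborel. (\<lambda>n. \<phi> (x + ?e n *\<^sub>R z) * of_real (gauss 1 z)) \<longlonglongrightarrow> \<phi> x * of_real (gauss 1 z)"
      proof (rule AE_I2)
        fix z :: R3
        have "(\<lambda>n. x + ?e n *\<^sub>R z) \<longlonglongrightarrow> x + 0 *\<^sub>R z" by (intro tendsto_intros e0)
        then have "(\<lambda>n. \<phi> (x + ?e n *\<^sub>R z)) \<longlonglongrightarrow> \<phi> x"
          by (intro continuous_on_tendsto_compose[OF test_functions_continuous[OF \<phi>]]) auto
        then show "(\<lambda>n. \<phi> (x + ?e n *\<^sub>R z) * of_real (gauss 1 z)) \<longlonglongrightarrow> \<phi> x * of_real (gauss 1 z)"
          by (intro tendsto_intros)
      qed
      show "AE z in lborel. norm (\<phi> (x + ?e n *\<^sub>R z) * of_real (gauss 1 z)) \<le> B * gauss 1 z" for n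
        using B by (auto simp: norm_mult gauss_def)
      show "integrable lborel (\<lambda>z. B * gauss 1 z)" using gi by simp
    qed measurable
    then show ?thesis by (simp add: ig)
  qed
  have Gb: "cmod (?G n x) \<le> B * (\<integral>z. gauss 1 z \<partial>lborel)" for n x
  proof -
    have "cmod (?G n x) \<le> (\<integral>z. B * gauss 1 z \<partial>lborel)"
    proof (rule Bochner_Integration.integral_norm_bound_integral)
      show le: "norm (\<phi> (x + ?e n *\<^sub>R z) * of_real (gauss 1 z)) \<le> B * gauss 1 z" for z
        using B by (auto simp: norm_mult gauss_def)
      show gB: "integrable lborel (\<lambda>z. B * gauss 1 z)" using gi by simp
      show "integrable lborel (\<lambda>z. \<phi> (x + ?e n *\<^sub>R z) * of_real (gauss 1 z))"
      proof (rule Bochner_Integration.integrable_bound[OF gB])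
        show "(\<lambda>z. \<phi> (x + ?e n *\<^sub>R z) * complex_of_real (gauss 1 z)) \<in> borel_measurable lborel" by measurable
        show "AE z in lborel. norm (\<phi> (x + ?e n *\<^sub>R z) * complex_of_real (gauss 1 z)) \<le> norm (B * gauss 1 z)"
          by (intro AE_I2 order_trans[OF le]) simp
      qed
    qed
    then show ?thesis by simp
  qed
  have Gm[measurable]: "?G n \<in> borel_measurable borel" for n
  proof -
    have "?G n \<in> borel_measurable lborel" by (rule lborel.borel_measurable_lebesgue_integral) measurable
    then show ?thesis by simp
  qed
  have lim: "(\<lambda>n. \<integral>x. \<phi> x * cnj (?G n x) \<partial>lborel) \<longlonglongrightarrow> (\<integral>x. \<phi> x * cnj (\<phi> x * of_real ?c) \<partial>lborel)"
  proof (rule integral_dominated_convergence[where w = "\<lambda>x. cmod (\<phi> x) * (B * (\<integral>z. gauss 1 z \<partial>lborel))"])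
    show "AE x in lborel. (\<lambda>n. \<phi> x * cnj (?G n x)) \<longlonglongrightarrow> \<phi> x * cnj (\<phi> x * of_real ?c)"
      by (intro AE_I2 tendsto_intros G)
    show "AE x in lborel. norm (\<phi> x * cnj (?G n x)) \<le> cmod (\<phi> x) * (B * (\<integral>z. gauss 1 z \<partial>lborel))" for n
      using Gb by (auto simp: norm_mult intro!: mult_left_mono)
    show "integrable lborel (\<lambda>x. cmod (\<phi> x) * (B * (\<integral>z. gauss 1 z \<partial>lborel)))"
      using \<phi>i by (intro integrable_mult_left) auto
  qed measurable
  have "(\<integral>x. \<phi> x * cnj (\<phi> x * of_real ?c) \<partial>lborel) = (\<integral>x. of_real (?c * (cmod (\<phi> x))\<^sup>2) \<partial>lborel)"
    by (intro Bochner_Integration.integral_cong refl) (simp add: complex_norm_square[symmetric] mult_ac del: of_real_power)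
  also have "\<dots> = of_real (?c * (norm (abs_L2 \<phi>))\<^sup>2)"
    by (subst integral_complex_of_real) (simp add: norm_abs_L2_sq \<phi>i)
  finally have val: "(\<integral>x. \<phi> x * cnj (\<phi> x * of_real ?c) \<partial>lborel) = of_real (?c * (norm (abs_L2 \<phi>))\<^sup>2)" .
  let ?A = "\<lambda>n \<xi>. (cmod (ft \<phi> \<xi>))\<^sup>2 * gauss (?e n) \<xi>"
  have A: "complex_of_real (\<integral>\<xi>. ?A n \<xi> \<partial>lborel) = of_real ?c * (\<integral>x. \<phi> x * cnj (?G n x) \<partial>lborel)" for n
  proof -
    have "complex_of_real (\<integral>\<xi>. ?A n \<xi> \<partial>lborel) = (\<integral>\<xi>. ft \<phi> \<xi> * (of_real (gauss (?e n) \<xi>) * cnj (ft \<phi> \<xi>)) \<partial>lborel)"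
      unfolding integral_complex_of_real[symmetric]
      by (intro Bochner_Integration.integral_cong refl) (simp add: complex_norm_square mult_ac del: of_real_power)
    also have "\<dots> = of_real ?c * (\<integral>x. \<phi> x * cnj (?G n x) \<partial>lborel)"
      by (rule gauss_weighted_plancherel[OF \<phi>i(1)]) simp
    finally show ?thesis .
  qed
  have "(\<lambda>n. complex_of_real (\<integral>\<xi>. ?A n \<xi> \<partial>lborel)) \<longlonglongrightarrow> of_real ?c * of_real (?c * (norm (abs_L2 \<phi>))\<^sup>2)"
    unfolding A using lim unfolding val by (intro tendsto_intros)
  then have "(\<lambda>n. \<integral>\<xi>. ?A n \<xi> \<partial>lborel) \<longlonglongrightarrow> ?c * (?c * (norm (abs_L2 \<phi>))\<^sup>2)"
    by (subst (asm) of_real_mult[symmetric]) (simp only: tendsto_of_real_iff)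
  also have "?c * (?c * (norm (abs_L2 \<phi>))\<^sup>2) = (2 * pi)^3 * (norm (abs_L2 \<phi>))\<^sup>2"
  proof -
    have "?c * ?c = (sqrt (2 * pi) * sqrt (2 * pi)) ^ 3" by (simp only: power_mult_distrib)
    also have "\<dots> = (2 * pi)^3" by simp
    finally show ?thesis by (simp only: mult.assoc[symmetric])
  qed
  finally have limA: "(\<lambda>n. \<integral>\<xi>. ?A n \<xi> \<partial>lborel) \<longlonglongrightarrow> (2 * pi)^3 * (norm (abs_L2 \<phi>))\<^sup>2" .
  obtain C where C: "\<And>\<xi>. cmod (ft \<phi> \<xi>) \<le> C" using ft_bound[OF \<phi>i(1)] by blast
  have Ai: "integrable lborel (?A n)" for n
  proof (rule Bochner_Integration.integrable_bound)
    show "integrable lborel (\<lambda>\<xi>. C\<^sup>2 * gauss (?e n) \<xi>)"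
      using gauss_integrable[of "?e n"] by (simp add: complex_of_real_integrable_eq)
    show "AE \<xi> in lborel. norm (?A n \<xi>) \<le> norm (C\<^sup>2 * gauss (?e n) \<xi>)"
      using C by (auto simp: abs_mult gauss_def intro!: power_mono)
  qed measurable
  have nn: "(\<integral>\<^sup>+\<xi>. ennreal (?A n \<xi>) \<partial>lborel) = ennreal (\<integral>\<xi>. ?A n \<xi> \<partial>lborel)" for n
    by (rule nn_integral_eq_integral[OF Ai]) (auto simp: gauss_def)
  have "(\<lambda>n. \<integral>\<^sup>+\<xi>. ennreal (?A n \<xi>) \<partial>lborel) \<longlonglongrightarrow> (\<integral>\<^sup>+\<xi>. ennreal ((cmod (ft \<phi> \<xi>))\<^sup>2) \<partial>lborel)"
  proof (rule nn_integral_LIMSEQ)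
    show "incseq (\<lambda>n \<xi>. ennreal (?A n \<xi>))"
    proof (rule incseq_SucI, rule le_funI, rule ennreal_leI, rule mult_left_mono)
      fix n :: nat and \<xi> :: R3
      have "(?e (Suc n))\<^sup>2 \<le> (?e n)\<^sup>2" by (intro power_mono divide_left_mono) auto
      then have "(?e (Suc n))\<^sup>2 * (norm \<xi>)\<^sup>2 \<le> (?e n)\<^sup>2 * (norm \<xi>)\<^sup>2" by (intro mult_right_mono) auto
      then show "gauss (?e n) \<xi> \<le> gauss (?e (Suc n)) \<xi>"
        unfolding gauss_def by (simp only: exp_le_cancel_iff neg_le_iff_le divide_right_mono[of _ _ 2] zero_le_numeral)
    qed simp
    show "(\<lambda>n. ennreal (?A n \<xi>)) \<longlonglongrightarrow> ennreal ((cmod (ft \<phi> \<xi>))\<^sup>2)" for \<xi>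
    proof -
      have "(\<lambda>n. ?A n \<xi>) \<longlonglongrightarrow> (cmod (ft \<phi> \<xi>))\<^sup>2 * exp (- (0\<^sup>2 * (norm \<xi>)\<^sup>2 / 2))"
        unfolding gauss_def by (intro tendsto_intros e0) simp
      then show ?thesis by (intro tendsto_ennrealI) simp
    qed
  qed measurable
  moreover have "(\<lambda>n. \<integral>\<^sup>+\<xi>. ennreal (?A n \<xi>) \<partial>lborel) \<longlonglongrightarrow> ennreal ((2 * pi)^3 * (norm (abs_L2 \<phi>))\<^sup>2)"
    unfolding nn by (intro tendsto_ennrealI limA)
  ultimately have *: "(\<integral>\<^sup>+\<xi>. ennreal ((cmod (ft \<phi> \<xi>))\<^sup>2) \<partial>lborel) = ennreal ((2 * pi)^3 * (norm (abs_L2 \<phi>))\<^sup>2)"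
    by (rule LIMSEQ_unique)
  then show s: "square_integrable (ft \<phi>)" by (simp add: square_integrable_iff_nn ft_measurable)
  show "(norm (abs_L2 (ft \<phi>)))\<^sup>2 = (2 * pi)^3 * (norm (abs_L2 \<phi>))\<^sup>2"
    using * unfolding nn_norm_abs_L2[OF s] by (subst (asm) ennreal_inj) auto
qed


subsection \<open>Extension to \<open>L\<^sup>2\<close>\<close>

lemma integrable_mult_L2:
  assumes f: "square_integrable f" and g: "square_integrable g"
  shows "integrable lborel (\<lambda>x. f x * g x)"
proof -
  have [measurable]: "f \<in> borel_measurable borel" "g \<in> borel_measurable borel"
    using square_integrable_measurable[OF f] square_integrable_measurable[OF g] by auto
  show ?thesis
  proof (rule Bochner_Integration.integrable_bound)
    show "integrable lborel (\<lambda>x. (cmod (f x))\<^sup>2 + (cmod (g x))\<^sup>2)"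
      using f g by (auto simp: square_integrable_def)
    have "cmod (f x * g x) \<le> (cmod (f x))\<^sup>2 + (cmod (g x))\<^sup>2" for x
    proof -
      have "2 * cmod (f x) * cmod (g x) \<le> (cmod (f x))\<^sup>2 + (cmod (g x))\<^sup>2"
        by (rule sum_squares_bound)
      moreover have "0 \<le> cmod (f x) * cmod (g x)" by simp
      ultimately show ?thesis unfolding norm_mult by linarith
    qed
    then show "AE x in lborel. norm (f x * g x) \<le> norm ((cmod (f x))\<^sup>2 + (cmod (g x))\<^sup>2)" by auto
  qed measurable
qed

lemma square_integrable_cnj: "square_integrable f \<Longrightarrow> square_integrable (\<lambda>x. cnj (f x))"
  by (auto simp: square_integrable_def)

lemma integral_mult_inner:
  assumes f: "square_integrable f" and g: "square_integrable g"
  shows "(\<integral>x. f x * g x \<partial>lborel)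
    = Complex (inner (abs_L2 f) (abs_L2 (\<lambda>x. cnj (g x)))) (inner (abs_L2 f) (abs_L2 (\<lambda>x. \<i> * cnj (g x))))"
proof -
  have i: "integrable lborel (\<lambda>x. f x * g x)" by (rule integrable_mult_L2[OF f g])
  show ?thesis
    using i square_integrable_cnj[OF g] square_integrable_cmult[OF square_integrable_cnj[OF g], of \<i>]
    by (simp add: complex_eq_iff inner_abs_L2 f inner_complex_def flip: integral_Re integral_Im)
qed

lemma tendsto_integral_mult:
  assumes f: "\<And>n. square_integrable (f n)" "square_integrable h" "square_integrable g"
    and lim: "(\<lambda>n. abs_L2 (f n)) \<longlonglongrightarrow> abs_L2 h"
  shows "(\<lambda>n. \<integral>x. f n x * g x \<partial>lborel) \<longlonglongrightarrow> (\<integral>x. h x * g x \<partial>lborel)"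
  unfolding integral_mult_inner[OF f(1,3)] integral_mult_inner[OF f(2,3)]
  by (intro tendsto_Complex tendsto_inner lim tendsto_const)

lemma integrable_cube_supported:
  assumes f: "square_integrable f" and z: "\<And>x. x \<notin> cube n \<Longrightarrow> f x = 0"
  shows "integrable lborel f"
proof -
  have "f = (\<lambda>x. f x * indicator (UNIV \<inter> cube n) x)" using z by (auto simp: fun_eq_iff indicator_def)
  moreover have "integrable lborel (\<lambda>x. f x * indicator (UNIV \<inter> cube n) x)"
    by (rule integrable_mult_L2[OF f square_integrable_indicator_cube]) simp
  ultimately show ?thesis by simp
qed

text \<open>\<open>L\<^sup>2\<close> convergence with supports in one cube forces pointwise convergence of the Fourier
  integrals, so the isometry on test functions passes to the limit.\<close>

lemma plancherel_cube:
  assumes f: "square_integrable f" and z: "\<And>x. x \<notin> cube n \<Longrightarrow> f x = 0"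
  shows "square_integrable (ft f)" "norm (abs_L2 (ft f)) = sqrt ((2 * pi)^3) * norm (abs_L2 f)"
proof -
  obtain a where a: "\<And>k. a k \<in> cube_tests n" "a \<longlonglongrightarrow> abs_L2 f"
    using cube_tests_dense[OF f z] unfolding closure_sequential by blast
  obtain \<phi> where \<phi>: "\<And>k. \<phi> k \<in> test_functions" "\<And>k x. x \<notin> cube n \<Longrightarrow> \<phi> k x = 0" "\<And>k. a k = abs_L2 (\<phi> k)"
    using a(1) unfolding cube_tests_def image_iff Bex_def by (metis (mono_tags, lifting) mem_Collect_eq)
  have s: "square_integrable (\<phi> k)" for k by (rule test_functions_integrable[OF \<phi>(1)])
  have i: "integrable lborel (\<phi> k)" for k by (rule test_functions_integrable[OF \<phi>(1)])
  note p = plancherel_test[OF \<phi>(1)]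
  have pt: "(\<lambda>k. ft (\<phi> k) \<xi>) \<longlonglongrightarrow> ft f \<xi>" for \<xi>
  proof -
    let ?e = "\<lambda>x. cis (- (\<xi> \<bullet> x)) * indicator (UNIV \<inter> cube n) x"
    have e: "square_integrable ?e"
      by (rule square_integrable_bound[OF square_integrable_indicator_cube[of UNIV n], of _ 1])
         (auto simp: norm_mult)
    have eq: "ft g \<xi> = (\<integral>x. g x * ?e x \<partial>lborel)" if "\<And>x. x \<notin> cube n \<Longrightarrow> g x = 0" for g
      unfolding ft_def by (intro Bochner_Integration.integral_cong refl) (use that in \<open>auto simp: indicator_def\<close>)
    have "ft f \<xi> = (\<integral>x. f x * ?e x \<partial>lborel)" by (rule eq) (rule z)
    moreover have "ft (\<phi> k) \<xi> = (\<integral>x. \<phi> k x * ?e x \<partial>lborel)" for k by (rule eq) (rule \<phi>(2))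
    ultimately show ?thesis
      by (simp only:, intro tendsto_integral_mult[OF s f e]) (use a(2) in \<open>simp add: \<phi>(3)[symmetric]\<close>)
  qed
  have iso: "norm (abs_L2 (ft (\<phi> k)) - abs_L2 (ft (\<phi> j))) = sqrt ((2 * pi)^3) * norm (a k - a j)" for k j
  proof -
    have d: "(\<lambda>x. \<phi> k x - \<phi> j x) \<in> test_functions"
      using test_functions_add[OF \<phi>(1)[of k] test_functions_mult[OF \<phi>(1)[of j], of "\<lambda>x. -1"]] by simp
    have "ft (\<lambda>x. \<phi> k x - \<phi> j x) = (\<lambda>\<xi>. ft (\<phi> k) \<xi> - ft (\<phi> j) \<xi>)"
      using ft_diff[OF i i] by auto
    then have "(norm (abs_L2 (ft (\<phi> k)) - abs_L2 (ft (\<phi> j))))\<^sup>2 = (2 * pi)^3 * (norm (a k - a j))\<^sup>2"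
      using plancherel_test[OF d] by (simp add: abs_L2_diff p s \<phi>(3))
    then have "sqrt ((norm (abs_L2 (ft (\<phi> k)) - abs_L2 (ft (\<phi> j))))\<^sup>2) = sqrt ((2 * pi)^3 * (norm (a k - a j))\<^sup>2)"
      by (simp only:)
    then show ?thesis by (simp only: real_sqrt_mult real_sqrt_abs abs_norm_cancel)
  qed
  have "Cauchy (\<lambda>k. abs_L2 (ft (\<phi> k)))"
  proof (rule metric_CauchyI)
    fix e :: real assume e: "e > 0"
    have c: "sqrt ((2 * pi)^3) > 0" by simp
    have "Cauchy a" using a(2) by (rule LIMSEQ_imp_Cauchy)
    then obtain M where "\<forall>m\<ge>M. \<forall>n\<ge>M. norm (a m - a n) < e / sqrt ((2 * pi)^3)"
      using CauchyD[of a "e / sqrt ((2 * pi)^3)"] e c by auto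
    then show "\<exists>M. \<forall>m\<ge>M. \<forall>n\<ge>M. dist (abs_L2 (ft (\<phi> m))) (abs_L2 (ft (\<phi> n))) < e"
      using c by (intro exI[of _ M]) (simp add: dist_norm iso field_simps)
  qed
  then obtain g where g: "(\<lambda>k. abs_L2 (ft (\<phi> k))) \<longlonglongrightarrow> g"
    using Cauchy_convergent convergent_def by blast
  have fm: "ft f \<in> borel_measurable borel" using square_integrable_measurable[OF f] by (intro ft_measurable) simp
  note lp = L2_limit_pointwise[OF p(1) AE_I2[OF pt] fm g]
  show "square_integrable (ft f)" by (rule lp(1))
  have "norm (abs_L2 (ft (\<phi> k))) = sqrt ((2 * pi)^3) * norm (a k)" for k
  proof -
    have "sqrt ((norm (abs_L2 (ft (\<phi> k))))\<^sup>2) = sqrt ((2 * pi)^3 * (norm (a k))\<^sup>2)"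
      using p(2)[of k] by (simp only: \<phi>(3))
    then show ?thesis by (simp only: real_sqrt_mult real_sqrt_abs abs_norm_cancel)
  qed
  then have "(\<lambda>k. norm (abs_L2 (ft (\<phi> k)))) \<longlonglongrightarrow> sqrt ((2 * pi)^3) * norm (abs_L2 f)"
    by (simp only:) (intro tendsto_intros a(2))
  moreover have "(\<lambda>k. norm (abs_L2 (ft (\<phi> k)))) \<longlonglongrightarrow> norm (abs_L2 (ft f))"
    unfolding lp(2) by (intro tendsto_intros g)
  ultimately show "norm (abs_L2 (ft f)) = sqrt ((2 * pi)^3) * norm (abs_L2 f)"
    by (rule LIMSEQ_unique[symmetric])
qed

definition trunc :: "real \<Rightarrow> (R3 \<Rightarrow> complex) \<Rightarrow> R3 \<Rightarrow> complex" where
  "trunc r f x = indicator (cball 0 r) x * f x"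

lemma trunc_measurable [measurable]: "f \<in> borel_measurable borel \<Longrightarrow> trunc r f \<in> borel_measurable borel"
  unfolding trunc_def[abs_def] by (intro borel_measurable_times borel_measurable_indicator) auto

lemma trunc_bound: "cmod (trunc r f x) \<le> cmod (f x)"
  by (simp add: trunc_def indicator_def)

lemma trunc_cube: "\<exists>n. \<forall>x. x \<notin> cube n \<longrightarrow> trunc r f x = 0"
proof -
  obtain N :: nat where N: "r < real N" using reals_Archimedean2 by blast
  have "trunc r f x = 0" if "x \<notin> cube N" for x
  proof -
    obtain i where "\<not> (- real N < x $ i \<and> x $ i < real N)"
      using \<open>x \<notin> cube N\<close> unfolding cube_def mem_box_cart vec_component by blast
    then have "\<not> \<bar>x $ i\<bar> < real N" by (simp add: abs_less_iff) linarith
    then have "norm x > r" using component_le_norm_cart[of x i] N by linarith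
    then show ?thesis by (simp add: trunc_def)
  qed
  then show ?thesis by blast
qed

lemma trunc_square_integrable: "square_integrable f \<Longrightarrow> square_integrable (trunc r f)"
  using square_integrable_measurable[of f] by (intro square_integrable_bound[of f "trunc r f" 1]) (auto simp: trunc_bound)

lemma trunc_integrable: "square_integrable f \<Longrightarrow> integrable lborel (trunc r f)"
  using trunc_cube integrable_cube_supported[OF trunc_square_integrable] by metis

lemma plancherel_trunc:
  assumes "square_integrable f"
  shows "square_integrable (ft (trunc r f))" "norm (abs_L2 (ft (trunc r f))) = sqrt ((2 * pi)^3) * norm (abs_L2 (trunc r f))"
  using trunc_cube plancherel_cube[OF trunc_square_integrable[OF assms]] by metis+

lemma plancherel_trunc_diff:
  assumes f: "square_integrable f"
  shows "norm (abs_L2 (ft (trunc r f)) - abs_L2 (ft (trunc s f))) = sqrt ((2 * pi)^3) * norm (abs_L2 (trunc r f) - abs_L2 (trunc s f))"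
proof -
  let ?d = "\<lambda>x. trunc r f x - trunc s f x"
  have d: "square_integrable ?d" by (intro square_integrable_diff trunc_square_integrable f)
  have "trunc (max r s) ?d = ?d" by (auto simp: fun_eq_iff trunc_def indicator_def)
  with plancherel_trunc[OF d, of "max r s"]
  have "norm (abs_L2 (ft ?d)) = sqrt ((2 * pi)^3) * norm (abs_L2 ?d)" by simp
  moreover have "ft ?d = (\<lambda>\<xi>. ft (trunc r f) \<xi> - ft (trunc s f) \<xi>)"
    using ft_diff[OF trunc_integrable[OF f] trunc_integrable[OF f]] by auto
  ultimately show ?thesis by (simp add: abs_L2_diff plancherel_trunc f trunc_square_integrable)
qed

lemma trunc_tendsto:
  assumes f: "square_integrable f"
  shows "((\<lambda>r. abs_L2 (trunc r f)) \<longlongrightarrow> abs_L2 f) at_top"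
proof (rule tendsto_at_topI_sequentially)
  fix X :: "nat \<Rightarrow> real" assume X: "filterlim X at_top sequentially"
  have fm: "f \<in> borel_measurable borel" using square_integrable_measurable[OF f] by simp
  have "(\<lambda>n. trunc (X n) f x) \<longlonglongrightarrow> f x" for x
  proof (rule tendsto_eventually)
    have "\<forall>\<^sub>F n in sequentially. X n \<ge> norm x" using X by (simp add: filterlim_at_top)
    then show "\<forall>\<^sub>F n in sequentially. trunc (X n) f x = f x" by eventually_elim (simp add: trunc_def)
  qed
  then show "(\<lambda>n. abs_L2 (trunc (X n) f)) \<longlonglongrightarrow> abs_L2 f"
    by (intro L2_dominated_convergence(3)[where f = "\<lambda>n. trunc (X n) f" and g = f, OF trunc_measurable[OF fm] fm _ f])
       (auto simp: trunc_bound)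
qed

definition fourier :: "L2 \<Rightarrow> L2" where
  "fourier u = lim (\<lambda>n. abs_L2 (ft (trunc (real n) (rep_L2 u))))"

lemma fourier_limit_nat: "(\<lambda>n. abs_L2 (ft (trunc (real n) (rep_L2 u)))) \<longlonglongrightarrow> fourier u"
proof -
  let ?X = "\<lambda>n. abs_L2 (trunc (real n) (rep_L2 u))"
  have "?X \<longlonglongrightarrow> u"
    using filterlim_compose[OF trunc_tendsto[OF square_integrable_rep_L2] filterlim_real_sequentially] by simp
  then have C: "Cauchy ?X" by (rule LIMSEQ_imp_Cauchy)
  have "Cauchy (\<lambda>n. abs_L2 (ft (trunc (real n) (rep_L2 u))))"
  proof (rule metric_CauchyI)
    fix e :: real assume e: "e > 0"
    have c: "sqrt ((2 * pi)^3) > 0" by simp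
    obtain M where "\<forall>m\<ge>M. \<forall>n\<ge>M. norm (?X m - ?X n) < e / sqrt ((2 * pi)^3)"
      using CauchyD[OF C, of "e / sqrt ((2 * pi)^3)"] e c by auto
    then show "\<exists>M. \<forall>m\<ge>M. \<forall>n\<ge>M. dist (abs_L2 (ft (trunc (real m) (rep_L2 u)))) (abs_L2 (ft (trunc (real n) (rep_L2 u)))) < e"
      using c by (intro exI[of _ M]) (simp add: dist_norm plancherel_trunc_diff field_simps)
  qed
  then show ?thesis unfolding fourier_def by (simp add: Cauchy_convergent_iff convergent_LIMSEQ_iff)
qed

lemma fourier_limit: "((\<lambda>r. abs_L2 (ft (trunc r (rep_L2 u)))) \<longlongrightarrow> fourier u) at_top"
proof -
  have "norm (abs_L2 (ft (trunc r (rep_L2 u))) - fourier u) = sqrt ((2 * pi)^3) * norm (abs_L2 (trunc r (rep_L2 u)) - u)" for r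
  proof (rule LIMSEQ_unique)
    show "(\<lambda>n. norm (abs_L2 (ft (trunc r (rep_L2 u))) - abs_L2 (ft (trunc (real n) (rep_L2 u)))))
        \<longlonglongrightarrow> norm (abs_L2 (ft (trunc r (rep_L2 u))) - fourier u)"
      by (intro tendsto_intros fourier_limit_nat)
    have "(\<lambda>n. abs_L2 (trunc (real n) (rep_L2 u))) \<longlonglongrightarrow> u"
      using filterlim_compose[OF trunc_tendsto[OF square_integrable_rep_L2] filterlim_real_sequentially] by simp
    then show "(\<lambda>n. norm (abs_L2 (ft (trunc r (rep_L2 u))) - abs_L2 (ft (trunc (real n) (rep_L2 u)))))
        \<longlonglongrightarrow> sqrt ((2 * pi)^3) * norm (abs_L2 (trunc r (rep_L2 u)) - u)"
      unfolding plancherel_trunc_diff[OF square_integrable_rep_L2] by (intro tendsto_intros)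
  qed
  moreover have "((\<lambda>r. sqrt ((2 * pi)^3) * norm (abs_L2 (trunc r (rep_L2 u)) - u)) \<longlongrightarrow> sqrt ((2 * pi)^3) * norm (u - u)) at_top"
    using trunc_tendsto[OF square_integrable_rep_L2[of u]] by (intro tendsto_intros) simp
  ultimately have "((\<lambda>r. norm (abs_L2 (ft (trunc r (rep_L2 u))) - fourier u)) \<longlongrightarrow> 0) at_top" by simp
  then show ?thesis by (simp add: tendsto_norm_zero_iff LIM_zero_iff)
qed

lemma norm_fourier: "norm (fourier u) = sqrt ((2 * pi)^3) * norm u"
proof (rule LIMSEQ_unique)
  show "(\<lambda>n. norm (abs_L2 (ft (trunc (real n) (rep_L2 u))))) \<longlonglongrightarrow> norm (fourier u)"
    by (intro tendsto_intros fourier_limit_nat)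
  have "(\<lambda>n. abs_L2 (trunc (real n) (rep_L2 u))) \<longlonglongrightarrow> u"
    using filterlim_compose[OF trunc_tendsto[OF square_integrable_rep_L2] filterlim_real_sequentially] by simp
  then show "(\<lambda>n. norm (abs_L2 (ft (trunc (real n) (rep_L2 u))))) \<longlonglongrightarrow> sqrt ((2 * pi)^3) * norm u"
    unfolding plancherel_trunc(2)[OF square_integrable_rep_L2] by (intro tendsto_intros)
qed

text \<open>The bridge between the isometry built here and the Fourier transform by which multipliers
  are defined.\<close>

lemma L2_fourier_iff: "L2_fourier (rep_L2 u) v \<longleftrightarrow> square_integrable v \<and> abs_L2 v = fourier u"
proof (cases "square_integrable v")
  case True
  have eq: "(LINT x:cball 0 r|lborel. cis (- (\<xi> \<bullet> x)) * rep_L2 u x) = ft (trunc r (rep_L2 u)) \<xi>" for r \<xi>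
    unfolding set_lebesgue_integral_def ft_def trunc_def
    by (intro Bochner_Integration.integral_cong refl) (simp add: indicator_def)
  have "L2_fourier (rep_L2 u) v \<longleftrightarrow>
      ((\<lambda>r. ennreal ((norm (abs_L2 (ft (trunc r (rep_L2 u))) - abs_L2 v))\<^sup>2)) \<longlongrightarrow> ennreal 0) at_top"
    using True unfolding L2_fourier_def eq by (simp add: nn_norm_diff_L2 plancherel_trunc)
  also have "\<dots> \<longleftrightarrow> ((\<lambda>r. (norm (abs_L2 (ft (trunc r (rep_L2 u))) - abs_L2 v))\<^sup>2) \<longlongrightarrow> 0) at_top"
    by (subst tendsto_ennreal_iff) auto
  also have "\<dots> \<longleftrightarrow> ((\<lambda>r. norm (abs_L2 (ft (trunc r (rep_L2 u))) - abs_L2 v)) \<longlongrightarrow> 0) at_top"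
  proof
    assume "((\<lambda>r. (norm (abs_L2 (ft (trunc r (rep_L2 u))) - abs_L2 v))\<^sup>2) \<longlongrightarrow> 0) at_top"
    from tendsto_real_sqrt[OF this]
    show "((\<lambda>r. norm (abs_L2 (ft (trunc r (rep_L2 u))) - abs_L2 v)) \<longlongrightarrow> 0) at_top" by simp
  next
    assume "((\<lambda>r. norm (abs_L2 (ft (trunc r (rep_L2 u))) - abs_L2 v)) \<longlongrightarrow> 0) at_top"
    from tendsto_power[OF this, of 2]
    show "((\<lambda>r. (norm (abs_L2 (ft (trunc r (rep_L2 u))) - abs_L2 v))\<^sup>2) \<longlongrightarrow> 0) at_top" by simp
  qed
  also have "\<dots> \<longleftrightarrow> ((\<lambda>r. abs_L2 (ft (trunc r (rep_L2 u)))) \<longlongrightarrow> abs_L2 v) at_top"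
    by (simp add: tendsto_norm_zero_iff LIM_zero_iff)
  also have "\<dots> \<longleftrightarrow> abs_L2 v = fourier u"
    using tendsto_unique[OF _ fourier_limit] fourier_limit by fastforce
  finally show ?thesis using True by simp
qed (simp add: L2_fourier_def)

lemma fourier_integrable:
  assumes f: "square_integrable f" and i: "integrable lborel f"
  shows "square_integrable (ft f)" "fourier (abs_L2 f) = abs_L2 (ft f)"
proof -
  have fm: "f \<in> borel_measurable borel" using i by auto
  have e: "ft (trunc (real n) (rep_L2 (abs_L2 f))) = ft (trunc (real n) f)" for n
    by (intro ext ft_cong_AE trunc_measurable rep_L2_measurable fm eventually_mono[OF rep_abs_L2[OF f]])
       (simp add: trunc_def)
  have lim: "(\<lambda>n. ft (trunc (real n) f) \<xi>) \<longlonglongrightarrow> ft f \<xi>" for \<xi>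
    unfolding ft_def
  proof (rule integral_dominated_convergence[where w = "\<lambda>x. cmod (f x)"])
    show "AE x in lborel. (\<lambda>n. cis (- (\<xi> \<bullet> x)) * trunc (real n) f x) \<longlonglongrightarrow> cis (- (\<xi> \<bullet> x)) * f x"
    proof (rule AE_I2)
      fix x :: R3
      have "\<forall>\<^sub>F n in sequentially. real n \<ge> norm x" using filterlim_real_sequentially by (simp add: filterlim_at_top)
      then have "\<forall>\<^sub>F n in sequentially. cis (- (\<xi> \<bullet> x)) * trunc (real n) f x = cis (- (\<xi> \<bullet> x)) * f x"
        by eventually_elim (simp add: trunc_def)
      then show "(\<lambda>n. cis (- (\<xi> \<bullet> x)) * trunc (real n) f x) \<longlonglongrightarrow> cis (- (\<xi> \<bullet> x)) * f x"
        by (rule tendsto_eventually)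
    qed
    show "AE x in lborel. norm (cis (- (\<xi> \<bullet> x)) * trunc (real n) f x) \<le> cmod (f x)" for n
      by (auto simp: norm_mult trunc_bound)
    have c: "(\<lambda>x. cis (- (\<xi> \<bullet> x))) \<in> borel_measurable borel" by measurable
    show "(\<lambda>x. cis (- (\<xi> \<bullet> x)) * f x) \<in> borel_measurable lborel"
      "(\<lambda>x. cis (- (\<xi> \<bullet> x)) * trunc (real n) f x) \<in> borel_measurable lborel" for n
      using c fm trunc_measurable[OF fm] by auto
  qed (use i in auto)
  note lp = L2_limit_pointwise[OF plancherel_trunc(1)[OF f] AE_I2[OF lim] ft_measurable[OF fm], of "fourier (abs_L2 f)"]
  show "square_integrable (ft f)" by (rule lp(1)) (use fourier_limit_nat[of "abs_L2 f"] e in simp)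
  show "fourier (abs_L2 f) = abs_L2 (ft f)"
    by (rule lp(2)[symmetric]) (use fourier_limit_nat[of "abs_L2 f"] e in simp)
qed

lemma fourier_add: "fourier (u + v) = fourier u + fourier v"
proof (rule LIMSEQ_unique)
  have "abs_L2 (ft (trunc (real n) (rep_L2 (u + v)))) = abs_L2 (ft (trunc (real n) (rep_L2 u))) + abs_L2 (ft (trunc (real n) (rep_L2 v)))" for n
  proof -
    have "ft (trunc (real n) (rep_L2 (u + v))) \<xi> = ft (\<lambda>x. trunc (real n) (rep_L2 u) x + trunc (real n) (rep_L2 v) x) \<xi>" for \<xi>
      by (intro ft_cong_AE borel_measurable_add trunc_measurable rep_L2_measurable eventually_mono[OF rep_L2_add[of u v]])
         (simp add: trunc_def distrib_left)
    then have "ft (trunc (real n) (rep_L2 (u + v))) = (\<lambda>\<xi>. ft (trunc (real n) (rep_L2 u)) \<xi> + ft (trunc (real n) (rep_L2 v)) \<xi>)"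
      by (simp add: fun_eq_iff ft_add trunc_integrable)
    then show ?thesis by (simp add: abs_L2_add plancherel_trunc)
  qed
  then show "(\<lambda>n. abs_L2 (ft (trunc (real n) (rep_L2 (u + v))))) \<longlonglongrightarrow> fourier u + fourier v"
    by (simp only:) (intro tendsto_intros fourier_limit_nat)
qed (rule fourier_limit_nat)

lemma fourier_scaleC: "fourier (scaleC_L2 c u) = scaleC_L2 c (fourier u)"
proof (rule LIMSEQ_unique)
  have "abs_L2 (ft (trunc (real n) (rep_L2 (scaleC_L2 c u)))) = scaleC_L2 c (abs_L2 (ft (trunc (real n) (rep_L2 u))))" for n
  proof -
    have "ft (trunc (real n) (rep_L2 (scaleC_L2 c u))) \<xi> = ft (\<lambda>x. c * trunc (real n) (rep_L2 u) x) \<xi>" for \<xi>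
      by (intro ft_cong_AE borel_measurable_times borel_measurable_const trunc_measurable rep_L2_measurable
            eventually_mono[OF rep_L2_scaleC[of c u]])
         (simp add: trunc_def)
    then have "ft (trunc (real n) (rep_L2 (scaleC_L2 c u))) = (\<lambda>\<xi>. c * ft (trunc (real n) (rep_L2 u)) \<xi>)"
      by (simp add: fun_eq_iff ft_cmult)
    then show ?thesis by (simp add: abs_L2_scaleC plancherel_trunc)
  qed
  then show "(\<lambda>n. abs_L2 (ft (trunc (real n) (rep_L2 (scaleC_L2 c u))))) \<longlonglongrightarrow> scaleC_L2 c (fourier u)"
    by (simp only:) (intro bounded_linear.tendsto[OF bounded_linear_scaleC_L2] fourier_limit_nat)
qed (rule fourier_limit_nat)

lemma bounded_linear_fourier: "bounded_linear fourier"
  by (rule bounded_linear_intro[of _ "sqrt ((2 * pi)^3)"])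
     (auto simp: fourier_add fourier_scaleC scaleR_scaleC_L2 norm_fourier mult.commute)

lemma inner_fourier: "inner (fourier u) (fourier v) = (2 * pi)^3 * inner u v"
proof -
  have n: "(norm (fourier w))\<^sup>2 = (2 * pi)^3 * (norm w)\<^sup>2" for w
    by (simp add: norm_fourier power_mult_distrib)
  show ?thesis unfolding dot_norm fourier_add[symmetric] n by (simp add: field_simps)
qed

subsection \<open>Inversion\<close>

definition cnj_L2 :: "L2 \<Rightarrow> L2" where
  "cnj_L2 u = abs_L2 (\<lambda>x. cnj (rep_L2 u x))"

lemma cnj_abs_L2: "square_integrable f \<Longrightarrow> cnj_L2 (abs_L2 f) = abs_L2 (\<lambda>x. cnj (f x))"
  unfolding cnj_L2_def using rep_abs_L2[of f]
  by (subst abs_L2_eq_iff) (auto simp: square_integrable_cnj)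

lemma cnj_cnj_L2 [simp]: "cnj_L2 (cnj_L2 u) = u"
  using cnj_abs_L2[OF square_integrable_cnj[OF square_integrable_rep_L2[of u]]] by (simp add: cnj_L2_def)

lemma norm_cnj_L2 [simp]: "norm (cnj_L2 u) = norm u"
proof -
  have "(norm (cnj_L2 u))\<^sup>2 = (norm u)\<^sup>2"
    by (simp add: cnj_L2_def norm_abs_L2_sq square_integrable_cnj norm_L2_sq[of u])
  then show ?thesis by (simp add: power2_eq_iff_nonneg)
qed

lemma cnj_L2_add: "cnj_L2 (u + v) = cnj_L2 u + cnj_L2 v"
proof -
  have "u + v = abs_L2 (\<lambda>x. rep_L2 u x + rep_L2 v x)" by (simp add: plus_L2_def)
  then have "cnj_L2 (u + v) = abs_L2 (\<lambda>x. cnj (rep_L2 u x) + cnj (rep_L2 v x))"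
    by (simp add: cnj_abs_L2 square_integrable_add)
  then show ?thesis by (simp add: cnj_L2_def abs_L2_add square_integrable_cnj)
qed

lemma cnj_L2_scaleR: "cnj_L2 (r *\<^sub>R u) = r *\<^sub>R cnj_L2 u"
proof -
  have "r *\<^sub>R u = abs_L2 (\<lambda>x. r *\<^sub>R rep_L2 u x)" by (simp add: scaleR_L2_def)
  then have "cnj_L2 (r *\<^sub>R u) = abs_L2 (\<lambda>x. r *\<^sub>R cnj (rep_L2 u x))"
    by (simp add: cnj_abs_L2 square_integrable_scaleR)
  then show ?thesis by (simp add: cnj_L2_def abs_L2_scaleR square_integrable_cnj)
qed

lemma bounded_linear_cnj_L2: "bounded_linear cnj_L2"
  by (rule bounded_linear_intro[of _ 1]) (auto simp: cnj_L2_add cnj_L2_scaleR)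

text \<open>The multiplication formula extends from integrable functions by continuity.\<close>

lemma inner_fourier_cnj: "inner (fourier u) (cnj_L2 v) = inner u (cnj_L2 (fourier v))"
proof (rule LIMSEQ_unique)
  let ?U = "\<lambda>n x. indicator (cube n) x * rep_L2 u x" and ?V = "\<lambda>n x. indicator (cube n) x * rep_L2 v x"
  have s: "square_integrable (?U n)" "square_integrable (?V n)" for n
    by (intro cube_truncation_tendsto(2) square_integrable_rep_L2)+
  have i: "integrable lborel (?U n)" "integrable lborel (?V n)" for n
    by (rule integrable_cube_supported[OF s(1), of n] integrable_cube_supported[OF s(2), of n]; simp)+
  have lim: "(\<lambda>n. abs_L2 (?U n)) \<longlonglongrightarrow> u" "(\<lambda>n. abs_L2 (?V n)) \<longlonglongrightarrow> v"
    using cube_truncation_tendsto(1)[of "rep_L2 u"] cube_truncation_tendsto(1)[of "rep_L2 v"] by auto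
  note tF = bounded_linear.tendsto[OF bounded_linear_fourier] and tC = bounded_linear.tendsto[OF bounded_linear_cnj_L2]
  show "(\<lambda>n. inner (fourier (abs_L2 (?U n))) (cnj_L2 (abs_L2 (?V n)))) \<longlonglongrightarrow> inner (fourier u) (cnj_L2 v)"
    by (intro tendsto_inner tF tC lim)
  have "inner (fourier (abs_L2 (?U n))) (cnj_L2 (abs_L2 (?V n))) = inner (abs_L2 (?U n)) (cnj_L2 (fourier (abs_L2 (?V n))))" for n
  proof -
    note f = fourier_integrable[OF s(1) i(1), of n] fourier_integrable[OF s(2) i(2), of n]
    have "inner (fourier (abs_L2 (?U n))) (cnj_L2 (abs_L2 (?V n))) = Re (\<integral>x. ft (?U n) x * ?V n x \<partial>lborel)"
      using integral_mult_inner[OF f(1) s(2)[of n]] by (simp add: f cnj_abs_L2 s)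
    also have "\<dots> = Re (\<integral>x. ?U n x * ft (?V n) x \<partial>lborel)"
      by (simp only: ft_multiplication_formula[OF i])
    also have "\<dots> = inner (abs_L2 (?U n)) (cnj_L2 (fourier (abs_L2 (?V n))))"
      using integral_mult_inner[OF s(1)[of n] f(3)] by (simp add: f cnj_abs_L2 s)
    finally show ?thesis .
  qed
  then show "(\<lambda>n. inner (fourier (abs_L2 (?U n))) (cnj_L2 (abs_L2 (?V n)))) \<longlonglongrightarrow> inner u (cnj_L2 (fourier v))"
    by (simp only:) (intro tendsto_inner tF tC lim)
qed

definition ifourier :: "L2 \<Rightarrow> L2" where
  "ifourier v = (1 / (2 * pi)^3) *\<^sub>R cnj_L2 (fourier (cnj_L2 v))"

text \<open>The multiplication formula says that \<open>cnj \<circ> fourier \<circ> cnj\<close> is the adjoint of \<^const>\<open>fourier\<close>, so by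
  Plancherel it is a left inverse up to a factor. Conjugating that identity turns it into
  a right inverse as well, hence the Fourier transform is onto.\<close>

lemma ifourier_fourier [simp]: "ifourier (fourier v) = v"
proof -
  have "inner x (cnj_L2 (fourier (cnj_L2 (fourier v)))) = inner x ((2 * pi)^3 *\<^sub>R v)" for x
    using inner_fourier_cnj[of x "cnj_L2 (fourier v)"] by (simp add: inner_fourier)
  then have "cnj_L2 (fourier (cnj_L2 (fourier v))) = (2 * pi)^3 *\<^sub>R v"
    by (metis inner_commute vector_eq_ldot)
  then show ?thesis by (simp add: ifourier_def)
qed

lemma fourier_scaleR: "fourier (r *\<^sub>R u) = r *\<^sub>R fourier u"
  by (simp add: scaleR_scaleC_L2 fourier_scaleC)

lemma fourier_ifourier [simp]: "fourier (ifourier v) = v"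
proof -
  have "fourier (ifourier v) = cnj_L2 (ifourier (fourier (cnj_L2 v)))"
    by (simp add: ifourier_def fourier_scaleR cnj_L2_scaleR del: ifourier_fourier)
  then show ?thesis by simp
qed

lemma fourier_inj: "fourier u = fourier v \<Longrightarrow> u = v"
  by (metis ifourier_fourier)

subsection \<open>Multipliers\<close>

definition bounded_symbol :: "(R3 \<Rightarrow> complex) \<Rightarrow> bool" where
  "bounded_symbol m \<longleftrightarrow> m \<in> borel_measurable borel \<and> (\<exists>B. \<forall>\<xi>. cmod (m \<xi>) \<le> B)"

definition mult_L2 :: "(R3 \<Rightarrow> complex) \<Rightarrow> L2 \<Rightarrow> L2" where
  "mult_L2 m u = abs_L2 (\<lambda>\<xi>. m \<xi> * rep_L2 u \<xi>)"

lemma square_integrable_mult: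
  assumes m: "bounded_symbol m" and f: "square_integrable f"
  shows "square_integrable (\<lambda>\<xi>. m \<xi> * f \<xi>)"
proof -
  obtain B where B: "\<And>\<xi>. cmod (m \<xi>) \<le> B" using m by (auto simp: bounded_symbol_def)
  have "f \<in> borel_measurable borel" using square_integrable_measurable[OF f] by simp
  then show ?thesis using m B
    by (intro square_integrable_bound[OF f, of _ B]) (auto simp: bounded_symbol_def norm_mult intro!: mult_right_mono)
qed

lemma mult_abs_L2:
  assumes m: "bounded_symbol m" and f: "square_integrable f"
  shows "mult_L2 m (abs_L2 f) = abs_L2 (\<lambda>\<xi>. m \<xi> * f \<xi>)"
  unfolding mult_L2_def using rep_abs_L2[OF f] m f
  by (subst abs_L2_eq_iff) (auto intro: square_integrable_mult)

lemma rep_mult_L2: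
  assumes m: "bounded_symbol m"
  shows "AE \<xi> in lborel. rep_L2 (mult_L2 m u) \<xi> = m \<xi> * rep_L2 u \<xi>"
  unfolding mult_L2_def using m by (intro rep_abs_L2 square_integrable_mult) auto

lemma multiplier_eq:
  assumes m: "bounded_symbol m"
  shows "multiplier m u = ifourier (mult_L2 m (fourier u))"
  unfolding multiplier_def
proof (rule the_equality)
  have "L2_fourier (rep_L2 (ifourier (mult_L2 m (fourier u)))) (\<lambda>\<xi>. m \<xi> * rep_L2 (fourier u) \<xi>)"
    unfolding L2_fourier_iff using m by (auto simp: square_integrable_mult mult_L2_def)
  moreover have "L2_fourier (rep_L2 u) (rep_L2 (fourier u))" unfolding L2_fourier_iff by simp
  ultimately show "\<exists>v. L2_fourier (rep_L2 u) v \<and>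
      L2_fourier (rep_L2 (ifourier (mult_L2 m (fourier u)))) (\<lambda>\<xi>. m \<xi> * v \<xi>)" by blast
next
  fix w assume "\<exists>v. L2_fourier (rep_L2 u) v \<and> L2_fourier (rep_L2 w) (\<lambda>\<xi>. m \<xi> * v \<xi>)"
  then obtain v where v: "square_integrable v" "abs_L2 v = fourier u" "abs_L2 (\<lambda>\<xi>. m \<xi> * v \<xi>) = fourier w"
    unfolding L2_fourier_iff by blast
  then have "fourier w = mult_L2 m (fourier u)" using mult_abs_L2[OF m v(1)] by simp
  then show "w = ifourier (mult_L2 m (fourier u))" by (metis ifourier_fourier)
qed

lemma norm_mult_L2:
  assumes m: "m \<in> borel_measurable borel" and B: "\<And>\<xi>. cmod (m \<xi>) \<le> B"
  shows "norm (mult_L2 m u) \<le> B * norm u"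
proof (rule power2_le_imp_le)
  have b: "bounded_symbol m" using assms by (auto simp: bounded_symbol_def)
  have B0: "B \<ge> 0" using B[of 0] norm_ge_zero order_trans by blast
  have "(norm (mult_L2 m u))\<^sup>2 = (\<integral>\<xi>. (cmod (m \<xi> * rep_L2 u \<xi>))\<^sup>2 \<partial>lborel)"
    unfolding mult_L2_def by (rule norm_abs_L2_sq) (simp add: square_integrable_mult b)
  also have "\<dots> \<le> (\<integral>\<xi>. B\<^sup>2 * (cmod (rep_L2 u \<xi>))\<^sup>2 \<partial>lborel)"
  proof (rule integral_mono)
    show "integrable lborel (\<lambda>\<xi>. (cmod (m \<xi> * rep_L2 u \<xi>))\<^sup>2)"
      using square_integrable_mult[OF b square_integrable_rep_L2[of u]] by (simp add: square_integrable_def)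
    show "integrable lborel (\<lambda>\<xi>. B\<^sup>2 * (cmod (rep_L2 u \<xi>))\<^sup>2)"
      using square_integrable_rep_L2[of u] by (auto simp: square_integrable_def)
    show "(cmod (m \<xi> * rep_L2 u \<xi>))\<^sup>2 \<le> B\<^sup>2 * (cmod (rep_L2 u \<xi>))\<^sup>2" for \<xi>
      unfolding norm_mult power_mult_distrib using B by (intro mult_right_mono power_mono) auto
  qed
  also have "\<dots> = (B * norm u)\<^sup>2" by (simp add: norm_L2_sq power_mult_distrib)
  finally show "(norm (mult_L2 m u))\<^sup>2 \<le> (B * norm u)\<^sup>2" .
  show "0 \<le> B * norm u" using B0 by simp
qed

lemma bounded_linear_mult_L2:
  assumes "bounded_symbol m"
  shows "bounded_linear (mult_L2 m)"
proof -
  obtain B where B: "\<And>\<xi>. cmod (m \<xi>) \<le> B" using assms by (auto simp: bounded_symbol_def)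
  show ?thesis
  proof (rule bounded_linear_intro[of _ B])
    fix u v :: L2 and r :: real
    show "mult_L2 m (u + v) = mult_L2 m u + mult_L2 m v"
    proof -
      have "u + v = abs_L2 (\<lambda>x. rep_L2 u x + rep_L2 v x)" by (simp add: plus_L2_def)
      then have "mult_L2 m (u + v) = abs_L2 (\<lambda>x. m x * rep_L2 u x + m x * rep_L2 v x)"
        by (simp add: mult_abs_L2 assms square_integrable_add distrib_left)
      then show ?thesis by (simp add: mult_L2_def abs_L2_add square_integrable_mult assms)
    qed
    show "mult_L2 m (r *\<^sub>R u) = r *\<^sub>R mult_L2 m u"
    proof -
      have "r *\<^sub>R u = abs_L2 (\<lambda>x. r *\<^sub>R rep_L2 u x)" by (simp add: scaleR_L2_def)
      then have "mult_L2 m (r *\<^sub>R u) = abs_L2 (\<lambda>x. r *\<^sub>R (m x * rep_L2 u x))"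
        by (simp add: mult_abs_L2 assms square_integrable_scaleR)
      then show ?thesis by (simp add: mult_L2_def abs_L2_scaleR square_integrable_mult assms)
    qed
    show "norm (mult_L2 m u) \<le> norm u * B"
      using norm_mult_L2[of m B u] B assms by (simp add: bounded_symbol_def mult.commute)
  qed
qed

lemma mult_L2_scaleC:
  assumes "bounded_symbol m"
  shows "mult_L2 m (scaleC_L2 c u) = scaleC_L2 c (mult_L2 m u)"
proof -
  have "scaleC_L2 c u = abs_L2 (\<lambda>x. c * rep_L2 u x)" by (simp add: scaleC_L2_def)
  then have "mult_L2 m (scaleC_L2 c u) = abs_L2 (\<lambda>x. c * (m x * rep_L2 u x))"
    by (simp add: mult_abs_L2 assms square_integrable_cmult mult_ac)
  then show ?thesis by (simp add: mult_L2_def abs_L2_scaleC square_integrable_mult assms)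
qed

definition riesz_symbol :: "3 \<Rightarrow> 3 \<Rightarrow> R3 \<Rightarrow> complex" where
  "riesz_symbol j k \<xi> = complex_of_real (\<xi> $ j * \<xi> $ k / (norm \<xi>)\<^sup>2)"

lemma riesz_symbol_le: "cmod (riesz_symbol j k \<xi>) \<le> 1"
proof -
  have "\<bar>\<xi> $ j\<bar> * \<bar>\<xi> $ k\<bar> \<le> norm \<xi> * norm \<xi>"
    by (intro mult_mono component_le_norm_cart) auto
  then show ?thesis unfolding riesz_symbol_def norm_of_real
    by (cases "\<xi> = 0") (auto simp: abs_mult power2_eq_square divide_le_eq_1 zero_less_mult_iff)
qed

lemma riesz_symbol_bounded: "bounded_symbol (riesz_symbol j k)"
proof -
  have "riesz_symbol j k \<in> borel_measurable borel" unfolding riesz_symbol_def[abs_def] by measurable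
  then show ?thesis using riesz_symbol_le by (auto simp: bounded_symbol_def)
qed

lemma fourier_riesz: "fourier (riesz j k u) = mult_L2 (riesz_symbol j k) (fourier u)"
  using multiplier_eq[OF riesz_symbol_bounded[of j k], of u] by (simp add: riesz_def riesz_symbol_def[abs_def])

lemma riesz_scaleC: "riesz j k (scaleC_L2 c u) = scaleC_L2 c (riesz j k u)"
  by (rule fourier_inj) (simp add: fourier_riesz fourier_scaleC mult_L2_scaleC riesz_symbol_bounded)

section \<open>Distributional derivatives\<close>

text \<open>The inner product of \<^typ>\<open>L2\<close> is only the real part of the Hermitian one, so a complex
  pairing amounts to two real inner products.\<close>

lemma distr_of_inner:
  assumes "square_integrable \<phi>"
  shows "distr_of u \<phi> = Complex (inner u (abs_L2 (\<lambda>x. cnj (\<phi> x)))) (inner u (abs_L2 (\<lambda>x. \<i> * cnj (\<phi> x))))"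
  using integral_mult_inner[OF square_integrable_rep_L2[of u] assms] by (simp add: distr_of_def)

lemma L2_eq_if_tests:
  assumes "\<And>\<phi>. \<phi> \<in> test_functions \<Longrightarrow> inner u (abs_L2 \<phi>) = inner v (abs_L2 \<phi>)"
  shows "u = v"
proof -
  have "u - v \<in> closure (abs_L2 ` test_functions)" by (simp add: test_functions_dense)
  then obtain a where a: "\<And>n. a n \<in> abs_L2 ` test_functions" "a \<longlonglongrightarrow> u - v"
    unfolding closure_sequential by blast
  have "inner (u - v) (a n) = 0" for n using a(1)[of n] assms by (auto simp: inner_diff_left)
  moreover have "(\<lambda>n. inner (u - v) (a n)) \<longlonglongrightarrow> inner (u - v) (u - v)" by (intro tendsto_intros a)
  ultimately have "inner (u - v) (u - v) = 0" by (simp add: LIMSEQ_const_iff)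
  then show ?thesis by simp
qed

lemma represents_inner:
  assumes "represents w S" "\<phi> \<in> test_functions"
  shows "Re (S (\<lambda>x. cnj (\<phi> x))) = inner w (abs_L2 \<phi>)"
  using assms test_functions_cnj[OF assms(2)]
  by (simp add: represents_def distr_of_inner test_functions_integrable)

lemma represents_unique:
  assumes "represents w S" "represents w' S"
  shows "w = w'"
  by (rule L2_eq_if_tests) (metis assms represents_inner)

lemma to_L2_eq: "represents w S \<Longrightarrow> to_L2 S = w"
  unfolding to_L2_def using represents_unique by blast

lemma represents_to_L2: "in_L2 S \<Longrightarrow> represents (to_L2 S) S"
  unfolding in_L2_def using to_L2_eq by metis

subsection \<open>Shears\<close>

definition tr :: "3 \<Rightarrow> 3 \<Rightarrow> real \<Rightarrow> R3 \<Rightarrow> R3" where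
  "tr i j s x = x + (s * x $ j) *\<^sub>R axis i 1"

lemma tr_tr: "i \<noteq> j \<Longrightarrow> tr i j s (tr i j r x) = tr i j (s + r) x"
  by (simp add: tr_def axis_def algebra_simps)

lemma tr_0 [simp]: "tr i j 0 x = x"
  by (simp add: tr_def)

lemma linear_tr: "linear (tr i j s)"
  by (rule linearI) (auto simp: tr_def algebra_simps)

lemma bounded_linear_tr: "bounded_linear (tr i j s)"
  using linear_tr linear_conv_bounded_linear by blast

lemma tr_measurable [measurable]: "tr i j s \<in> borel_measurable borel"
  by (intro borel_measurable_continuous_onI linear_continuous_on bounded_linear_tr)

lemma inner_tr: "\<xi> \<bullet> tr i j s x = tr j i s \<xi> \<bullet> x"
  by (simp add: tr_def inner_add_left inner_add_right inner_axis inner_axis' mult_ac)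

lemma det_tr: "i \<noteq> j \<Longrightarrow> det (matrix (tr i j s)) = 1"
proof -
  assume "i \<noteq> j"
  then show ?thesis
    using exhaust_3[of i] exhaust_3[of j] by (auto simp: det_3 matrix_def tr_def axis_def)
qed

lemma distr_tr:
  assumes "i \<noteq> j"
  shows "distr lborel borel (tr i j s) = lborel"
proof (rule lborel_eqI[symmetric])
  fix l u :: R3 assume lu: "\<And>b. b \<in> Basis \<Longrightarrow> l \<bullet> b \<le> u \<bullet> b"
  have A: "tr i j s -` box l u = tr i j (- s) ` box l u"
  proof (intro set_eqI iffI)
    fix x assume "x \<in> tr i j s -` box l u"
    then show "x \<in> tr i j (- s) ` box l u"
      by (intro image_eqI[of _ _ "tr i j s x"]) (auto simp: tr_tr assms)
  qed (auto simp: tr_tr assms)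
  have Ab: "tr i j s -` box l u \<in> sets borel" using measurable_sets[OF tr_measurable[of i j s], of "box l u"] by simp
  have Al: "tr i j s -` box l u \<in> lmeasurable"
    unfolding A by (rule measurable_linear_image[OF linear_tr]) simp
  have "measure lborel (tr i j s -` box l u) = measure lebesgue (tr i j (- s) ` box l u)"
    using Ab unfolding A[symmetric] by simp
  also have "\<dots> = measure lborel (box l u)"
    by (subst measure_linear_image[OF linear_tr]) (auto simp: det_tr assms)
  finally have m: "measure lborel (tr i j s -` box l u) = measure lborel (box l u)" .
  have "emeasure (distr lborel borel (tr i j s)) (box l u) = emeasure lborel (tr i j s -` box l u)"
    by (subst emeasure_distr) auto
  also have "\<dots> = ennreal (measure lborel (tr i j s -` box l u))"
    using Al Ab by (intro emeasure_eq_ennreal_measure) (auto simp: fmeasurable_def top.not_eq_extremum)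
  also have "\<dots> = (\<Prod>b\<in>Basis. (u - l) \<bullet> b)"
    unfolding m using lu by (simp add: measure_lborel_box_eq)
  finally show "emeasure (distr lborel borel (tr i j s)) (box l u) = (\<Prod>b\<in>Basis. (u - l) \<bullet> b)" .
qed simp

lemma integral_tr:
  fixes f :: "R3 \<Rightarrow> 'a :: {banach, second_countable_topology}"
  assumes "i \<noteq> j" "f \<in> borel_measurable borel"
  shows "(\<integral>x. f (tr i j s x) \<partial>lborel) = (\<integral>x. f x \<partial>lborel)"
    "integrable lborel (\<lambda>x. f (tr i j s x)) \<longleftrightarrow> integrable lborel f"
proof -
  have "(\<integral>x. f (tr i j s x) \<partial>lborel) = (\<integral>x. f x \<partial>distr lborel borel (tr i j s))"
    using assms by (subst integral_distr) auto
  then show "(\<integral>x. f (tr i j s x) \<partial>lborel) = (\<integral>x. f x \<partial>lborel)" by (simp add: distr_tr assms)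
  have "integrable lborel (\<lambda>x. f (tr i j s x)) \<longleftrightarrow> integrable (distr lborel borel (tr i j s)) f"
    using assms by (subst integrable_distr_eq) auto
  then show "integrable lborel (\<lambda>x. f (tr i j s x)) \<longleftrightarrow> integrable lborel f" by (simp add: distr_tr assms)
qed

lemma AE_tr:
  assumes "i \<noteq> j" "AE x in lborel. P x"
  shows "AE x in lborel. P (tr i j s x)"
proof -
  have "AE x in distr lborel borel (tr i j s). P x" unfolding distr_tr[OF assms(1)] by (rule assms(2))
  then show ?thesis by (rule AE_distrD[rotated]) simp
qed

lemma square_integrable_tr:
  assumes "i \<noteq> j" "square_integrable f"
  shows "square_integrable (\<lambda>x. f (tr i j s x))"
proof -
  have fm: "f \<in> borel_measurable borel" using square_integrable_measurable[OF assms(2)] by simp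
  have "integrable lborel (\<lambda>x. (cmod (f (tr i j s x)))\<^sup>2)"
    using assms fm by (subst integral_tr(2)[of i j "\<lambda>x. (cmod (f x))\<^sup>2"]) (auto simp: square_integrable_def)
  then show ?thesis using fm by (simp add: square_integrable_def)
qed

text \<open>For \<open>i = 1\<close> and \<open>j = 2\<close> this is the unitary group of the flow of \<open>y \<partial>\<^sub>x\<close>. Difference quotients
  along it replace the unbounded operator \<^const>\<open>y_dx\<close>, which has no explicit description on its
  domain.\<close>

definition shear :: "3 \<Rightarrow> 3 \<Rightarrow> real \<Rightarrow> L2 \<Rightarrow> L2" where
  "shear i j s u = abs_L2 (\<lambda>x. rep_L2 u (tr i j s x))"

lemma shear_abs_L2:
  assumes "i \<noteq> j" "square_integrable f"
  shows "shear i j s (abs_L2 f) = abs_L2 (\<lambda>x. f (tr i j s x))"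
  unfolding shear_def using AE_tr[OF assms(1) rep_abs_L2[OF assms(2)]]
  by (subst abs_L2_eq_iff) (auto simp: square_integrable_tr assms)

lemma inner_shear:
  assumes "i \<noteq> j"
  shows "inner (shear i j s u) (shear i j s v) = inner u v"
proof -
  have "inner (shear i j s u) (shear i j s v) = (\<integral>x. rep_L2 u (tr i j s x) \<bullet> rep_L2 v (tr i j s x) \<partial>lborel)"
    unfolding shear_def by (rule inner_abs_L2; rule square_integrable_tr[OF assms square_integrable_rep_L2])
  also have "\<dots> = inner u v"
    unfolding inner_L2_rep by (rule integral_tr(1)[OF assms, of "\<lambda>x. rep_L2 u x \<bullet> rep_L2 v x"]) simp
  finally show ?thesis .
qed

lemma norm_shear: "i \<noteq> j \<Longrightarrow> norm (shear i j s u) = norm u"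
  by (simp add: norm_eq_sqrt_inner inner_shear)

lemma shear_shear:
  assumes "i \<noteq> j"
  shows "shear i j s (shear i j r u) = shear i j (r + s) u"
  using shear_abs_L2[OF assms square_integrable_tr[OF assms square_integrable_rep_L2[of u], of r], of s]
  by (simp add: shear_def tr_tr assms)

lemma shear_0 [simp]: "shear i j 0 u = u"
  by (simp add: shear_def)

lemma inner_shear_left: "i \<noteq> j \<Longrightarrow> inner (shear i j s u) v = inner u (shear i j (- s) v)"
  using inner_shear[of i j s u "shear i j (- s) v"] by (simp add: shear_shear)

lemma bounded_linear_shear:
  assumes "i \<noteq> j"
  shows "bounded_linear (shear i j s)"
proof (rule bounded_linear_intro[of _ 1])
  fix u v :: L2 and r :: real
  show "shear i j s (u + v) = shear i j s u + shear i j s v"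
  proof -
    have "u + v = abs_L2 (\<lambda>x. rep_L2 u x + rep_L2 v x)" by (simp add: plus_L2_def)
    then have "shear i j s (u + v) = abs_L2 (\<lambda>x. rep_L2 u (tr i j s x) + rep_L2 v (tr i j s x))"
      by (simp add: shear_abs_L2 assms square_integrable_add)
    then show ?thesis by (simp add: shear_def abs_L2_add square_integrable_tr assms)
  qed
  show "shear i j s (r *\<^sub>R u) = r *\<^sub>R shear i j s u"
  proof -
    have "r *\<^sub>R u = abs_L2 (\<lambda>x. r *\<^sub>R rep_L2 u x)" by (simp add: scaleR_L2_def)
    then have "shear i j s (r *\<^sub>R u) = abs_L2 (\<lambda>x. r *\<^sub>R rep_L2 u (tr i j s x))"
      by (simp add: shear_abs_L2 assms square_integrable_scaleR)
    then show ?thesis by (simp add: shear_def abs_L2_scaleR square_integrable_tr assms)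
  qed
qed (simp add: norm_shear assms)

text \<open>The transpose of a shear is the shear with exchanged axes.\<close>

lemma fourier_shear:
  assumes ij: "i \<noteq> j"
  shows "fourier (shear i j s u) = shear j i (- s) (fourier u)"
proof (rule LIMSEQ_unique)
  let ?U = "\<lambda>n x. indicator (cube n) x * rep_L2 u x"
  have s: "square_integrable (?U n)" for n
    by (intro cube_truncation_tendsto(2) square_integrable_rep_L2)
  have i: "integrable lborel (?U n)" for n
    by (rule integrable_cube_supported[OF s, of n]) simp
  have lim: "(\<lambda>n. abs_L2 (?U n)) \<longlonglongrightarrow> u"
    using cube_truncation_tendsto(1)[of "rep_L2 u"] by auto
  show "(\<lambda>n. fourier (shear i j s (abs_L2 (?U n)))) \<longlonglongrightarrow> fourier (shear i j s u)"
    by (intro bounded_linear.tendsto[OF bounded_linear_fourier] bounded_linear.tendsto[OF bounded_linear_shear] ij lim)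
  have "fourier (shear i j s (abs_L2 (?U n))) = shear j i (- s) (fourier (abs_L2 (?U n)))" for n
  proof -
    have m: "?U n \<in> borel_measurable borel" using i[of n] by auto
    have si: "integrable lborel (\<lambda>x. ?U n (tr i j s x))"
      using integral_tr(2)[OF ij m] i by simp
    have ss: "square_integrable (\<lambda>x. ?U n (tr i j s x))" by (rule square_integrable_tr[OF ij s])
    have "ft (\<lambda>x. ?U n (tr i j s x)) \<xi> = ft (?U n) (tr j i (- s) \<xi>)" for \<xi>
    proof -
      have "ft (\<lambda>x. ?U n (tr i j s x)) \<xi> = (\<integral>x. cis (- (\<xi> \<bullet> tr i j (- s) (tr i j s x))) * ?U n (tr i j s x) \<partial>lborel)"
        unfolding ft_def by (simp add: tr_tr ij)
      also have "\<dots> = (\<integral>x. cis (- (\<xi> \<bullet> tr i j (- s) x)) * ?U n x \<partial>lborel)"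
      proof (rule integral_tr(1)[OF ij, of "\<lambda>x. cis (- (\<xi> \<bullet> tr i j (- s) x)) * ?U n x"])
        have "(\<lambda>x. cis (- (\<xi> \<bullet> tr i j (- s) x))) \<in> borel_measurable borel" by measurable
        then show "(\<lambda>x. cis (- (\<xi> \<bullet> tr i j (- s) x)) * ?U n x) \<in> borel_measurable borel"
          using m by (rule borel_measurable_times)
      qed
      finally show ?thesis unfolding ft_def inner_tr .
    qed
    then have "ft (\<lambda>x. ?U n (tr i j s x)) = (\<lambda>\<xi>. ft (?U n) (tr j i (- s) \<xi>))" by auto
    then show ?thesis
      using fourier_integrable[OF ss si] fourier_integrable[OF s i, of n] ij
      by (simp add: shear_abs_L2[OF ij s] shear_abs_L2[of j i])
  qed
  then show "(\<lambda>n. fourier (shear i j s (abs_L2 (?U n)))) \<longlonglongrightarrow> shear j i (- s) (fourier u)"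
    using ij by (simp only:) (intro bounded_linear.tendsto[OF bounded_linear_fourier] bounded_linear.tendsto[OF bounded_linear_shear] lim, auto)
qed

subsection \<open>Difference quotients of test functions\<close>

lemma has_vector_derivative_at_quotient:
  "(f has_vector_derivative D) (at t) \<longleftrightarrow> ((\<lambda>h. (f (t + h) - f t) /\<^sub>R h) \<longlongrightarrow> D) (at 0)"
proof -
  have "norm (f (t + h) - f t - h *\<^sub>R D) / norm h = norm ((f (t + h) - f t) /\<^sub>R h - D)" if "h \<noteq> 0" for h
  proof -
    have "(f (t + h) - f t) /\<^sub>R h - D = (f (t + h) - f t - h *\<^sub>R D) /\<^sub>R h"
      using that by (simp add: scaleR_diff_right)
    then show ?thesis by (simp add: divide_inverse mult.commute)
  qed
  then have "((\<lambda>h. norm (f (t + h) - f t - h *\<^sub>R D) / norm h) \<longlongrightarrow> 0) (at 0)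
      \<longleftrightarrow> ((\<lambda>h. norm ((f (t + h) - f t) /\<^sub>R h - D)) \<longlongrightarrow> 0) (at 0)"
    by (intro tendsto_cong) (simp add: eventually_at_filter)
  then show ?thesis
    by (simp add: has_vector_derivative_def has_derivative_at bounded_linear_scaleR_left
        tendsto_norm_zero_iff LIM_zero_iff)
qed

lemma test_functions_lipschitz:
  assumes \<phi>: "\<phi> \<in> test_functions"
  shows "\<exists>M>0. \<forall>x y. cmod (\<phi> y - \<phi> x) \<le> M * norm (y - x)"
proof -
  have "\<forall>j. \<exists>B>0. \<forall>x. cmod (pd j \<phi> x) \<le> B" using test_functions_integrable(3)[OF test_functions_pd[OF \<phi>]] by blast
  then obtain B where B: "\<And>j. B j > 0" "\<And>j x. cmod (pd j \<phi> x) \<le> B j" by metis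
  let ?M = "\<Sum>j\<in>UNIV. B j"
  have d: "(\<phi> has_derivative frechet_derivative \<phi> (at x)) (at x)" for x
    using test_functions_differentiable[OF \<phi>] by (simp add: frechet_derivative_works)
  have "onorm (frechet_derivative \<phi> (at x)) \<le> ?M" for x
  proof (rule onorm_le)
    fix h
    have "cmod (frechet_derivative \<phi> (at x) h) \<le> (\<Sum>j\<in>UNIV. cmod (of_real (h $ j) * pd j \<phi> x))"
      unfolding frechet_sum_pd[OF test_functions_differentiable[OF \<phi>]] by (rule norm_sum)
    also have "\<dots> \<le> (\<Sum>j\<in>UNIV. B j * norm h)"
      unfolding norm_mult norm_of_real mult.commute[of "\<bar>h $ _\<bar>"]
      using B by (intro sum_mono mult_mono component_le_norm_cart) (auto intro: less_imp_le)
    finally show "cmod (frechet_derivative \<phi> (at x) h) \<le> ?M * norm h" by (simp add: sum_distrib_right)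
  qed
  then have "cmod (\<phi> y - \<phi> x) \<le> ?M * norm (y - x)" for x y
    by (intro differentiable_bound[of UNIV \<phi> "\<lambda>x. frechet_derivative \<phi> (at x)"])
       (use d in \<open>auto simp: has_derivative_at_withinI\<close>)
  then show ?thesis using B(1) by (intro exI[of _ ?M] conjI sum_pos) auto
qed

text \<open>Difference quotients along a vector field of at most linear growth keep a common compact
  support and a common bound, as needed for dominated convergence.\<close>

lemma difference_quotient_test:
  fixes w :: "R3 \<Rightarrow> R3"
  assumes \<phi>: "\<phi> \<in> test_functions" and w: "\<And>x. norm (w x) \<le> 1 + norm x"
  shows "\<exists>B R. \<forall>s x. \<bar>s\<bar> \<le> 1/2 \<longrightarrow> cmod ((\<phi> (x + s *\<^sub>R w x) - \<phi> x) / of_real s) \<le> B * indicator (cball 0 R) x"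
    "((\<lambda>s. (\<phi> (x + s *\<^sub>R w x) - \<phi> x) / of_real s) \<longlongrightarrow> frechet_derivative \<phi> (at x) (w x)) (at 0)"
proof -
  obtain R where R: "R > 0" "\<And>x. norm x > R \<Longrightarrow> \<phi> x = 0" using test_functions_bounded_support[OF \<phi>] by blast
  obtain M where M: "M > 0" "\<And>x y. cmod (\<phi> y - \<phi> x) \<le> M * norm (y - x)"
    using test_functions_lipschitz[OF \<phi>] by blast
  show "\<exists>B R. \<forall>s x. \<bar>s\<bar> \<le> 1/2 \<longrightarrow> cmod ((\<phi> (x + s *\<^sub>R w x) - \<phi> x) / of_real s) \<le> B * indicator (cball 0 R) x"
  proof (rule exI[of _ "M * (2 + 2 * R)"], rule exI[of _ "2 * R + 1"], intro allI impI)
    fix s :: real and x :: R3 assume s: "\<bar>s\<bar> \<le> 1/2"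
    show "cmod ((\<phi> (x + s *\<^sub>R w x) - \<phi> x) / of_real s) \<le> M * (2 + 2 * R) * indicator (cball 0 (2 * R + 1)) x"
    proof (cases "norm x \<le> 2 * R + 1")
      case True
      have "cmod (\<phi> (x + s *\<^sub>R w x) - \<phi> x) \<le> M * (\<bar>s\<bar> * norm (w x))" using M(2)[of "x + s *\<^sub>R w x" x] by simp
      also have "\<dots> \<le> M * (\<bar>s\<bar> * (2 + 2 * R))"
        using w[of x] True M(1) by (intro mult_left_mono) auto
      finally show ?thesis using True M(1) R(1) by (cases "s = 0") (auto simp: norm_divide field_simps)
    next
      case False
      have "norm (s *\<^sub>R w x) \<le> 1/2 * (1 + norm x)" unfolding norm_scaleR using s w[of x] by (intro mult_mono) auto
      then have "norm (x + s *\<^sub>R w x) > R" using False norm_diff_ineq[of x "s *\<^sub>R w x"] by (simp add: field_simps)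
      then show ?thesis using R False by simp
    qed
  qed
  have a: "((\<lambda>s. x + s *\<^sub>R w x) has_derivative (\<lambda>h. h *\<^sub>R w x)) (at 0)" by (auto intro!: derivative_eq_intros)
  have b: "(\<phi> has_derivative frechet_derivative \<phi> (at x)) (at ((\<lambda>s. x + s *\<^sub>R w x) 0))"
    using test_functions_differentiable[OF \<phi>] by (simp add: frechet_derivative_works)
  have "((\<lambda>s. \<phi> (x + s *\<^sub>R w x)) has_derivative (\<lambda>h. frechet_derivative \<phi> (at x) (h *\<^sub>R w x))) (at 0)"
    using diff_chain_at[OF a b] by (simp add: o_def)
  moreover have "frechet_derivative \<phi> (at x) (h *\<^sub>R w x) = h *\<^sub>R frechet_derivative \<phi> (at x) (w x)" for h
    using linear_frechet_derivative[OF test_functions_differentiable[OF \<phi>]] by (rule linear_scale)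
  ultimately have "((\<lambda>s. \<phi> (x + s *\<^sub>R w x)) has_vector_derivative frechet_derivative \<phi> (at x) (w x)) (at 0)"
    by (simp add: has_vector_derivative_def)
  then have "((\<lambda>s. (\<phi> (x + s *\<^sub>R w x) - \<phi> x) /\<^sub>R s) \<longlongrightarrow> frechet_derivative \<phi> (at x) (w x)) (at 0)"
    by (simp add: has_vector_derivative_at_quotient)
  then show "((\<lambda>s. (\<phi> (x + s *\<^sub>R w x) - \<phi> x) / of_real s) \<longlongrightarrow> frechet_derivative \<phi> (at x) (w x)) (at 0)"
    by (simp add: scaleR_conv_of_real divide_inverse mult.commute)
qed


lemma pd_coord_mult:
  assumes "\<phi> \<in> test_functions" "i \<noteq> j"
  shows "pd j (\<lambda>x. complex_of_real (x $ i) * \<phi> x) = (\<lambda>x. complex_of_real (x $ i) * pd j \<phi> x)"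
proof
  fix x :: R3
  have d: "((\<lambda>x::R3. complex_of_real (x $ i)) has_derivative (\<lambda>h. of_real (h $ i))) (at x)"
    by (intro has_derivative_of_real bounded_linear_imp_has_derivative bounded_linear_vec_nth)
  have "pd j (\<lambda>x. complex_of_real (x $ i)) x = 0" using pd_eqI[OF d, of j] assms(2) by (simp add: axis_def)
  moreover have "(\<lambda>x::R3. complex_of_real (x $ i)) differentiable (at x)" using d by (auto simp: differentiable_def)
  ultimately show "pd j (\<lambda>x. complex_of_real (x $ i) * \<phi> x) x = complex_of_real (x $ i) * pd j \<phi> x"
    using pd_mult[OF _ test_functions_differentiable[OF assms(1)]] by simp
qed

lemma pd_bounded_linear:
  assumes "\<phi> \<in> test_functions" "bounded_linear B"
  shows "pd i (\<lambda>x. B (\<phi> x)) = (\<lambda>x. B (pd i \<phi> x))"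
proof
  fix x
  have "((\<lambda>x. B (\<phi> x)) has_derivative (\<lambda>h. B (frechet_derivative \<phi> (at x) h))) (at x)"
    using test_functions_differentiable[OF assms(1)]
    by (intro bounded_linear.has_derivative[OF assms(2)]) (auto simp: frechet_derivative_works)
  from pd_eqI[OF this] show "pd i (\<lambda>x. B (\<phi> x)) x = B (pd i \<phi> x)" by (simp add: pd_def)
qed

text \<open>A distribution \<open>\<phi> \<mapsto> distr_of u (D \<phi>)\<close> with \<open>D\<close> real and linear is determined by real inner products.\<close>

lemma represents_iff_inner:
  assumes D: "\<And>\<phi>. \<phi> \<in> test_functions \<Longrightarrow> D \<phi> \<in> test_functions"
    and Dcnj: "\<And>\<phi>. \<phi> \<in> test_functions \<Longrightarrow> D (\<lambda>x. cnj (\<phi> x)) = (\<lambda>x. cnj (D \<phi> x))"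
    and Di: "\<And>\<phi>. \<phi> \<in> test_functions \<Longrightarrow> D (\<lambda>x. \<i> * \<phi> x) = (\<lambda>x. \<i> * D \<phi> x)"
  shows "represents k (\<lambda>\<phi>. distr_of u (D \<phi>)) \<longleftrightarrow>
    (\<forall>\<phi>\<in>test_functions. inner k (abs_L2 \<phi>) = inner u (abs_L2 (D \<phi>)))" (is "?L \<longleftrightarrow> ?R")
proof
  assume ?L
  show ?R
  proof
    fix \<phi> assume \<phi>: "\<phi> \<in> test_functions"
    from represents_inner[OF \<open>?L\<close> \<phi>] show "inner k (abs_L2 \<phi>) = inner u (abs_L2 (D \<phi>))"
      using test_functions_integrable(2)[OF D[OF \<phi>]]
      by (simp add: Dcnj \<phi> distr_of_inner square_integrable_cnj)
  qed
next
  assume R: ?R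
  show ?L unfolding represents_def
  proof
    fix \<phi> assume \<phi>: "\<phi> \<in> test_functions"
    have c: "(\<lambda>x. cnj (\<phi> x)) \<in> test_functions" by (rule test_functions_cnj[OF \<phi>])
    have ic: "(\<lambda>x. \<i> * cnj (\<phi> x)) \<in> test_functions" by (rule test_functions_mult[OF c]) simp
    show "distr_of u (D \<phi>) = distr_of k \<phi>"
      using R[rule_format, OF c] R[rule_format, OF ic] test_functions_integrable(2)[OF D[OF \<phi>]]
        test_functions_integrable(2)[OF \<phi>]
      by (simp add: distr_of_inner Dcnj \<phi> Di[OF c])
  qed
qed

subsection \<open>The transport term\<close>

definition y_dx_test :: "(R3 \<Rightarrow> complex) \<Rightarrow> R3 \<Rightarrow> complex" where
  "y_dx_test \<phi> x = of_real (x $ 2) * pd 1 \<phi> x"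

lemma y_dx_test_in: "\<phi> \<in> test_functions \<Longrightarrow> y_dx_test \<phi> \<in> test_functions"
  unfolding y_dx_test_def[abs_def] by (intro test_functions_mult test_functions_pd Ck_coord)

lemma represents_y_dx:
  "represents k (y_dx u) \<longleftrightarrow> (\<forall>\<phi>\<in>test_functions. inner k (abs_L2 \<phi>) = - inner u (abs_L2 (y_dx_test \<phi>)))"
proof -
  let ?D = "\<lambda>\<phi> x. - y_dx_test \<phi> x"
  have Dt: "?D \<phi> \<in> test_functions" if "\<phi> \<in> test_functions" for \<phi>
    using test_functions_mult[OF y_dx_test_in[OF that], of "\<lambda>x. -1"] by simp
  have y: "y_dx u \<phi> = distr_of u (?D \<phi>)" if "\<phi> \<in> test_functions" for \<phi>
  proof -
    have "y_dx u \<phi> = - distr_of u (y_dx_test \<phi>)"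
      by (simp add: y_dx_def distr_mult_def distr_pd_def pd_coord_mult that y_dx_test_def[abs_def])
    also have "\<dots> = distr_of u (?D \<phi>)"
      by (simp add: distr_of_def)
    finally show ?thesis .
  qed
  have "represents k (y_dx u) \<longleftrightarrow> represents k (\<lambda>\<phi>. distr_of u (?D \<phi>))"
    unfolding represents_def using y by simp
  also have "\<dots> \<longleftrightarrow> (\<forall>\<phi>\<in>test_functions. inner k (abs_L2 \<phi>) = inner u (abs_L2 (?D \<phi>)))"
    by (rule represents_iff_inner[OF Dt])
       (auto simp: y_dx_test_def pd_bounded_linear bounded_linear_cnj bounded_linear_mult_right)
  also have "\<dots> \<longleftrightarrow> (\<forall>\<phi>\<in>test_functions. inner k (abs_L2 \<phi>) = - inner u (abs_L2 (y_dx_test \<phi>)))"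
  proof -
    have "abs_L2 (?D \<phi>) = - abs_L2 (y_dx_test \<phi>)" if "\<phi> \<in> test_functions" for \<phi>
      using abs_L2_scaleR[OF test_functions_integrable(2)[OF y_dx_test_in[OF that]], of "-1"] by simp
    then show ?thesis by simp
  qed
  finally show ?thesis .
qed

lemma tr_test_functions: "i \<noteq> j \<Longrightarrow> \<phi> \<in> test_functions \<Longrightarrow> (\<lambda>x. \<phi> (tr i j s x)) \<in> test_functions"
  using test_functions_affine[of \<phi> "tr i j s" "tr i j (- s)" 0] by (simp add: bounded_linear_tr tr_tr)

text \<open>On test functions the shear group is differentiable in norm, by dominated convergence.\<close>

lemma shear_test_quotient:
  assumes \<phi>: "\<phi> \<in> test_functions"
  shows "((\<lambda>s. (shear 1 2 s (abs_L2 \<phi>) - abs_L2 \<phi>) /\<^sub>R s) \<longlongrightarrow> abs_L2 (y_dx_test \<phi>)) (at 0)"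
  unfolding tendsto_at_iff_sequentially
proof (intro allI impI)
  fix s :: "nat \<Rightarrow> real" assume s: "\<forall>n. s n \<in> UNIV - {0}" "s \<longlonglongrightarrow> 0"
  let ?w = "\<lambda>x::R3. (x $ 2) *\<^sub>R axis 1 1 :: R3"
  have w: "norm (?w x) \<le> 1 + norm x" for x using component_le_norm_cart[of x 2] by (simp add: norm_axis_1)
  note dq = difference_quotient_test[OF \<phi>, of ?w, OF w]
  have tr: "tr 1 2 s x = x + s *\<^sub>R ?w x" for s x by (simp add: tr_def)
  let ?q = "\<lambda>s x. (\<phi> (x + s *\<^sub>R ?w x) - \<phi> x) / of_real s"
  obtain B R where BR: "\<And>s x. \<bar>s\<bar> \<le> 1/2 \<Longrightarrow> cmod (?q s x) \<le> B * indicator (cball 0 R) x" using dq(1) by blast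
  have \<phi>m: "\<phi> \<in> borel_measurable borel" by (rule test_functions_measurable[OF \<phi>])
  have qt: "?q t \<in> test_functions" for t
  proof -
    have "(\<lambda>x. inverse (complex_of_real t) * (\<phi> (tr 1 2 t x) + (- 1) * \<phi> x)) \<in> test_functions"
      by (intro test_functions_mult test_functions_add tr_test_functions \<phi>) auto
    then show ?thesis by (simp add: tr divide_inverse mult.commute)
  qed
  have "\<forall>\<^sub>F n in sequentially. \<bar>s n\<bar> < 1/2"
    using tendstoD[OF s(2), of "1/2"] by (simp add: dist_real_def)
  then obtain N where N: "\<And>n. n \<ge> N \<Longrightarrow> \<bar>s n\<bar> < 1/2" by (auto simp: eventually_sequentially)
  have "(\<lambda>n. abs_L2 (?q (s (n + N)))) \<longlonglongrightarrow> abs_L2 (y_dx_test \<phi>)"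
  proof (rule L2_dominated_convergence(3))
    show "?q (s (n + N)) \<in> borel_measurable borel" for n by (rule test_functions_measurable[OF qt])
    show "y_dx_test \<phi> \<in> borel_measurable borel" by (rule test_functions_measurable[OF y_dx_test_in[OF \<phi>]])
    show "AE x in lborel. (\<lambda>n. ?q (s (n + N)) x) \<longlonglongrightarrow> y_dx_test \<phi> x"
    proof (rule AE_I2)
      fix x :: R3
      have "frechet_derivative \<phi> (at x) (?w x) = y_dx_test \<phi> x"
        using linear_scale[OF linear_frechet_derivative[OF test_functions_differentiable[OF \<phi>]]]
        by (simp add: y_dx_test_def pd_def scaleR_conv_of_real)
      then have "((\<lambda>s. ?q s x) \<longlongrightarrow> y_dx_test \<phi> x) (at 0)" using dq(2)[of x] by simp
      moreover have "filterlim (\<lambda>n. s (n + N)) (at 0) sequentially"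
        using s by (auto simp: filterlim_at intro!: LIMSEQ_ignore_initial_segment)
      ultimately show "(\<lambda>n. ?q (s (n + N)) x) \<longlonglongrightarrow> y_dx_test \<phi> x" by (rule filterlim_compose)
    qed
    have c: "(\<lambda>x. complex_of_real (B * indicator (cball 0 R) x)) \<in> borel_measurable borel"
      by (rule borel_measurable_continuous_on[where f = complex_of_real]) (auto intro!: continuous_intros borel_measurable_times borel_measurable_indicator)
    show "square_integrable (\<lambda>x. complex_of_real (B * indicator (cball 0 R) x))"
      by (rule bounded_support_integrable(2)[OF c, of R "\<bar>B\<bar>"]) (auto simp: abs_mult indicator_def)
    show "AE x in lborel. cmod (?q (s (n + N)) x) \<le> cmod (complex_of_real (B * indicator (cball 0 R) x))" for n
      using N[of "n + N"] by (intro AE_I2 order_trans[OF BR]) (auto simp only: norm_of_real abs_ge_self, auto)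
  qed
  then have "(\<lambda>n. abs_L2 (?q (s n))) \<longlonglongrightarrow> abs_L2 (y_dx_test \<phi>)" by (rule LIMSEQ_offset)
  moreover have "(shear 1 2 t (abs_L2 \<phi>) - abs_L2 \<phi>) /\<^sub>R t = abs_L2 (?q t)" for t
  proof -
    have "(shear 1 2 t (abs_L2 \<phi>) - abs_L2 \<phi>) /\<^sub>R t = inverse t *\<^sub>R abs_L2 (\<lambda>x. \<phi> (tr 1 2 t x) - \<phi> x)"
      using tr_test_functions[OF _ \<phi>, of 1 2] 
      by (simp add: shear_abs_L2 test_functions_integrable \<phi> abs_L2_diff)
    also have "\<dots> = abs_L2 (?q t)"
      using tr_test_functions[OF _ \<phi>, of 1 2 t] 
      by (simp add: abs_L2_scaleR square_integrable_diff test_functions_integrable \<phi> tr scaleR_conv_of_real divide_inverse mult.commute)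
    finally show ?thesis .
  qed
  ultimately show "((\<lambda>s. (shear 1 2 s (abs_L2 \<phi>) - abs_L2 \<phi>) /\<^sub>R s) \<circ> s) \<longlonglongrightarrow> abs_L2 (y_dx_test \<phi>)"
    by (simp add: o_def)
qed


text \<open>Weak differentiability at every time \<open>t\<close> reduces to time \<open>0\<close> by moving the shear onto the test
  function.\<close>

lemma y_dx_shear_derivative:
  assumes k: "represents k (y_dx u)" and \<phi>: "\<phi> \<in> test_functions"
  shows "((\<lambda>s. inner (shear 1 2 s u) (abs_L2 \<phi>)) has_vector_derivative inner k (shear 1 2 (- t) (abs_L2 \<phi>))) (at t)"
proof -
  let ?\<psi> = "\<lambda>x. \<phi> (tr 1 2 (- t) x)"
  have \<psi>: "?\<psi> \<in> test_functions" by (rule tr_test_functions[OF _ \<phi>]) simp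
  have a\<psi>: "abs_L2 ?\<psi> = shear 1 2 (- t) (abs_L2 \<phi>)"
    by (simp add: shear_abs_L2 test_functions_integrable \<phi>)
  have m: "filterlim (\<lambda>h::real. - h) (at 0) (at 0)"
    unfolding filterlim_at by (auto simp: eventually_at_filter intro!: tendsto_eq_intros)
  have "((\<lambda>h. inner u ((shear 1 2 (- h) (abs_L2 ?\<psi>) - abs_L2 ?\<psi>) /\<^sub>R (- h))) \<longlongrightarrow> inner u (abs_L2 (y_dx_test ?\<psi>))) (at 0)"
    by (intro tendsto_inner tendsto_const filterlim_compose[OF shear_test_quotient[OF \<psi>] m])
  then have "((\<lambda>h. - inner u ((shear 1 2 (- h) (abs_L2 ?\<psi>) - abs_L2 ?\<psi>) /\<^sub>R (- h))) \<longlongrightarrow> - inner u (abs_L2 (y_dx_test ?\<psi>))) (at 0)"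
    by (rule tendsto_minus)
  also have "- inner u (abs_L2 (y_dx_test ?\<psi>)) = inner k (abs_L2 ?\<psi>)"
    using k \<psi> by (simp add: represents_y_dx)
  also have "(\<lambda>h. - inner u ((shear 1 2 (- h) (abs_L2 ?\<psi>) - abs_L2 ?\<psi>) /\<^sub>R (- h)))
      = (\<lambda>h. (inner (shear 1 2 (t + h) u) (abs_L2 \<phi>) - inner (shear 1 2 t u) (abs_L2 \<phi>)) /\<^sub>R h)"
    by (simp add: fun_eq_iff a\<psi> shear_shear inner_shear_left inner_diff_right)
  finally show ?thesis unfolding has_vector_derivative_at_quotient a\<psi> .
qed

lemma norm_le_if_tests:
  assumes C: "\<And>\<phi>. \<phi> \<in> test_functions \<Longrightarrow> inner w (abs_L2 \<phi>) \<le> C * norm (abs_L2 \<phi>)" and "C \<ge> 0"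
  shows "norm w \<le> C"
proof -
  have "w \<in> closure (abs_L2 ` test_functions)" by (simp add: test_functions_dense)
  then obtain a where a: "\<And>n. a n \<in> abs_L2 ` test_functions" "a \<longlonglongrightarrow> w"
    unfolding closure_sequential by blast
  have "inner w w \<le> C * norm w"
  proof (rule LIMSEQ_le)
    show "(\<lambda>n. inner w (a n)) \<longlonglongrightarrow> inner w w" by (intro tendsto_intros a)
    show "(\<lambda>n. C * norm (a n)) \<longlonglongrightarrow> C * norm w" by (intro tendsto_intros a)
    have "inner w (a n) \<le> C * norm (a n)" for n using a(1)[of n] C by auto
    then show "\<exists>N. \<forall>n\<ge>N. inner w (a n) \<le> C * norm (a n)" by blast
  qed
  then have "norm w * norm w \<le> C * norm w" by (simp add: power2_norm_eq_inner[symmetric] power2_eq_square)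
  then show ?thesis using assms(2) by (cases "norm w = 0") (auto simp: mult_le_cancel_right)
qed

text \<open>The mean value theorem, applied to the weak derivative, bounds the difference quotients
  uniformly in the test function and hence in norm.\<close>

lemma norm_shear_diff_le:
  assumes k: "represents k (y_dx u)"
  shows "norm (shear 1 2 s u - u) \<le> norm k * \<bar>s\<bar>"
proof (rule norm_le_if_tests)
  fix \<phi> assume \<phi>: "\<phi> \<in> test_functions"
  let ?f = "\<lambda>s. inner (shear 1 2 s u) (abs_L2 \<phi>)"
  have "norm (?f s - ?f 0) \<le> (norm k * norm (abs_L2 \<phi>)) * norm (s - 0)"
  proof (rule field_differentiable_bound[of UNIV])
    show "(?f has_field_derivative inner k (shear 1 2 (- t) (abs_L2 \<phi>))) (at t within UNIV)" for t
      using y_dx_shear_derivative[OF k \<phi>, of t] by (simp add: has_real_derivative_iff_has_vector_derivative)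
    show "norm (inner k (shear 1 2 (- t) (abs_L2 \<phi>))) \<le> norm k * norm (abs_L2 \<phi>)" for t
      using Cauchy_Schwarz_ineq2[of k "shear 1 2 (- t) (abs_L2 \<phi>)"] by (simp add: norm_shear)
  qed auto
  then show "inner (shear 1 2 s u - u) (abs_L2 \<phi>) \<le> norm k * \<bar>s\<bar> * norm (abs_L2 \<phi>)"
    by (simp add: inner_diff_left mult_ac)
qed simp

lemma norm_quotient_le:
  fixes X :: "'a :: real_normed_vector"
  shows "norm X \<le> K * \<bar>s\<bar> \<Longrightarrow> 0 \<le> K \<Longrightarrow> norm (X /\<^sub>R s) \<le> K"
  by (cases "s = 0") (auto simp: field_simps)

text \<open>Bounded difference quotients that converge against a dense set converge weakly.\<close>

lemma y_dx_shear_weak_limit: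
  assumes k: "represents k (y_dx u)"
  shows "((\<lambda>s. inner ((shear 1 2 s u - u) /\<^sub>R s) v) \<longlongrightarrow> inner k v) (at 0)"
proof (rule tendstoI)
  fix e :: real assume e: "e > 0"
  let ?F = "\<lambda>s. (shear 1 2 s u - u) /\<^sub>R s"
  have F: "norm (?F s) \<le> norm k" for s
    by (intro norm_quotient_le norm_shear_diff_le k norm_ge_zero)
  let ?d = "e / (3 * (norm k + 1))"
  have d: "?d > 0" using e by (auto intro!: divide_pos_pos add_nonneg_pos)
  have "v \<in> closure (abs_L2 ` test_functions)" by (simp add: test_functions_dense)
  then obtain \<phi> where \<phi>: "\<phi> \<in> test_functions" "dist (abs_L2 \<phi>) v < ?d"
    using d unfolding closure_approachable by blast
  have kd: "norm k * ?d \<le> e / 3"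
  proof -
    have "norm k * ?d \<le> (norm k + 1) * ?d" using d by (intro mult_right_mono) auto
    also have "\<dots> = e / 3" using add_nonneg_pos[OF norm_ge_zero[of k] zero_less_one] by (simp add: field_simps)
    finally show ?thesis .
  qed
  have b: "\<bar>inner w (v - abs_L2 \<phi>)\<bar> \<le> e / 3" if "norm w \<le> norm k" for w
  proof -
    have "\<bar>inner w (v - abs_L2 \<phi>)\<bar> \<le> norm w * norm (v - abs_L2 \<phi>)" by (rule Cauchy_Schwarz_ineq2)
    also have "\<dots> \<le> norm k * ?d" using that \<phi>(2) by (intro mult_mono) (auto simp: dist_norm norm_minus_commute)
    finally show ?thesis using kd by linarith
  qed
  have "((\<lambda>s. inner (?F s) (abs_L2 \<phi>)) \<longlongrightarrow> inner k (abs_L2 \<phi>)) (at 0)"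
    using y_dx_shear_derivative[OF k \<phi>(1), of 0] unfolding has_vector_derivative_at_quotient
    by (simp add: inner_diff_left divide_inverse mult.commute)
  from tendstoD[OF this, of "e / 3"] e
  have "\<forall>\<^sub>F s in at 0. \<bar>inner (?F s) (abs_L2 \<phi>) - inner k (abs_L2 \<phi>)\<bar> < e / 3"
    by (simp add: dist_real_def)
  then show "\<forall>\<^sub>F s in at 0. dist (inner (?F s) v) (inner k v) < e"
  proof eventually_elim
    case (elim s)
    have "inner (?F s) v - inner k v
      = inner (?F s) (v - abs_L2 \<phi>) + (inner (?F s) (abs_L2 \<phi>) - inner k (abs_L2 \<phi>)) - inner k (v - abs_L2 \<phi>)"
      by (simp only: inner_diff_right)
    then show ?case using elim b[OF F[of s]] b[of k] unfolding dist_real_def by linarith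
  qed
qed

lemma represents_y_dxI:
  assumes lim: "((\<lambda>s. (shear 1 2 s u - u) /\<^sub>R s) \<longlongrightarrow> k) (at 0)"
  shows "represents k (y_dx u)"
  unfolding represents_y_dx
proof
  fix \<phi> assume \<phi>: "\<phi> \<in> test_functions"
  have m: "filterlim (\<lambda>h::real. - h) (at 0) (at 0)"
    unfolding filterlim_at by (auto simp: eventually_at_filter intro!: tendsto_eq_intros)
  have "((\<lambda>s. inner ((shear 1 2 s u - u) /\<^sub>R s) (abs_L2 \<phi>)) \<longlongrightarrow> inner k (abs_L2 \<phi>)) (at 0)"
    by (intro tendsto_intros lim)
  moreover have "((\<lambda>s. - inner u ((shear 1 2 (- s) (abs_L2 \<phi>) - abs_L2 \<phi>) /\<^sub>R (- s))) \<longlongrightarrow> - inner u (abs_L2 (y_dx_test \<phi>))) (at 0)"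
    by (intro tendsto_minus tendsto_inner tendsto_const filterlim_compose[OF shear_test_quotient[OF \<phi>] m])
  moreover have "(\<lambda>s. - inner u ((shear 1 2 (- s) (abs_L2 \<phi>) - abs_L2 \<phi>) /\<^sub>R (- s)))
      = (\<lambda>s. inner ((shear 1 2 s u - u) /\<^sub>R s) (abs_L2 \<phi>))"
    by (simp add: fun_eq_iff inner_shear_left inner_diff_right inner_diff_left)
  ultimately show "inner k (abs_L2 \<phi>) = - inner u (abs_L2 (y_dx_test \<phi>))"
    using tendsto_unique[OF trivial_limit_at] by metis
qed

definition rmult :: "(R3 \<Rightarrow> real) \<Rightarrow> L2 \<Rightarrow> L2" where
  "rmult q = mult_L2 (\<lambda>\<xi>. complex_of_real (q \<xi>))"

definition bounded_weight :: "(R3 \<Rightarrow> real) \<Rightarrow> bool" where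
  "bounded_weight q \<longleftrightarrow> q \<in> borel_measurable borel \<and> (\<exists>B. \<forall>\<xi>. \<bar>q \<xi>\<bar> \<le> B)"

lemma bounded_weight_symbol: "bounded_weight q \<Longrightarrow> bounded_symbol (\<lambda>\<xi>. complex_of_real (q \<xi>))"
  by (auto simp: bounded_weight_def bounded_symbol_def)

lemma bounded_linear_rmult: "bounded_weight q \<Longrightarrow> bounded_linear (rmult q)"
  unfolding rmult_def by (intro bounded_linear_mult_L2 bounded_weight_symbol)

lemma inner_rmult:
  assumes q: "bounded_weight q"
  shows "inner u (rmult q v) = (\<integral>\<xi>. q \<xi> * (rep_L2 u \<xi> \<bullet> rep_L2 v \<xi>) \<partial>lborel)"
    "integrable lborel (\<lambda>\<xi>. q \<xi> * (rep_L2 u \<xi> \<bullet> rep_L2 v \<xi>))"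
proof -
  let ?g = "\<lambda>\<xi>. complex_of_real (q \<xi>) * rep_L2 v \<xi>"
  have s: "square_integrable ?g"
    by (intro square_integrable_mult bounded_weight_symbol q square_integrable_rep_L2)
  have eq: "rep_L2 u \<xi> \<bullet> ?g \<xi> = q \<xi> * (rep_L2 u \<xi> \<bullet> rep_L2 v \<xi>)" for \<xi>
    by (simp add: inner_complex_def algebra_simps)
  have "inner u (rmult q v) = inner (abs_L2 (rep_L2 u)) (abs_L2 ?g)" by (simp add: rmult_def mult_L2_def)
  also have "\<dots> = (\<integral>\<xi>. rep_L2 u \<xi> \<bullet> ?g \<xi> \<partial>lborel)" by (rule inner_abs_L2[OF _ s]) simp
  finally show "inner u (rmult q v) = (\<integral>\<xi>. q \<xi> * (rep_L2 u \<xi> \<bullet> rep_L2 v \<xi>) \<partial>lborel)" by (simp only: eq)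
  show "integrable lborel (\<lambda>\<xi>. q \<xi> * (rep_L2 u \<xi> \<bullet> rep_L2 v \<xi>))"
    using square_integrable_inner[OF square_integrable_rep_L2[of u] s] by (simp only: eq)
qed

lemma inner_rmult_commute: "bounded_weight q \<Longrightarrow> inner u (rmult q v) = inner v (rmult q u)"
  by (simp add: inner_rmult inner_commute)

text \<open>A bounded weight that is differentiable along the shear flow can be differentiated under
  the quadratic form: the shear moves the increment from the function to the weight.\<close>

lemma weighted_transport_identity:
  assumes k: "represents k (y_dx u)" and q: "bounded_weight q"
    and lip: "\<And>s \<xi>. \<bar>q (tr 2 1 s \<xi>) - q \<xi>\<bar> \<le> C * \<bar>s\<bar>"
    and q': "bounded_weight q'" "\<And>\<xi>. ((\<lambda>s. (q (tr 2 1 s \<xi>) - q \<xi>) / s) \<longlongrightarrow> q' \<xi>) (at 0)"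
  shows "2 * inner (fourier k) (rmult q (fourier u)) = inner (fourier u) (rmult q' (fourier u))"
proof -
  let ?h = "fourier u"
  define s where "s n = 1 / real (Suc n)" for n
  have s0: "s n > 0" for n by (simp add: s_def)
  have s: "s \<longlonglongrightarrow> 0" unfolding s_def using LIMSEQ_inverse_real_of_nat by (simp add: inverse_eq_divide)
  have sat: "filterlim s (at 0) sequentially"
    using s s0 by (auto simp: filterlim_at less_imp_neq[symmetric])
  define v where "v n = fourier (shear 1 2 (s n) u)" for n
  define d where "d n = (v n - ?h) /\<^sub>R s n" for n
  interpret F: bounded_linear fourier by (rule bounded_linear_fourier)
  interpret Q: bounded_linear "rmult q" by (rule bounded_linear_rmult[OF q])
  have d: "d n = fourier ((shear 1 2 (s n) u - u) /\<^sub>R s n)" for n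
    by (simp add: d_def v_def F.scaleR F.diff)
  have weak: "(\<lambda>n. inner (d n) w) \<longlonglongrightarrow> inner (fourier k) w" for w
  proof -
    have "(\<lambda>n. (2 * pi)^3 * inner ((shear 1 2 (s n) u - u) /\<^sub>R s n) (ifourier w)) \<longlonglongrightarrow> (2 * pi)^3 * inner k (ifourier w)"
      by (intro tendsto_mult tendsto_const filterlim_compose[OF y_dx_shear_weak_limit[OF k] sat])
    then show ?thesis unfolding d inner_fourier[symmetric] by simp
  qed
  have dn: "norm (d n) \<le> sqrt ((2 * pi)^3) * norm k" for n
    unfolding d norm_fourier by (intro mult_left_mono norm_quotient_le norm_shear_diff_le k norm_ge_zero) simp
  have vd: "v n = ?h + s n *\<^sub>R d n" for n using s0[of n] by (simp add: d_def)
  have expand: "(inner (v n) (rmult q (v n)) - inner ?h (rmult q ?h)) / s n = 2 * inner (d n) (rmult q ?h) + s n * inner (d n) (rmult q (d n))" for n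
    unfolding vd using s0[of n] inner_rmult_commute[OF q, of ?h "d n"]
    by (simp add: Q.add Q.scaleR inner_add_left inner_add_right field_simps)
  have "(\<lambda>n. s n * inner (d n) (rmult q (d n))) \<longlonglongrightarrow> 0"
  proof -
    obtain K where K: "\<And>x. norm (rmult q x) \<le> norm x * K" "K > 0" using Q.pos_bounded by blast
    have le: "norm (s n * inner (d n) (rmult q (d n))) \<le> s n * ((sqrt ((2 * pi)^3) * norm k)\<^sup>2 * K)" for n
    proof -
      have "\<bar>inner (d n) (rmult q (d n))\<bar> \<le> norm (d n) * norm (rmult q (d n))" by (rule Cauchy_Schwarz_ineq2)
      also have "\<dots> \<le> norm (d n) * (norm (d n) * K)" by (intro mult_left_mono K) auto
      also have "\<dots> = (norm (d n))\<^sup>2 * K" by (simp add: power2_eq_square)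
      also have "\<dots> \<le> (sqrt ((2 * pi)^3) * norm k)\<^sup>2 * K" using dn K(2) by (intro mult_right_mono power_mono) auto
      finally show ?thesis using s0[of n] by (simp add: abs_mult)
    qed
    have z: "(\<lambda>n. s n * ((sqrt ((2 * pi)^3) * norm k)\<^sup>2 * K)) \<longlonglongrightarrow> 0" by (rule tendsto_mult_left_zero[OF s])
    show ?thesis by (rule Lim_null_comparison[OF always_eventually z]) (use le in blast)
  qed
  then have lim1: "(\<lambda>n. (inner (v n) (rmult q (v n)) - inner ?h (rmult q ?h)) / s n) \<longlonglongrightarrow> 2 * inner (fourier k) (rmult q ?h) + 0"
    unfolding expand by (intro tendsto_add tendsto_mult tendsto_const weak)
  have qm: "q \<in> borel_measurable borel" using q by (simp add: bounded_weight_def)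
  have qs: "bounded_weight (\<lambda>\<xi>. q (tr 2 1 (s n) \<xi>))" for n
    using q by (auto simp: bounded_weight_def)
  \<comment> \<open>A change of variables by the shear, which preserves volume.\<close>
  have move: "inner (v n) (rmult q (v n)) = inner ?h (rmult (\<lambda>\<xi>. q (tr 2 1 (s n) \<xi>)) ?h)" for n
  proof -
    have v: "v n = abs_L2 (\<lambda>\<xi>. rep_L2 ?h (tr 2 1 (- s n) \<xi>))"
      unfolding v_def by (subst fourier_shear) (simp_all add: shear_def)
    have "rmult q (v n) = abs_L2 (\<lambda>\<xi>. of_real (q (tr 2 1 (s n) (tr 2 1 (- s n) \<xi>))) * rep_L2 ?h (tr 2 1 (- s n) \<xi>))"
      unfolding v rmult_def by (simp add: mult_abs_L2 bounded_weight_symbol q square_integrable_tr tr_tr)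
    also have "\<dots> = shear 2 1 (- s n) (rmult (\<lambda>\<xi>. q (tr 2 1 (s n) \<xi>)) ?h)"
      unfolding rmult_def mult_L2_def
      by (subst shear_abs_L2) (auto intro!: square_integrable_mult bounded_weight_symbol qs)
    finally show ?thesis unfolding v_def by (simp add: fourier_shear inner_shear)
  qed
  have "(\<lambda>n. rmult (\<lambda>\<xi>. (q (tr 2 1 (s n) \<xi>) - q \<xi>) / s n) ?h) \<longlonglongrightarrow> rmult q' ?h"
    unfolding rmult_def mult_L2_def
  proof (rule L2_dominated_convergence(3))
    show "AE \<xi> in lborel. (\<lambda>n. complex_of_real ((q (tr 2 1 (s n) \<xi>) - q \<xi>) / s n) * rep_L2 ?h \<xi>) \<longlonglongrightarrow> complex_of_real (q' \<xi>) * rep_L2 ?h \<xi>"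
      by (intro AE_I2 tendsto_mult tendsto_of_real tendsto_const filterlim_compose[OF q'(2) sat])
    show "square_integrable (\<lambda>\<xi>. complex_of_real C * rep_L2 ?h \<xi>)" by (intro square_integrable_cmult square_integrable_rep_L2)
    show "AE \<xi> in lborel. cmod (complex_of_real ((q (tr 2 1 (s n) \<xi>) - q \<xi>) / s n) * rep_L2 ?h \<xi>) \<le> cmod (complex_of_real C * rep_L2 ?h \<xi>)" for n
    proof (rule AE_I2)
      fix \<xi> :: R3
      have "\<bar>(q (tr 2 1 (s n) \<xi>) - q \<xi>) / s n\<bar> \<le> C" using lip[of "s n" \<xi>] s0[of n] by (simp add: abs_mult field_simps)
      then show "cmod (complex_of_real ((q (tr 2 1 (s n) \<xi>) - q \<xi>) / s n) * rep_L2 ?h \<xi>) \<le> cmod (complex_of_real C * rep_L2 ?h \<xi>)"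
        unfolding norm_mult norm_of_real by (intro mult_right_mono) auto
    qed
    show "(\<lambda>\<xi>. complex_of_real ((q (tr 2 1 (s n) \<xi>) - q \<xi>) / s n) * rep_L2 ?h \<xi>) \<in> borel_measurable borel" for n
      using qm by measurable
    show "(\<lambda>\<xi>. complex_of_real (q' \<xi>) * rep_L2 ?h \<xi>) \<in> borel_measurable borel"
    proof -
      have [measurable]: "q' \<in> borel_measurable borel" using q'(1) by (simp add: bounded_weight_def)
      show ?thesis by measurable
    qed
  qed
  then have "(\<lambda>n. inner ?h (rmult (\<lambda>\<xi>. (q (tr 2 1 (s n) \<xi>) - q \<xi>) / s n) ?h)) \<longlonglongrightarrow> inner ?h (rmult q' ?h)"
    by (intro tendsto_intros)
  moreover have "inner ?h (rmult (\<lambda>\<xi>. (q (tr 2 1 (s n) \<xi>) - q \<xi>) / s n) ?h) = (inner (v n) (rmult q (v n)) - inner ?h (rmult q ?h)) / s n" for n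
  proof -
    have b: "bounded_weight (\<lambda>\<xi>. (q (tr 2 1 (s n) \<xi>) - q \<xi>) / s n)"
      unfolding bounded_weight_def
    proof
      show "(\<lambda>\<xi>. (q (tr 2 1 (s n) \<xi>) - q \<xi>) / s n) \<in> borel_measurable borel" using qm by measurable
      show "\<exists>B. \<forall>\<xi>. \<bar>(q (tr 2 1 (s n) \<xi>) - q \<xi>) / s n\<bar> \<le> B"
        using lip[of "s n"] s0[of n] by (intro exI[of _ C]) (simp add: field_simps)
    qed
    show ?thesis
      unfolding move unfolding inner_rmult(1)[OF b] inner_rmult(1)[OF qs] inner_rmult(1)[OF q]
      by (subst Bochner_Integration.integral_diff[symmetric, OF inner_rmult(2)[OF qs] inner_rmult(2)[OF q]])
         (simp add: left_diff_distrib[symmetric] flip: integral_divide_zero)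
  qed
  ultimately have "(\<lambda>n. (inner (v n) (rmult q (v n)) - inner ?h (rmult q ?h)) / s n) \<longlonglongrightarrow> inner ?h (rmult q' ?h)" by simp
  from LIMSEQ_unique[OF lim1 this] show ?thesis by simp
qed


subsection \<open>The Laplacian\<close>

lemma ft_translate:
  assumes "\<phi> \<in> borel_measurable borel"
  shows "ft (\<lambda>x. \<phi> (x + a)) \<xi> = cis (\<xi> \<bullet> a) * ft \<phi> \<xi>"
proof -
  have m: "(\<lambda>x. cis (- (\<xi> \<bullet> x)) * \<phi> x) \<in> borel_measurable borel" using assms by measurable
  have "ft \<phi> \<xi> = (\<integral>x. cis (- (\<xi> \<bullet> (a + x))) * \<phi> (a + x) \<partial>lborel)"
    unfolding ft_def using integral_lborel_affine[OF m, of 1 a] by simp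
  also have "\<dots> = (\<integral>x. cis (- (\<xi> \<bullet> a)) * (cis (- (\<xi> \<bullet> x)) * \<phi> (x + a)) \<partial>lborel)"
  proof (intro Bochner_Integration.integral_cong refl)
    fix x
    have "cis (- (\<xi> \<bullet> (a + x))) = cis (- (\<xi> \<bullet> a)) * cis (- (\<xi> \<bullet> x))" by (simp add: cis_mult inner_add_right)
    then show "cis (- (\<xi> \<bullet> (a + x))) * \<phi> (a + x) = cis (- (\<xi> \<bullet> a)) * (cis (- (\<xi> \<bullet> x)) * \<phi> (x + a))"
      by (simp add: add.commute)
  qed
  also have "\<dots> = cis (- (\<xi> \<bullet> a)) * ft (\<lambda>x. \<phi> (x + a)) \<xi>" by (simp add: ft_def)
  finally show ?thesis by (simp add: mult.assoc[symmetric] cis_mult)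
qed

lemma ft_pd:
  assumes \<phi>: "\<phi> \<in> test_functions"
  shows "ft (pd i \<phi>) \<xi> = \<i> * of_real (\<xi> $ i) * ft \<phi> \<xi>"
proof -
  let ?e = "axis i 1 :: R3"
  let ?q = "\<lambda>s x. (\<phi> (x + s *\<^sub>R ?e) - \<phi> x) / of_real s"
  define s where "s n = 1 / real (Suc (Suc n))" for n
  have s0: "s n > 0" "\<bar>s n\<bar> \<le> 1/2" for n by (auto simp: s_def field_simps)
  have "(\<lambda>n. 1 / real (Suc n)) \<longlonglongrightarrow> 0" using LIMSEQ_inverse_real_of_nat by (simp add: inverse_eq_divide)
  then have s: "s \<longlonglongrightarrow> 0" unfolding s_def by (rule LIMSEQ_Suc)
  have sat: "filterlim s (at 0) sequentially"
    using s s0 by (auto simp: filterlim_at less_imp_neq[symmetric])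
  have w: "norm ?e \<le> 1 + norm x" for x :: R3 by (simp add: norm_axis_1)
  note dq = difference_quotient_test[OF \<phi>, of "\<lambda>_. ?e", OF w]
  obtain B R where BR: "\<And>s x. \<bar>s\<bar> \<le> 1/2 \<Longrightarrow> cmod (?q s x) \<le> B * indicator (cball 0 R) x" using dq(1) by blast
  have [measurable]: "\<phi> \<in> borel_measurable borel" by (rule test_functions_measurable[OF \<phi>])
  have [measurable]: "pd i \<phi> \<in> borel_measurable borel" by (rule test_functions_measurable[OF test_functions_pd[OF \<phi>]])
  have tI: "integrable lborel (\<lambda>x. \<phi> (x + a))" for a
    using test_functions_affine[OF \<phi>, of "\<lambda>x. x" "\<lambda>x. x" a] by (auto intro: test_functions_integrable simp: bounded_linear_ident)
  have "ft (?q t) \<xi> = (cis (t * \<xi> $ i) - 1) / of_real t * ft \<phi> \<xi>" for t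
  proof -
    have "ft (?q t) \<xi> = inverse (of_real t) * ft (\<lambda>x. \<phi> (x + t *\<^sub>R ?e) - \<phi> x) \<xi>"
      by (subst ft_cmult[symmetric]) (simp add: divide_inverse mult.commute)
    also have "\<dots> = inverse (of_real t) * (cis (t * \<xi> $ i) * ft \<phi> \<xi> - ft \<phi> \<xi>)"
      using tI[of 0] by (simp add: ft_diff tI ft_translate inner_axis)
    finally show ?thesis by (simp add: divide_inverse algebra_simps)
  qed
  moreover have "(\<lambda>n. (cis (s n * \<xi> $ i) - 1) / of_real (s n) * ft \<phi> \<xi>) \<longlonglongrightarrow> \<i> * of_real (\<xi> $ i) * ft \<phi> \<xi>"
  proof -
    have "((\<lambda>t. exp (t *\<^sub>R (\<i> * of_real (\<xi> $ i)))) has_vector_derivative \<i> * of_real (\<xi> $ i)) (at 0)"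
      using exp_scaleR_has_vector_derivative_right[of "\<i> * of_real (\<xi> $ i)" 0 UNIV] by simp
    then have "((\<lambda>t. (cis (t * \<xi> $ i) - 1) / of_real t) \<longlongrightarrow> \<i> * of_real (\<xi> $ i)) (at 0)"
      unfolding has_vector_derivative_at_quotient
      by (simp add: cis_conv_exp scaleR_conv_of_real divide_inverse mult_ac)
    from filterlim_compose[OF this sat] show ?thesis by (intro tendsto_mult tendsto_const)
  qed
  moreover have "(\<lambda>n. ft (?q (s n)) \<xi>) \<longlonglongrightarrow> ft (pd i \<phi>) \<xi>"
    unfolding ft_def
  proof (rule integral_dominated_convergence[where w = "\<lambda>x. B * indicator (cball 0 R) x"])
    show "AE x in lborel. (\<lambda>n. cis (- (\<xi> \<bullet> x)) * ?q (s n) x) \<longlonglongrightarrow> cis (- (\<xi> \<bullet> x)) * pd i \<phi> x"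
      unfolding pd_def by (intro AE_I2 tendsto_mult tendsto_const filterlim_compose[OF dq(2) sat])
    show "AE x in lborel. norm (cis (- (\<xi> \<bullet> x)) * ?q (s n) x) \<le> B * indicator (cball 0 R) x" for n
      unfolding norm_mult norm_cis mult_1 by (intro AE_I2 BR s0)
    have "emeasure lborel (cball 0 R :: R3 set) < \<infinity>" by (intro emeasure_bounded_finite) auto
    then show "integrable lborel (\<lambda>x::R3. B * indicator (cball 0 R) x)"
      by (intro integrable_mult_right integrable_real_indicator) auto
  qed measurable
  ultimately show ?thesis using LIMSEQ_unique by force
qed

definition lap :: "(R3 \<Rightarrow> complex) \<Rightarrow> R3 \<Rightarrow> complex" where
  "lap \<phi> x = (\<Sum>i\<in>UNIV. pd i (pd i \<phi>) x)"

lemma test_functions_sum: "finite A \<Longrightarrow> (\<And>i. i \<in> A \<Longrightarrow> \<phi> i \<in> test_functions) \<Longrightarrow> (\<lambda>x. \<Sum>i\<in>A. \<phi> i x) \<in> test_functions"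
proof (induction A rule: finite_induct)
  case empty
  show ?case by (rule test_functionsI[of _ 0]) auto
qed (auto intro!: test_functions_add)

lemma lap_test: "\<phi> \<in> test_functions \<Longrightarrow> lap \<phi> \<in> test_functions"
  unfolding lap_def[abs_def] by (intro test_functions_sum test_functions_pd finite)

lemma ft_lap:
  assumes \<phi>: "\<phi> \<in> test_functions"
  shows "ft (lap \<phi>) \<xi> = - of_real ((norm \<xi>)\<^sup>2) * ft \<phi> \<xi>"
proof -
  have "ft (lap \<phi>) \<xi> = (\<Sum>i\<in>UNIV. ft (pd i (pd i \<phi>)) \<xi>)"
    unfolding ft_def lap_def sum_distrib_left
    by (intro Bochner_Integration.integral_sum integrable_cis_mult test_functions_integrable test_functions_pd \<phi>) simp
  also have "\<dots> = (\<Sum>i\<in>UNIV. - of_real ((\<xi> $ i)\<^sup>2) * ft \<phi> \<xi>)"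
    by (intro sum.cong refl) (simp add: ft_pd test_functions_pd \<phi> power2_eq_square mult_ac)
  also have "\<dots> = - of_real ((norm \<xi>)\<^sup>2) * ft \<phi> \<xi>"
    by (simp add: norm_sq_R3 sum_distrib_right sum_negf)
  finally show ?thesis .
qed

lemma represents_laplacian:
  "represents w (nu_laplacian \<nu> u) \<longleftrightarrow> (\<forall>\<phi>\<in>test_functions. inner w (abs_L2 \<phi>) = \<nu> * inner u (abs_L2 (lap \<phi>)))"
proof -
  let ?D = "\<lambda>\<phi> x. of_real \<nu> * lap \<phi> x"
  have Dt: "?D \<phi> \<in> test_functions" if "\<phi> \<in> test_functions" for \<phi>
    by (rule test_functions_mult[OF lap_test[OF that]]) simp
  have y: "nu_laplacian \<nu> u \<phi> = distr_of u (?D \<phi>)" if \<phi>: "\<phi> \<in> test_functions" for \<phi>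
  proof -
    have "distr_of u (?D \<phi>) = of_real \<nu> * (\<integral>x. (\<Sum>i\<in>UNIV. rep_L2 u x * pd i (pd i \<phi>) x) \<partial>lborel)"
      unfolding distr_of_def lap_def
      by (subst integral_mult_right_zero[symmetric], intro Bochner_Integration.integral_cong refl)
         (simp add: sum_distrib_left mult.left_commute)
    also have "\<dots> = of_real \<nu> * (\<Sum>i\<in>UNIV. distr_of u (pd i (pd i \<phi>)))"
      unfolding distr_of_def
      by (subst Bochner_Integration.integral_sum)
         (rule integrable_mult_L2[OF square_integrable_rep_L2 test_functions_integrable(2)[OF test_functions_pd[OF test_functions_pd[OF \<phi>]]]], simp)
    finally show ?thesis by (simp add: nu_laplacian_def distr_pd_def)
  qed
  have lb: "lap (\<lambda>x. T (\<phi> x)) = (\<lambda>x. T (lap \<phi> x))" if "\<phi> \<in> test_functions" "bounded_linear T" for \<phi> T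
    unfolding lap_def[abs_def] using that
    by (simp add: pd_bounded_linear test_functions_pd linear_sum bounded_linear.linear)
  have "represents w (nu_laplacian \<nu> u) \<longleftrightarrow> represents w (\<lambda>\<phi>. distr_of u (?D \<phi>))"
    unfolding represents_def using y by simp
  also have "\<dots> \<longleftrightarrow> (\<forall>\<phi>\<in>test_functions. inner w (abs_L2 \<phi>) = inner u (abs_L2 (?D \<phi>)))"
  proof (rule represents_iff_inner[OF Dt])
    fix \<phi> assume \<phi>: "\<phi> \<in> test_functions"
    show "?D (\<lambda>x. cnj (\<phi> x)) = (\<lambda>x. cnj (?D \<phi> x))"
      by (simp add: lb[OF \<phi> bounded_linear_cnj])
    show "?D (\<lambda>x. \<i> * \<phi> x) = (\<lambda>x. \<i> * ?D \<phi> x)"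
      by (simp add: lb[OF \<phi> bounded_linear_mult_right] mult.left_commute)
  qed
  also have "\<dots> \<longleftrightarrow> (\<forall>\<phi>\<in>test_functions. inner w (abs_L2 \<phi>) = \<nu> * inner u (abs_L2 (lap \<phi>)))"
  proof -
    have "abs_L2 (?D \<phi>) = \<nu> *\<^sub>R abs_L2 (lap \<phi>)" if "\<phi> \<in> test_functions" for \<phi>
      using test_functions_integrable(2)[OF lap_test[OF that]] by (simp add: abs_L2_scaleC scaleR_scaleC_L2)
    then show ?thesis by simp
  qed
  finally show ?thesis .
qed

lemma fourier_test:
  assumes "\<phi> \<in> test_functions"
  shows "fourier (abs_L2 \<phi>) = abs_L2 (ft \<phi>)" "square_integrable (ft \<phi>)"
  using fourier_integrable[OF test_functions_integrable(2,1)[OF assms]] by auto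

lemma inner_via_fourier: "inner u v = inner (fourier u) (fourier v) / (2 * pi)^3"
  by (simp add: inner_fourier)

lemma represents_laplacianI:
  assumes w: "AE \<xi> in lborel. rep_L2 (fourier w) \<xi> = - of_real (\<nu> * (norm \<xi>)\<^sup>2) * rep_L2 (fourier u) \<xi>"
  shows "represents w (nu_laplacian \<nu> u)"
  unfolding represents_laplacian
proof
  fix \<phi> assume \<phi>: "\<phi> \<in> test_functions"
  note f = fourier_test[OF \<phi>] fourier_test[OF lap_test[OF \<phi>]]
  have "inner (fourier w) (abs_L2 (ft \<phi>)) = (\<integral>\<xi>. rep_L2 (fourier w) \<xi> \<bullet> ft \<phi> \<xi> \<partial>lborel)"
    using inner_abs_L2[OF square_integrable_rep_L2 f(2), of "fourier w"] by simp
  also have "\<dots> = (\<integral>\<xi>. \<nu> * (rep_L2 (fourier u) \<xi> \<bullet> ft (lap \<phi>) \<xi>) \<partial>lborel)"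
  proof (rule integral_cong_AE)
    show "AE \<xi> in lborel. rep_L2 (fourier w) \<xi> \<bullet> ft \<phi> \<xi> = \<nu> * (rep_L2 (fourier u) \<xi> \<bullet> ft (lap \<phi>) \<xi>)"
      using w by eventually_elim (simp add: ft_lap \<phi> inner_complex_def algebra_simps)
    have [measurable]: "ft \<phi> \<in> borel_measurable borel" "ft (lap \<phi>) \<in> borel_measurable borel"
      by (intro ft_measurable test_functions_measurable lap_test \<phi>)+
    show "(\<lambda>\<xi>. rep_L2 (fourier w) \<xi> \<bullet> ft \<phi> \<xi>) \<in> borel_measurable lborel"
      "(\<lambda>\<xi>. \<nu> * (rep_L2 (fourier u) \<xi> \<bullet> ft (lap \<phi>) \<xi>)) \<in> borel_measurable lborel" by measurable
  qed
  also have "\<dots> = \<nu> * inner (fourier u) (abs_L2 (ft (lap \<phi>)))"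
    using inner_abs_L2[OF square_integrable_rep_L2 f(4), of "fourier u"] by simp
  finally show "inner w (abs_L2 \<phi>) = \<nu> * inner u (abs_L2 (lap \<phi>))"
    by (simp add: inner_via_fourier[of _ "abs_L2 _"] f)
qed

text \<open>A positive bump supported where \<open>\<bar>\<xi> \<bullet> x\<bar> \<le> \<pi>/3\<close> has \<open>cos (\<xi> \<bullet> x) \<ge> 1/2\<close> on its support.\<close>

lemma ft_bump_nonzero: "\<exists>n. ft (\<lambda>x. complex_of_real (box_bump 1 (vec (- (1 / real (Suc n)))) (vec (1 / real (Suc n))) x)) \<xi> \<noteq> 0"
proof -
  obtain n :: nat where n: "3 * norm \<xi> < real n" using reals_Archimedean2 by blast
  let ?l = "vec (- (1 / real (Suc n))) :: R3" and ?r = "vec (1 / real (Suc n)) :: R3"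
  let ?b = "box_bump 1 ?l ?r"
  note t = box_bump_test[of 1 ?l ?r]
  have bi: "integrable lborel ?b"
    using test_functions_integrable(1)[OF t] by (simp add: complex_of_real_integrable_eq)
  have bm[measurable]: "?b \<in> borel_measurable borel" using bi by auto
  have c: "cos (\<xi> \<bullet> x) * ?b x \<ge> 1/2 * ?b x" for x
  proof (cases "x \<in> box ?l ?r")
    case True
    have "\<bar>x $ i\<bar> \<le> 1 / real (Suc n)" for i
    proof -
      have "- (1 / real (Suc n)) < x $ i \<and> x $ i < 1 / real (Suc n)"
        using True unfolding mem_box_cart vec_component by blast
      then show ?thesis by linarith
    qed
    then have "norm x \<le> (\<Sum>i\<in>(UNIV :: 3 set). 1 / real (Suc n))"
      by (intro order_trans[OF norm_le_l1_cart] sum_mono)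
    then have "norm x \<le> 3 / real (Suc n)" by simp
    then have "norm \<xi> * norm x \<le> norm \<xi> * (3 / real (Suc n))" by (intro mult_left_mono) auto
    also have "\<dots> \<le> 1" using n by (simp add: field_simps)
    finally have "\<bar>\<xi> \<bullet> x\<bar> \<le> 1" using Cauchy_Schwarz_ineq2[of \<xi> x] by linarith
    also have "1 \<le> pi / 3" using pi_gt3 by simp
    finally have "cos (\<bar>\<xi> \<bullet> x\<bar>) \<ge> cos (pi / 3)" by (intro cos_monotone_0_pi_le) auto
    then have "cos (\<xi> \<bullet> x) \<ge> 1 / 2" by (simp add: cos_60)
    then show ?thesis using box_bump_bounds by (intro mult_right_mono) auto
  qed (simp add: box_bump_zero)
  have ci: "integrable lborel (\<lambda>x. cos (\<xi> \<bullet> x) * ?b x)"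
  proof (rule Bochner_Integration.integrable_bound[OF bi])
    show "AE x in lborel. norm (cos (\<xi> \<bullet> x) * ?b x) \<le> norm (?b x)"
      by (intro AE_I2) (auto simp: abs_mult intro!: mult_left_le_one_le)
  qed measurable
  have "Re (ft (\<lambda>x. complex_of_real (?b x)) \<xi>) = (\<integral>x. cos (\<xi> \<bullet> x) * ?b x \<partial>lborel)"
    unfolding ft_def
    by (subst integral_Re[symmetric], rule integrable_cis_mult[OF test_functions_integrable(1)[OF t]]) auto
  also have "\<dots> \<ge> (\<integral>x. 1/2 * ?b x \<partial>lborel)"
    by (intro integral_mono ci integrable_mult_right bi c)
  finally have le: "1/2 * (\<integral>x. ?b x \<partial>lborel) \<le> Re (ft (\<lambda>x. complex_of_real (?b x)) \<xi>)" by simp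
  have "(\<integral>x. ?b x \<partial>lborel) \<noteq> 0"
  proof
    assume "(\<integral>x. ?b x \<partial>lborel) = 0"
    then have "AE x in lborel. ?b x = 0"
      using bi box_bump_bounds by (subst (asm) integral_nonneg_eq_0_iff_AE) auto
    then have "AE x in lborel. x \<notin> box ?l ?r"
      by eventually_elim (use box_bump_pos[of _ ?l ?r 1] in force)
    then have "emeasure lborel (box ?l ?r) = 0"
      by (subst (asm) AE_iff_measurable[of "box ?l ?r"]) auto
    moreover have "emeasure lborel (box ?l ?r) = ennreal (\<Prod>b\<in>Basis. (?r - ?l) \<bullet> b)"
      by (rule emeasure_lborel_box) (auto simp: Basis_vec_def inner_axis)
    moreover have "(\<Prod>b\<in>Basis. (?r - ?l) \<bullet> b) > 0"
      by (intro prod_pos) (auto simp: Basis_vec_def inner_axis)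
    ultimately show False by (metis ennreal_eq_0_iff not_le)
  qed
  moreover have "(\<integral>x. ?b x \<partial>lborel) \<ge> 0" by (intro integral_nonneg_AE) (simp add: box_bump_bounds)
  ultimately have "(\<integral>x. ?b x \<partial>lborel) > 0" by linarith
  with le show ?thesis by (intro exI[of _ n]) auto
qed

text \<open>Testing against all translates of one bump \<open>\<rho>\<close> shows that the integrable function
  \<open>(w\<^sup>^ + \<nu> \<bar>\<xi>\<bar>\<^sup>2 u\<^sup>^) (\<rho>\<^sup>^)\<^sup>*\<close> has vanishing Fourier transform. Bumps of shrinking support
  have transforms without a common zero.\<close>

lemma fourier_laplacian:
  assumes w: "represents w (nu_laplacian \<nu> u)"
  shows "AE \<xi> in lborel. rep_L2 (fourier w) \<xi> = - of_real (\<nu> * (norm \<xi>)\<^sup>2) * rep_L2 (fourier u) \<xi>"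
proof -
  let ?k = "rep_L2 (fourier w)" and ?h = "rep_L2 (fourier u)"
  have main: "AE \<xi> in lborel. (?k \<xi> + of_real (\<nu> * (norm \<xi>)\<^sup>2) * ?h \<xi>) * cnj (ft \<rho> \<xi>) = 0"
    if \<rho>: "\<rho> \<in> test_functions" for \<rho>
  proof -
    note lr = lap_test[OF \<rho>]
    note f = fourier_test[OF \<rho>] fourier_test[OF lr]
    let ?P = "\<lambda>\<xi>. ?k \<xi> * cnj (ft \<rho> \<xi>) - of_real \<nu> * (?h \<xi> * cnj (ft (lap \<rho>) \<xi>))"
    have bs: "bounded_symbol (\<lambda>\<xi>. cnj (ft \<psi> \<xi>))" if "\<psi> \<in> test_functions" for \<psi>
      using ft_bound[OF test_functions_integrable(1)[OF that]]
        borel_measurable_cnj[OF ft_measurable[OF test_functions_measurable[OF that]]]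
      by (auto simp: bounded_symbol_def)
    have Ps: "square_integrable ?P"
      using square_integrable_mult[OF bs[OF \<rho>] square_integrable_rep_L2[of "fourier w"]]
        square_integrable_mult[OF bs[OF lr] square_integrable_rep_L2[of "fourier u"]]
      by (intro square_integrable_diff square_integrable_cmult) (simp_all add: mult.commute)
    have i1: "integrable lborel (\<lambda>\<xi>. ?k \<xi> * cnj (ft \<rho> \<xi>))"
      by (intro integrable_mult_L2 square_integrable_rep_L2 square_integrable_cnj f)
    have i2: "integrable lborel (\<lambda>\<xi>. of_real \<nu> * (?h \<xi> * cnj (ft (lap \<rho>) \<xi>)))"
      by (intro integrable_mult_right integrable_mult_L2 square_integrable_rep_L2 square_integrable_cnj f)
    have Pi: "integrable lborel ?P" using i1 i2 by (rule Bochner_Integration.integrable_diff)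
    have zero: "Re (cnj c * ft ?P a) = 0" for a c
    proof -
      let ?\<phi> = "\<lambda>x. c * \<rho> (x + a)"
      have \<rho>a: "(\<lambda>x. \<rho> (x + a)) \<in> test_functions"
        using test_functions_affine[OF \<rho>, of "\<lambda>x. x" "\<lambda>x. x" a] by (simp add: bounded_linear_ident)
      have \<phi>: "?\<phi> \<in> test_functions" by (rule test_functions_mult[OF \<rho>a]) simp
      have ft: "ft ?\<phi> \<xi> = c * (cis (\<xi> \<bullet> a) * ft \<rho> \<xi>)" for \<xi>
        by (simp add: ft_cmult ft_translate test_functions_measurable \<rho>)
      have ftl: "ft (lap ?\<phi>) \<xi> = c * (cis (\<xi> \<bullet> a) * ft (lap \<rho>) \<xi>)" for \<xi>
        unfolding ft_lap[OF \<phi>] ft_lap[OF \<rho>] ft by (simp add: algebra_simps)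
      note g = fourier_test[OF \<phi>] fourier_test[OF lap_test[OF \<phi>]]
      have "inner (fourier w) (abs_L2 (ft ?\<phi>)) = \<nu> * inner (fourier u) (abs_L2 (ft (lap ?\<phi>)))"
        using w[unfolded represents_laplacian, rule_format, OF \<phi>]
        by (simp add: inner_via_fourier[of _ "abs_L2 _"] g)
      then have "(\<integral>\<xi>. ?k \<xi> \<bullet> ft ?\<phi> \<xi> \<partial>lborel) - \<nu> * (\<integral>\<xi>. ?h \<xi> \<bullet> ft (lap ?\<phi>) \<xi> \<partial>lborel) = 0"
        using inner_abs_L2[OF square_integrable_rep_L2 g(2), of "fourier w"]
          inner_abs_L2[OF square_integrable_rep_L2 g(4), of "fourier u"] by simp
      then have "0 = (\<integral>\<xi>. ?k \<xi> \<bullet> ft ?\<phi> \<xi> - \<nu> * (?h \<xi> \<bullet> ft (lap ?\<phi>) \<xi>) \<partial>lborel)"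
        by (subst Bochner_Integration.integral_diff)
           (auto intro!: square_integrable_inner square_integrable_rep_L2 g integrable_mult_right)
      also have "\<dots> = (\<integral>\<xi>. Re (cnj c * (cis (- (a \<bullet> \<xi>)) * ?P \<xi>)) \<partial>lborel)"
      proof (intro Bochner_Integration.integral_cong refl)
        fix \<xi> :: R3
        have ip: "x \<bullet> y = Re (x * cnj y)" for x y :: complex by (simp add: inner_complex_def)
        have "?k \<xi> \<bullet> ft ?\<phi> \<xi> - \<nu> * (?h \<xi> \<bullet> ft (lap ?\<phi>) \<xi>)
          = Re (?k \<xi> * cnj (ft ?\<phi> \<xi>) - of_real \<nu> * (?h \<xi> * cnj (ft (lap ?\<phi>) \<xi>)))" by (simp add: ip)
        also have "?k \<xi> * cnj (ft ?\<phi> \<xi>) - of_real \<nu> * (?h \<xi> * cnj (ft (lap ?\<phi>) \<xi>)) = cnj c * (cis (- (a \<bullet> \<xi>)) * ?P \<xi>)"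
          unfolding ft ftl by (simp add: cis_cnj inner_commute algebra_simps)
        finally show "?k \<xi> \<bullet> ft ?\<phi> \<xi> - \<nu> * (?h \<xi> \<bullet> ft (lap ?\<phi>) \<xi>) = Re (cnj c * (cis (- (a \<bullet> \<xi>)) * ?P \<xi>))" .
      qed
      also have "\<dots> = Re (\<integral>\<xi>. cnj c * (cis (- (a \<bullet> \<xi>)) * ?P \<xi>) \<partial>lborel)"
        by (rule integral_Re) (intro integrable_mult_right integrable_cis_mult Pi, simp)
      also have "(\<integral>\<xi>. cnj c * (cis (- (a \<bullet> \<xi>)) * ?P \<xi>) \<partial>lborel) = cnj c * ft ?P a"
        unfolding ft_def by simp
      finally show ?thesis by simp
    qed
    have "ft ?P a = 0" for a using zero[of 1 a] zero[of \<i> a] by (simp add: complex_eq_iff)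
    then have "ft ?P = (\<lambda>_. 0)" by (rule ext)
    then have "fourier (abs_L2 ?P) = 0"
      using fourier_integrable(2)[OF Ps Pi] by (simp only: zero_L2_abs)
    then have "abs_L2 ?P = abs_L2 (\<lambda>_. 0)"
      using fourier_inj[of "abs_L2 ?P" 0] linear_0[OF bounded_linear.linear[OF bounded_linear_fourier]] by (simp add: zero_L2_abs)
    then have "AE \<xi> in lborel. ?P \<xi> = 0" by (simp add: abs_L2_eq_iff Ps square_integrable_zero)
    then show ?thesis by eventually_elim (simp add: ft_lap \<rho> algebra_simps)
  qed
  have "AE \<xi> in lborel. \<forall>n. (?k \<xi> + of_real (\<nu> * (norm \<xi>)\<^sup>2) * ?h \<xi>) *
      cnj (ft (\<lambda>x. complex_of_real (box_bump 1 (vec (- (1 / real (Suc n)))) (vec (1 / real (Suc n))) x)) \<xi>) = 0"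
    unfolding AE_all_countable by (intro allI main box_bump_test)
  then show ?thesis
  proof eventually_elim
    case (elim \<xi>)
    then have "?k \<xi> + of_real (\<nu> * (norm \<xi>)\<^sup>2) * ?h \<xi> = 0" using ft_bump_nonzero[of \<xi>] by auto
    then show ?case by (simp add: eq_neg_iff_add_eq_0)
  qed
qed

section \<open>Strongly continuous semigroups\<close>

text \<open>Let \<open>g\<close> have length \<open>r\<close> and nearly attain \<open>\<parallel>A\<parallel>\<close>. As \<open>2 A g = A (x + g) - A (x - g)\<close>, one of the points
  \<open>x \<plusminus> g\<close> has an image at least as long as \<open>A g\<close>.\<close>

lemma blinfun_large_value_nearby:
  fixes A :: "'a::real_normed_vector \<Rightarrow>\<^sub>L 'b::real_normed_vector"
  assumes r: "r > 0"
  shows "\<exists>y. norm (y - x) \<le> r \<and> norm (A y) \<ge> 2/3 * r * norm A"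
proof (cases "norm A = 0")
  case False
  have "\<exists>h. norm (A h) > 2/3 * norm A * norm h"
  proof (rule ccontr)
    assume "\<nexists>h. norm (A h) > 2/3 * norm A * norm h"
    then have "norm A \<le> 2/3 * norm A" by (intro norm_blinfun_bound) (auto simp: not_less)
    then show False using False norm_ge_zero[of A] by linarith
  qed
  then obtain h where h: "norm (A h) > 2/3 * norm A * norm h" by blast
  then have h0: "h \<noteq> 0" by (metis blinfun.zero_right mult_zero_right norm_zero less_irrefl)
  define g where "g = (r / norm h) *\<^sub>R h"
  have g: "norm g = r" using h0 r by (simp add: g_def)
  have Ag: "norm (A g) \<ge> 2/3 * r * norm A"
    using h h0 r by (simp add: g_def blinfun.scaleR_right field_simps)
  have "2 * norm (A g) = norm (A (x + g) - A (x - g))"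
    by (simp add: blinfun.add_right blinfun.diff_right) (simp add: scaleR_2[symmetric])
  also have "\<dots> \<le> norm (A (x + g)) + norm (A (x - g))" by (rule norm_triangle_ineq4)
  finally have "norm (A (x + g)) \<ge> norm (A g) \<or> norm (A (x - g)) \<ge> norm (A g)" by linarith
  then show ?thesis
  proof
    assume "norm (A (x + g)) \<ge> norm (A g)"
    then show ?thesis using Ag g by (intro exI[of _ "x + g"]) auto
  next
    assume "norm (A (x - g)) \<ge> norm (A g)"
    then show ?thesis using Ag g by (intro exI[of _ "x - g"]) auto
  qed
qed (use r in \<open>intro exI[of _ x], auto\<close>)

text \<open>Sokal's gliding argument for the uniform boundedness principle: along a subsequence with
  norms at least \<open>4\<^sup>k\<close>, steps of length \<open>3\<^sup>-\<^sup>k\<close> converge to a point at which the operators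
  are unbounded.\<close>

lemma uniform_boundedness:
  fixes X :: "nat \<Rightarrow> 'a::banach \<Rightarrow>\<^sub>L 'b::real_normed_vector"
  assumes pw: "\<And>u. \<exists>C. \<forall>n. norm (X n u) \<le> C"
  shows "\<exists>C. \<forall>n. norm (X n) \<le> C"
proof (rule ccontr)
  assume "\<nexists>C. \<forall>n. norm (X n) \<le> C"
  then have "\<exists>n. norm (X n) \<ge> 4^k" for k :: nat by (metis linear)
  then obtain m where m: "\<And>k. norm (X (m k)) \<ge> 4^k" by metis
  have step: "\<exists>y. norm (y - x) \<le> (1/3)^k \<and> norm (X (m k) y) \<ge> 2/3 * (1/3)^k * norm (X (m k))" for x k
    by (rule blinfun_large_value_nearby) simp
  define x where "x = rec_nat (0::'a) (\<lambda>k x. SOME y. norm (y - x) \<le> (1/3)^k \<and> norm (X (m k) y) \<ge> 2/3 * (1/3)^k * norm (X (m k)))"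
  have xs: "norm (x (Suc k) - x k) \<le> (1/3)^k" "norm (X (m k) (x (Suc k))) \<ge> 2/3 * (1/3)^k * norm (X (m k))" for k
    using someI_ex[OF step[of "x k" k]] by (auto simp: x_def)
  have "summable (\<lambda>k. x (Suc k) - x k)"
    by (rule summable_comparison_test'[where g = "\<lambda>k. (1/3)^k" and N = 0]) (auto simp: xs intro!: summable_geometric)
  then have "convergent (\<lambda>n. \<Sum>k<n. x (Suc k) - x k)" by (simp add: summable_iff_convergent)
  then have "convergent (\<lambda>n. x n - x 0)" by (simp only: sum_lessThan_telescope)
  then obtain l where l: "x \<longlonglongrightarrow> l" by (auto simp: convergent_diff_const_right_iff convergent_def)
  have close: "norm (x (Suc k + n) - x (Suc k)) \<le> (1/2) * (1/3)^k" for k n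
  proof -
    have "norm (x (Suc k + n) - x (Suc k)) \<le> (1/2) * (1/3)^k - (1/2) * (1/3)^(k + n)"
    proof (induction n)
      case (Suc n)
      have "norm (x (Suc k + Suc n) - x (Suc k)) \<le> norm (x (Suc (Suc k + n)) - x (Suc k + n)) + norm (x (Suc k + n) - x (Suc k))"
        using norm_triangle_ineq[of "x (Suc (Suc k + n)) - x (Suc k + n)" "x (Suc k + n) - x (Suc k)"] by simp
      also have "\<dots> \<le> (1/3)^(Suc k + n) + ((1/2) * (1/3)^k - (1/2) * (1/3)^(k + n))"
        by (intro add_mono xs Suc.IH)
      also have "\<dots> = (1/2) * (1/3)^k - (1/2) * (1/3)^(k + Suc n)" by simp
      finally show ?case .
    qed simp
    also have "\<dots> \<le> (1/2) * (1/3)^k" by simp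
    finally show ?thesis .
  qed
  have lk: "norm (l - x (Suc k)) \<le> (1/2) * (1/3)^k" for k
  proof (rule LIMSEQ_le_const2)
    have "(\<lambda>n. x (Suc k + n)) \<longlonglongrightarrow> l" using LIMSEQ_ignore_initial_segment[OF l, of "Suc k"] by (simp add: add.commute)
    then show "(\<lambda>n. norm (x (Suc k + n) - x (Suc k))) \<longlonglongrightarrow> norm (l - x (Suc k))" by (intro tendsto_intros)
    show "\<exists>N. \<forall>n\<ge>N. norm (x (Suc k + n) - x (Suc k)) \<le> (1/2) * (1/3)^k" using close by blast
  qed
  obtain C where C: "\<And>n. norm (X n l) \<le> C" using pw[of l] by blast
  have bound: "1/6 * (4/3)^k \<le> C" for k :: nat
  proof -
    let ?A = "X (m k)"
    have "norm (?A (x (Suc k))) \<le> norm (?A l) + norm (?A (l - x (Suc k)))"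
      using norm_triangle_ineq4[of "?A l" "?A (l - x (Suc k))"] by (simp add: blinfun.diff_right)
    moreover have "norm (?A (l - x (Suc k))) \<le> norm ?A * ((1/2) * (1/3)^k)"
      by (rule order_trans[OF norm_blinfun mult_left_mono[OF lk]]) simp
    ultimately have "2/3 * (1/3)^k * norm ?A - norm ?A * ((1/2) * (1/3)^k) \<le> C"
      using xs(2)[of k] C[of "m k"] by linarith
    moreover have "2/3 * (1/3)^k * norm ?A - norm ?A * ((1/2) * (1/3)^k) = 1/6 * (1/3)^k * norm ?A" by (simp add: field_simps)
    moreover have "1/6 * (1/3)^k * norm ?A \<ge> 1/6 * (1/3)^k * (4::real)^k" using m by (intro mult_left_mono) auto
    moreover have "1/6 * (1/3)^k * (4::real)^k = 1/6 * (4/3)^k" by (simp add: power_divide)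
    ultimately show ?thesis by linarith
  qed
  obtain k where "(4/3::real)^k > 6 * C" using real_arch_pow[of "4/3" "6 * C"] by auto
  with bound[of k] show False by linarith
qed

lemma has_vector_derivative_quotient_right:
  assumes "(f has_vector_derivative D) (at b within {b..c})" "b < c"
  shows "((\<lambda>h. (f (b + h) - f b) /\<^sub>R h) \<longlongrightarrow> D) (at_right 0)"
proof -
  have "((\<lambda>y. norm (f y - f b - (y - b) *\<^sub>R D) / norm (y - b)) \<longlongrightarrow> 0) (at b within {b..c})"
    using assms(1) by (simp add: has_vector_derivative_def has_derivative_iff_norm)
  moreover have "filterlim (\<lambda>h. b + h) (at b within {b..c}) (at_right 0)"
    unfolding filterlim_at
  proof
    show "((\<lambda>h. b + h) \<longlongrightarrow> b) (at_right 0)" by (auto intro!: tendsto_eq_intros)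
    show "\<forall>\<^sub>F h in at_right 0. b + h \<in> {b..c} \<and> b + h \<noteq> b"
      unfolding eventually_at_right_field using assms(2) by (intro exI[of _ "c - b"]) auto
  qed
  ultimately have "((\<lambda>h. norm (f (b + h) - f b - (b + h - b) *\<^sub>R D) / norm (b + h - b)) \<longlongrightarrow> 0) (at_right 0)"
    by (rule filterlim_compose)
  then have "((\<lambda>h. norm ((f (b + h) - f b) /\<^sub>R h - D)) \<longlongrightarrow> 0) (at_right 0)"
  proof (rule Lim_transform_eventually)
    show "\<forall>\<^sub>F h in at_right 0. norm (f (b + h) - f b - (b + h - b) *\<^sub>R D) / norm (b + h - b) = norm ((f (b + h) - f b) /\<^sub>R h - D)"
      unfolding eventually_at_right_field
    proof (intro exI[of _ 1] conjI allI impI)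
      fix h :: real assume h: "0 < h"
      have "(f (b + h) - f b) /\<^sub>R h - D = (f (b + h) - f b - h *\<^sub>R D) /\<^sub>R h"
        using h by (simp add: scaleR_diff_right)
      then show "norm (f (b + h) - f b - (b + h - b) *\<^sub>R D) / norm (b + h - b) = norm ((f (b + h) - f b) /\<^sub>R h - D)"
        by (simp add: divide_inverse mult.commute)
    qed simp
  qed
  then show ?thesis by (simp add: tendsto_norm_zero_iff LIM_zero_iff)
qed

context
  fixes T :: "real \<Rightarrow> 'a::banach \<Rightarrow>\<^sub>L 'a"
  assumes T: "C0_semigroup T"
begin

lemma semigroup_0: "T 0 u = u"
  using T by (simp add: C0_semigroup_def)

lemma semigroup_add: "0 \<le> s \<Longrightarrow> 0 \<le> t \<Longrightarrow> T (s + t) u = T s (T t u)"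
  using T by (simp add: C0_semigroup_def)

lemma semigroup_right: "((\<lambda>t. T t u) \<longlongrightarrow> u) (at_right 0)"
  using T by (simp add: C0_semigroup_def)

text \<open>Otherwise the norms would blow up along some times \<open>t\<^sub>n \<rightarrow> 0\<close>, although every orbit converges
  along these times.\<close>

lemma semigroup_bounded_near_0: "\<exists>M \<delta>. 1 \<le> M \<and> \<delta> > 0 \<and> (\<forall>t. 0 \<le> t \<and> t \<le> \<delta> \<longrightarrow> norm (T t) \<le> M)"
proof (rule ccontr)
  assume neg: "\<not> ?thesis"
  have "\<exists>t. 0 \<le> t \<and> t \<le> 1 / real (Suc n) \<and> norm (T t) > real (Suc n)" for n
  proof (rule ccontr)
    assume "\<nexists>t. 0 \<le> t \<and> t \<le> 1 / real (Suc n) \<and> norm (T t) > real (Suc n)"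
    then have "\<forall>t. 0 \<le> t \<and> t \<le> 1 / real (Suc n) \<longrightarrow> norm (T t) \<le> real (Suc n)" using not_less by blast
    moreover have "1 \<le> real (Suc n)" "1 / real (Suc n) > 0" by auto
    ultimately show False using neg by blast
  qed
  then obtain t where t: "\<And>n. 0 \<le> t n" "\<And>n. t n \<le> 1 / real (Suc n)" "\<And>n. norm (T (t n)) > real (Suc n)" by metis
  have t0: "t \<longlonglongrightarrow> 0"
  proof (rule tendsto_sandwich[of "\<lambda>_. 0" _ _ "\<lambda>n. 1 / real (Suc n)"])
    show "(\<lambda>n. 1 / real (Suc n)) \<longlonglongrightarrow> 0" using LIMSEQ_inverse_real_of_nat by (simp add: inverse_eq_divide)
  qed (use t in auto)
  have "\<exists>C. \<forall>n. norm (T (t n) u) \<le> C" for u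
  proof -
    have "(\<lambda>n. T (t n) u) \<longlonglongrightarrow> u"
    proof (rule tendstoI)
      fix e :: real assume e: "e > 0"
      have "\<forall>\<^sub>F s in at_right 0. dist (T s u) u < e" using tendstoD[OF semigroup_right e] .
      then obtain b where b: "b > 0" "\<And>s. 0 < s \<Longrightarrow> s < b \<Longrightarrow> dist (T s u) u < e"
        unfolding eventually_at_right_field by auto
      have "\<forall>\<^sub>F n in sequentially. t n < b" using order_tendstoD(2)[OF t0 b(1)] .
      then show "\<forall>\<^sub>F n in sequentially. dist (T (t n) u) u < e"
      proof eventually_elim
        case (elim n)
        then show ?case using b(2)[of "t n"] t(1)[of n] e by (cases "t n = 0") (auto simp: semigroup_0)
      qed
    qed
    then have "Bseq (\<lambda>n. T (t n) u)" by (intro convergent_imp_Bseq) (auto simp: convergent_def)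
    then show ?thesis by (auto simp: Bseq_def)
  qed
  from uniform_boundedness[of "\<lambda>n. T (t n)", OF this] obtain C where "\<And>n. norm (T (t n)) \<le> C" by blast
  moreover obtain n :: nat where "C < real n" using reals_Archimedean2 by blast
  ultimately show False using t(3)[of n] by (smt (verit) of_nat_Suc)
qed

lemma semigroup_bounded: "\<exists>M\<ge>1. \<forall>t. 0 \<le> t \<and> t \<le> b \<longrightarrow> norm (T t) \<le> M"
proof -
  obtain M \<delta> where M: "1 \<le> M" "\<delta> > 0" "\<And>t. 0 \<le> t \<Longrightarrow> t \<le> \<delta> \<Longrightarrow> norm (T t) \<le> M"
    using semigroup_bounded_near_0 by blast
  have *: "norm (T t) \<le> M ^ Suc n" if "0 \<le> t" "t \<le> real (Suc n) * \<delta>" for t n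
    using that
  proof (induction n arbitrary: t)
    case 0
    then show ?case using M by simp
  next
    case (Suc n)
    show ?case
    proof (cases "t \<le> \<delta>")
      case True
      then have "norm (T t) \<le> M * 1" using M Suc.prems by simp
      also have "\<dots> \<le> M * M ^ Suc n" using M(1) by (intro mult_left_mono one_le_power) auto
      finally show ?thesis by simp
    next
      case False
      have "\<And>s t. 0 \<le> s \<Longrightarrow> 0 \<le> t \<Longrightarrow> T (s + t) = T s o\<^sub>L T t" using T by (simp add: C0_semigroup_def)
      from this[of \<delta> "t - \<delta>"] have "T t = T \<delta> o\<^sub>L T (t - \<delta>)" using M(2) False by simp
      then have "norm (T t) \<le> norm (T \<delta>) * norm (T (t - \<delta>))" by (simp add: norm_blinfun_compose)
      also have "\<dots> \<le> M * M ^ Suc n" using M Suc False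
        by (intro mult_mono Suc.IH) (auto simp: algebra_simps)
      finally show ?thesis by simp
    qed
  qed
  obtain n :: nat where n: "b / \<delta> < real n" using reals_Archimedean2 by blast
  then have "b \<le> real (Suc n) * \<delta>" using M(2) by (simp add: field_simps)
  then show ?thesis using * M(1) by (intro exI[of _ "M ^ Suc n"]) (auto intro!: one_le_power simp del: power_Suc)
qed

lemma semigroup_continuous: "continuous_on {0..} (\<lambda>t. T t u)"
proof -
  have "continuous_on {0..b} (\<lambda>t. T t u)" for b
  proof -
    obtain M where M: "1 \<le> M" "\<And>t. 0 \<le> t \<Longrightarrow> t \<le> b \<Longrightarrow> norm (T t) \<le> M" using semigroup_bounded by blast
    have le: "norm (T t u - T s u) \<le> M * norm (T (t - s) u - u)" if "0 \<le> s" "s \<le> t" "t \<le> b" for s t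
    proof -
      have "T t u - T s u = T s (T (t - s) u - u)"
        using semigroup_add[of s "t - s" u] that by (simp add: blinfun.diff_right)
      then have "norm (T t u - T s u) \<le> norm (T s) * norm (T (t - s) u - u)" by (simp add: norm_blinfun)
      also have "\<dots> \<le> M * norm (T (t - s) u - u)" using M that by (intro mult_right_mono) auto
      finally show ?thesis .
    qed
    show ?thesis unfolding continuous_on_iff
    proof (intro ballI allI impI)
      fix x e assume x: "x \<in> {0..b}" and e: "(e::real) > 0"
      have "e / M > 0" using e M by simp
      from tendstoD[OF semigroup_right[of u] this]
      obtain d where d: "d > 0" "\<And>s. 0 < s \<Longrightarrow> s < d \<Longrightarrow> dist (T s u) u < e / M"
        unfolding eventually_at_right_field by auto
      have small: "M * norm (T s u - u) < e" if "0 \<le> s" "s < d" for s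
        using d(2)[of s] that M(1) e by (cases "s = 0") (auto simp: semigroup_0 dist_norm field_simps)
      show "\<exists>d>0. \<forall>x'\<in>{0..b}. dist x' x < d \<longrightarrow> dist (T x' u) (T x u) < e"
      proof (intro exI[of _ d] conjI d ballI impI)
        fix x' assume x': "x' \<in> {0..b}" "dist x' x < d"
        show "dist (T x' u) (T x u) < e"
        proof (cases "x \<le> x'")
          case True
          then show ?thesis using le[of x x'] small[of "x' - x"] x x' by (auto simp: dist_norm)
        next
          case False
          then show ?thesis using le[of x' x] small[of "x - x'"] x x' by (auto simp: dist_norm norm_minus_commute)
        qed
      qed
    qed
  qed
  then have c: "continuous_on {0..} (\<lambda>t. T t u) " 
  proof -
    assume c: "\<And>b. continuous_on {0..b} (\<lambda>t. T t u)"
    show ?thesis unfolding continuous_on_eq_continuous_within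
    proof
      fix x :: real assume x: "x \<in> {0..}"
      have "continuous (at x within {0..x+1}) (\<lambda>t. T t u)" using c[of "x+1"] x by (simp add: continuous_on_eq_continuous_within)
      moreover have "at x within {0..x+1} = at x within {0..}"
        by (rule at_within_nhd[of _ "{..<x+1}"]) (use x in auto)
      ultimately show "continuous (at x within {0..}) (\<lambda>t. T t u)" by simp
    qed
  qed
  then show ?thesis .
qed

lemma generator_invariant:
  assumes uv: "(u, v) \<in> generator_graph T" and t: "t \<ge> 0"
  shows "(T t u, T t v) \<in> generator_graph T"
proof -
  have "((\<lambda>h. T t ((T h u - u) /\<^sub>R h)) \<longlongrightarrow> T t v) (at_right 0)"
    using uv by (intro tendsto_intros) (simp add: generator_graph_def)
  then have "((\<lambda>h. (T h (T t u) - T t u) /\<^sub>R h) \<longlongrightarrow> T t v) (at_right 0)"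
  proof (rule Lim_transform_eventually)
    show "\<forall>\<^sub>F h in at_right 0. T t ((T h u - u) /\<^sub>R h) = (T h (T t u) - T t u) /\<^sub>R h"
      unfolding eventually_at_right_field
    proof (intro exI[of _ 1] conjI allI impI)
      fix h :: real assume "0 < h"
      then have "T h (T t u) = T t (T h u)" using semigroup_add[of h t u] semigroup_add[of t h u] t by (simp add: add.commute)
      then show "T t ((T h u - u) /\<^sub>R h) = (T h (T t u) - T t u) /\<^sub>R h"
        by (simp add: blinfun.scaleR_right blinfun.diff_right)
    qed simp
  qed
  then show ?thesis by (simp add: generator_graph_def)
qed

text \<open>The left difference quotient at \<open>t\<close> is \<open>T (t - h)\<close> applied to the quotient at \<open>0\<close>; it converges
  because the operators \<open>T (t - h)\<close> are bounded uniformly in \<open>h\<close>.\<close>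

lemma semigroup_has_vector_derivative:
  assumes uv: "(u, v) \<in> generator_graph T" and t: "t > 0"
  shows "((\<lambda>t. T t u) has_vector_derivative T t v) (at t)"
  unfolding has_vector_derivative_at_quotient
proof (rule filterlim_split_at)
  let ?q = "\<lambda>h. (T h u - u) /\<^sub>R h"
  have q: "(?q \<longlongrightarrow> v) (at_right 0)" using uv by (simp add: generator_graph_def)
  have "((\<lambda>h. T t (?q h)) \<longlongrightarrow> T t v) (at_right 0)" by (intro tendsto_intros q)
  then show "((\<lambda>h. (T (t + h) u - T t u) /\<^sub>R h) \<longlongrightarrow> T t v) (at_right 0)"
  proof (rule Lim_transform_eventually)
    show "\<forall>\<^sub>F h in at_right 0. T t (?q h) = (T (t + h) u - T t u) /\<^sub>R h"
      unfolding eventually_at_right_field using t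
      by (intro exI[of _ 1] conjI allI impI) (auto simp: semigroup_add blinfun.scaleR_right blinfun.diff_right)
  qed
  obtain M where M: "1 \<le> M" "\<And>s. 0 \<le> s \<Longrightarrow> s \<le> t \<Longrightarrow> norm (T s) \<le> M" using semigroup_bounded by blast
  have ev: "\<forall>\<^sub>F h in at_right 0. 0 < h \<and> h < t" unfolding eventually_at_right_field using t by blast
  have "((\<lambda>h. T (t - h) (?q h - v)) \<longlongrightarrow> 0) (at_right 0)"
  proof (rule Lim_null_comparison)
    show "\<forall>\<^sub>F h in at_right 0. norm (T (t - h) (?q h - v)) \<le> M * norm (?q h - v)"
      using ev by eventually_elim (rule order_trans[OF norm_blinfun mult_right_mono], auto intro!: M)
    have "((\<lambda>h. M * norm (?q h - v)) \<longlongrightarrow> M * norm (v - v)) (at_right 0)" by (intro tendsto_intros q)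
    then show "((\<lambda>h. M * norm (?q h - v)) \<longlongrightarrow> 0) (at_right 0)" by simp
  qed
  moreover have "((\<lambda>h. T (t - h) v) \<longlongrightarrow> T t v) (at_right 0)"
  proof -
    have "isCont (\<lambda>s. T s v) t"
      using semigroup_continuous[of v] t by (intro continuous_on_interior[of "{0..}"]) (auto simp: interior_real_atLeast)
    moreover have "((\<lambda>h. t - h) \<longlongrightarrow> t) (at_right 0)" by (auto intro!: tendsto_eq_intros)
    ultimately show ?thesis by (rule isCont_tendsto_compose)
  qed
  ultimately have "((\<lambda>h. T (t - h) (?q h - v) + T (t - h) v) \<longlongrightarrow> 0 + T t v) (at_right 0)" by (rule tendsto_add)
  then have "((\<lambda>h. T (t - h) (?q h)) \<longlongrightarrow> T t v) (at_right 0)" by (simp add: blinfun.diff_right)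
  then have "((\<lambda>h. (T (t + - h) u - T t u) /\<^sub>R (- h)) \<longlongrightarrow> T t v) (at_right 0)"
  proof (rule Lim_transform_eventually)
    show "\<forall>\<^sub>F h in at_right 0. T (t - h) (?q h) = (T (t + - h) u - T t u) /\<^sub>R (- h)"
      using ev
    proof eventually_elim
      case (elim h)
      then have "T t u = T (t - h) (T h u)" using semigroup_add[of "t - h" h u] by simp
      then show ?case by (simp add: blinfun.scaleR_right blinfun.diff_right algebra_simps)
    qed
  qed
  then show "((\<lambda>h. (T (t + h) u - T t u) /\<^sub>R h) \<longlongrightarrow> T t v) (at_left 0)"
    by (subst at_left_minus) (simp add: filterlim_filtermap)
qed

subsection \<open>Time averages\<close>

lemma semigroup_integrable: "(\<lambda>t. T t u) integrable_on {0..b}"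
  by (intro integrable_continuous_interval continuous_on_subset[OF semigroup_continuous]) auto

lemma semigroup_integral_increment:
  assumes b: "0 \<le> b"
  shows "((\<lambda>h. (integral {0..b + h} (\<lambda>t. T t u) - integral {0..b} (\<lambda>t. T t u)) /\<^sub>R h) \<longlongrightarrow> T b u) (at_right 0)"
proof -
  let ?J = "\<lambda>b. integral {0..b} (\<lambda>t. T t u)"
  have "(?J has_vector_derivative T b u) (at b within {0..b+1})"
    using b by (intro integral_has_vector_derivative continuous_on_subset[OF semigroup_continuous]) auto
  then have "(?J has_vector_derivative T b u) (at b within {b..b+1})"
    by (rule has_vector_derivative_within_subset) (use b in auto)
  then show ?thesis by (rule has_vector_derivative_quotient_right) simp
qed


lemma semigroup_integral_shift:
  assumes "0 \<le> b" "0 \<le> h"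
  shows "T h (integral {0..b} (\<lambda>t. T t u)) = integral {0..b + h} (\<lambda>t. T t u) - integral {0..h} (\<lambda>t. T t u)"
proof -
  have "T h (integral {0..b} (\<lambda>t. T t u)) = integral {0..b} (T h \<circ> (\<lambda>t. T t u))"
    by (rule integral_linear[OF semigroup_integrable blinfun.bounded_linear_right, symmetric])
  also have "\<dots> = integral {0..b} ((\<lambda>t. T t u) \<circ> (+) h)"
    by (rule integral_spike[of "{}"]) (use assms in \<open>auto simp: semigroup_add\<close>)
  also have "\<dots> = integral {h..b + h} (\<lambda>t. T t u)"
    using integral_shift_Icc_real[of 0 b "\<lambda>t. T t u" h] by simp
  also have "\<dots> = integral {0..b + h} (\<lambda>t. T t u) - integral {0..h} (\<lambda>t. T t u)"
    using Henstock_Kurzweil_Integration.integral_combine[OF assms(2) _ semigroup_integrable, of "b + h" u] assms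
    by (simp add: algebra_simps)
  finally show ?thesis .
qed

lemma semigroup_average_tendsto: "((\<lambda>h. integral {0..h} (\<lambda>t. T t u) /\<^sub>R h) \<longlongrightarrow> u) (at_right 0)"
  using semigroup_integral_increment[of 0 u] by (simp add: semigroup_0)

lemma semigroup_integral_in_graph:
  assumes b: "0 \<le> b"
  shows "(integral {0..b} (\<lambda>t. T t u), T b u - u) \<in> generator_graph T"
proof -
  let ?J = "\<lambda>b. integral {0..b} (\<lambda>t. T t u)"
  have "((\<lambda>h. (?J (b + h) - ?J b) /\<^sub>R h - ?J h /\<^sub>R h) \<longlongrightarrow> T b u - u) (at_right 0)"
    by (intro tendsto_diff semigroup_integral_increment[OF b] semigroup_average_tendsto)
  then have "((\<lambda>h. (T h (?J b) - ?J b) /\<^sub>R h) \<longlongrightarrow> T b u - u) (at_right 0)"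
  proof (rule Lim_transform_eventually)
    show "\<forall>\<^sub>F h in at_right 0. (?J (b + h) - ?J b) /\<^sub>R h - ?J h /\<^sub>R h = (T h (?J b) - ?J b) /\<^sub>R h"
      unfolding eventually_at_right_field using b
      by (intro exI[of _ 1] conjI allI impI) (auto simp: semigroup_integral_shift algebra_simps)
  qed
  then show ?thesis by (simp add: generator_graph_def)
qed

lemma generator_graph_diff: "(u, v) \<in> generator_graph T \<Longrightarrow> (u', v') \<in> generator_graph T \<Longrightarrow> (u - u', v - v') \<in> generator_graph T"
proof -
  assume "(u, v) \<in> generator_graph T" "(u', v') \<in> generator_graph T"
  then have "((\<lambda>h. (T h u - u) /\<^sub>R h - (T h u' - u') /\<^sub>R h) \<longlongrightarrow> v - v') (at_right 0)"
    by (intro tendsto_diff) (auto simp: generator_graph_def)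
  then show ?thesis by (simp add: generator_graph_def blinfun.diff_right algebra_simps)
qed

lemma generator_graph_scaleR: "(u, v) \<in> generator_graph T \<Longrightarrow> (r *\<^sub>R u, r *\<^sub>R v) \<in> generator_graph T"
proof -
  assume "(u, v) \<in> generator_graph T"
  then have "((\<lambda>h. r *\<^sub>R ((T h u - u) /\<^sub>R h)) \<longlongrightarrow> r *\<^sub>R v) (at_right 0)"
    by (intro tendsto_scaleR tendsto_const) (auto simp: generator_graph_def)
  then show ?thesis by (simp add: generator_graph_def blinfun.scaleR_right scaleR_diff_right mult.commute)
qed

lemma generator_dense: "closure (fst ` generator_graph T) = UNIV"
proof -
  have "u \<in> closure (fst ` generator_graph T)" for u
  proof -
    let ?J = "\<lambda>b. integral {0..b} (\<lambda>t. T t u)"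
    have "filterlim (\<lambda>n. 1 / real (Suc n)) (at_right 0) sequentially"
      using LIMSEQ_inverse_real_of_nat by (simp add: filterlim_at inverse_eq_divide)
    from filterlim_compose[OF semigroup_average_tendsto this]
    have "(\<lambda>n. ?J (1 / real (Suc n)) /\<^sub>R (1 / real (Suc n))) \<longlonglongrightarrow> u" .
    moreover have "?J (1 / real (Suc n)) /\<^sub>R (1 / real (Suc n)) \<in> fst ` generator_graph T" for n
      using generator_graph_scaleR[OF semigroup_integral_in_graph[of "1 / real (Suc n)" u]] by (force intro: rev_image_eqI)
    ultimately show ?thesis unfolding closure_sequential
      by (intro exI[of _ "\<lambda>n. ?J (1 / real (Suc n)) /\<^sub>R (1 / real (Suc n))"]) blast
  qed
  then show ?thesis by blast
qed

text \<open>The preimage under the generator is the integral of the orbit over all times.\<close>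

lemma generator_onto_of_decay:
  assumes K: "\<And>t. t \<ge> 0 \<Longrightarrow> norm (T t) \<le> K * exp (- a * t)" and a: "a > 0"
  shows "\<exists>u. (u, - v) \<in> generator_graph T"
proof -
  let ?J = "\<lambda>b. integral {0..b} (\<lambda>t. T t v)"
  have Tn: "norm (T (real n) w) \<le> K * norm w * exp (- a) ^ n" for n w
  proof -
    have "norm (T (real n) w) \<le> norm (T (real n)) * norm w" by (rule norm_blinfun)
    also have "\<dots> \<le> K * exp (- a * real n) * norm w" by (intro mult_right_mono K) auto
    finally show ?thesis by (simp add: exp_of_nat_mult[symmetric] mult_ac)
  qed
  have ea: "norm (exp (- a)) < 1" using a by simp
  have step: "?J (real (Suc n)) - ?J (real n) = T (real n) (?J 1)" for n
    using semigroup_integral_shift[of 1 "real n" v] by (simp add: add.commute)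
  have "summable (\<lambda>n. ?J (real (Suc n)) - ?J (real n))"
    unfolding step
    by (rule summable_comparison_test'[where g = "\<lambda>n. K * norm (?J 1) * exp (- a) ^ n" and N = 0])
       (auto intro!: summable_mult summable_geometric Tn simp: a)
  then have "convergent (\<lambda>n. \<Sum>k<n. ?J (real (Suc k)) - ?J (real k))" by (simp add: summable_iff_convergent)
  then have "convergent (\<lambda>n. ?J (real n) - ?J (real 0))"
    by (subst (asm) sum_lessThan_telescope[where f = "\<lambda>n. ?J (real n)"])
  then obtain u where u: "(\<lambda>n. ?J (real n)) \<longlonglongrightarrow> u" by (auto simp: convergent_def)
  have eq: "T h u - u = - ?J h" if h: "h \<ge> 0" for h
  proof (rule LIMSEQ_unique)
    show "(\<lambda>n. T h (?J (real n)) - ?J (real n)) \<longlonglongrightarrow> T h u - u" by (intro tendsto_intros u)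
    have "(\<lambda>n. K * norm (?J h) * exp (- a) ^ n) \<longlonglongrightarrow> 0"
      by (intro tendsto_mult_right_zero LIMSEQ_power_zero ea)
    then have "(\<lambda>n. T (real n) (?J h)) \<longlonglongrightarrow> 0"
      by (rule Lim_null_comparison[rotated]) (intro always_eventually allI Tn)
    then have "(\<lambda>n. T (real n) (?J h) - ?J h) \<longlonglongrightarrow> 0 - ?J h" by (intro tendsto_intros)
    moreover have "T (real n) (?J h) - ?J h = T h (?J (real n)) - ?J (real n)" for n
      using semigroup_integral_shift[of h "real n" v] semigroup_integral_shift[of "real n" h v] h by (simp add: add.commute)
    ultimately show "(\<lambda>n. T h (?J (real n)) - ?J (real n)) \<longlonglongrightarrow> - ?J h" by simp
  qed
  have "((\<lambda>h. - (?J h /\<^sub>R h)) \<longlongrightarrow> - v) (at_right 0)" by (intro tendsto_minus semigroup_average_tendsto)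
  then have "((\<lambda>h. (T h u - u) /\<^sub>R h) \<longlongrightarrow> - v) (at_right 0)"
  proof (rule Lim_transform_eventually)
    show "\<forall>\<^sub>F h in at_right 0. - (?J h /\<^sub>R h) = (T h u - u) /\<^sub>R h"
      unfolding eventually_at_right_field by (intro exI[of _ 1] conjI allI impI) (auto simp: eq)
  qed
  then show ?thesis by (auto simp: generator_graph_def)
qed

subsection \<open>Energy estimates\<close>

context
  fixes B :: "'a \<Rightarrow> 'a \<Rightarrow> real" and \<omega> :: real
  assumes B: "bounded_bilinear B" and sym: "\<And>u v. B u v = B v u"
    and diss: "\<And>u v. (u, v) \<in> generator_graph T \<Longrightarrow> B u v \<le> \<omega> * B u u"
begin

text \<open>Dissipativity makes \<open>e\<^sup>-\<^sup>2\<^sup>\<omega>\<^sup>s B (w s) (w s)\<close> nonincreasing. The curve \<open>w\<close> is arbitrary, as the estimate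
  is used for orbits and for commutators.\<close>

lemma energy_estimate:
  assumes cont: "continuous_on {0..} w" and t: "t \<ge> 0"
    and deriv: "\<And>s. s > 0 \<Longrightarrow> (w has_vector_derivative w' s) (at s)"
    and graph: "\<And>s. s > 0 \<Longrightarrow> (w s, w' s) \<in> generator_graph T"
  shows "B (w t) (w t) \<le> exp (2 * \<omega> * t) * B (w 0) (w 0)"
proof (cases "t = 0")
  case False
  define \<phi> where "\<phi> s = exp (- (2 * \<omega>) * s) * B (w s) (w s)" for s
  have "\<phi> t \<le> \<phi> 0"
  proof (rule DERIV_nonpos_imp_decreasing_open[of 0 t \<phi>])
    show "0 \<le> t" by (rule t)
    show "\<exists>y. DERIV \<phi> s :> y \<and> y \<le> 0" if s: "0 < s" "s < t" for s
    proof (intro exI[of _ "exp (- (2 * \<omega>) * s) * (2 * B (w s) (w' s) - 2 * \<omega> * B (w s) (w s))"] conjI)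
      have "((\<lambda>s. B (w s) (w s)) has_vector_derivative B (w s) (w' s) + B (w' s) (w s)) (at s)"
        by (rule bounded_bilinear.has_vector_derivative[OF B deriv[OF s(1)] deriv[OF s(1)]])
      then have "((\<lambda>s. B (w s) (w s)) has_real_derivative 2 * B (w s) (w' s)) (at s)"
        using sym[of "w' s" "w s"] by (simp add: has_real_derivative_iff_has_vector_derivative)
      then show "DERIV \<phi> s :> exp (- (2 * \<omega>) * s) * (2 * B (w s) (w' s) - 2 * \<omega> * B (w s) (w s))"
        unfolding \<phi>_def by (auto intro!: derivative_eq_intros simp: algebra_simps)
      show "exp (- (2 * \<omega>) * s) * (2 * B (w s) (w' s) - 2 * \<omega> * B (w s) (w s)) \<le> 0"
        using diss[OF graph[OF s(1)]] by (intro mult_nonneg_nonpos) auto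
    qed
    have "continuous_on {0..t} w" by (rule continuous_on_subset[OF cont]) auto
    then show "continuous_on {0..t} \<phi>"
      unfolding \<phi>_def by (intro continuous_intros bounded_bilinear.continuous_on[OF B])
  qed
  then have "exp (2 * \<omega> * t) * \<phi> t \<le> exp (2 * \<omega> * t) * B (w 0) (w 0)" by (simp add: \<phi>_def)
  then show ?thesis by (simp add: \<phi>_def mult.assoc[symmetric] exp_add[symmetric])
qed simp

lemma energy_growth:
  assumes t: "t \<ge> 0"
  shows "B (T t u) (T t u) \<le> exp (2 * \<omega> * t) * B u u"
proof -
  have "u \<in> closure (fst ` generator_graph T)" by (simp add: generator_dense)
  then obtain x where x: "\<And>n. x n \<in> fst ` generator_graph T" "x \<longlonglongrightarrow> u" unfolding closure_sequential by blast
  have le: "B (T t (x n)) (T t (x n)) \<le> exp (2 * \<omega> * t) * B (x n) (x n)" for n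
  proof -
    obtain v where v: "(x n, v) \<in> generator_graph T" using x(1)[of n] by force
    show ?thesis
      using energy_estimate[OF semigroup_continuous t semigroup_has_vector_derivative[OF v] generator_invariant[OF v]]
      by (simp add: semigroup_0)
  qed
  note tB = bounded_bilinear.tendsto[OF B]
  show ?thesis
  proof (rule LIMSEQ_le)
    show "(\<lambda>n. B (T t (x n)) (T t (x n))) \<longlonglongrightarrow> B (T t u) (T t u)" by (intro tB tendsto_intros x)
    show "(\<lambda>n. exp (2 * \<omega> * t) * B (x n) (x n)) \<longlonglongrightarrow> exp (2 * \<omega> * t) * B u u" by (intro tendsto_mult tendsto_const tB x)
    show "\<exists>N. \<forall>n\<ge>N. B (T t (x n)) (T t (x n)) \<le> exp (2 * \<omega> * t) * B (x n) (x n)"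
      by (intro exI allI impI le)
  qed
qed

text \<open>An operator that commutes with the generator commutes with the semigroup, since the
  commutator solves the evolution equation with zero initial value.\<close>

lemma semigroup_commute:
  assumes pos: "\<And>u. u \<noteq> 0 \<Longrightarrow> B u u > 0" and J: "bounded_linear J"
    and JT: "\<And>u v. (u, v) \<in> generator_graph T \<Longrightarrow> (J u, J v) \<in> generator_graph T" and t: "t \<ge> 0"
  shows "T t (J u) = J (T t u)"
proof -
  interpret J: bounded_linear J by (rule J)
  have eq: "T t (J u) = J (T t u)" if uv: "(u, v) \<in> generator_graph T" for u v
  proof -
    let ?w = "\<lambda>s. T s (J u) - J (T s u)"
    have "B (?w t) (?w t) \<le> exp (2 * \<omega> * t) * B (?w 0) (?w 0)"
    proof (rule energy_estimate[where w' = "\<lambda>s. T s (J v) - J (T s v)"])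
      show "continuous_on {0..} ?w" by (intro continuous_intros semigroup_continuous J.continuous_on)
      fix s :: real assume s: "s > 0"
      show "(?w has_vector_derivative T s (J v) - J (T s v)) (at s)"
        by (intro has_vector_derivative_diff semigroup_has_vector_derivative JT uv s J.has_vector_derivative)
      show "(?w s, T s (J v) - J (T s v)) \<in> generator_graph T"
        using s by (intro generator_graph_diff generator_invariant JT uv) auto
    qed (rule t)
    also have "B (?w 0) (?w 0) = 0"
      by (simp add: semigroup_0 bounded_bilinear.zero_left[OF B])
    finally have "?w t = 0" using pos[of "?w t"] by force
    then show ?thesis by simp
  qed
  have "u \<in> closure (fst ` generator_graph T)" by (simp add: generator_dense)
  then obtain x where x: "\<And>n. x n \<in> fst ` generator_graph T" "x \<longlonglongrightarrow> u" unfolding closure_sequential by blast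
  have "T t (J (x n)) = J (T t (x n))" for n using x(1)[of n] eq by force
  moreover have "(\<lambda>n. T t (J (x n))) \<longlonglongrightarrow> T t (J u)" by (intro tendsto_intros J.tendsto x)
  moreover have "(\<lambda>n. J (T t (x n))) \<longlonglongrightarrow> J (T t u)" by (intro tendsto_intros J.tendsto x)
  ultimately show ?thesis by (simp only:) (rule LIMSEQ_unique)
qed

end

end

subsection \<open>Growth\<close>

text \<open>If \<open>\<mu>\<close> is an approximate eigenvalue, then for fixed \<open>t\<close> the orbit of an approximate eigenvector \<open>u\<close>
  stays close to \<open>e\<^sup>\<mu>\<^sup>t u\<close>.\<close>

lemma semigroup_norm_ge_exp:
  fixes T :: "real \<Rightarrow> 'a::{banach, real_inner} \<Rightarrow>\<^sub>L 'a"
  assumes T: "C0_semigroup T"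
    and approx: "\<And>\<delta>. \<delta> > 0 \<Longrightarrow> \<exists>u v. (u, v) \<in> generator_graph T \<and> u \<noteq> 0 \<and> norm (v - \<mu> *\<^sub>R u) \<le> \<delta> * norm u"
    and t: "t \<ge> 0"
  shows "exp (\<mu> * t) \<le> norm (T t)"
proof (rule field_le_epsilon)
  fix e :: real assume e: "e > 0"
  obtain M where M: "1 \<le> M" "\<And>s. 0 \<le> s \<Longrightarrow> s \<le> t \<Longrightarrow> norm (T s) \<le> M" using semigroup_bounded[OF T] by blast
  let ?C = "exp (\<bar>\<mu>\<bar> * t) * M * (t + 1)"
  have C: "?C > 0" using M t by (intro mult_pos_pos) auto
  obtain u v where uv: "(u, v) \<in> generator_graph T" "u \<noteq> 0" "norm (v - \<mu> *\<^sub>R u) \<le> e / ?C * norm u"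
    using approx[of "e / ?C"] e C by (meson divide_pos_pos)
  let ?w = "\<lambda>s. exp (\<mu> * (t - s)) *\<^sub>R T s u"
  have diff: "norm (?w t - ?w 0) \<le> e * norm u"
  proof (cases "t = 0")
    case False
    then have t0: "0 < t" using t by simp
    let ?w' = "\<lambda>s. exp (\<mu> * (t - s)) *\<^sub>R T s (v - \<mu> *\<^sub>R u)"
    have "\<exists>x\<in>{0<..<t}. norm (?w t - ?w 0) \<le> norm ((\<lambda>h. h *\<^sub>R ?w' x) (t - 0))"
    proof (rule mvt_general[OF t0, of ?w "\<lambda>s h. h *\<^sub>R ?w' s"])
      have "continuous_on {0..t} (\<lambda>s. T s u)" by (rule continuous_on_subset[OF semigroup_continuous[OF T]]) auto
      then show "continuous_on {0..t} ?w" by (intro continuous_on_scaleR) (auto intro!: continuous_intros)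
      fix s assume s: "0 < s" "s < t"
      have "((\<lambda>s. exp (\<mu> * (t - s))) has_real_derivative - \<mu> * exp (\<mu> * (t - s))) (at s)"
        by (auto intro!: derivative_eq_intros)
      then have "(?w has_vector_derivative exp (\<mu> * (t - s)) *\<^sub>R T s v + (- \<mu> * exp (\<mu> * (t - s))) *\<^sub>R T s u) (at s)"
        by (rule has_vector_derivative_scaleR[OF _ semigroup_has_vector_derivative[OF T uv(1) s(1)]])
      then show "(?w has_derivative (\<lambda>h. h *\<^sub>R ?w' s)) (at s)"
        by (simp add: has_vector_derivative_def blinfun.diff_right blinfun.scaleR_right algebra_simps)
    qed
    then obtain x where x: "0 < x" "x < t" "norm (?w t - ?w 0) \<le> t * norm (?w' x)" using t by auto
    have "norm (?w' x) = exp (\<mu> * (t - x)) * norm (T x (v - \<mu> *\<^sub>R u))" by simp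
    also have "\<dots> \<le> exp (\<bar>\<mu>\<bar> * t) * (M * (e / ?C * norm u))"
    proof (intro mult_mono)
      have "\<mu> * (t - x) \<le> \<bar>\<mu>\<bar> * t" using x by (intro mult_mono) auto
      then show "exp (\<mu> * (t - x)) \<le> exp (\<bar>\<mu>\<bar> * t)" by simp
      show "norm (T x (v - \<mu> *\<^sub>R u)) \<le> M * (e / ?C * norm u)"
        using x M by (intro order_trans[OF norm_blinfun] mult_mono uv) auto
    qed auto
    finally have "t * norm (?w' x) \<le> (t + 1) * (exp (\<bar>\<mu>\<bar> * t) * (M * (e / ?C * norm u)))" using t by (intro mult_mono) auto
    also have "\<dots> = e * norm u * (?C / ?C)" by (simp add: mult_ac)
    also have "?C / ?C = 1" using C by (intro divide_self) auto
    finally show ?thesis using x(3) by simp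
  qed (use e in simp)
  have "norm (?w 0) \<le> norm (?w t) + norm (?w t - ?w 0)"
    using norm_triangle_ineq4[of "?w t" "?w t - ?w 0"] by simp
  then have "exp (\<mu> * t) * norm u \<le> norm (T t u) + e * norm u" using diff by (simp add: semigroup_0[OF T])
  also have "norm (T t u) \<le> norm (T t) * norm u" by (rule norm_blinfun)
  finally have "exp (\<mu> * t) * norm u \<le> (norm (T t) + e) * norm u" by (simp add: algebra_simps)
  then show "exp (\<mu> * t) \<le> norm (T t) + e" using uv(2) by (simp add: mult_le_cancel_right)
qed

lemma has_growth_boundI:
  assumes upper: "\<And>\<epsilon>. \<epsilon> > 0 \<Longrightarrow> \<exists>K>0. \<forall>t\<ge>0. norm (T t) \<le> K * exp ((\<mu> + \<epsilon>) * t)"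
    and lower: "\<And>t. t \<ge> 0 \<Longrightarrow> exp (\<mu> * t) \<le> norm (T t)"
  shows "has_growth_bound T \<mu>"
  unfolding has_growth_bound_def
proof (rule tendstoI)
  fix e :: real assume e: "e > 0"
  obtain K where K: "K > 0" "\<And>t. t \<ge> 0 \<Longrightarrow> norm (T t) \<le> K * exp ((\<mu> + e / 2) * t)" using upper[of "e / 2"] e by auto
  have "\<forall>\<^sub>F t in at_top. t > max 0 (2 * ln K / e)" by (rule eventually_gt_at_top)
  then show "\<forall>\<^sub>F t in at_top. dist (1 / t * ln (norm (T t))) \<mu> < e"
  proof eventually_elim
    case (elim t)
    then have t: "t > 0" "2 * ln K < e * t" using e by (auto simp: field_simps)
    have n: "norm (T t) > 0" using lower[of t] t exp_gt_zero[of "\<mu> * t"] by linarith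
    have "ln (exp (\<mu> * t)) \<le> ln (norm (T t))" using lower[of t] t n by (subst ln_le_cancel_iff) auto
    then have 1: "\<mu> * t \<le> ln (norm (T t))" by simp
    have "ln (norm (T t)) \<le> ln (K * exp ((\<mu> + e / 2) * t))" using K t n by (subst ln_le_cancel_iff) auto
    also have "\<dots> = ln K + (\<mu> + e / 2) * t" using K by (simp add: ln_mult)
    finally have 2: "ln (norm (T t)) < \<mu> * t + e * t" using t by (simp add: algebra_simps)
    have "\<mu> \<le> 1 / t * ln (norm (T t))" "1 / t * ln (norm (T t)) < \<mu> + e" using 1 2 t by (auto simp: field_simps)
    then show ?case by (simp add: dist_real_def)
  qed
qed

section \<open>Dissipativity of the linearized operator\<close>

lemma weighted_product_le: "0 < (a::real) \<Longrightarrow> 0 < b \<Longrightarrow> 2 * sqrt (a * b) * (x * y) \<le> a * x\<^sup>2 + b * y\<^sup>2"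
proof -
  assume "0 < a" "0 < b"
  then have "0 \<le> (sqrt a * x - sqrt b * y)\<^sup>2" "(sqrt a)\<^sup>2 = a" "(sqrt b)\<^sup>2 = b" by auto
  then show ?thesis by (simp add: power2_diff power_mult_distrib real_sqrt_mult algebra_simps)
qed

text \<open>With weights \<open>f\<close> and \<open>1 - f\<close> the coupling of the first two components that survives for
  \<open>\<xi>\<^sub>1 = 0\<close> is bounded by \<open>\<Lambda>\<close> times the energy. The remaining terms carry a factor
  \<open>\<bar>r\<^sub>1\<^sub>2\<bar> + r\<^sub>1\<^sub>1\<close>; the third component is driven by the others and gets the small weight \<open>\<delta>\<close>.\<close>

lemma symbol_energy_le:
  fixes f \<Lambda> \<delta> :: real and w1 w2 w3 :: complex
  assumes f: "0 < f" "f < 1" and \<Lambda>: "\<Lambda> = sqrt (f * (1 - f))" and \<delta>: "0 < \<delta>" "\<delta> * 2 / (\<Lambda> * (1 - f)) \<le> \<epsilon>"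
    and r: "0 \<le> r11" "0 \<le> r22" "r22 \<le> 1" "\<bar>r23\<bar> \<le> 1" "\<bar>r13\<bar> \<le> 1"
    and err: "(2 + f / \<Lambda>) * (\<bar>r12\<bar> + r11) \<le> \<epsilon> + \<theta>" and \<theta>: "0 \<le> \<theta>"
  shows "f * (w1 \<bullet> ((f * r12) *\<^sub>R w1 + (f - 1) *\<^sub>R w2 + ((2 - f) * r11) *\<^sub>R w2))
      + (1 - f) * (w2 \<bullet> ((- f) *\<^sub>R w1 + (f * r22) *\<^sub>R w1 + ((2 - f) * r12) *\<^sub>R w2))
      + \<delta> * (w3 \<bullet> ((f * r23) *\<^sub>R w1 + ((2 - f) * r13) *\<^sub>R w2))
    \<le> (\<Lambda> + 2 * \<epsilon> + \<theta>) * (f * (w1 \<bullet> w1) + (1 - f) * (w2 \<bullet> w2) + \<delta> * (w3 \<bullet> w3))"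
proof -
  define x y z where "x = cmod w1" and "y = cmod w2" and "z = cmod w3"
  have xyz: "0 \<le> x" "0 \<le> y" "0 \<le> z" by (auto simp: x_def y_def z_def)
  have sq: "w1 \<bullet> w1 = x\<^sup>2" "w2 \<bullet> w2 = y\<^sup>2" "w3 \<bullet> w3 = z\<^sup>2" by (auto simp: x_def y_def z_def power2_norm_eq_inner)
  have cs: "\<bar>w1 \<bullet> w2\<bar> \<le> x * y" "\<bar>w3 \<bullet> w1\<bar> \<le> x * z" "\<bar>w3 \<bullet> w2\<bar> \<le> y * z"
    using Cauchy_Schwarz_ineq2[of w1 w2] Cauchy_Schwarz_ineq2[of w3 w1] Cauchy_Schwarz_ineq2[of w3 w2]
    by (auto simp: x_def y_def z_def mult.commute)
  have L0: "\<Lambda> > 0" and L2: "\<Lambda>\<^sup>2 = f * (1 - f)" using f by (auto simp: \<Lambda>)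
  define E where "E = f * x\<^sup>2 + (1 - f) * y\<^sup>2"
  have E0: "0 \<le> E" using f by (auto simp: E_def intro!: add_nonneg_nonneg mult_nonneg_nonneg)
  have xyE: "2 * \<Lambda> * (x * y) \<le> E" unfolding \<Lambda> E_def using f by (intro weighted_product_le) auto
  have xy0: "0 \<le> x * y" using xyz by simp
  have main: "- (f * (1 - f) * (2 - r22)) * (w1 \<bullet> w2) \<le> \<Lambda> * E"
  proof -
    have "- (f * (1 - f) * (2 - r22)) * (w1 \<bullet> w2) \<le> \<bar>f * (1 - f) * (2 - r22)\<bar> * \<bar>w1 \<bullet> w2\<bar>"
      by (metis abs_ge_self abs_minus_cancel abs_mult)
    also have "\<dots> \<le> (f * (1 - f) * 2) * (x * y)"
    proof (intro mult_mono cs)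
      have "f * (1 - f) * (2 - r22) \<le> f * (1 - f) * 2" using f r by (intro mult_left_mono) auto
      then show "\<bar>f * (1 - f) * (2 - r22)\<bar> \<le> f * (1 - f) * 2" using f r by (simp add: abs_mult)
    qed (use f in auto)
    also have "\<dots> = \<Lambda> * (2 * \<Lambda> * (x * y))" by (simp add: L2[symmetric] power2_eq_square)
    also have "\<dots> \<le> \<Lambda> * E" using xyE L0 by (intro mult_left_mono) auto
    finally show ?thesis .
  qed
  have e11: "f * (2 - f) * r11 * (w1 \<bullet> w2) \<le> f / \<Lambda> * r11 * E"
  proof -
    have "f * (2 - f) * r11 * (w1 \<bullet> w2) \<le> f * (2 - f) * r11 * (x * y)"
      using f r cs(1) by (intro mult_left_mono) auto
    also have "\<dots> \<le> f * 2 * r11 * (x * y)" using f r xy0 by (intro mult_right_mono mult_left_mono) auto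
    also have "\<dots> = f / \<Lambda> * r11 * (2 * \<Lambda> * (x * y))" using L0 by simp
    also have "\<dots> \<le> f / \<Lambda> * r11 * E" using xyE L0 f r by (intro mult_left_mono) auto
    finally show ?thesis .
  qed
  have e12: "f * (f * r12) * x\<^sup>2 + (1 - f) * ((2 - f) * r12) * y\<^sup>2 \<le> 2 * \<bar>r12\<bar> * E"
  proof -
    have "f * r12 \<le> 2 * \<bar>r12\<bar>" "(2 - f) * r12 \<le> 2 * \<bar>r12\<bar>"
    proof -
      have "f * r12 \<le> f * \<bar>r12\<bar>" "(2 - f) * r12 \<le> (2 - f) * \<bar>r12\<bar>" using f by (auto intro!: mult_left_mono)
      moreover have "f * \<bar>r12\<bar> \<le> 2 * \<bar>r12\<bar>" "(2 - f) * \<bar>r12\<bar> \<le> 2 * \<bar>r12\<bar>" using f by (auto intro!: mult_right_mono)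
      ultimately show "f * r12 \<le> 2 * \<bar>r12\<bar>" "(2 - f) * r12 \<le> 2 * \<bar>r12\<bar>" by linarith+
    qed
    then have "f * (f * r12) * x\<^sup>2 + (1 - f) * ((2 - f) * r12) * y\<^sup>2
      \<le> f * (2 * \<bar>r12\<bar>) * x\<^sup>2 + (1 - f) * (2 * \<bar>r12\<bar>) * y\<^sup>2"
      using f by (intro add_mono mult_right_mono mult_left_mono) auto
    also have "\<dots> = 2 * \<bar>r12\<bar> * E" by (simp add: E_def algebra_simps)
    finally show ?thesis .
  qed
  have errE: "2 * \<bar>r12\<bar> * E + f / \<Lambda> * r11 * E \<le> (\<epsilon> + \<theta>) * E"
  proof -
    have "2 * \<bar>r12\<bar> + f / \<Lambda> * r11 \<le> (2 + f / \<Lambda>) * (\<bar>r12\<bar> + r11)"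
      using f L0 r by (simp add: algebra_simps)
    then have "(2 * \<bar>r12\<bar> + f / \<Lambda> * r11) * E \<le> (\<epsilon> + \<theta>) * E" using err E0 by (intro mult_right_mono) auto
    then show ?thesis by (simp add: algebra_simps)
  qed
  have third: "\<delta> * (f * r23 * (w3 \<bullet> w1) + (2 - f) * r13 * (w3 \<bullet> w2)) \<le> \<Lambda> * (\<delta> * z\<^sup>2) + \<epsilon> * E"
  proof -
    have "f * r23 * (w3 \<bullet> w1) \<le> f * (x * z)"
    proof -
      have "r23 * (w3 \<bullet> w1) \<le> \<bar>r23\<bar> * \<bar>w3 \<bullet> w1\<bar>" by (metis abs_ge_self abs_mult)
      also have "\<dots> \<le> 1 * (x * z)" using r cs by (intro mult_mono) auto
      finally show ?thesis using f by (simp add: mult.assoc)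
    qed
    moreover have "(2 - f) * r13 * (w3 \<bullet> w2) \<le> 2 * (y * z)"
    proof -
      have "(2 - f) * (r13 * (w3 \<bullet> w2)) \<le> (2 - f) * (\<bar>r13\<bar> * \<bar>w3 \<bullet> w2\<bar>)"
        using f by (intro mult_left_mono) (auto simp flip: abs_mult)
      also have "\<dots> \<le> 2 * (1 * (y * z))" using f r cs by (intro mult_mono) auto
      finally show ?thesis by (simp add: mult.assoc)
    qed
    moreover have "f * (x * z) \<le> \<Lambda> / 2 * z\<^sup>2 + 2 / (\<Lambda> * (1 - f)) * (f * x\<^sup>2)"
    proof -
      have "0 \<le> (\<Lambda> * z - f * x)\<^sup>2" by simp
      then have "2 * \<Lambda> * (f * (x * z)) \<le> \<Lambda>\<^sup>2 * z\<^sup>2 + f\<^sup>2 * x\<^sup>2" by (simp add: power2_diff power_mult_distrib algebra_simps)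
      then have "f * (x * z) \<le> (\<Lambda>\<^sup>2 * z\<^sup>2 + f\<^sup>2 * x\<^sup>2) / (2 * \<Lambda>)" using L0 by (simp add: field_simps)
      also have "\<dots> = \<Lambda> / 2 * z\<^sup>2 + f / (2 * \<Lambda>) * (f * x\<^sup>2)" using L0 by (simp add: field_simps power2_eq_square)
      also have "f / (2 * \<Lambda>) * (f * x\<^sup>2) \<le> 2 / (\<Lambda> * (1 - f)) * (f * x\<^sup>2)"
      proof (rule mult_right_mono)
        have "f * (1 - f) \<le> 1 * 1" using f by (intro mult_mono) auto
        then have "f * (1 - f) \<le> 4" by simp
        then show "f / (2 * \<Lambda>) \<le> 2 / (\<Lambda> * (1 - f))" using f L0 by (simp add: divide_simps)
      qed (use f in auto)
      finally show ?thesis by simp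
    qed
    moreover have "2 * (y * z) \<le> \<Lambda> / 2 * z\<^sup>2 + 2 / (\<Lambda> * (1 - f)) * ((1 - f) * y\<^sup>2)"
    proof -
      have "0 \<le> (\<Lambda> * z - 2 * y)\<^sup>2" by simp
      then have "4 * \<Lambda> * (y * z) \<le> \<Lambda>\<^sup>2 * z\<^sup>2 + 4 * y\<^sup>2" by (simp add: power2_diff power_mult_distrib algebra_simps)
      then have "2 * (y * z) \<le> (\<Lambda>\<^sup>2 * z\<^sup>2 + 4 * y\<^sup>2) / (2 * \<Lambda>)" using L0 by (simp add: field_simps)
      also have "\<dots> = \<Lambda> / 2 * z\<^sup>2 + 2 / (\<Lambda> * (1 - f)) * ((1 - f) * y\<^sup>2)" using L0 f by (simp add: field_simps power2_eq_square)
      finally show ?thesis .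
    qed
    ultimately have "f * r23 * (w3 \<bullet> w1) + (2 - f) * r13 * (w3 \<bullet> w2) \<le> \<Lambda> * z\<^sup>2 + 2 / (\<Lambda> * (1 - f)) * E"
      unfolding E_def distrib_left by linarith
    then have "\<delta> * (f * r23 * (w3 \<bullet> w1) + (2 - f) * r13 * (w3 \<bullet> w2)) \<le> \<delta> * (\<Lambda> * z\<^sup>2 + 2 / (\<Lambda> * (1 - f)) * E)"
      using \<delta> by (intro mult_left_mono) auto
    also have "\<dots> = \<Lambda> * (\<delta> * z\<^sup>2) + \<delta> * 2 / (\<Lambda> * (1 - f)) * E" by (simp add: algebra_simps)
    also have "\<dots> \<le> \<Lambda> * (\<delta> * z\<^sup>2) + \<epsilon> * E" using \<delta>(2) E0 by (intro add_left_mono mult_right_mono) auto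
    finally show ?thesis .
  qed
  have "f * (w1 \<bullet> ((f * r12) *\<^sub>R w1 + (f - 1) *\<^sub>R w2 + ((2 - f) * r11) *\<^sub>R w2))
      + (1 - f) * (w2 \<bullet> ((- f) *\<^sub>R w1 + (f * r22) *\<^sub>R w1 + ((2 - f) * r12) *\<^sub>R w2))
      + \<delta> * (w3 \<bullet> ((f * r23) *\<^sub>R w1 + ((2 - f) * r13) *\<^sub>R w2))
    = - (f * (1 - f) * (2 - r22)) * (w1 \<bullet> w2) + f * (2 - f) * r11 * (w1 \<bullet> w2)
      + (f * (f * r12) * x\<^sup>2 + (1 - f) * ((2 - f) * r12) * y\<^sup>2)
      + \<delta> * (f * r23 * (w3 \<bullet> w1) + (2 - f) * r13 * (w3 \<bullet> w2))"
    unfolding sq[symmetric] inner_add_right inner_scaleR_right inner_commute[of w2 w1] by algebra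
  also have "\<dots> \<le> \<Lambda> * E + (\<epsilon> + \<theta>) * E + (\<Lambda> * (\<delta> * z\<^sup>2) + \<epsilon> * E)"
    using main e11 e12 errE third by linarith
  also have "\<dots> \<le> (\<Lambda> + 2 * \<epsilon> + \<theta>) * (E + \<delta> * z\<^sup>2)"
  proof -
    have "\<epsilon> \<ge> 0" using \<delta> L0 f by (smt (verit) divide_nonneg_pos mult_pos_pos)
    then have "0 \<le> (2 * \<epsilon> + \<theta>) * (\<delta> * z\<^sup>2)" using \<delta> \<theta> by simp
    then show ?thesis by (simp add: algebra_simps)
  qed
  finally show ?thesis unfolding sq E_def .
qed

text \<open>The error symbols exceed \<open>\<eta>\<close> only for \<open>\<bar>\<xi>\<^sub>2\<bar> = O(\<bar>\<xi>\<^sub>1\<bar> / \<eta>)\<close>; the excess is absorbed by a multiple of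
  \<open>\<xi>\<^sub>1\<^sup>2 / (\<xi>\<^sub>1\<^sup>2 + \<xi>\<^sub>2\<^sup>2)\<close>, which is what the weight below produces under the shear.\<close>

lemma error_symbol_le:
  fixes a b p :: real
  assumes p: "a\<^sup>2 + b\<^sup>2 \<le> p" and K: "K \<ge> 0" and \<eta>: "\<eta> > 0"
  shows "K * (\<bar>a * b / p\<bar> + a * a / p) \<le> \<eta> + (K + K\<^sup>2 / (4 * \<eta>)) * (a\<^sup>2 / (a\<^sup>2 + b\<^sup>2))"
proof (cases "a = 0")
  case False
  define s where "s = a\<^sup>2 + b\<^sup>2"
  have s: "s > 0" "s \<le> p" using False p by (auto simp: s_def add_pos_nonneg)
  have "\<bar>a * b / p\<bar> + a * a / p \<le> \<bar>a\<bar> * \<bar>b\<bar> / s + a\<^sup>2 / s"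
  proof (intro add_mono)
    have "\<bar>a * b / p\<bar> = \<bar>a\<bar> * \<bar>b\<bar> / p" using s by (simp add: abs_mult)
    also have "\<dots> \<le> \<bar>a\<bar> * \<bar>b\<bar> / s" using s by (intro divide_left_mono) auto
    finally show "\<bar>a * b / p\<bar> \<le> \<bar>a\<bar> * \<bar>b\<bar> / s" .
    show "a * a / p \<le> a\<^sup>2 / s" unfolding power2_eq_square using s by (intro divide_left_mono) auto
  qed
  then have "K * (\<bar>a * b / p\<bar> + a * a / p) \<le> K * (\<bar>a\<bar> * \<bar>b\<bar> / s + a\<^sup>2 / s)" using K by (rule mult_left_mono)
  also have "\<dots> = (K * \<bar>a\<bar> * \<bar>b\<bar> + K * a\<^sup>2) / s" by (simp add: add_divide_distrib distrib_left mult.assoc)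
  also have "\<dots> \<le> (\<eta> * s + (K + K\<^sup>2 / (4 * \<eta>)) * a\<^sup>2) / s"
  proof (rule divide_right_mono)
    have "0 \<le> (2 * \<eta> * \<bar>b\<bar> - K * \<bar>a\<bar>)\<^sup>2" by simp
    then have "4 * \<eta> * (K * \<bar>a\<bar> * \<bar>b\<bar>) \<le> 4 * \<eta>\<^sup>2 * b\<^sup>2 + K\<^sup>2 * a\<^sup>2"
      by (simp add: power2_diff power_mult_distrib algebra_simps)
    then have "K * \<bar>a\<bar> * \<bar>b\<bar> \<le> (4 * \<eta>\<^sup>2 * b\<^sup>2 + K\<^sup>2 * a\<^sup>2) / (4 * \<eta>)" using \<eta> by (simp add: field_simps)
    also have "\<dots> = \<eta> * b\<^sup>2 + K\<^sup>2 / (4 * \<eta>) * a\<^sup>2" using \<eta> by (simp add: field_simps power2_eq_square)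
    finally have "K * \<bar>a\<bar> * \<bar>b\<bar> \<le> \<eta> * b\<^sup>2 + K\<^sup>2 / (4 * \<eta>) * a\<^sup>2" .
    moreover have "\<eta> * b\<^sup>2 \<le> \<eta> * s" using \<eta> by (intro mult_left_mono) (auto simp: s_def)
    ultimately show "K * \<bar>a\<bar> * \<bar>b\<bar> + K * a\<^sup>2 \<le> \<eta> * s + (K + K\<^sup>2 / (4 * \<eta>)) * a\<^sup>2" by (simp add: algebra_simps)
  qed (use s in auto)
  also have "\<dots> = \<eta> + (K + K\<^sup>2 / (4 * \<eta>)) * (a\<^sup>2 / s)" using s by (simp add: field_simps)
  finally show ?thesis by (simp add: s_def)
qed (use \<eta> in auto)

subsection \<open>The weight\<close>

text \<open>Under the shear \<open>\<xi>\<^sub>2 / \<xi>\<^sub>1\<close> moves with unit speed, so the weight grows at the relative rate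
  \<open>2N / (1 + (\<xi>\<^sub>2/\<xi>\<^sub>1)\<^sup>2)\<close>; since the arctangent is bounded, the total growth along a trajectory is at
  most \<open>e\<^sup>2\<^sup>\<pi>\<^sup>N\<close>. On the null set \<open>\<xi>\<^sub>1 = 0\<close>, which the shear leaves fixed, division by zero makes the
  weight \<open>1\<close> and its rate \<open>0\<close>.\<close>

definition ghost :: "real \<Rightarrow> R3 \<Rightarrow> real" where
  "ghost N \<xi> = exp (2 * N * arctan (\<xi> $ 2 / \<xi> $ 1))"

definition ghost_rate :: "R3 \<Rightarrow> real" where
  "ghost_rate \<xi> = (\<xi> $ 1)\<^sup>2 / ((\<xi> $ 1)\<^sup>2 + (\<xi> $ 2)\<^sup>2)"

lemma ghost_rate_bounds: "0 \<le> ghost_rate \<xi>" "ghost_rate \<xi> \<le> 1"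
  unfolding ghost_rate_def by (auto simp: divide_le_eq_1 add_nonneg_eq_0_iff not_less less_le)

lemma ghost_bounds:
  assumes "N \<ge> 0"
  shows "exp (- (pi * N)) \<le> ghost N \<xi>" "ghost N \<xi> \<le> exp (pi * N)"
proof -
  let ?t = "arctan (\<xi> $ 2 / \<xi> $ 1)"
  have "2 * N * (- (pi / 2)) \<le> 2 * N * ?t" "2 * N * ?t \<le> 2 * N * (pi / 2)"
    using arctan_bounded[of "\<xi> $ 2 / \<xi> $ 1"] assms by (auto simp only: intro!: mult_left_mono)
  then show "exp (- (pi * N)) \<le> ghost N \<xi>" "ghost N \<xi> \<le> exp (pi * N)"
    unfolding ghost_def by (auto simp: mult.commute)
qed

lemma ghost_pos: "ghost N \<xi> > 0"
  by (simp add: ghost_def)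

lemma ghost_measurable [measurable]: "ghost N \<in> borel_measurable borel"
proof -
  have "arctan \<in> borel_measurable borel"
    by (intro borel_measurable_continuous_onI continuous_at_imp_continuous_on ballI isCont_arctan)
  then have "(\<lambda>\<xi>::R3. arctan (\<xi> $ 2 / \<xi> $ 1)) \<in> borel_measurable borel"
    by (rule measurable_compose[rotated]) measurable
  then show ?thesis unfolding ghost_def[abs_def] by measurable
qed

lemma ghost_weight: "N \<ge> 0 \<Longrightarrow> bounded_weight (ghost N)"
  unfolding bounded_weight_def using ghost_bounds(2)[of N] ghost_pos[of N]
  by (intro conjI ghost_measurable exI[of _ "exp (pi * N)"]) (auto simp: abs_of_pos)

lemma ghost_rate_ghost_le:
  assumes "N \<ge> 0"
  shows "\<bar>2 * N * ghost_rate \<xi> * ghost N \<xi>\<bar> \<le> 2 * N * exp (pi * N)"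
proof -
  have "ghost_rate \<xi> * ghost N \<xi> \<le> 1 * exp (pi * N)"
    using ghost_bounds[OF assms, of \<xi>] ghost_rate_bounds[of \<xi>] ghost_pos[of N \<xi>] by (intro mult_mono) auto
  then have "2 * N * (ghost_rate \<xi> * ghost N \<xi>) \<le> 2 * N * exp (pi * N)"
    using assms by (intro mult_left_mono) auto
  then show ?thesis using assms ghost_rate_bounds[of \<xi>] ghost_pos[of N \<xi>] by (simp add: abs_mult mult.assoc)
qed

lemma ghost_rate_weight:
  assumes "N \<ge> 0"
  shows "bounded_weight (\<lambda>\<xi>. 2 * N * ghost_rate \<xi> * ghost N \<xi>)"
  unfolding bounded_weight_def
proof (intro conjI exI allI)
  have "ghost_rate \<in> borel_measurable borel" unfolding ghost_rate_def[abs_def] by measurable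
  then show "(\<lambda>\<xi>. 2 * N * ghost_rate \<xi> * ghost N \<xi>) \<in> borel_measurable borel" by measurable
  show "\<bar>2 * N * ghost_rate \<xi> * ghost N \<xi>\<bar> \<le> 2 * N * exp (pi * N)" for \<xi>
    by (rule ghost_rate_ghost_le[OF assms])
qed

lemma ghost_shear_derivative:
  "((\<lambda>s. ghost N (tr 2 1 s \<xi>)) has_real_derivative 2 * N * ghost_rate (tr 2 1 s \<xi>) * ghost N (tr 2 1 s \<xi>)) (at s)"
proof (cases "\<xi> $ 1 = 0")
  case True
  then show ?thesis by (simp add: ghost_def ghost_rate_def tr_def axis_def)
next
  case False
  let ?\<tau> = "\<xi> $ 2 / \<xi> $ 1"
  have eq: "(tr 2 1 s \<xi>) $ 2 / (tr 2 1 s \<xi>) $ 1 = ?\<tau> + s" for s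
    using False by (simp add: tr_def axis_def field_simps)
  have rate: "ghost_rate (tr 2 1 s \<xi>) = inverse (1 + (?\<tau> + s)\<^sup>2)"
    using False by (simp add: ghost_rate_def tr_def axis_def field_simps power2_eq_square)
  have "((\<lambda>s. exp (2 * N * arctan (?\<tau> + s))) has_real_derivative
      exp (2 * N * arctan (?\<tau> + s)) * (2 * N * (inverse (1 + (?\<tau> + s)\<^sup>2)))) (at s)"
    by (auto intro!: derivative_eq_intros)
  then show ?thesis unfolding ghost_def eq rate by (simp add: mult_ac)
qed

lemma ghost_transport:
  assumes N: "N \<ge> 0" and k: "represents k (y_dx u)"
  shows "2 * inner (fourier k) (rmult (ghost N) (fourier u))
    = inner (fourier u) (rmult (\<lambda>\<xi>. 2 * N * ghost_rate \<xi> * ghost N \<xi>) (fourier u))"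
proof (rule weighted_transport_identity[OF k ghost_weight[OF N] _ ghost_rate_weight[OF N]])
  show "\<bar>ghost N (tr 2 1 s \<xi>) - ghost N \<xi>\<bar> \<le> 2 * N * 1 * exp (pi * N) * \<bar>s\<bar>" for s \<xi>
  proof -
    let ?g = "\<lambda>s. ghost N (tr 2 1 s \<xi>)"
    have "norm (?g s - ?g 0) \<le> (2 * N * 1 * exp (pi * N)) * norm (s - 0)"
    proof (rule field_differentiable_bound[of UNIV])
      show "(?g has_field_derivative 2 * N * ghost_rate (tr 2 1 r \<xi>) * ghost N (tr 2 1 r \<xi>)) (at r within UNIV)" for r
        using ghost_shear_derivative[of N \<xi> r] by simp
      show "norm (2 * N * ghost_rate (tr 2 1 r \<xi>) * ghost N (tr 2 1 r \<xi>)) \<le> 2 * N * 1 * exp (pi * N)" for r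
        unfolding real_norm_def mult_1_right by (rule ghost_rate_ghost_le[OF N])
    qed auto
    then show ?thesis by simp
  qed
  show "((\<lambda>s. (ghost N (tr 2 1 s \<xi>) - ghost N \<xi>) / s) \<longlongrightarrow> 2 * N * ghost_rate \<xi> * ghost N \<xi>) (at 0)" for \<xi>
    using ghost_shear_derivative[of N \<xi> 0] unfolding DERIV_def by simp
qed


subsection \<open>The energy\<close>

definition energy_weight :: "real \<Rightarrow> real \<Rightarrow> 3 \<Rightarrow> real" where
  "energy_weight f \<delta> j = (if j = 1 then f else if j = 2 then 1 - f else \<delta>)"

definition energy :: "real \<Rightarrow> real \<Rightarrow> real \<Rightarrow> L2_field \<Rightarrow> L2_field \<Rightarrow> real" where
  "energy f \<delta> N u v = (\<Sum>j\<in>UNIV. energy_weight f \<delta> j * inner (fourier (u $ j)) (rmult (ghost N) (fourier (v $ j))))"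

lemma energy_sym: "N \<ge> 0 \<Longrightarrow> energy f \<delta> N u v = energy f \<delta> N v u"
  unfolding energy_def by (intro sum.cong refl) (simp add: inner_rmult_commute ghost_weight)

lemma bounded_bilinear_energy:
  assumes N: "N \<ge> 0"
  shows "bounded_bilinear (energy f \<delta> N)"
proof -
  have F: "bounded_linear (\<lambda>u::L2_field. fourier (u $ j))" for j
    by (rule bounded_linear_compose[OF bounded_linear_fourier bounded_linear_vec_nth])
  have Q: "bounded_linear (\<lambda>v::L2_field. rmult (ghost N) (fourier (v $ j)))" for j
    by (rule bounded_linear_compose[OF bounded_linear_rmult[OF ghost_weight[OF N]] F])
  let ?b = "\<lambda>j u v. energy_weight f \<delta> j * inner (fourier (u $ j)) (rmult (ghost N) (fourier (v $ j)))"
  have s: "bounded_bilinear (?b j)" for j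
  proof -
    interpret F: bounded_linear "\<lambda>u::L2_field. fourier (u $ j)" by (rule F)
    interpret Q: bounded_linear "\<lambda>v::L2_field. rmult (ghost N) (fourier (v $ j))" by (rule Q)
    interpret R: bounded_linear "rmult (ghost N)" by (rule bounded_linear_rmult[OF ghost_weight[OF N]])
    obtain K where K: "\<And>u. norm (fourier (u $ j)) \<le> norm u * K" "K > 0" using F.pos_bounded by blast
    obtain L where L: "\<And>u. norm (rmult (ghost N) (fourier (u $ j))) \<le> norm u * L" "L > 0" using Q.pos_bounded by blast
    show ?thesis
    proof (rule bounded_bilinear.intro)
      show "\<exists>M. \<forall>u v. norm (?b j u v) \<le> norm u * norm v * M"
      proof (intro exI allI)
        fix u v
        have "\<bar>inner (fourier (u $ j)) (rmult (ghost N) (fourier (v $ j)))\<bar> \<le> (norm u * K) * (norm v * L)"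
          using K L by (intro order_trans[OF Cauchy_Schwarz_ineq2] mult_mono) auto
        then have "norm (?b j u v) \<le> \<bar>energy_weight f \<delta> j\<bar> * ((norm u * K) * (norm v * L))"
          unfolding real_norm_def abs_mult by (intro mult_left_mono) auto
        then show "norm (?b j u v) \<le> norm u * norm v * (\<bar>energy_weight f \<delta> j\<bar> * (K * L))" by (simp only: mult_ac)
      qed
    qed (simp_all only: F.add F.scaleR R.add R.scaleR inner_add_left inner_add_right inner_scaleR_left inner_scaleR_right
          distrib_left real_scaleR_def mult.left_commute)
  qed
  show ?thesis
  proof (rule bounded_bilinear.intro)
    have "\<forall>j. \<exists>K. \<forall>u v. norm (?b j u v) \<le> norm u * norm v * K"
      using s unfolding bounded_bilinear_def by blast
    then obtain K where K: "\<And>j u v. norm (?b j u v) \<le> norm u * norm v * K j" by metis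
    have "norm (energy f \<delta> N u v) \<le> norm u * norm v * (\<Sum>j\<in>UNIV. K j)" for u v
      unfolding energy_def sum_distrib_left by (rule order_trans[OF norm_sum sum_mono[OF K]])
    then show "\<exists>M. \<forall>u v. norm (energy f \<delta> N u v) \<le> norm u * norm v * M" by blast
  qed (simp_all only: energy_def bounded_bilinear.add_left[OF s] bounded_bilinear.add_right[OF s]
        bounded_bilinear.scaleR_left[OF s] bounded_bilinear.scaleR_right[OF s] sum.distrib scaleR_sum_right)
qed

lemma inner_ghost_bounds:
  assumes N: "N \<ge> 0"
  shows "exp (- (pi * N)) * (norm h)\<^sup>2 \<le> inner h (rmult (ghost N) h)"
    "inner h (rmult (ghost N) h) \<le> exp (pi * N) * (norm h)\<^sup>2"
proof -
  have n: "(norm h)\<^sup>2 = (\<integral>\<xi>. rep_L2 h \<xi> \<bullet> rep_L2 h \<xi> \<partial>lborel)" by (simp add: power2_norm_eq_inner inner_L2_rep)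
  have i: "integrable lborel (\<lambda>\<xi>. rep_L2 h \<xi> \<bullet> rep_L2 h \<xi>)" by (simp add: square_integrable_inner)
  note w = inner_rmult[OF ghost_weight[OF N], of h h]
  have "(\<integral>\<xi>. exp (- (pi * N)) * (rep_L2 h \<xi> \<bullet> rep_L2 h \<xi>) \<partial>lborel) \<le> (\<integral>\<xi>. ghost N \<xi> * (rep_L2 h \<xi> \<bullet> rep_L2 h \<xi>) \<partial>lborel)"
    by (intro integral_mono integrable_mult_right i w(2) mult_right_mono ghost_bounds N inner_ge_zero)
  then show "exp (- (pi * N)) * (norm h)\<^sup>2 \<le> inner h (rmult (ghost N) h)" unfolding w(1) n by simp
  have "(\<integral>\<xi>. ghost N \<xi> * (rep_L2 h \<xi> \<bullet> rep_L2 h \<xi>) \<partial>lborel) \<le> (\<integral>\<xi>. exp (pi * N) * (rep_L2 h \<xi> \<bullet> rep_L2 h \<xi>) \<partial>lborel)"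
    by (intro integral_mono integrable_mult_right i w(2) mult_right_mono ghost_bounds N inner_ge_zero)
  then show "inner h (rmult (ghost N) h) \<le> exp (pi * N) * (norm h)\<^sup>2" unfolding w(1) n by simp
qed

lemma norm_field_sq: "(norm (u :: L2_field))\<^sup>2 = (\<Sum>j\<in>UNIV. (norm (u $ j))\<^sup>2)"
  by (simp add: norm_vec_def L2_set_def sum_nonneg)

lemma energy_bounds:
  assumes N: "N \<ge> 0" and c: "\<And>j. c \<le> energy_weight f \<delta> j" "\<And>j. energy_weight f \<delta> j \<le> 1" "c \<ge> 0"
  shows "(2 * pi)^3 * (c * exp (- (pi * N))) * (norm u)\<^sup>2 \<le> energy f \<delta> N u u"
    "energy f \<delta> N u u \<le> (2 * pi)^3 * exp (pi * N) * (norm u)\<^sup>2"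
proof -
  have n: "(norm (fourier w))\<^sup>2 = (2 * pi)^3 * (norm w)\<^sup>2" for w
    by (simp add: norm_fourier power_mult_distrib)
  have "(2 * pi)^3 * (c * exp (- (pi * N))) * (norm u)\<^sup>2 = (\<Sum>j\<in>UNIV. c * (exp (- (pi * N)) * (norm (fourier (u $ j)))\<^sup>2))"
    unfolding norm_field_sq n sum_distrib_left by (intro sum.cong refl) (simp only: mult_ac)
  also have "\<dots> \<le> energy f \<delta> N u u"
    unfolding energy_def using c order_trans[OF c(3) c(1)] by (intro sum_mono mult_mono inner_ghost_bounds N) auto
  finally show "(2 * pi)^3 * (c * exp (- (pi * N))) * (norm u)\<^sup>2 \<le> energy f \<delta> N u u" .
  have nn: "0 \<le> inner h (rmult (ghost N) h)" for h
    using inner_ghost_bounds(1)[OF N, of h] by (rule order_trans[rotated]) simp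
  have "energy f \<delta> N u u \<le> (\<Sum>j\<in>UNIV. 1 * (exp (pi * N) * (norm (fourier (u $ j)))\<^sup>2))"
    unfolding energy_def using c by (intro sum_mono mult_mono inner_ghost_bounds N nn) auto
  also have "\<dots> = (2 * pi)^3 * exp (pi * N) * (norm u)\<^sup>2"
    unfolding norm_field_sq n sum_distrib_left by (intro sum.cong refl) (simp only: mult_ac mult_1_left)
  finally show "energy f \<delta> N u u \<le> (2 * pi)^3 * exp (pi * N) * (norm u)\<^sup>2" .
qed

lemma couette_op_components:
  fixes f \<nu> u
  defines "P \<equiv> \<lambda>g. to_L2 (nu_laplacian \<nu> g) - to_L2 (y_dx g)"
  shows "couette_op f \<nu> u $ 1 = P (u $ 1) + f *\<^sub>R riesz 1 2 (u $ 1) + (f - 1) *\<^sub>R u $ 2 + (2 - f) *\<^sub>R riesz 1 1 (u $ 2)"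
    "couette_op f \<nu> u $ 2 = (- f) *\<^sub>R u $ 1 + f *\<^sub>R riesz 2 2 (u $ 1) + P (u $ 2) + (2 - f) *\<^sub>R riesz 1 2 (u $ 2)"
    "couette_op f \<nu> u $ 3 = f *\<^sub>R riesz 2 3 (u $ 1) + (2 - f) *\<^sub>R riesz 1 3 (u $ 2) + P (u $ 3)"
  unfolding couette_op_def Let_def P_def by (simp_all add: vector_3)

lemma rep_fourier_riesz: "AE \<xi> in lborel. rep_L2 (fourier (riesz j k u)) \<xi> = (\<xi> $ j * \<xi> $ k / (norm \<xi>)\<^sup>2) *\<^sub>R rep_L2 (fourier u) \<xi>"
  unfolding fourier_riesz using rep_mult_L2[OF riesz_symbol_bounded[of j k], of "fourier u"]
  by eventually_elim (simp add: riesz_symbol_def scaleR_conv_of_real)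

lemma fourier_diff: "fourier (u - v) = fourier u - fourier v"
  by (rule linear_diff[OF bounded_linear.linear[OF bounded_linear_fourier]])

text \<open>The dissipative inequality. After adding the transport terms back, every entry of \<open>\<L>\<close> acts by
  multiplication in frequency, so the estimate reduces to a pointwise one; the transport terms
  themselves contribute the rate of the weight along the shear.\<close>

lemma energy_dissipation:
  assumes f: "0 < f" "f < 1" and \<Lambda>: "\<Lambda> = sqrt (f * (1 - f))" and \<nu>: "\<nu> > 0"
    and \<epsilon>: "\<epsilon> > 0" and \<delta>: "0 < \<delta>" "\<delta> * 2 / (\<Lambda> * (1 - f)) \<le> \<epsilon>"
    and K: "K = 2 + f / \<Lambda>" and N: "N = K + K\<^sup>2 / (4 * \<epsilon>)"
    and u: "u \<in> couette_dom \<nu>"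
  shows "energy f \<delta> N u (couette_op f \<nu> u) \<le> (\<Lambda> + 2 * \<epsilon>) * energy f \<delta> N u u"
proof -
  let ?c = "energy_weight f \<delta>"
  define h where "h j = rep_L2 (fourier (u $ j))" for j
  define p where "p j = to_L2 (nu_laplacian \<nu> (u $ j))" for j
  define k where "k j = to_L2 (y_dx (u $ j))" for j
  have \<Lambda>0: "\<Lambda> > 0" using f by (simp add: \<Lambda>)
  have K0: "K \<ge> 0" using f \<Lambda>0 by (simp add: K)
  have N0: "N \<ge> 0" using K0 \<epsilon> by (simp add: N)
  have c0: "?c j \<ge> 0" for j using f \<delta> by (simp add: energy_weight_def)
  have p: "represents (p j) (nu_laplacian \<nu> (u $ j))" and k: "represents (k j) (y_dx (u $ j))" for j
    using u by (auto simp: couette_dom_def p_def k_def intro!: represents_to_L2)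
  \<comment> \<open>\<open>k j\<close> cancels the transport term of \<open>\<L> u\<close>, so that \<open>X j\<close> is pointwise linear in the transform of \<open>u\<close>.\<close>
  define X where "X j = fourier (couette_op f \<nu> u $ j + k j)" for j
  let ?q = "ghost N" and ?q' = "\<lambda>\<xi>. 2 * N * ghost_rate \<xi> * ghost N \<xi>"
  note qw = ghost_weight[OF N0] and q'w = ghost_rate_weight[OF N0]
  interpret Q: bounded_linear "rmult ?q" by (rule bounded_linear_rmult[OF qw])
  have Xeq: "AE \<xi> in lborel.
      rep_L2 (X 1) \<xi> = - (\<nu> * (norm \<xi>)\<^sup>2) *\<^sub>R h 1 \<xi> + ((f * (\<xi> $ 1 * \<xi> $ 2 / (norm \<xi>)\<^sup>2)) *\<^sub>R h 1 \<xi> + (f - 1) *\<^sub>R h 2 \<xi> + ((2 - f) * (\<xi> $ 1 * \<xi> $ 1 / (norm \<xi>)\<^sup>2)) *\<^sub>R h 2 \<xi>) \<and>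
      rep_L2 (X 2) \<xi> = - (\<nu> * (norm \<xi>)\<^sup>2) *\<^sub>R h 2 \<xi> + ((- f) *\<^sub>R h 1 \<xi> + (f * (\<xi> $ 2 * \<xi> $ 2 / (norm \<xi>)\<^sup>2)) *\<^sub>R h 1 \<xi> + ((2 - f) * (\<xi> $ 1 * \<xi> $ 2 / (norm \<xi>)\<^sup>2)) *\<^sub>R h 2 \<xi>) \<and>
      rep_L2 (X 3) \<xi> = - (\<nu> * (norm \<xi>)\<^sup>2) *\<^sub>R h 3 \<xi> + ((f * (\<xi> $ 2 * \<xi> $ 3 / (norm \<xi>)\<^sup>2)) *\<^sub>R h 1 \<xi> + ((2 - f) * (\<xi> $ 1 * \<xi> $ 3 / (norm \<xi>)\<^sup>2)) *\<^sub>R h 2 \<xi>)"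
  proof -
    have pa: "AE \<xi> in lborel. rep_L2 (fourier (p j)) \<xi> = - (\<nu> * (norm \<xi>)\<^sup>2) *\<^sub>R h j \<xi>" for j
      using fourier_laplacian[OF p[of j]] by eventually_elim (simp add: h_def scaleR_conv_of_real)
    let ?r = "\<lambda>i j l. fourier (riesz i j (u $ l))"
    have x1: "X 1 = fourier (p 1) + (f *\<^sub>R ?r 1 2 1 + ((f - 1) *\<^sub>R fourier (u $ 2) + (2 - f) *\<^sub>R ?r 1 1 2))"
      unfolding X_def by (simp add: couette_op_components fourier_add fourier_scaleR fourier_diff p_def k_def)
    have x2: "X 2 = fourier (p 2) + ((- f) *\<^sub>R fourier (u $ 1) + (f *\<^sub>R ?r 2 2 1 + (2 - f) *\<^sub>R ?r 1 2 2))"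
      unfolding X_def by (simp add: couette_op_components fourier_add fourier_scaleR fourier_diff p_def k_def linear_neg[OF bounded_linear.linear[OF bounded_linear_fourier]])
    have x3: "X 3 = fourier (p 3) + (f *\<^sub>R ?r 2 3 1 + (2 - f) *\<^sub>R ?r 1 3 2)"
      unfolding X_def by (simp add: couette_op_components fourier_add fourier_scaleR fourier_diff p_def k_def)
    have l2: "AE \<xi> in lborel. rep_L2 (v + (a *\<^sub>R x + b *\<^sub>R y)) \<xi> = rep_L2 v \<xi> + (a *\<^sub>R rep_L2 x \<xi> + b *\<^sub>R rep_L2 y \<xi>)" for v x y a b
      using rep_L2_add[of v "a *\<^sub>R x + b *\<^sub>R y"] rep_L2_add[of "a *\<^sub>R x" "b *\<^sub>R y"] rep_L2_scaleR[of a x] rep_L2_scaleR[of b y]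
      by eventually_elim simp
    have l3: "AE \<xi> in lborel. rep_L2 (v + (a *\<^sub>R x + (b *\<^sub>R y + c *\<^sub>R z))) \<xi> = rep_L2 v \<xi> + (a *\<^sub>R rep_L2 x \<xi> + (b *\<^sub>R rep_L2 y \<xi> + c *\<^sub>R rep_L2 z \<xi>))" for v x y z a b c
      using rep_L2_add[of v "a *\<^sub>R x + (b *\<^sub>R y + c *\<^sub>R z)"] rep_L2_add[of "a *\<^sub>R x" "b *\<^sub>R y + c *\<^sub>R z"] rep_L2_scaleR[of a x]
        rep_L2_add[of "b *\<^sub>R y" "c *\<^sub>R z"] rep_L2_scaleR[of b y] rep_L2_scaleR[of c z]
      by eventually_elim simp
    show ?thesis
      using pa[of 1] pa[of 2] pa[of 3]
        l3[of "fourier (p 1)" f "?r 1 2 1" "f - 1" "fourier (u $ 2)" "2 - f" "?r 1 1 2"]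
        l3[of "fourier (p 2)" "- f" "fourier (u $ 1)" f "?r 2 2 1" "2 - f" "?r 1 2 2"]
        l2[of "fourier (p 3)" f "?r 2 3 1" "2 - f" "?r 1 3 2"]
        rep_fourier_riesz[of 1 2 "u $ 1"] rep_fourier_riesz[of 1 1 "u $ 2"] rep_fourier_riesz[of 2 2 "u $ 1"]
        rep_fourier_riesz[of 1 2 "u $ 2"] rep_fourier_riesz[of 2 3 "u $ 1"] rep_fourier_riesz[of 1 3 "u $ 2"]
      unfolding x1[symmetric] x2[symmetric] x3[symmetric]
      by eventually_elim (simp add: h_def[symmetric] add.assoc)
  qed
  let ?E = "\<lambda>\<xi>. \<Sum>j\<in>UNIV. ?c j * (h j \<xi> \<bullet> h j \<xi>)"
  have pw: "AE \<xi> in lborel. (\<Sum>j\<in>UNIV. ?c j * (h j \<xi> \<bullet> rep_L2 (X j) \<xi>)) \<le> (\<Lambda> + 2 * \<epsilon> + N * ghost_rate \<xi>) * ?E \<xi>"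
    using Xeq
  proof eventually_elim
    case (elim \<xi>)
    let ?p = "(norm \<xi>)\<^sup>2"
    have pp: "?p = (\<xi> $ 1)\<^sup>2 + (\<xi> $ 2)\<^sup>2 + (\<xi> $ 3)\<^sup>2" by (simp add: norm_sq_R3 sum_3)
    have le1: "\<bar>\<xi> $ i * \<xi> $ j / ?p\<bar> \<le> 1" for i j
      using riesz_symbol_le[of i j \<xi>] unfolding riesz_symbol_def norm_of_real .
    have err: "(2 + f / \<Lambda>) * (\<bar>\<xi> $ 1 * \<xi> $ 2 / ?p\<bar> + \<xi> $ 1 * \<xi> $ 1 / ?p) \<le> \<epsilon> + N * ghost_rate \<xi>"
      unfolding N ghost_rate_def K[symmetric] by (rule error_symbol_le[OF _ K0 \<epsilon>]) (simp add: pp)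
    have S: "f * (h 1 \<xi> \<bullet> ((f * (\<xi> $ 1 * \<xi> $ 2 / ?p)) *\<^sub>R h 1 \<xi> + (f - 1) *\<^sub>R h 2 \<xi> + ((2 - f) * (\<xi> $ 1 * \<xi> $ 1 / ?p)) *\<^sub>R h 2 \<xi>))
      + (1 - f) * (h 2 \<xi> \<bullet> ((- f) *\<^sub>R h 1 \<xi> + (f * (\<xi> $ 2 * \<xi> $ 2 / ?p)) *\<^sub>R h 1 \<xi> + ((2 - f) * (\<xi> $ 1 * \<xi> $ 2 / ?p)) *\<^sub>R h 2 \<xi>))
      + \<delta> * (h 3 \<xi> \<bullet> ((f * (\<xi> $ 2 * \<xi> $ 3 / ?p)) *\<^sub>R h 1 \<xi> + ((2 - f) * (\<xi> $ 1 * \<xi> $ 3 / ?p)) *\<^sub>R h 2 \<xi>))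
      \<le> (\<Lambda> + 2 * \<epsilon> + N * ghost_rate \<xi>) * (f * (h 1 \<xi> \<bullet> h 1 \<xi>) + (1 - f) * (h 2 \<xi> \<bullet> h 2 \<xi>) + \<delta> * (h 3 \<xi> \<bullet> h 3 \<xi>))"
    proof (rule symbol_energy_le[OF f \<Lambda> \<delta> _ _ _ _ _ err])
      show "0 \<le> N * ghost_rate \<xi>" using N0 ghost_rate_bounds by simp
      show "\<xi> $ 2 * \<xi> $ 2 / ?p \<le> 1" using le1[of 2 2] by (simp only: abs_le_iff)
    qed (use le1 in auto)
    have visc: "0 \<le> (\<nu> * ?p) * (f * (h 1 \<xi> \<bullet> h 1 \<xi>))" "0 \<le> (\<nu> * ?p) * ((1 - f) * (h 2 \<xi> \<bullet> h 2 \<xi>))"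
      "0 \<le> (\<nu> * ?p) * (\<delta> * (h 3 \<xi> \<bullet> h 3 \<xi>))"
      using \<nu> f \<delta> by (auto intro!: mult_nonneg_nonneg)
    have vis_eq: "c * (w \<bullet> (- t *\<^sub>R w + a)) = c * (w \<bullet> a) - t * (c * (w \<bullet> w))" for c t and w a :: complex
      by (simp add: inner_diff_right inner_add_right algebra_simps)
    have E: "?E \<xi> = f * (h 1 \<xi> \<bullet> h 1 \<xi>) + (1 - f) * (h 2 \<xi> \<bullet> h 2 \<xi>) + \<delta> * (h 3 \<xi> \<bullet> h 3 \<xi>)"
      by (simp add: sum_3 energy_weight_def)
    have "(\<Sum>j\<in>UNIV. ?c j * (h j \<xi> \<bullet> rep_L2 (X j) \<xi>))
      = f * (h 1 \<xi> \<bullet> rep_L2 (X 1) \<xi>) + (1 - f) * (h 2 \<xi> \<bullet> rep_L2 (X 2) \<xi>) + \<delta> * (h 3 \<xi> \<bullet> rep_L2 (X 3) \<xi>)"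
      by (simp add: sum_3 energy_weight_def)
    also have "\<dots> \<le> (\<Lambda> + 2 * \<epsilon> + N * ghost_rate \<xi>) * ?E \<xi>"
      using S visc unfolding E elim[THEN conjunct1] elim[THEN conjunct2, THEN conjunct1] elim[THEN conjunct2, THEN conjunct2] vis_eq
      by linarith
    finally show ?case .
  qed
  have ie: "integrable lborel (\<lambda>\<xi>. \<Sum>j\<in>UNIV. ?c j * (q \<xi> * (h j \<xi> \<bullet> rep_L2 (Y j) \<xi>)))" if "bounded_weight q" for q Y
    unfolding h_def by (intro Bochner_Integration.integrable_sum integrable_mult_right inner_rmult(2) that)
  have se: "(\<Sum>j\<in>UNIV. ?c j * inner (fourier (u $ j)) (rmult q (Y j))) = (\<integral>\<xi>. (\<Sum>j\<in>UNIV. ?c j * (q \<xi> * (h j \<xi> \<bullet> rep_L2 (Y j) \<xi>))) \<partial>lborel)"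
    if "bounded_weight q" for q Y
    unfolding inner_rmult(1)[OF that] h_def
    by (subst Bochner_Integration.integral_sum) (auto intro!: integrable_mult_right inner_rmult(2) that)
  have "(\<Sum>j\<in>UNIV. ?c j * inner (fourier (u $ j)) (rmult ?q (X j)))
    \<le> (\<integral>\<xi>. (\<Lambda> + 2 * \<epsilon>) * (\<Sum>j\<in>UNIV. ?c j * (?q \<xi> * (h j \<xi> \<bullet> rep_L2 (fourier (u $ j)) \<xi>)))
        + 1/2 * (\<Sum>j\<in>UNIV. ?c j * (?q' \<xi> * (h j \<xi> \<bullet> rep_L2 (fourier (u $ j)) \<xi>))) \<partial>lborel)"
    unfolding se[OF qw]
  proof (rule integral_mono_AE)
    show "integrable lborel (\<lambda>\<xi>. \<Sum>j\<in>UNIV. ?c j * (?q \<xi> * (h j \<xi> \<bullet> rep_L2 (X j) \<xi>)))" by (rule ie[OF qw])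
    show "integrable lborel (\<lambda>\<xi>. (\<Lambda> + 2 * \<epsilon>) * (\<Sum>j\<in>UNIV. ?c j * (?q \<xi> * (h j \<xi> \<bullet> rep_L2 (fourier (u $ j)) \<xi>)))
        + 1/2 * (\<Sum>j\<in>UNIV. ?c j * (?q' \<xi> * (h j \<xi> \<bullet> rep_L2 (fourier (u $ j)) \<xi>))))"
      by (intro Bochner_Integration.integrable_add integrable_mult_right ie qw q'w)
    show "AE \<xi> in lborel. (\<Sum>j\<in>UNIV. ?c j * (?q \<xi> * (h j \<xi> \<bullet> rep_L2 (X j) \<xi>)))
      \<le> (\<Lambda> + 2 * \<epsilon>) * (\<Sum>j\<in>UNIV. ?c j * (?q \<xi> * (h j \<xi> \<bullet> rep_L2 (fourier (u $ j)) \<xi>)))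
        + 1/2 * (\<Sum>j\<in>UNIV. ?c j * (?q' \<xi> * (h j \<xi> \<bullet> rep_L2 (fourier (u $ j)) \<xi>)))"
      using pw
    proof eventually_elim
      case (elim \<xi>)
      have "?q \<xi> * (\<Sum>j\<in>UNIV. ?c j * (h j \<xi> \<bullet> rep_L2 (X j) \<xi>)) \<le> ?q \<xi> * ((\<Lambda> + 2 * \<epsilon> + N * ghost_rate \<xi>) * ?E \<xi>)"
        using elim ghost_pos[of N \<xi>] by (intro mult_left_mono) auto
      also have "\<dots> = (\<Lambda> + 2 * \<epsilon>) * (?q \<xi> * ?E \<xi>) + 1/2 * (?q' \<xi> * ?E \<xi>)" by (simp add: algebra_simps)
      finally show ?case by (simp add: sum_distrib_left mult_ac h_def)
    qed
  qed
  also have "\<dots> = (\<Lambda> + 2 * \<epsilon>) * energy f \<delta> N u u + 1/2 * (\<Sum>j\<in>UNIV. ?c j * inner (fourier (u $ j)) (rmult ?q' (fourier (u $ j))))"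
    unfolding energy_def se[OF qw] se[OF q'w]
    by (subst Bochner_Integration.integral_add) (auto intro!: integrable_mult_right ie qw q'w)
  also have "(\<Sum>j\<in>UNIV. ?c j * inner (fourier (u $ j)) (rmult ?q' (fourier (u $ j)))) = 2 * (\<Sum>j\<in>UNIV. ?c j * inner (fourier (u $ j)) (rmult ?q (fourier (k j))))"
    unfolding sum_distrib_left ghost_transport[OF N0 k, symmetric] inner_rmult_commute[OF qw, of "fourier (k _)"]
    by (intro sum.cong refl) simp
  also have "(\<Sum>j\<in>UNIV. ?c j * inner (fourier (u $ j)) (rmult ?q (X j)))
    = energy f \<delta> N u (couette_op f \<nu> u) + (\<Sum>j\<in>UNIV. ?c j * inner (fourier (u $ j)) (rmult ?q (fourier (k j))))"
    unfolding energy_def X_def fourier_add Q.add inner_add_right distrib_left sum.distrib ..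
  finally show ?thesis by simp
qed

section \<open>Complex scalars\<close>

lemma scaleC_field_nth [simp]: "scaleC_field c u $ j = scaleC_L2 c (u $ j)"
  by (simp add: scaleC_field_def)

lemma scaleC_L2_add_left: "scaleC_L2 (c + d) u = scaleC_L2 c u + scaleC_L2 d u"
proof -
  have "AE x in lborel. rep_L2 (scaleC_L2 (c + d) u) x = rep_L2 (scaleC_L2 c u + scaleC_L2 d u) x"
    using rep_L2_scaleC[of "c + d" u] rep_L2_scaleC[of c u] rep_L2_scaleC[of d u] rep_L2_add[of "scaleC_L2 c u" "scaleC_L2 d u"]
    by eventually_elim (simp add: distrib_right)
  then show ?thesis by (rule L2_eqI)
qed

lemma scaleC_field_scaleC: "scaleC_field c (scaleC_field d u) = scaleC_field (c * d) u"
  by (simp add: vec_eq_iff scaleC_L2_scaleC)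

lemma scaleC_field_one [simp]: "scaleC_field 1 u = u"
  by (simp add: vec_eq_iff)

lemma scaleR_scaleC_field: "r *\<^sub>R u = scaleC_field (of_real r) u"
  by (simp add: vec_eq_iff scaleR_scaleC_L2)

lemma norm_scaleC_field: "norm (scaleC_field c u) = cmod c * norm u"
  by (simp add: norm_vec_def norm_scaleC_L2 L2_set_right_distrib)

lemma bounded_bilinear_scaleC_field: "bounded_bilinear scaleC_field"
proof (rule bounded_bilinear.intro)
  show "scaleC_field (c + d) u = scaleC_field c u + scaleC_field d u" for c d u
    by (simp add: vec_eq_iff scaleC_L2_add_left)
  show "scaleC_field c (u + v) = scaleC_field c u + scaleC_field c v" for c u v
    by (simp add: vec_eq_iff scaleC_L2_add)
  show "scaleC_field (r *\<^sub>R c) u = r *\<^sub>R scaleC_field c u" for r c u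
    by (simp add: vec_eq_iff scaleR_scaleC_L2 scaleC_L2_scaleC scaleR_conv_of_real)
  show "scaleC_field c (r *\<^sub>R u) = r *\<^sub>R scaleC_field c u" for r c u
    by (simp add: vec_eq_iff scaleR_scaleC_L2 scaleC_L2_scaleC mult.commute)
  show "\<exists>K. \<forall>c u. norm (scaleC_field c u) \<le> norm c * norm u * K"
    by (intro exI[of _ 1]) (simp add: norm_scaleC_field)
qed

lemma distr_of_scaleC: "distr_of (scaleC_L2 c u) \<phi> = c * distr_of u \<phi>" if "\<phi> \<in> test_functions"
proof -
  have [measurable]: "\<phi> \<in> borel_measurable borel" using that by (rule test_functions_measurable)
  have "distr_of (scaleC_L2 c u) \<phi> = (\<integral>x. c * (rep_L2 u x * \<phi> x) \<partial>lborel)"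
    unfolding distr_of_def
  proof (rule integral_cong_AE)
    show "AE x in lborel. rep_L2 (scaleC_L2 c u) x * \<phi> x = c * (rep_L2 u x * \<phi> x)"
      using rep_L2_scaleC[of c u] by eventually_elim simp
  qed measurable
  then show ?thesis by (simp add: distr_of_def)
qed

lemma represents_y_dx_scaleC:
  assumes "represents k (y_dx u)"
  shows "represents (scaleC_L2 c k) (y_dx (scaleC_L2 c u))"
proof -
  have "y_dx (scaleC_L2 c u) \<phi> = c * y_dx u \<phi>" if "\<phi> \<in> test_functions" for \<phi>
    using that by (simp add: distr_of_scaleC y_dx_def distr_mult_def distr_pd_def test_functions_pd test_functions_mult Ck_coord)
  then show ?thesis using assms by (simp add: represents_def distr_of_scaleC)
qed

lemma represents_laplacian_scaleC:
  assumes "represents k (nu_laplacian \<nu> u)"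
  shows "represents (scaleC_L2 c k) (nu_laplacian \<nu> (scaleC_L2 c u))"
  using assms unfolding represents_def
  by (simp add: distr_of_scaleC nu_laplacian_def distr_pd_def test_functions_pd sum_distrib_left[symmetric] mult.left_commute)

lemma couette_domI:
  assumes "\<And>j. represents (p j) (nu_laplacian \<nu> (u $ j))" "\<And>j. represents (k j) (y_dx (u $ j))"
  shows "u \<in> couette_dom \<nu>"
  using assms by (auto simp: couette_dom_def in_L2_def)

lemma couette_scaleC:
  assumes u: "u \<in> couette_dom \<nu>"
  shows "scaleC_field c u \<in> couette_dom \<nu>" "couette_op f \<nu> (scaleC_field c u) = scaleC_field c (couette_op f \<nu> u)"
proof -
  have p: "represents (to_L2 (nu_laplacian \<nu> (u $ j))) (nu_laplacian \<nu> (u $ j))"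
    and k: "represents (to_L2 (y_dx (u $ j))) (y_dx (u $ j))" for j
    using u by (auto simp: couette_dom_def intro!: represents_to_L2)
  note pc = represents_laplacian_scaleC[OF p, of c] and kc = represents_y_dx_scaleC[OF k, of c]
  show "scaleC_field c u \<in> couette_dom \<nu>"
    by (rule couette_domI[of "\<lambda>j. scaleC_L2 c (to_L2 (nu_laplacian \<nu> (u $ j)))" _ _ "\<lambda>j. scaleC_L2 c (to_L2 (y_dx (u $ j)))"])
       (simp_all add: pc kc)
  have lin: "scaleC_L2 c (x - y) = scaleC_L2 c x - scaleC_L2 c y" "scaleC_L2 c (r *\<^sub>R x) = r *\<^sub>R scaleC_L2 c x" 
    "scaleC_L2 c (- x) = - scaleC_L2 c x" for x y r
    using bounded_linear_scaleC_L2[of c] 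
    by (auto simp: bounded_linear.linear linear_diff linear_scale linear_neg)
  show "couette_op f \<nu> (scaleC_field c u) = scaleC_field c (couette_op f \<nu> u)"
    unfolding vec_eq_iff forall_3 scaleC_field_nth couette_op_components
    by (simp add: to_L2_eq[OF pc] to_L2_eq[OF kc] riesz_scaleC lin scaleC_L2_add)
qed

section \<open>Upper bounds\<close>

text \<open>The constants of the energy method for a loss of \<open>\<epsilon>\<close>, with \<open>\<epsilon>/4\<close> spent on each of the two error
  terms: \<open>error_const\<close> is the factor of the error symbols, \<open>weight_exp\<close> the exponent \<open>N\<close> that absorbs
  them, and \<open>third_weight\<close> is so small that the third component costs at most \<open>\<epsilon>/4\<close>. All three weights
  are at least \<open>weight_floor \<cdot> min 1 \<epsilon>\<close>, so the energy and the squared norm are equivalent with ratio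
  \<open>growth_const\<^sup>2\<close>.\<close>

definition \<Lambda>f :: "real \<Rightarrow> real" where "\<Lambda>f f = sqrt (f * (1 - f))"

definition error_const :: "real \<Rightarrow> real" where "error_const f = 2 + f / \<Lambda>f f"

definition weight_exp :: "real \<Rightarrow> real \<Rightarrow> real" where
  "weight_exp f \<epsilon> = error_const f + (error_const f)\<^sup>2 / \<epsilon>"

definition third_weight :: "real \<Rightarrow> real \<Rightarrow> real" where
  "third_weight f \<epsilon> = min 1 \<epsilon> * \<Lambda>f f * (1 - f) / 8"

definition weight_floor :: "real \<Rightarrow> real" where
  "weight_floor f = \<Lambda>f f * f * (1 - f) / 8"

definition growth_const :: "real \<Rightarrow> real \<Rightarrow> real" where
  "growth_const f \<epsilon> = sqrt (1 / (weight_floor f * min 1 \<epsilon>)) * exp (pi * weight_exp f \<epsilon>)"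

abbreviation (input) energy\<^sub>\<epsilon> :: "real \<Rightarrow> real \<Rightarrow> L2_field \<Rightarrow> L2_field \<Rightarrow> real" where
  "energy\<^sub>\<epsilon> f \<epsilon> \<equiv> energy f (third_weight f \<epsilon>) (weight_exp f \<epsilon>)"

context
  fixes f \<epsilon> :: real
  assumes f: "0 < f" "f < 1" and \<epsilon>: "\<epsilon> > 0"
begin

lemma \<Lambda>f_pos: "0 < \<Lambda>f f" and \<Lambda>f_le: "\<Lambda>f f \<le> 1"
proof -
  show "0 < \<Lambda>f f" using f by (simp add: \<Lambda>f_def)
  have "f * (1 - f) \<le> 1 * 1" using f by (intro mult_mono) auto
  then show "\<Lambda>f f \<le> 1" by (simp add: \<Lambda>f_def)
qed

lemma weight_exp_nonneg: "0 \<le> weight_exp f \<epsilon>"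
  using f \<epsilon> \<Lambda>f_pos by (simp add: weight_exp_def error_const_def)

lemma weight_floor_pos: "0 < weight_floor f"
  using f \<Lambda>f_pos by (simp add: weight_floor_def)

lemma energy_weight_bounds:
  "weight_floor f * min 1 \<epsilon> \<le> energy_weight f (third_weight f \<epsilon>) j"
  "energy_weight f (third_weight f \<epsilon>) j \<le> 1"
proof -
  have L: "0 \<le> \<Lambda>f f" "\<Lambda>f f \<le> 1" using \<Lambda>f_pos \<Lambda>f_le by auto
  have m: "0 \<le> min 1 \<epsilon>" "min 1 \<epsilon> \<le> 1" using \<epsilon> by auto
  have a: "\<Lambda>f f * (1 - f) \<le> 1" "\<Lambda>f f * f \<le> 1" using L f by (auto intro!: mult_le_one)
  have w1: "weight_floor f * min 1 \<epsilon> \<le> f"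
  proof -
    have "(\<Lambda>f f * (1 - f)) * min 1 \<epsilon> * f \<le> 1 * 1 * f" using a m L f by (intro mult_mono) auto
    then show ?thesis using f by (simp add: weight_floor_def mult_ac)
  qed
  have w2: "weight_floor f * min 1 \<epsilon> \<le> 1 - f"
  proof -
    have "(\<Lambda>f f * f) * min 1 \<epsilon> * (1 - f) \<le> 1 * 1 * (1 - f)" using a m L f by (intro mult_mono) auto
    then have "(\<Lambda>f f * f) * min 1 \<epsilon> * (1 - f) / 8 \<le> (1 - f) / 8" by (simp only: mult_1 divide_right_mono)
    also have "\<dots> \<le> 1 - f" using f by simp
    finally have "(\<Lambda>f f * f) * min 1 \<epsilon> * (1 - f) / 8 \<le> 1 - f" .
    then show ?thesis by (simp add: weight_floor_def mult_ac)
  qed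
  have w3: "weight_floor f * min 1 \<epsilon> \<le> third_weight f \<epsilon>"
  proof -
    have "(\<Lambda>f f * (1 - f) * min 1 \<epsilon>) * f \<le> (\<Lambda>f f * (1 - f) * min 1 \<epsilon>) * 1" using L f m by (intro mult_left_mono) auto
    then show ?thesis by (simp add: weight_floor_def third_weight_def mult_ac)
  qed
  have w4: "third_weight f \<epsilon> \<le> 1"
  proof -
    have "(\<Lambda>f f * (1 - f)) * min 1 \<epsilon> \<le> 1 * 1" using a m L f by (intro mult_mono) auto
    then show ?thesis by (simp add: third_weight_def mult_ac)
  qed
  show "weight_floor f * min 1 \<epsilon> \<le> energy_weight f (third_weight f \<epsilon>) j"
    "energy_weight f (third_weight f \<epsilon>) j \<le> 1"
    using w1 w2 w3 w4 f by (auto simp: energy_weight_def)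
qed

lemma energy_norm_bounds:
  "(2 * pi)^3 * (weight_floor f * min 1 \<epsilon> * exp (- (pi * weight_exp f \<epsilon>))) * (norm u)\<^sup>2 \<le> energy\<^sub>\<epsilon> f \<epsilon> u u"
  "energy\<^sub>\<epsilon> f \<epsilon> u u \<le> (2 * pi)^3 * exp (pi * weight_exp f \<epsilon>) * (norm u)\<^sup>2"
proof -
  have c: "0 \<le> weight_floor f * min 1 \<epsilon>" using weight_floor_pos \<epsilon> by simp
  show "(2 * pi)^3 * (weight_floor f * min 1 \<epsilon> * exp (- (pi * weight_exp f \<epsilon>))) * (norm u)\<^sup>2 \<le> energy\<^sub>\<epsilon> f \<epsilon> u u"
    using energy_bounds(1)[OF weight_exp_nonneg energy_weight_bounds c] by simp
  show "energy\<^sub>\<epsilon> f \<epsilon> u u \<le> (2 * pi)^3 * exp (pi * weight_exp f \<epsilon>) * (norm u)\<^sup>2"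
    using energy_bounds(2)[OF weight_exp_nonneg energy_weight_bounds c] by simp
qed

lemma energy_pos: "u \<noteq> 0 \<Longrightarrow> energy\<^sub>\<epsilon> f \<epsilon> u u > 0"
  by (rule less_le_trans[OF _ energy_norm_bounds(1)]) (use weight_floor_pos \<epsilon> in auto)

text \<open>Comparing norms through the energy costs the factor \<^const>\<open>growth_const\<close>.\<close>

lemma norm_le_of_energy_le:
  assumes le: "energy\<^sub>\<epsilon> f \<epsilon> u u \<le> r\<^sup>2 * energy\<^sub>\<epsilon> f \<epsilon> v v" and r: "r \<ge> 0"
  shows "norm u \<le> r * growth_const f \<epsilon> * norm v"
proof (rule power2_le_imp_le)
  let ?c = "weight_floor f * min 1 \<epsilon>" and ?e = "exp (pi * weight_exp f \<epsilon>)"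
  have c: "?c > 0" using weight_floor_pos \<epsilon> by simp
  have "(2 * pi)^3 * (?c * exp (- (pi * weight_exp f \<epsilon>))) * (norm u)\<^sup>2 \<le> r\<^sup>2 * ((2 * pi)^3 * ?e * (norm v)\<^sup>2)"
    by (rule order_trans[OF energy_norm_bounds(1) order_trans[OF le mult_left_mono[OF energy_norm_bounds(2)]]]) simp
  also have "\<dots> = (2 * pi)^3 * (r\<^sup>2 * ?e * (norm v)\<^sup>2)" by (simp only: mult_ac)
  finally have "(2 * pi)^3 * (?c / ?e * (norm u)\<^sup>2) \<le> (2 * pi)^3 * (r\<^sup>2 * ?e * (norm v)\<^sup>2)"
    by (simp only: exp_minus divide_inverse mult_ac)
  then have "?c / ?e * (norm u)\<^sup>2 \<le> r\<^sup>2 * ?e * (norm v)\<^sup>2" by (subst (asm) mult_le_cancel_left_pos) auto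
  then have "(norm u)\<^sup>2 \<le> r\<^sup>2 * ?e * (norm v)\<^sup>2 / (?c / ?e)" using c by (subst pos_le_divide_eq) (auto simp: mult.commute)
  also have "\<dots> = (r * growth_const f \<epsilon> * norm v)\<^sup>2"
  proof -
    have "(sqrt (1 / ?c))\<^sup>2 = 1 / ?c" using c by (intro real_sqrt_pow2) simp
    then show ?thesis unfolding growth_const_def power_mult_distrib by (simp add: power2_eq_square)
  qed
  finally show "(norm u)\<^sup>2 \<le> (r * growth_const f \<epsilon> * norm v)\<^sup>2" .
  show "0 \<le> r * growth_const f \<epsilon> * norm v" using r c by (simp add: growth_const_def)
qed

lemma couette_dissipation:
  assumes "\<nu> > 0" "u \<in> couette_dom \<nu>"
  shows "energy\<^sub>\<epsilon> f \<epsilon> u (couette_op f \<nu> u) \<le> (\<Lambda>f f + \<epsilon> / 2) * energy\<^sub>\<epsilon> f \<epsilon> u u"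
proof -
  have e4: "\<epsilon> / 4 > 0" using \<epsilon> by simp
  have d: "0 < third_weight f \<epsilon>" using f \<epsilon> \<Lambda>f_pos by (simp add: third_weight_def)
  have d2: "third_weight f \<epsilon> * 2 / (\<Lambda>f f * (1 - f)) \<le> \<epsilon> / 4"
  proof -
    define L where "L = \<Lambda>f f * (1 - f)"
    have "L \<noteq> 0" using f \<Lambda>f_pos by (simp add: L_def)
    moreover have t: "third_weight f \<epsilon> = min 1 \<epsilon> * L / 8" by (simp add: third_weight_def L_def mult.assoc)
    ultimately have "third_weight f \<epsilon> * 2 / L = min 1 \<epsilon> / 4" unfolding t by simp
    then show ?thesis by (simp add: L_def)
  qed
  have N: "weight_exp f \<epsilon> = error_const f + (error_const f)\<^sup>2 / (4 * (\<epsilon> / 4))" by (simp add: weight_exp_def)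
  show ?thesis
    using energy_dissipation[OF f \<Lambda>f_def assms(1) e4 d d2 error_const_def N assms(2)] by simp
qed

lemma energy_scaleC: "energy\<^sub>\<epsilon> f \<epsilon> u (scaleC_field z u) = Re z * energy\<^sub>\<epsilon> f \<epsilon> u u"
proof -
  have "inner h (rmult (ghost N) (scaleC_L2 z h)) = Re z * inner h (rmult (ghost N) h)" if N: "N \<ge> 0" for N h
  proof -
    note w = inner_rmult[OF ghost_weight[OF N]]
    have "inner h (rmult (ghost N) (scaleC_L2 z h)) = (\<integral>\<xi>. Re z * (ghost N \<xi> * (rep_L2 h \<xi> \<bullet> rep_L2 h \<xi>)) \<partial>lborel)"
      unfolding w(1)
    proof (rule integral_cong_AE)
      show "AE \<xi> in lborel. ghost N \<xi> * (rep_L2 h \<xi> \<bullet> rep_L2 (scaleC_L2 z h) \<xi>) = Re z * (ghost N \<xi> * (rep_L2 h \<xi> \<bullet> rep_L2 h \<xi>))"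
        using rep_L2_scaleC[of z h] by eventually_elim (simp add: inner_complex_def algebra_simps)
    qed measurable
    then show ?thesis by (simp add: w(1))
  qed
  from this[OF weight_exp_nonneg] show ?thesis
    unfolding energy_def by (simp add: fourier_scaleC sum_distrib_left mult.left_commute)
qed

text \<open>With \<open>v = (z - \<L>) u\<close> dissipativity gives \<open>(\<epsilon>/2) B u u \<le> B u v\<close>, and Cauchy--Schwarz for the
  energy turns this into a bound of \<open>u\<close> by \<open>(2/\<epsilon>) v\<close>.\<close>

lemma resolvent_a_priori:
  assumes "\<nu> > 0" "u \<in> couette_dom \<nu>" and z: "Re z \<ge> \<Lambda>f f + \<epsilon>"
  shows "norm u \<le> 2 / \<epsilon> * growth_const f \<epsilon> * norm (scaleC_field z u - couette_op f \<nu> u)"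
proof (rule norm_le_of_energy_le)
  let ?v = "scaleC_field z u - couette_op f \<nu> u" and ?B = "energy\<^sub>\<epsilon> f \<epsilon>"
  interpret B: bounded_bilinear ?B by (rule bounded_bilinear_energy[OF weight_exp_nonneg])
  have nn: "0 \<le> ?B w w" for w
    by (cases "w = 0") (auto simp: B.zero_left intro: less_imp_le energy_pos)
  have "(\<epsilon> / 2) * ?B u u \<le> (Re z - (\<Lambda>f f + \<epsilon> / 2)) * ?B u u"
    using z nn by (intro mult_right_mono) auto
  also have "\<dots> \<le> ?B u ?v"
    using couette_dissipation[OF assms(1,2)] by (simp add: B.diff_right energy_scaleC algebra_simps)
  finally have 1: "(\<epsilon> / 2) * ?B u u \<le> ?B u ?v" .
  \<comment> \<open>Cauchy--Schwarz in the form needed here is positivity of one square.\<close>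
  have "0 \<le> ?B ((\<epsilon> / 2) *\<^sub>R u - ?v) ((\<epsilon> / 2) *\<^sub>R u - ?v)" by (rule nn)
  also have "\<dots> = (\<epsilon> / 2) * (\<epsilon> / 2) * ?B u u - \<epsilon> * ?B u ?v + ?B ?v ?v"
    unfolding B.diff_left[of "(\<epsilon> / 2) *\<^sub>R u"] B.diff_right[of _ "(\<epsilon> / 2) *\<^sub>R u"] B.scaleR_left B.scaleR_right
      energy_sym[OF weight_exp_nonneg, of f _ ?v u] by (simp add: algebra_simps)
  finally have "\<epsilon> * ?B u ?v \<le> \<epsilon>\<^sup>2 / 4 * ?B u u + ?B ?v ?v" by (simp add: power2_eq_square)
  moreover have "\<epsilon> * ((\<epsilon> / 2) * ?B u u) \<le> \<epsilon> * ?B u ?v" using 1 \<epsilon> by (intro mult_left_mono) auto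
  ultimately have "\<epsilon>\<^sup>2 / 4 * ?B u u \<le> ?B ?v ?v" by (simp add: power2_eq_square)
  then show "?B u u \<le> (2 / \<epsilon>)\<^sup>2 * ?B ?v ?v" using \<epsilon> by (simp add: power_divide field_simps)
qed (use \<epsilon> in simp)

context
  fixes \<nu> :: real and T :: "real \<Rightarrow> L2_field \<Rightarrow>\<^sub>L L2_field"
  assumes \<nu>: "\<nu> > 0" and T: "generates (couette_dom \<nu>) (couette_op f \<nu>) T"
begin

lemma C0: "C0_semigroup T"
  using T by (simp add: generates_def)

lemma graph_iff: "(u, v) \<in> generator_graph T \<longleftrightarrow> u \<in> couette_dom \<nu> \<and> v = couette_op f \<nu> u"
  using T by (auto simp: generates_def)

lemma graph_dissipation: "(u, v) \<in> generator_graph T \<Longrightarrow> energy\<^sub>\<epsilon> f \<epsilon> u v \<le> (\<Lambda>f f + \<epsilon> / 2) * energy\<^sub>\<epsilon> f \<epsilon> u u"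
  using couette_dissipation[OF \<nu>] by (auto simp: graph_iff)

lemma semigroup_upper_bound:
  assumes t: "t \<ge> 0"
  shows "norm (T t) \<le> growth_const f \<epsilon> * exp ((\<Lambda>f f + \<epsilon> / 2) * t)"
proof (rule norm_blinfun_bound)
  show "0 \<le> growth_const f \<epsilon> * exp ((\<Lambda>f f + \<epsilon> / 2) * t)"
    using weight_floor_pos \<epsilon> by (simp add: growth_const_def)
  fix u
  have "energy\<^sub>\<epsilon> f \<epsilon> (T t u) (T t u) \<le> exp (2 * (\<Lambda>f f + \<epsilon> / 2) * t) * energy\<^sub>\<epsilon> f \<epsilon> u u"
    by (rule energy_growth[OF C0 bounded_bilinear_energy energy_sym graph_dissipation t]) (rule weight_exp_nonneg | assumption)+
  also have "exp (2 * (\<Lambda>f f + \<epsilon> / 2) * t) = (exp ((\<Lambda>f f + \<epsilon> / 2) * t))\<^sup>2"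
    by (simp add: power2_eq_square exp_add[symmetric])
  finally show "norm (T t u) \<le> growth_const f \<epsilon> * exp ((\<Lambda>f f + \<epsilon> / 2) * t) * norm u"
    using norm_le_of_energy_le[of "T t u" "exp ((\<Lambda>f f + \<epsilon> / 2) * t)" u] by (simp add: mult_ac)
qed

text \<open>The semigroup consists of real-linear operators; that it is complex-linear follows from
  complex linearity of its generator. The resolvent at a non-real point relies on it.\<close>

lemma semigroup_scaleC:
  assumes t: "t \<ge> 0"
  shows "T t (scaleC_field c u) = scaleC_field c (T t u)"
  by (rule semigroup_commute[OF C0 bounded_bilinear_energy energy_sym graph_dissipation energy_pos
        bounded_bilinear.bounded_linear_right[OF bounded_bilinear_scaleC_field] _ t])
     (auto simp: weight_exp_nonneg graph_iff couette_scaleC)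

subsection \<open>The resolvent\<close>

text \<open>The rescaled semigroup \<open>e\<^sup>-\<^sup>z\<^sup>t T(t)\<close> decays and its generator is \<open>\<L> - z\<close>, hence \<open>z - \<L>\<close> is onto.\<close>

lemma resolvent_onto:
  assumes z: "Re z \<ge> \<Lambda>f f + \<epsilon>"
  shows "\<exists>u\<in>couette_dom \<nu>. scaleC_field z u - couette_op f \<nu> u = v"
proof -
  interpret J: bounded_bilinear scaleC_field by (rule bounded_bilinear_scaleC_field)
  define sc where "sc c = Blinfun (scaleC_field c)" for c
  have sc: "sc c u = scaleC_field c u" for c u
    unfolding sc_def by (rule bounded_linear_Blinfun_apply[OF J.bounded_linear_right, THEN fun_cong])
  define S where "S t = sc (exp (- z * of_real t)) o\<^sub>L T t" for t
  have S: "S t u = scaleC_field (exp (- z * of_real t)) (T t u)" for t u by (simp add: S_def sc)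
  have C0S: "C0_semigroup S"
    unfolding C0_semigroup_def
  proof (intro conjI allI impI)
    show "S 0 = id_blinfun" by (rule blinfun_eqI) (simp add: S semigroup_0[OF C0])
    fix s t :: real assume st: "0 \<le> s" "0 \<le> t"
    show "S (s + t) = S s o\<^sub>L S t"
    proof (rule blinfun_eqI)
      fix u
      have "exp (- z * of_real (s + t)) = exp (- z * of_real s) * exp (- z * of_real t)"
        by (simp add: exp_add[symmetric] algebra_simps)
      then show "S (s + t) u = (S s o\<^sub>L S t) u"
        using st by (simp add: S semigroup_add[OF C0] semigroup_scaleC scaleC_field_scaleC)
    qed
  next
    fix u
    have "((\<lambda>t. exp (- z * of_real t)) \<longlongrightarrow> exp (- z * of_real 0)) (at_right 0)" by (intro tendsto_intros)
    then have "((\<lambda>t. scaleC_field (exp (- z * of_real t)) (T t u)) \<longlongrightarrow> scaleC_field (exp (- z * of_real 0)) u) (at_right 0)"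
      by (intro J.tendsto semigroup_right[OF C0])
    then show "((\<lambda>t. S t u) \<longlongrightarrow> u) (at_right 0)" by (simp add: S)
  qed
  have decay: "norm (S t) \<le> growth_const f \<epsilon> * exp (- (\<epsilon> / 2) * t)" if t: "t \<ge> 0" for t
  proof (rule norm_blinfun_bound)
    show "0 \<le> growth_const f \<epsilon> * exp (- (\<epsilon> / 2) * t)" using weight_floor_pos \<epsilon> by (simp add: growth_const_def)
    fix u
    have "norm (S t u) = exp (- Re z * t) * norm (T t u)" by (simp add: S norm_scaleC_field)
    also have "\<dots> \<le> exp (- (\<Lambda>f f + \<epsilon>) * t) * (growth_const f \<epsilon> * exp ((\<Lambda>f f + \<epsilon> / 2) * t) * norm u)"
    proof (rule mult_mono)
      show "exp (- Re z * t) \<le> exp (- (\<Lambda>f f + \<epsilon>) * t)" using mult_right_mono[OF z t] by (simp add: algebra_simps)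
      show "norm (T t u) \<le> growth_const f \<epsilon> * exp ((\<Lambda>f f + \<epsilon> / 2) * t) * norm u"
        by (rule order_trans[OF norm_blinfun mult_right_mono[OF semigroup_upper_bound[OF t]]]) simp
    qed auto
    also have "\<dots> = growth_const f \<epsilon> * (exp (- (\<Lambda>f f + \<epsilon>) * t) * exp ((\<Lambda>f f + \<epsilon> / 2) * t)) * norm u" by (simp only: mult_ac)
    also have "exp (- (\<Lambda>f f + \<epsilon>) * t) * exp ((\<Lambda>f f + \<epsilon> / 2) * t) = exp (- (\<epsilon> / 2) * t)"
      by (simp add: exp_add[symmetric] algebra_simps)
    finally show "norm (S t u) \<le> growth_const f \<epsilon> * exp (- (\<epsilon> / 2) * t) * norm u" .
  qed
  obtain u where u: "(u, - v) \<in> generator_graph S"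
    using generator_onto_of_decay[OF C0S decay, of v] \<epsilon> by auto
  have lim1: "((\<lambda>h. scaleC_field (exp (z * of_real h)) ((S h u - u) /\<^sub>R h)) \<longlongrightarrow> scaleC_field (exp (z * of_real 0)) (- v)) (at_right 0)"
    using u by (intro J.tendsto tendsto_intros) (simp add: generator_graph_def)
  have "((\<lambda>t. exp (t *\<^sub>R z)) has_vector_derivative z) (at 0)"
    using exp_scaleR_has_vector_derivative_right[of z 0 UNIV] by simp
  then have "((\<lambda>h. (exp (z * of_real h) - 1) /\<^sub>R h) \<longlongrightarrow> z) (at 0)"
    unfolding has_vector_derivative_at_quotient by (simp add: scaleR_conv_of_real mult.commute)
  then have "((\<lambda>h. (exp (z * of_real h) - 1) /\<^sub>R h) \<longlongrightarrow> z) (at_right 0)"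
    by (rule filterlim_mono) (auto simp: at_le)
  then have lim2: "((\<lambda>h. scaleC_field ((exp (z * of_real h) - 1) /\<^sub>R h) u) \<longlongrightarrow> scaleC_field z u) (at_right 0)"
    by (intro J.tendsto tendsto_const)
  have "((\<lambda>h. (T h u - u) /\<^sub>R h) \<longlongrightarrow> scaleC_field (exp (z * of_real 0)) (- v) + scaleC_field z u) (at_right 0)"
  proof (rule Lim_transform_eventually[OF tendsto_add[OF lim1 lim2]], intro always_eventually allI)
    fix h :: real
    have "exp (z * of_real h) * exp (- z * of_real h) = 1" by (simp add: exp_add[symmetric])
    then have "scaleC_field (exp (z * of_real h)) (S h u) = T h u"
      by (simp add: S scaleC_field_scaleC)
    then show "scaleC_field (exp (z * of_real h)) ((S h u - u) /\<^sub>R h) + scaleC_field ((exp (z * of_real h) - 1) /\<^sub>R h) u = (T h u - u) /\<^sub>R h"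
      by (simp add: J.scaleR_right J.scaleR_left J.diff_right J.diff_left scaleR_diff_right)
  qed
  then have "(u, scaleC_field z u - v) \<in> generator_graph T"
    by (simp add: generator_graph_def)
  then show ?thesis by (intro bexI[of _ u]) (auto simp: graph_iff algebra_simps)
qed

lemma resolvent_bound:
  assumes z: "Re z \<ge> \<Lambda>f f + \<epsilon>"
  shows "\<exists>R. is_resolvent (couette_dom \<nu>) (couette_op f \<nu>) z R \<and> norm R \<le> 2 / \<epsilon> * growth_const f \<epsilon>"
proof -
  interpret J: bounded_bilinear scaleC_field by (rule bounded_bilinear_scaleC_field)
  let ?A = "\<lambda>u. scaleC_field z u - couette_op f \<nu> u" and ?C = "2 / \<epsilon> * growth_const f \<epsilon>"
  have C: "?C \<ge> 0" using \<epsilon> weight_floor_pos by (simp add: growth_const_def)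
  obtain R0 where R0: "\<And>v. R0 v \<in> couette_dom \<nu>" "\<And>v. ?A (R0 v) = v" using resolvent_onto[OF z] by metis
  have inj: "u = w" if "u \<in> couette_dom \<nu>" "w \<in> couette_dom \<nu>" "?A u = ?A w" for u w
  proof -
    have g: "(u - w, couette_op f \<nu> u - couette_op f \<nu> w) \<in> generator_graph T"
      using that by (intro generator_graph_diff[OF C0]) (auto simp: graph_iff)
    then have "u - w \<in> couette_dom \<nu>" and o: "couette_op f \<nu> (u - w) = couette_op f \<nu> u - couette_op f \<nu> w"
      by (auto simp: graph_iff)
    from resolvent_a_priori[OF \<nu> this(1) z] have "norm (u - w) \<le> ?C * norm (?A u - ?A w)"
      by (simp add: o J.diff_right algebra_simps)
    then show ?thesis using that(3) by simp
  qed
  have add: "(u + w) \<in> couette_dom \<nu> \<and> couette_op f \<nu> (u + w) = couette_op f \<nu> u + couette_op f \<nu> w"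
    if "u \<in> couette_dom \<nu>" "w \<in> couette_dom \<nu>" for u w
  proof -
    have w: "(- 1) *\<^sub>R w \<in> couette_dom \<nu> \<and> couette_op f \<nu> ((- 1) *\<^sub>R w) = (- 1) *\<^sub>R couette_op f \<nu> w"
      using couette_scaleC[OF that(2), where c = "-1"] by (simp only: scaleR_scaleC_field of_real_minus of_real_1)
    have "(u - (- 1) *\<^sub>R w, couette_op f \<nu> u - (- 1) *\<^sub>R couette_op f \<nu> w) \<in> generator_graph T"
      using that w by (intro generator_graph_diff[OF C0]) (auto simp: graph_iff)
    then show ?thesis by (simp add: graph_iff)
  qed
  have "bounded_linear R0"
  proof (rule bounded_linear_intro[of _ ?C])
    fix v w :: L2_field and r :: real
    show "R0 (v + w) = R0 v + R0 w"
    proof (rule inj)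
      show "?A (R0 (v + w)) = ?A (R0 v + R0 w)"
        using R0 add[OF R0(1)[of v] R0(1)[of w]] by (simp add: J.add_right algebra_simps)
    qed (use R0 add in auto)
    show "R0 (r *\<^sub>R v) = r *\<^sub>R R0 v"
    proof (rule inj)
      note s = couette_scaleC[OF R0(1)[of v], where c = "of_real r"]
      show "r *\<^sub>R R0 v \<in> couette_dom \<nu>" using s(1) by (simp add: scaleR_scaleC_field)
      have "?A (r *\<^sub>R R0 v) = r *\<^sub>R ?A (R0 v)"
        using s(2) by (simp add: scaleR_scaleC_field[symmetric] J.scaleR_right scaleR_diff_right)
      then show "?A (R0 (r *\<^sub>R v)) = ?A (r *\<^sub>R R0 v)" by (simp only: R0(2))
    qed (rule R0)
    show "norm (R0 v) \<le> norm v * ?C"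
      using resolvent_a_priori[OF \<nu> R0(1)[of v] z] by (simp add: R0(2) mult.commute)
  qed
  then have app: "blinfun_apply (Blinfun R0) = R0" by (rule bounded_linear_Blinfun_apply)
  have "is_resolvent (couette_dom \<nu>) (couette_op f \<nu>) z (Blinfun R0)"
    unfolding is_resolvent_def app using R0 inj by blast
  moreover have "norm (Blinfun R0) \<le> ?C"
    using resolvent_a_priori[OF \<nu> R0(1) z] C by (intro norm_blinfun_bound) (simp_all add: app R0(2))
  ultimately show ?thesis by blast
qed

end

end

text \<open>Up to factors that depend on \<open>f\<close> alone, \<open>growth_const f \<epsilon>\<close> is \<open>(min 1 \<epsilon>)\<^sup>-\<^sup>1\<^sup>/\<^sup>2\<close>, which is at most
  \<open>1 + 1/\<epsilon>\<close>, times an exponential of a multiple of \<open>1/\<epsilon>\<close>.\<close>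

lemma growth_const_le:
  assumes f: "0 < f" "f < 1"
  shows "\<exists>C>0. \<forall>\<epsilon>>0. 2 / \<epsilon> * growth_const f \<epsilon> \<le> C * (1 / \<epsilon>) * (1 + 1 / \<epsilon>) * exp (C / \<epsilon>)"
proof -
  let ?A = "2 * sqrt (1 / weight_floor f) * exp (pi * error_const f)" and ?B = "pi * (error_const f)\<^sup>2"
  have w: "weight_floor f > 0" using f by (simp add: weight_floor_def \<Lambda>f_def)
  have A: "?A > 0" using w by simp
  show ?thesis
  proof (intro exI[of _ "max ?A ?B"] conjI allI impI)
    show "max ?A ?B > 0" using A by (simp add: less_max_iff_disj)
    fix \<epsilon> :: real assume \<epsilon>: "\<epsilon> > 0"
    let ?m = "1 / min 1 \<epsilon>"
    have m: "1 \<le> ?m" "?m \<le> 1 + 1 / \<epsilon>" using \<epsilon> by (auto simp: min_def field_simps)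
    have "sqrt ?m \<le> ?m"
    proof (rule real_le_lsqrt)
      show "?m \<le> ?m\<^sup>2" using m(1) by (rule self_le_power) simp
    qed (use m \<epsilon> in auto)
    then have s: "sqrt ?m \<le> 1 + 1 / \<epsilon>" using m(2) by linarith
    have e: "exp (pi * weight_exp f \<epsilon>) = exp (pi * error_const f) * exp (?B / \<epsilon>)"
      by (simp add: weight_exp_def exp_add[symmetric] distrib_left)
    have "2 / \<epsilon> * growth_const f \<epsilon> = (?A * (1 / \<epsilon>)) * sqrt ?m * exp (?B / \<epsilon>)"
      unfolding growth_const_def e by (simp add: real_sqrt_mult real_sqrt_divide mult_ac)
    also have "\<dots> \<le> (max ?A ?B * (1 / \<epsilon>)) * (1 + 1 / \<epsilon>) * exp (max ?A ?B / \<epsilon>)"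
    proof (rule mult_mono[OF mult_mono[OF mult_right_mono[OF max.cobounded1] s]])
      have "0 < max ?A ?B" using A by (simp add: less_max_iff_disj)
      then show "0 \<le> max ?A ?B * (1 / \<epsilon>)" "0 \<le> max ?A ?B * (1 / \<epsilon>) * (1 + 1 / \<epsilon>)" using \<epsilon> by simp_all
      show "exp (?B / \<epsilon>) \<le> exp (max ?A ?B / \<epsilon>)"
        using divide_right_mono[OF max.cobounded2[of ?B ?A], of \<epsilon>] \<epsilon> by simp
    qed (use \<epsilon> m in auto)
    finally show "2 / \<epsilon> * growth_const f \<epsilon> \<le> max ?A ?B * (1 / \<epsilon>) * (1 + 1 / \<epsilon>) * exp (max ?A ?B / \<epsilon>)" .
  qed
qed

section \<open>Approximate eigenvectors\<close>

definition bump :: "real \<Rightarrow> real" where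
  "bump \<tau> = (max 0 (1 - \<tau>\<^sup>2))\<^sup>2"

definition bump_deriv :: "real \<Rightarrow> real" where
  "bump_deriv \<tau> = - 4 * \<tau> * max 0 (1 - \<tau>\<^sup>2)"

lemma bump_eq_0: "1 \<le> \<bar>\<tau>\<bar> \<Longrightarrow> bump \<tau> = 0" "1 \<le> \<bar>\<tau>\<bar> \<Longrightarrow> bump_deriv \<tau> = 0"
  by (auto simp: bump_def bump_deriv_def max_def abs_le_square_iff[of 1, simplified])

lemma bump_bounds: "0 \<le> bump \<tau>" "bump \<tau> \<le> 1" "\<bar>bump_deriv \<tau>\<bar> \<le> 4" "\<bar>\<tau>\<bar> \<le> 1/2 \<Longrightarrow> 9/16 \<le> bump \<tau>"
proof -
  have m: "0 \<le> max 0 (1 - \<tau>\<^sup>2)" "max 0 (1 - \<tau>\<^sup>2) \<le> 1" by auto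
  show "0 \<le> bump \<tau>" by (simp add: bump_def)
  show "bump \<tau> \<le> 1" unfolding bump_def using m by (intro power_le_one)
  show "\<bar>bump_deriv \<tau>\<bar> \<le> 4"
  proof (cases "1 \<le> \<bar>\<tau>\<bar>")
    case False
    then have "\<bar>\<tau>\<bar> * max 0 (1 - \<tau>\<^sup>2) \<le> 1 * 1" using m by (intro mult_mono) auto
    then show ?thesis using m by (simp add: bump_deriv_def abs_mult)
  qed (simp add: bump_eq_0)
  assume "\<bar>\<tau>\<bar> \<le> 1/2"
  then have "\<tau>\<^sup>2 \<le> (1/2)\<^sup>2" using power_mono[of "\<bar>\<tau>\<bar>" "1/2" 2] by simp
  then have "(3/4)\<^sup>2 \<le> (max 0 (1 - \<tau>\<^sup>2))\<^sup>2" by (intro power_mono) (auto simp: power2_eq_square)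
  then show "9/16 \<le> bump \<tau>" by (simp add: bump_def power2_eq_square)
qed

text \<open>This quadratic Taylor estimate makes difference quotients along a shear converge uniformly,
  at a rate, and with common support.\<close>

lemma bump_taylor:
  assumes r: "\<bar>r\<bar> \<le> 1"
  shows "\<bar>bump (\<tau> + r) - bump \<tau> - r * bump_deriv \<tau>\<bar> \<le> 27 * r\<^sup>2 * indicator {-2..2} \<tau>"
proof (cases "\<bar>\<tau>\<bar> \<le> 2")
  case False
  then show ?thesis using r by (auto simp: bump_eq_0)
next
  case True
  let ?p = "1 - \<tau>\<^sup>2" and ?q = "1 - (\<tau> + r)\<^sup>2"
  let ?m = "max 0 :: real \<Rightarrow> real"
  have sq: "\<bar>(?m q)\<^sup>2 - (?m p)\<^sup>2 - 2 * (q - p) * ?m p\<bar> \<le> (q - p)\<^sup>2" for p q :: real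
  proof -
    have d: "(q - p)\<^sup>2 = q * q - 2 * (q * p) + p * p" by (simp add: power2_eq_square algebra_simps)
    consider "0 \<le> p" "0 \<le> q" | "0 \<le> p" "q \<le> 0" | "p \<le> 0" "0 \<le> q" | "p \<le> 0" "q \<le> 0" by linarith
    then show ?thesis
    proof cases
      case 2
      then have m: "?m p = p" "?m q = 0" and "q * p \<le> 0" by (simp_all add: mult_nonpos_nonneg)
      moreover have "\<bar>(?m q)\<^sup>2 - (?m p)\<^sup>2 - 2 * (q - p) * ?m p\<bar> = \<bar>p * p - 2 * (q * p)\<bar>"
        unfolding m by (simp add: power2_eq_square algebra_simps)
      ultimately show ?thesis unfolding d by (simp only: m) (use zero_le_square[of p] zero_le_square[of q] in linarith)
    next
      case 3
      then have m: "?m p = 0" "?m q = q" and "q * p \<le> 0" by (simp_all add: mult_nonneg_nonpos)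
      have "\<bar>(?m q)\<^sup>2 - (?m p)\<^sup>2 - 2 * (q - p) * ?m p\<bar> = q * q" unfolding m by (simp add: power2_eq_square)
      then show ?thesis unfolding d using \<open>q * p \<le> 0\<close> zero_le_square[of p] by linarith
    next
      case 1
      then have m: "?m p = p" "?m q = q" by simp_all
      have "(?m q)\<^sup>2 - (?m p)\<^sup>2 - 2 * (q - p) * ?m p = (q - p)\<^sup>2" unfolding m by (simp add: power2_eq_square algebra_simps)
      then show ?thesis by simp
    next
      case 4
      then show ?thesis by simp
    qed
  qed
  have qp: "?q - ?p = - (r * (2 * \<tau> + r))" by (simp add: power2_eq_square algebra_simps)
  have x: "r * (- 4 * \<tau> * M) = 2 * (- (r * (2 * \<tau> + r))) * M + 2 * r\<^sup>2 * M" for M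
    by (simp add: power2_eq_square algebra_simps)
  have e: "bump (\<tau> + r) - bump \<tau> - r * bump_deriv \<tau> = ((?m ?q)\<^sup>2 - (?m ?p)\<^sup>2 - 2 * (?q - ?p) * ?m ?p) - 2 * r\<^sup>2 * ?m ?p"
    unfolding qp bump_def bump_deriv_def x by simp
  have "\<bar>bump (\<tau> + r) - bump \<tau> - r * bump_deriv \<tau>\<bar> \<le> (?q - ?p)\<^sup>2 + 2 * r\<^sup>2 * 1"
  proof -
    have "\<bar>2 * r\<^sup>2 * ?m ?p\<bar> \<le> 2 * r\<^sup>2 * 1" unfolding abs_mult by (intro mult_mono) auto
    then show ?thesis unfolding e using sq[where p = ?p and q = ?q] by linarith
  qed
  also have "(?q - ?p)\<^sup>2 = r\<^sup>2 * (2 * \<tau> + r)\<^sup>2" unfolding qp by (simp add: power_mult_distrib)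
  also have "\<dots> \<le> r\<^sup>2 * 5\<^sup>2"
    using True r power_mono[of "\<bar>2 * \<tau> + r\<bar>" 5 2] by (intro mult_left_mono) auto
  finally show ?thesis using True by (auto simp: indicator_def)
qed

definition packet_box :: "real \<Rightarrow> real \<Rightarrow> real \<Rightarrow> R3 set" where
  "packet_box \<alpha> \<gamma> w = cbox (vector [0, - w, \<gamma>]) (vector [\<alpha>, w, 2 * \<gamma>])"

lemma mem_packet_box:
  "\<xi> \<in> packet_box \<alpha> \<gamma> w \<longleftrightarrow> 0 \<le> \<xi> $ 1 \<and> \<xi> $ 1 \<le> \<alpha> \<and> \<bar>\<xi> $ 2\<bar> \<le> w \<and> \<gamma> \<le> \<xi> $ 3 \<and> \<xi> $ 3 \<le> 2 * \<gamma>"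
  by (auto simp: packet_box_def mem_box_cart forall_3 vector_3)

lemma prod_3: "prod f (UNIV :: 3 set) = f 1 * f 2 * f 3"
  unfolding UNIV_3 by (simp add: mult.assoc)

lemma packet_box_norm:
  assumes "0 < \<alpha>" "0 < \<gamma>" "0 < w"
  shows "square_integrable (indicator (packet_box \<alpha> \<gamma> w))"
    "(norm (abs_L2 (indicator (packet_box \<alpha> \<gamma> w))))\<^sup>2 = 2 * w * \<alpha> * \<gamma>"
proof -
  let ?B = "packet_box \<alpha> \<gamma> w"
  have i: "(\<lambda>\<xi>. (cmod (indicator ?B \<xi>))\<^sup>2) = indicat_real ?B" by (auto simp: indicator_def)
  have B: "?B \<in> sets borel" by (simp add: packet_box_def)
  have "emeasure lborel ?B < \<infinity>" unfolding packet_box_def by (rule emeasure_bounded_finite[OF bounded_cbox])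
  then have "integrable lborel (indicat_real ?B)" using B by (intro integrable_real_indicator) simp_all
  then show s: "square_integrable (indicator ?B)"
    unfolding square_integrable_def i using B by simp
  have ne: "cbox (vector [0, - w, \<gamma>] :: R3) (vector [\<alpha>, w, 2 * \<gamma>]) \<noteq> {}"
    unfolding interval_ne_empty_cart forall_3 vector_3 using assms by simp
  have "measure lborel ?B = \<alpha> * (w - - w) * (2 * \<gamma> - \<gamma>)"
    unfolding packet_box_def content_cbox_cart[OF ne] prod_3 by (simp add: vector_3)
  then show "(norm (abs_L2 (indicator ?B)))\<^sup>2 = 2 * w * \<alpha> * \<gamma>"
    unfolding norm_abs_L2_sq[OF s] i using B by simp
qed

lemma norm_abs_L2_mono:
  assumes "square_integrable f" "square_integrable g" "\<And>x. cmod (f x) \<le> c * cmod (g x)" "0 \<le> c"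
  shows "norm (abs_L2 f) \<le> c * norm (abs_L2 g)"
proof (rule power2_le_imp_le)
  have "(norm (abs_L2 f))\<^sup>2 \<le> (\<integral>x. (c * cmod (g x))\<^sup>2 \<partial>lborel)"
    unfolding norm_abs_L2_sq[OF assms(1)]
    using assms by (intro integral_mono power_mono) (auto simp: square_integrable_def power_mult_distrib)
  then show "(norm (abs_L2 f))\<^sup>2 \<le> (c * norm (abs_L2 g))\<^sup>2"
    by (simp add: norm_abs_L2_sq assms power_mult_distrib)
qed (use assms in simp)

lemma norm_le_via_fourier: "norm (fourier u) \<le> c * norm (fourier v) \<Longrightarrow> norm u \<le> c * norm v"
proof -
  assume "norm (fourier u) \<le> c * norm (fourier v)"
  then have "sqrt ((2 * pi)^3) * norm u \<le> sqrt ((2 * pi)^3) * (c * norm v)"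
    by (simp only: norm_fourier mult_ac)
  then show ?thesis by (subst (asm) mult_le_cancel_left_pos) auto
qed

text \<open>The packet is concentrated near the vertical frequency axis, where the Riesz symbols other than
  the \<open>33\<close> one are small. It is much narrower in \<open>\<xi>\<^sub>1\<close> than in \<open>\<xi>\<^sub>2\<close>, so that the transport
  \<open>\<xi>\<^sub>1 \<partial>\<^sub>2\<close> hardly moves it, and at so low a frequency that viscosity is negligible.\<close>

lemma packet:
  assumes \<eta>: "0 < \<eta>" "\<eta> \<le> 1" and \<nu>: "\<nu> > 0"
  shows "\<exists>g k p. g \<noteq> 0 \<and> represents k (y_dx g) \<and> represents p (nu_laplacian \<nu> g) \<and>
    norm k \<le> \<eta> * norm g \<and> norm p \<le> \<eta> * norm g \<and> (\<forall>i j. i \<noteq> 3 \<longrightarrow> norm (riesz i j g) \<le> \<eta> * norm g)"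
proof -
  \<comment> \<open>The choice of \<open>\<gamma>\<close> makes viscosity at most \<open>\<eta>\<close>, that of \<open>\<beta>\<close> the Riesz symbols and that of \<open>\<alpha>\<close> the
    transport term.\<close>
  define \<gamma> where "\<gamma> = sqrt (\<eta> / (6 * \<nu>))"
  define \<beta> where "\<beta> = \<eta> * \<gamma>"
  define \<alpha> where "\<alpha> = \<eta> * \<beta> / 16"
  have \<gamma>: "\<gamma> > 0" and \<gamma>2: "\<nu> * (6 * \<gamma>\<^sup>2) = \<eta>" using \<eta> \<nu> by (simp_all add: \<gamma>_def)
  have \<beta>: "\<beta> > 0" "\<beta> \<le> \<gamma>" using \<gamma> \<eta> by (simp_all add: \<beta>_def)
  have "\<eta> * \<beta> \<le> 1 * \<beta>" using \<eta> \<beta> by (intro mult_right_mono) auto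
  then have \<alpha>: "\<alpha> > 0" "\<alpha> \<le> \<beta>" using \<beta> \<eta> by (simp_all add: \<alpha>_def)
  define S where "S = {\<xi> :: R3. 0 \<le> \<xi> $ 1 \<and> \<xi> $ 1 \<le> \<alpha> \<and> \<gamma> \<le> \<xi> $ 3 \<and> \<xi> $ 3 \<le> 2 * \<gamma>}"
  define h where "h \<xi> = complex_of_real (indicator S \<xi> * bump (\<xi> $ 2 / \<beta>))" for \<xi> :: R3
  define d where "d \<xi> = complex_of_real (indicator S \<xi> * (\<xi> $ 1 / \<beta> * bump_deriv (\<xi> $ 2 / \<beta>)))" for \<xi> :: R3
  let ?I = "\<lambda>w. indicator (packet_box \<alpha> \<gamma> w) :: R3 \<Rightarrow> complex"
  have S[measurable]: "S \<in> sets borel" unfolding S_def by measurable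
  have [measurable]: "bump \<in> borel_measurable borel" "bump_deriv \<in> borel_measurable borel"
    unfolding bump_def[abs_def] bump_deriv_def[abs_def] by measurable
  have hm[measurable]: "h \<in> borel_measurable borel" and dm[measurable]: "d \<in> borel_measurable borel"
    unfolding h_def[abs_def] d_def[abs_def] by measurable
  have Is: "square_integrable (?I w)" if "w > 0" for w by (rule packet_box_norm[OF \<alpha>(1) \<gamma> that])
  have In: "norm (abs_L2 (?I w)) = sqrt (2 * w * \<alpha> * \<gamma>)" if "w > 0" for w
    by (rule real_sqrt_unique[symmetric]) (simp_all add: packet_box_norm(2)[OF \<alpha>(1) \<gamma> that])
  have zero: "\<xi> \<in> S \<Longrightarrow> \<xi> \<notin> packet_box \<alpha> \<gamma> \<beta> \<Longrightarrow> 1 \<le> \<bar>\<xi> $ 2 / \<beta>\<bar>" for \<xi>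
    using \<beta> by (auto simp: S_def mem_packet_box)
  have hI: "cmod (h \<xi>) \<le> 1 * cmod (?I \<beta> \<xi>)" for \<xi>
    using bump_bounds(1,2)[of "\<xi> $ 2 / \<beta>"] bump_eq_0(1)[OF zero, of \<xi>] by (auto simp: h_def indicator_def)
  have hs: "square_integrable h" by (rule square_integrable_bound[OF Is[OF \<beta>(1)] hm hI])
  have Ih: "cmod (?I (\<beta> / 2) \<xi>) \<le> 16 / 9 * cmod (h \<xi>)" for \<xi>
  proof (cases "\<xi> \<in> packet_box \<alpha> \<gamma> (\<beta> / 2)")
    case True
    then have "\<bar>\<xi> $ 2 / \<beta>\<bar> \<le> 1/2" "\<xi> \<in> S" using \<beta> by (auto simp: S_def mem_packet_box field_simps)
    then show ?thesis using bump_bounds(4)[of "\<xi> $ 2 / \<beta>"] by (simp add: h_def indicator_def)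
  qed simp
  \<comment> \<open>The profile is at least \<open>9/16\<close> on the inner half of the box, so \<open>h\<close> is comparable with the
    indicator that dominates it.\<close>
  have I4: "norm (abs_L2 (?I \<beta>)) \<le> 4 * norm (abs_L2 h)"
  proof -
    have "norm (abs_L2 (?I \<beta>)) = sqrt 2 * norm (abs_L2 (?I (\<beta> / 2)))"
      using \<beta> by (simp add: In real_sqrt_mult[symmetric])
    also have "\<dots> \<le> 2 * (16 / 9 * norm (abs_L2 h))"
      using \<beta> sqrt2_less_2 by (intro mult_mono norm_abs_L2_mono Is hs Ih) auto
    also have "\<dots> \<le> 4 * norm (abs_L2 h)" by simp
    finally show ?thesis .
  qed
  have dI: "cmod (d \<xi>) \<le> (4 * \<alpha> / \<beta>) * cmod (?I \<beta> \<xi>)" for \<xi>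
  proof (cases "\<xi> \<in> S \<and> \<xi> \<in> packet_box \<alpha> \<gamma> \<beta>")
    case True
    then have "\<bar>\<xi> $ 1 / \<beta>\<bar> * \<bar>bump_deriv (\<xi> $ 2 / \<beta>)\<bar> \<le> (\<alpha> / \<beta>) * 4"
      using \<beta> \<alpha> by (intro mult_mono bump_bounds) (auto simp: S_def divide_right_mono)
    moreover have "cmod (d \<xi>) = \<bar>\<xi> $ 1 / \<beta>\<bar> * \<bar>bump_deriv (\<xi> $ 2 / \<beta>)\<bar>"
      using True unfolding d_def norm_of_real abs_mult by simp
    ultimately show ?thesis using True by (simp add: mult.commute)
  next
    case False
    then have "d \<xi> = 0" using bump_eq_0(2)[OF zero, of \<xi>] by (cases "\<xi> \<in> S") (simp_all add: d_def)
    then show ?thesis using \<alpha> \<beta> by simp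
  qed
  have ds: "square_integrable d" by (rule square_integrable_bound[OF Is[OF \<beta>(1)] dm dI])
  have dh: "norm (abs_L2 d) \<le> \<eta> * norm (abs_L2 h)"
  proof -
    have "norm (abs_L2 d) \<le> (4 * \<alpha> / \<beta>) * norm (abs_L2 (?I \<beta>))"
      using \<alpha> \<beta> by (intro norm_abs_L2_mono ds Is dI) auto
    also have "\<dots> \<le> (4 * \<alpha> / \<beta>) * (4 * norm (abs_L2 h))" using \<alpha> \<beta> I4 by (intro mult_left_mono) auto
    also have "\<dots> = \<eta> * norm (abs_L2 h)" using \<beta> by (simp add: \<alpha>_def)
    finally show ?thesis .
  qed
  define g where "g = ifourier (abs_L2 h)"
  define k where "k = ifourier (abs_L2 (\<lambda>\<xi>. - d \<xi>))"
  have nd: "norm (abs_L2 (\<lambda>\<xi>. - d \<xi>)) \<le> \<eta> * norm (abs_L2 h)"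
    using norm_abs_L2_mono[OF square_integrable_uminus[OF ds] ds, of 1] dh by simp
  have hne: "g \<noteq> 0"
  proof
    assume "g = 0"
    then have "fourier g = 0" using norm_fourier[of g] by simp
    then have "abs_L2 h = 0" by (simp add: g_def)
    then have "norm (abs_L2 (?I \<beta>)) \<le> 0" using I4 by simp
    moreover have "0 < 2 * \<beta> * \<alpha> * \<gamma>" using \<alpha> \<beta> \<gamma> by simp
    ultimately show False using In[OF \<beta>(1)] by (simp del: mult_le_0_iff)
  qed
  have sb: "\<xi> \<in> packet_box \<alpha> \<gamma> \<beta>" if "h \<xi> \<noteq> 0" for \<xi>
    using hI[of \<xi>] that by (cases "\<xi> \<in> packet_box \<alpha> \<gamma> \<beta>") auto
  have k: "represents k (y_dx g)"
  proof (rule represents_y_dxI)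
    let ?q = "\<lambda>s \<xi>. (1 / s) *\<^sub>R (h (tr 2 1 (- s) \<xi>) - h \<xi>) + d \<xi>"
    have ne: "(2 :: 3) \<noteq> 1" by simp
    have hq: "square_integrable (\<lambda>\<xi>. h (tr 2 1 (- s) \<xi>))" for s by (rule square_integrable_tr[OF ne hs])
    note q1 = square_integrable_diff[OF hq hs]
    note q2 = square_integrable_scaleR[OF q1]
    have qs: "square_integrable (?q s)" for s by (rule square_integrable_add[OF q2 ds])
    have F: "fourier ((shear 1 2 s g - g) /\<^sub>R s - k) = abs_L2 (?q s)" for s
    proof -
      have "fourier ((shear 1 2 s g - g) /\<^sub>R s - k) = (1 / s) *\<^sub>R (shear 2 1 (- s) (abs_L2 h) - abs_L2 h) - abs_L2 (\<lambda>\<xi>. - d \<xi>)"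
        using bounded_linear.linear[OF bounded_linear_fourier]
        by (simp add: linear_diff fourier_scaleR fourier_shear g_def k_def inverse_eq_divide)
      also have "\<dots> = abs_L2 (?q s)"
        by (simp add: shear_abs_L2[OF ne hs] abs_L2_diff[OF hq hs] abs_L2_scaleR[OF q1]
            abs_L2_diff[OF q2 square_integrable_uminus[OF ds]])
      finally show ?thesis .
    qed
    have q: "cmod (?q s \<xi>) \<le> (27 * \<bar>s\<bar>) * cmod (?I (2 * \<beta>) \<xi>)" if s: "\<bar>s\<bar> \<le> 1" "s \<noteq> 0" for s \<xi>
    proof (cases "\<xi> \<in> S")
      case False
      then have "tr 2 1 (- s) \<xi> \<notin> S" by (simp add: S_def tr_def axis_def)
      then show ?thesis using False by (simp add: h_def d_def)
    next
      case True
      then have tS: "tr 2 1 (- s) \<xi> \<in> S" by (simp add: S_def tr_def axis_def)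
      let ?\<tau> = "\<xi> $ 2 / \<beta>" and ?c = "\<xi> $ 1 / \<beta>"
      let ?r = "- s * ?c"
      have c: "\<bar>?c\<bar> \<le> 1" using True \<alpha> \<beta> by (simp add: S_def)
      have r: "\<bar>?r\<bar> \<le> \<bar>s\<bar>" unfolding abs_mult using mult_left_mono[OF c, of "\<bar>s\<bar>"] by simp
      have t: "tr 2 1 (- s) \<xi> $ 2 / \<beta> = ?\<tau> + ?r" by (simp add: tr_def axis_def diff_divide_distrib)
      have "?q s \<xi> = of_real ((bump (?\<tau> + ?r) - bump ?\<tau> - ?r * bump_deriv ?\<tau>) / s)"
        unfolding h_def d_def t using True tS s by (simp add: scaleR_conv_of_real field_simps)
      then have "cmod (?q s \<xi>) = \<bar>bump (?\<tau> + ?r) - bump ?\<tau> - ?r * bump_deriv ?\<tau>\<bar> / \<bar>s\<bar>" by (simp only: norm_of_real abs_divide)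
      also have "\<dots> \<le> 27 * ?r\<^sup>2 * indicator {-2..2} ?\<tau> / \<bar>s\<bar>"
        using r s by (intro divide_right_mono bump_taylor) auto
      also have "\<dots> \<le> 27 * s\<^sup>2 * indicator {-2..2} ?\<tau> / \<bar>s\<bar>"
        using r by (intro divide_right_mono mult_right_mono mult_left_mono) (simp_all only: abs_le_square_iff, simp_all)
      also have "\<dots> = (27 * \<bar>s\<bar>) * indicator {-2..2} ?\<tau>"
        using s by (simp add: power2_eq_square) (simp add: abs_if)
      also have "indicator {-2..2} ?\<tau> = cmod (?I (2 * \<beta>) \<xi>)"
        using True \<beta> by (auto simp: indicator_def mem_packet_box S_def field_simps)
      finally show ?thesis .
    qed
    have "((\<lambda>s. (shear 1 2 s g - g) /\<^sub>R s - k) \<longlongrightarrow> 0) (at 0)"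
    proof (rule Lim_null_comparison)
      let ?C = "norm (abs_L2 (?I (2 * \<beta>)))"
      have "norm ((shear 1 2 s g - g) /\<^sub>R s - k) \<le> \<bar>s\<bar> * (27 * ?C / sqrt ((2 * pi)^3))" if "\<bar>s\<bar> \<le> 1" "s \<noteq> 0" for s
      proof -
        have "sqrt ((2 * pi)^3) * norm ((shear 1 2 s g - g) /\<^sub>R s - k) \<le> (27 * \<bar>s\<bar>) * ?C"
          unfolding norm_fourier[symmetric] F using \<beta> by (intro norm_abs_L2_mono qs Is q that) auto
        then show ?thesis by (simp add: pos_le_divide_eq mult_ac)
      qed
      then show "\<forall>\<^sub>F s in at 0. norm ((shear 1 2 s g - g) /\<^sub>R s - k) \<le> \<bar>s\<bar> * (27 * ?C / sqrt ((2 * pi)^3))"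
        unfolding eventually_at by (intro exI[of _ 1]) (auto simp: dist_norm)
      show "((\<lambda>s. \<bar>s\<bar> * (27 * ?C / sqrt ((2 * pi)^3))) \<longlongrightarrow> 0) (at (0::real))"
        by (auto intro!: tendsto_eq_intros)
    qed
    then show "((\<lambda>s. (shear 1 2 s g - g) /\<^sub>R s) \<longlongrightarrow> k) (at 0)" by (simp add: LIM_zero_iff)
  qed
  have riesz: "norm (riesz i j g) \<le> \<eta> * norm g" if "i \<noteq> 3" for i j
  proof (rule norm_le_via_fourier)
    have s: "square_integrable (\<lambda>\<xi>. riesz_symbol i j \<xi> * h \<xi>)"
      by (rule square_integrable_mult[OF riesz_symbol_bounded hs])
    have "cmod (riesz_symbol i j \<xi> * h \<xi>) \<le> \<eta> * cmod (h \<xi>)" for \<xi>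
    proof (cases "h \<xi> = 0")
      case False
      then have b: "\<xi> \<in> packet_box \<alpha> \<gamma> \<beta>" by (rule sb)
      then have i: "\<bar>\<xi> $ i\<bar> \<le> \<beta>" using exhaust_3[of i] that \<alpha> by (auto simp: mem_packet_box)
      have n: "\<gamma> \<le> norm \<xi>" using b component_le_norm_cart[of \<xi> 3] by (auto simp: mem_packet_box)
      have "\<bar>\<xi> $ i\<bar> * \<bar>\<xi> $ j\<bar> \<le> \<beta> * norm \<xi>" using \<beta> i by (intro mult_mono component_le_norm_cart) auto
      also have "\<dots> = \<eta> * (\<gamma> * norm \<xi>)" by (simp add: \<beta>_def)
      also have "\<dots> \<le> \<eta> * (norm \<xi> * norm \<xi>)" using \<eta> n by (intro mult_left_mono mult_right_mono) auto
      finally have "\<bar>\<xi> $ i * \<xi> $ j\<bar> \<le> \<eta> * (norm \<xi>)\<^sup>2" by (simp add: abs_mult power2_eq_square)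
      moreover have "0 < (norm \<xi>)\<^sup>2" using n \<gamma> by (intro zero_less_power) linarith
      ultimately have "cmod (riesz_symbol i j \<xi>) \<le> \<eta>"
        by (simp only: riesz_symbol_def norm_of_real abs_divide abs_power2 abs_norm_cancel pos_divide_le_eq)
      then show ?thesis unfolding norm_mult by (rule mult_right_mono) simp
    qed simp
    then show "norm (fourier (riesz i j g)) \<le> \<eta> * norm (fourier g)"
      unfolding fourier_riesz g_def fourier_ifourier mult_abs_L2[OF riesz_symbol_bounded hs]
      using \<eta> by (intro norm_abs_L2_mono s hs) auto
  qed
  define p where "p = ifourier (abs_L2 (\<lambda>\<xi>. - of_real (\<nu> * (norm \<xi>)\<^sup>2) * h \<xi>))"
  have ph: "cmod (- of_real (\<nu> * (norm \<xi>)\<^sup>2) * h \<xi>) \<le> \<eta> * cmod (h \<xi>)" for \<xi>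
  proof (cases "h \<xi> = 0")
    case False
    then have b: "\<xi> \<in> packet_box \<alpha> \<gamma> \<beta>" by (rule sb)
    have "(norm \<xi>)\<^sup>2 = \<bar>\<xi> $ 1\<bar>\<^sup>2 + \<bar>\<xi> $ 2\<bar>\<^sup>2 + \<bar>\<xi> $ 3\<bar>\<^sup>2" by (simp add: norm_sq_R3 sum_3)
    also have "\<dots> \<le> \<gamma>\<^sup>2 + \<gamma>\<^sup>2 + (2 * \<gamma>)\<^sup>2"
      using b \<alpha> \<beta> \<gamma> by (intro add_mono power_mono) (auto simp: mem_packet_box)
    also have "\<dots> = 6 * \<gamma>\<^sup>2" by (simp add: power_mult_distrib)
    finally have "\<nu> * (norm \<xi>)\<^sup>2 \<le> \<eta>" unfolding \<gamma>2[symmetric] using \<nu> by (intro mult_left_mono) auto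
    then show ?thesis unfolding norm_mult norm_minus_cancel norm_of_real
      using \<nu> by (intro mult_right_mono) simp_all
  qed simp
  have ps: "square_integrable (\<lambda>\<xi>. - of_real (\<nu> * (norm \<xi>)\<^sup>2) * h \<xi>)"
    by (rule square_integrable_bound[OF hs _ ph]) measurable
  have p: "represents p (nu_laplacian \<nu> g)"
  proof (rule represents_laplacianI)
    show "AE \<xi> in lborel. rep_L2 (fourier p) \<xi> = - of_real (\<nu> * (norm \<xi>)\<^sup>2) * rep_L2 (fourier g) \<xi>"
      using rep_abs_L2[OF ps] rep_abs_L2[OF hs] unfolding p_def g_def fourier_ifourier by eventually_elim simp
  qed
  have "norm (fourier p) \<le> \<eta> * norm (fourier g)"
    unfolding p_def g_def fourier_ifourier using \<eta> by (intro norm_abs_L2_mono ps hs ph) simp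
  then have pn: "norm p \<le> \<eta> * norm g" by (rule norm_le_via_fourier)
  have "norm (fourier k) \<le> \<eta> * norm (fourier g)" using nd by (simp only: k_def g_def fourier_ifourier)
  then have kn: "norm k \<le> \<eta> * norm g" by (rule norm_le_via_fourier)
  show ?thesis by (rule exI[of _ g], rule exI[of _ k], rule exI[of _ p]) (simp add: hne k p kn pn riesz)
qed

lemma riesz_scaleR: "riesz j k (r *\<^sub>R u) = r *\<^sub>R riesz j k u"
  by (simp add: scaleR_scaleC_L2 riesz_scaleC)

text \<open>The packet is polarized along the eigenvector of the matrix obtained from the operator by
  dropping viscosity, transport and all Riesz transforms; its eigenvalue is \<open>\<Lambda>\<close>.\<close>

lemma approximate_eigenvector:
  assumes f: "0 < f" "f < 1" and \<eta>: "0 < \<eta>" "\<eta> \<le> 1" and \<nu>: "\<nu> > 0"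
  shows "\<exists>u\<in>couette_dom \<nu>. u \<noteq> 0 \<and> norm (couette_op f \<nu> u - \<Lambda>f f *\<^sub>R u) \<le> 13 * \<eta> * norm u"
proof -
  obtain g k p where g: "g \<noteq> 0" and k: "represents k (y_dx g)" and p: "represents p (nu_laplacian \<nu> g)"
    and kn: "norm k \<le> \<eta> * norm g" and pn: "norm p \<le> \<eta> * norm g"
    and R: "\<And>i j. i \<noteq> 3 \<Longrightarrow> norm (riesz i j g) \<le> \<eta> * norm g"
    using packet[OF \<eta> \<nu>] by blast
  define a where "a = sqrt (1 - f)"
  define b where "b = sqrt f"
  have a: "0 \<le> a" "a \<le> 1" "a * a = 1 - f" and b: "0 \<le> b" "b \<le> 1" "b * b = f"
    using f by (simp_all add: a_def b_def)
  have \<Lambda>: "\<Lambda>f f = a * b" by (simp add: \<Lambda>f_def a_def b_def real_sqrt_mult mult.commute)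
  define c :: "3 \<Rightarrow> real" where "c j = (if j = 1 then a else if j = 2 then - b else 0)" for j
  define u :: L2_field where "u = (\<chi> j. c j *\<^sub>R g)"
  let ?w = "couette_op f \<nu> u - \<Lambda>f f *\<^sub>R u"
  have u: "u $ j = c j *\<^sub>R g" for j by (simp add: u_def)
  have c: "c 1 = a" "c 2 = - b" "c 3 = 0" by (simp_all add: c_def)
  have pc: "represents (c j *\<^sub>R p) (nu_laplacian \<nu> (u $ j))" and kc: "represents (c j *\<^sub>R k) (y_dx (u $ j))" for j
    unfolding u scaleR_scaleC_L2 by (rule represents_laplacian_scaleC[OF p], rule represents_y_dx_scaleC[OF k])
  have dom: "u \<in> couette_dom \<nu>" by (rule couette_domI[OF pc kc])
  have "(norm u)\<^sup>2 = (a * a + b * b) * (norm g)\<^sup>2"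
    unfolding norm_field_sq sum_3 u c norm_scaleR power_mult_distrib
    by (simp add: power2_eq_square[of a] power2_eq_square[of b] distrib_right)
  then have nu: "norm u = norm g" using a(3) b(3) by simp
  have e1: "?w $ 1 = a *\<^sub>R (p - k) + (f * a) *\<^sub>R riesz 1 2 g - ((2 - f) * b) *\<^sub>R riesz 1 1 g"
  proof -
    have "f - 1 = - (a * a)" using a(3) by simp
    then have x: "(f - 1) *\<^sub>R (- b) *\<^sub>R g = (\<Lambda>f f * a) *\<^sub>R g" by (simp add: \<Lambda> mult_ac)
    show ?thesis
      unfolding vector_minus_component vector_scaleR_component couette_op_components to_L2_eq[OF pc] to_L2_eq[OF kc]
      unfolding u c riesz_scaleR x
      by (simp add: algebra_simps)
  qed
  have e2: "?w $ 2 = (f * a) *\<^sub>R riesz 2 2 g - b *\<^sub>R (p - k) - ((2 - f) * b) *\<^sub>R riesz 1 2 g"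
  proof -
    have "- f * a = \<Lambda>f f * (- b)" unfolding \<Lambda> unfolding b(3)[symmetric] by (simp add: mult_ac)
    then have x: "(- f) *\<^sub>R a *\<^sub>R g = (\<Lambda>f f * (- b)) *\<^sub>R g" by (simp only: scaleR_scaleR)
    show ?thesis
      unfolding vector_minus_component vector_scaleR_component couette_op_components to_L2_eq[OF pc] to_L2_eq[OF kc]
      unfolding u c riesz_scaleR x
      by (simp add: algebra_simps)
  qed
  have e3: "?w $ 3 = (f * a) *\<^sub>R riesz 2 3 g - ((2 - f) * b) *\<^sub>R riesz 1 3 g"
    unfolding vector_minus_component vector_scaleR_component couette_op_components to_L2_eq[OF pc] to_L2_eq[OF kc]
      unfolding u c riesz_scaleR
    by (simp add: algebra_simps)
  have fa: "f * a \<le> 1" and fb: "(2 - f) * b \<le> 2"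
    using f a b mult_mono[of f 1 a 1] mult_mono[of "2 - f" 2 b 1] by auto
  have s: "norm (r *\<^sub>R x) \<le> C * (\<eta> * norm g)" if "0 \<le> r" "r \<le> C" "norm x \<le> \<eta> * norm g" for r C and x :: L2
    unfolding norm_scaleR using that by (intro mult_mono) auto
  have pk: "norm (r *\<^sub>R (p - k)) \<le> 2 * (\<eta> * norm g)" if "0 \<le> r" "r \<le> 1" for r
    using s[OF that pn] s[OF that kn] norm_triangle_ineq4[of "r *\<^sub>R p" "r *\<^sub>R k"] by (simp add: scaleR_diff_right)
  have R1: "norm ((f * a) *\<^sub>R riesz i j g) \<le> 1 * (\<eta> * norm g)" if "i \<noteq> 3" for i j
    using f a fa by (intro s R that) auto
  have R2: "norm (((2 - f) * b) *\<^sub>R riesz i j g) \<le> 2 * (\<eta> * norm g)" if "i \<noteq> 3" for i j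
    using f b fb by (intro s R that) auto
  have n1: "norm (?w $ 1) \<le> 5 * (\<eta> * norm g)"
    unfolding e1 using norm_triangle_ineq[of "a *\<^sub>R (p - k)" "(f * a) *\<^sub>R riesz 1 2 g"]
      norm_triangle_ineq4[of "a *\<^sub>R (p - k) + (f * a) *\<^sub>R riesz 1 2 g" "((2 - f) * b) *\<^sub>R riesz 1 1 g"]
      pk[OF a(1,2)] R1[of 1 2] R2[of 1 1] by simp
  have n2: "norm (?w $ 2) \<le> 5 * (\<eta> * norm g)"
    unfolding e2 using norm_triangle_ineq4[of "(f * a) *\<^sub>R riesz 2 2 g" "b *\<^sub>R (p - k)"]
      norm_triangle_ineq4[of "(f * a) *\<^sub>R riesz 2 2 g - b *\<^sub>R (p - k)" "((2 - f) * b) *\<^sub>R riesz 1 2 g"]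
      pk[OF b(1,2)] R1[of 2 2] R2[of 1 2] by simp
  have n3: "norm (?w $ 3) \<le> 3 * (\<eta> * norm g)"
    unfolding e3 using norm_triangle_ineq4[of "(f * a) *\<^sub>R riesz 2 3 g" "((2 - f) * b) *\<^sub>R riesz 1 3 g"]
      R1[of 2 3] R2[of 1 3] by simp
  have "norm ?w \<le> (\<Sum>j\<in>UNIV. norm (?w $ j))" unfolding norm_vec_def by (rule L2_set_le_sum) simp
  also have "\<dots> \<le> 13 * \<eta> * norm u" unfolding sum_3 nu using n1 n2 n3 by simp
  finally have "norm ?w \<le> 13 * \<eta> * norm u" .
  moreover have "u \<noteq> 0" using g nu by auto
  ultimately show ?thesis using dom by blast
qed

lemma semigroup_lower_bound:
  assumes f: "0 < f" "f < 1" and \<nu>: "\<nu> > 0"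
    and T: "generates (couette_dom \<nu>) (couette_op f \<nu>) T" and t: "t \<ge> 0"
  shows "exp (\<Lambda>f f * t) \<le> norm (T t)"
proof (rule semigroup_norm_ge_exp[OF _ _ t])
  show "C0_semigroup T" using T by (simp add: generates_def)
  fix \<delta> :: real assume \<delta>: "\<delta> > 0"
  obtain u where u: "u \<in> couette_dom \<nu>" "u \<noteq> 0"
    "norm (couette_op f \<nu> u - \<Lambda>f f *\<^sub>R u) \<le> 13 * min 1 (\<delta> / 13) * norm u"
    using approximate_eigenvector[OF f, of "min 1 (\<delta> / 13)" \<nu>] \<delta> \<nu> by auto
  have "13 * min 1 (\<delta> / 13) * norm u \<le> \<delta> * norm u" by (intro mult_right_mono) auto
  then have "norm (couette_op f \<nu> u - \<Lambda>f f *\<^sub>R u) \<le> \<delta> * norm u" using u(3) by (rule order_trans[rotated])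
  moreover have "(u, couette_op f \<nu> u) \<in> generator_graph T" using u(1) T by (auto simp: generates_def)
  ultimately show "\<exists>u v. (u, v) \<in> generator_graph T \<and> u \<noteq> 0 \<and> norm (v - \<Lambda>f f *\<^sub>R u) \<le> \<delta> * norm u"
    using u(2) by blast
qed

section \<open>Growth bound and resolvent\<close>

theorem theorem1p1:
  fixes f \<Lambda> :: real
  assumes "0 < f" and "f < 1" and "\<Lambda> = sqrt (f * (1 - f))"
  shows "\<exists>C>0. \<forall>\<nu>>0. \<forall>T. generates (couette_dom \<nu>) (couette_op f \<nu>) T \<longrightarrow>
    has_growth_bound T \<Lambda> \<and>
    (\<forall>\<epsilon>>0. \<exists>K>0. \<forall>t\<ge>0. norm (T t) \<le> K * exp ((\<Lambda> + \<epsilon>) * t)) \<and>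
    (\<forall>\<epsilon>>0. \<forall>z. Re z \<ge> \<Lambda> + \<epsilon> \<longrightarrow>
      (\<exists>R. is_resolvent (couette_dom \<nu>) (couette_op f \<nu>) z R \<and>
           norm R \<le> C * (1 / \<epsilon>) * (1 + 1 / \<epsilon>) * exp (C / \<epsilon>)))"
proof -
  note f = assms(1,2)
  have \<Lambda>: "\<Lambda> = \<Lambda>f f" using assms(3) by (simp add: \<Lambda>f_def)
  obtain C where C: "C > 0" "\<And>\<epsilon>. \<epsilon> > 0 \<Longrightarrow> 2 / \<epsilon> * growth_const f \<epsilon> \<le> C * (1 / \<epsilon>) * (1 + 1 / \<epsilon>) * exp (C / \<epsilon>)"
    using growth_const_le[OF f] by blast
  show ?thesis
  proof (rule exI[of _ C], intro conjI allI impI C(1))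
    fix \<nu> :: real and T assume \<nu>: "\<nu> > 0" and T: "generates (couette_dom \<nu>) (couette_op f \<nu>) T"
    show up: "\<exists>K>0. \<forall>t\<ge>0. norm (T t) \<le> K * exp ((\<Lambda> + \<epsilon>) * t)" if \<epsilon>: "\<epsilon> > 0" for \<epsilon>
    proof (intro exI[of _ "growth_const f \<epsilon>"] conjI allI impI)
      show g: "growth_const f \<epsilon> > 0" using weight_floor_pos[OF f] \<epsilon> by (simp add: growth_const_def)
      fix t :: real assume t: "t \<ge> 0"
      have "norm (T t) \<le> growth_const f \<epsilon> * exp ((\<Lambda>f f + \<epsilon> / 2) * t)"
        by (rule semigroup_upper_bound[OF f \<epsilon> \<nu> T t])
      also have "\<dots> \<le> growth_const f \<epsilon> * exp ((\<Lambda> + \<epsilon>) * t)"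
        unfolding \<Lambda> using g \<epsilon> t by (intro mult_left_mono) (auto intro!: mult_right_mono)
      finally show "norm (T t) \<le> growth_const f \<epsilon> * exp ((\<Lambda> + \<epsilon>) * t)" .
    qed
    show "has_growth_bound T \<Lambda>"
      by (rule has_growth_boundI[OF up]) (use semigroup_lower_bound[OF f \<nu> T] \<Lambda> in auto)
    fix \<epsilon> :: real and z assume \<epsilon>: "\<epsilon> > 0" and z: "Re z \<ge> \<Lambda> + \<epsilon>"
    show "\<exists>R. is_resolvent (couette_dom \<nu>) (couette_op f \<nu>) z R \<and>
           norm R \<le> C * (1 / \<epsilon>) * (1 + 1 / \<epsilon>) * exp (C / \<epsilon>)"
      using resolvent_bound[OF f \<epsilon> \<nu> T, of z] z C(2)[OF \<epsilon>] unfolding \<Lambda> by (meson order_trans)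
  qed
qed

end
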